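(* Let $(P_1,P_2)$ and $(Q_1,Q_2)$ be two pairs of cameras with different fundamental forms and let $S_P,S_Q$ be the associated quadrics. Let $S_P$ be two planes with the two camera centers $p_1,p_2$ not both lying on the intersection, and let $C_P\subset S_P$ be a curve of type $(a,b,c_0,c_1,c_2)$ such that $C_P$ does not contain either of the epipolar lines $g_{P_1}^2,g_{P_2}^1$ or the line spanned by the camera centers. Then the conjugate curve $C_Q\subset S_Q$ is of type $$(2a-c_0-c_1-c_2,\; b,\; a-c_1-c_2,\; a-c_0-c_2,\; a-c_0-c_1).$$
   Context: $\mathbb{P}^n$ is projective space over $\mathbb{C}$. A camera is a linear projection $P:\mathbb{P}^3\dashrightarrow\mathbb{P}^2$ given by a real $3\times4$ matrix of rank $3$; its center is the kernel of the matrix. The pairs $(P_1,P_2)$, $(Q_1,Q_2)$ have centers $p_1\ne p_2$ and $q_1\neq q_2$. The fundamental form of $(P_1,P_2)$ is the real rank $2$ bilinear form $F_P(\mathbf{x},\mathbf{y})=\det\begin{bmatrix}P_1&\mathbf{x}&0\\P_2&0&\mathbf{y}\end{bmatrix}$ (up to scale), and similarly $F_Q$; assume $F_P\neq F_Q$. The quadrics $S_P,S_Q\subset\mathbb{P}^3$ are given by $S_P(x)=F_Q(P_1(x),P_2(x))$ and $S_Q(x)=F_P(Q_1(x),Q_2(x))$; $S_P$ contains $p_1,p_2$ and $S_Q$ contains $q_1,q_2$. The epipolar lines on $S_P$ are the lines $g_{P_1}^{2}\ni p_1$ and $g_{P_2}^{1}\ni p_2$ which are the blow-downs of $P_1^{-1}(Q_1(q_2))$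 and $P_2^{-1}(Q_2(q_1))$ (preimages in the blow-up of $\mathbb{P}^3$ in $p_1,p_2$, where the cameras become morphisms); the epipolar lines $g_{Q_1}^2,g_{Q_2}^1$ on $S_Q$ are defined in the same way with the roles of $P$ and $Q$ exchanged. When $S_P$ is a union of two planes, the two epipolar lines on $S_P$ lie in the same plane, and $S_Q$ is also a union of two planes. Points $x$ and $y$ on the strict transforms of $S_P$ and $S_Q$ (in the blow-ups of $\mathbb{P}^3$ in the respective camera centers) are conjugate if $P_i(x)=Q_i(y)$ for $i=1,2$. Taking a point to its conjugate defines a birational map $\psi_P$ from $S_P$ to $S_Q$; the conjugate curve $C_Q$ of $C_P$ is the curve on $S_Q$ corresponding to $C_P$ under $\psi_P$. Type of a curve: let $S_P$ be two planes with the two camera centers not both lying on the intersection and let $C_P$ be a curve on $S_P$. $C_P$ is of type $(a,b,c_0,c_1,c_2)$, where $a$ is the degree of the curve in the plane with the epipolar lines, $b$ the degree of the curve in the other plane, $c_0$ is the multiplicity of $C_P$ in the intersection of the epipolar lines, and $c_1,c_2$ are the multiplicities of $C_P$ in the camera centers $p_1,p_2$ respectively. Types on $S_Q$ are defined in the same way using $q_1,q_2$ and the epipolar lines on $S_Q$.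
   Formalization: c_0, c_1, c_2 count only the part of the curve in the plane with the epipolar lines; if a camera center lies on both planes, c_0 is the multiplicity of the strict transform at the intersection of the epipolar lines in the blow-up. Read literally, the formula fails in these cases. *)

theory Defs
  imports "HOL-Analysis.Analysis" "HOL-Computational_Algebra.Polynomial"
begin

text \<open>The points of projective \<open>(n-1)\<close>-space over the complex numbers are the lines through the
  origin of \<open>\<complex>\<^sup>n\<close>; the space has the index type \<open>'n\<close> of its homogeneous coordinates as parameter, so
  the projective plane is \<open>3 projective\<close>.\<close>

typedef (overloaded) ('n::finite) projective =
  "{L :: (complex ^ 'n) set. vec.subspace L \<and> vec.dim L = 1}"
  morphisms line_of point_of
proof -
  obtain k :: 'n where True by simp
  have "axis k (1::complex) \<noteq> 0" by (simp add: axis_eq_0_iff)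
  then have "vec.dim (vec.span {axis k (1::complex)}) = 1"
    by (simp add: vec.dim_eq_card_independent)
  moreover have "vec.subspace (vec.span {axis k (1::complex)})" by (rule vec.subspace_span)
  ultimately show ?thesis by blast
qed

definition points :: "(complex ^ 'n::finite) set \<Rightarrow> 'n projective set" where
  "points W = {x. line_of x \<subseteq> W}"

definition is_plane :: "(complex ^ 4) set \<Rightarrow> bool" where
  "is_plane W \<longleftrightarrow> vec.subspace W \<and> vec.dim W = 3"

definition line_through :: "4 projective \<Rightarrow> 4 projective \<Rightarrow> 4 projective set" where
  "line_through x y = points (vec.span (line_of x \<union> line_of y))"

definition form :: "nat \<Rightarrow> (complex ^ 'n::finite \<Rightarrow> complex) \<Rightarrow> bool" where
  "form d F \<longleftrightarrow> (\<exists>c :: ('n \<Rightarrow> nat) \<Rightarrow> complex.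
     \<forall>x. F x = (\<Sum>\<alpha> | (\<Sum>i\<in>UNIV. \<alpha> i) = d. c \<alpha> * (\<Prod>i\<in>UNIV. (x $ i) ^ \<alpha> i)))"

definition zeros :: "(complex ^ 'n::finite \<Rightarrow> complex) \<Rightarrow> 'n projective set" where
  "zeros F = {x. \<forall>v\<in>line_of x. F v = 0}"

definition zariski_closure :: "'n::finite projective set \<Rightarrow> 'n projective set" where
  "zariski_closure X = \<Inter> {zeros F | F d. form d F \<and> X \<subseteq> zeros F}"

type_synonym camera = "real ^ 4 ^ 3"

definition is_camera :: "camera \<Rightarrow> bool" where
  "is_camera P \<longleftrightarrow> rank P = 3"

definition cmatrix :: "camera \<Rightarrow> complex ^ 4 ^ 3" where
  "cmatrix P = map_matrix complex_of_real P"

definition center :: "camera \<Rightarrow> 4 projective" where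
  "center P = point_of {v. cmatrix P *v v = 0}"

text \<open>The image of a point other than the center (and unspecified at the center).\<close>

definition picture :: "camera \<Rightarrow> 4 projective \<Rightarrow> 3 projective" where
  "picture P x = point_of ((\<lambda>v. cmatrix P *v v) ` line_of x)"

definition fundamental_form ::
    "camera \<Rightarrow> camera \<Rightarrow> complex ^ 3 \<Rightarrow> complex ^ 3 \<Rightarrow> complex" where
  "fundamental_form P\<^sub>1 P\<^sub>2 x y =
    (let A = cmatrix P\<^sub>1; B = cmatrix P\<^sub>2 in
     det (vector
      [vector [A$1$1, A$1$2, A$1$3, A$1$4, x$1, 0],
       vector [A$2$1, A$2$2, A$2$3, A$2$4, x$2, 0],
       vector [A$3$1, A$3$2, A$3$3, A$3$4, x$3, 0],
       vector [B$1$1, B$1$2, B$1$3, B$1$4, 0, y$1],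
       vector [B$2$1, B$2$2, B$2$3, B$2$4, 0, y$2],
       vector [B$3$1, B$3$2, B$3$3, B$3$4, 0, y$3]] :: complex ^ 6 ^ 6))"

definition same_form ::
    "(complex ^ 3 \<Rightarrow> complex ^ 3 \<Rightarrow> complex) \<Rightarrow> (complex ^ 3 \<Rightarrow> complex ^ 3 \<Rightarrow> complex) \<Rightarrow> bool" where
  "same_form F G \<longleftrightarrow> (\<exists>c. c \<noteq> 0 \<and> (\<forall>x y. F x y = c * G x y))"

text \<open>In the definitions below the first pair of cameras is the one that views the space in which
  the defined object lives: with \<open>P\<close> and \<open>Q\<close> exchanged they give the objects attached to \<open>Q\<close>.\<close>

definition quadric :: "camera \<Rightarrow> camera \<Rightarrow> camera \<Rightarrow> camera \<Rightarrow> 4 projective set" where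
  "quadric P\<^sub>1 P\<^sub>2 Q\<^sub>1 Q\<^sub>2 =
     zeros (\<lambda>v. fundamental_form Q\<^sub>1 Q\<^sub>2 (cmatrix P\<^sub>1 *v v) (cmatrix P\<^sub>2 *v v))"

text \<open>The blow-up of projective 3-space in the two (distinct) centers, as the closure of the graph of
  \<open>(P\<^sub>1, P\<^sub>2)\<close>. A component \<open>u\<close> is determined by \<open>x\<close> unless \<open>x\<close> is the center of \<open>P\<^sub>1\<close>, over
  which it is arbitrary and names the tangent direction given by the line \<open>P\<^sub>1\<^sup>-\<^sup>1(u)\<close>; likewise \<open>w\<close>.
  The cameras become the projections to the second and third component.\<close>

definition blowup :: "camera \<Rightarrow> camera \<Rightarrow> (4 projective \<times> 3 projective \<times> 3 projective) set" where
  "blowup P\<^sub>1 P\<^sub>2 = {(x, u, w).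
     (\<lambda>v. cmatrix P\<^sub>1 *v v) ` line_of x \<subseteq> line_of u \<and>
     (\<lambda>v. cmatrix P\<^sub>2 *v v) ` line_of x \<subseteq> line_of w}"

definition epipolar_line1 :: "camera \<Rightarrow> camera \<Rightarrow> camera \<Rightarrow> camera \<Rightarrow> 4 projective set" where
  "epipolar_line1 P\<^sub>1 P\<^sub>2 Q\<^sub>1 Q\<^sub>2 =
     {x. \<exists>u w. (x, u, w) \<in> blowup P\<^sub>1 P\<^sub>2 \<and> u = picture Q\<^sub>1 (center Q\<^sub>2)}"

definition epipolar_line2 :: "camera \<Rightarrow> camera \<Rightarrow> camera \<Rightarrow> camera \<Rightarrow> 4 projective set" where
  "epipolar_line2 P\<^sub>1 P\<^sub>2 Q\<^sub>1 Q\<^sub>2 =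
     {x. \<exists>u w. (x, u, w) \<in> blowup P\<^sub>1 P\<^sub>2 \<and> w = picture Q\<^sub>2 (center Q\<^sub>1)}"

text \<open>Outside the centers the blow-ups are isomorphic to the projective spaces, and there
  conjugate points are the following.\<close>

definition conjugate ::
    "camera \<Rightarrow> camera \<Rightarrow> camera \<Rightarrow> camera \<Rightarrow> 4 projective \<Rightarrow> 4 projective \<Rightarrow> bool" where
  "conjugate P\<^sub>1 P\<^sub>2 Q\<^sub>1 Q\<^sub>2 x y \<longleftrightarrow>
     x \<in> quadric P\<^sub>1 P\<^sub>2 Q\<^sub>1 Q\<^sub>2 \<and> x \<noteq> center P\<^sub>1 \<and> x \<noteq> center P\<^sub>2 \<and>
     y \<in> quadric Q\<^sub>1 Q\<^sub>2 P\<^sub>1 P\<^sub>2 \<and> y \<noteq> center Q\<^sub>1 \<and> y \<noteq> center Q\<^sub>2 \<and>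
     picture P\<^sub>1 x = picture Q\<^sub>1 y \<and> picture P\<^sub>2 x = picture Q\<^sub>2 y"

text \<open>The birational map of the quadrics sends \<open>x\<close> to \<open>y\<close> if \<open>y\<close> is the only conjugate of \<open>x\<close>. (The
  intersection point of the epipolar lines is conjugate to the whole line spanned by the other two
  centers.) On the quadric of \<open>P\<close> this defines the map at all points outside the epipolar lines.\<close>

definition psi_graph ::
    "camera \<Rightarrow> camera \<Rightarrow> camera \<Rightarrow> camera \<Rightarrow> (4 projective \<times> 4 projective) set" where
  "psi_graph P\<^sub>1 P\<^sub>2 Q\<^sub>1 Q\<^sub>2 = {(x, y). conjugate P\<^sub>1 P\<^sub>2 Q\<^sub>1 Q\<^sub>2 x y \<and>
     (\<forall>y'. conjugate P\<^sub>1 P\<^sub>2 Q\<^sub>1 Q\<^sub>2 x y' \<longrightarrow> y' = y)}"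

definition conjugate_curve ::
    "camera \<Rightarrow> camera \<Rightarrow> camera \<Rightarrow> camera \<Rightarrow> 4 projective set \<Rightarrow> 4 projective set" where
  "conjugate_curve P\<^sub>1 P\<^sub>2 Q\<^sub>1 Q\<^sub>2 C = zariski_closure (psi_graph P\<^sub>1 P\<^sub>2 Q\<^sub>1 Q\<^sub>2 `` C)"

text \<open>A plane curve in the plane \<open>W\<close> is given by a form on the ambient space that is squarefree
  as a form on \<open>W\<close> (every form on \<open>W\<close> is the restriction of a form of the same degree); its degree
  is the degree of the form. The empty curve, of degree 0, is included.\<close>

definition squarefree_on :: "(complex ^ 4) set \<Rightarrow> (complex ^ 4 \<Rightarrow> complex) \<Rightarrow> bool" where
  "squarefree_on W F \<longleftrightarrow> (\<exists>v\<in>W. F v \<noteq> 0) \<and>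
     \<not> (\<exists>d e H K. d > 0 \<and> form d H \<and> form e K \<and> (\<forall>v\<in>W. F v = (H v)\<^sup>2 * K v))"

definition plane_curve ::
    "(complex ^ 4) set \<Rightarrow> (complex ^ 4 \<Rightarrow> complex) \<Rightarrow> nat \<Rightarrow> 4 projective set \<Rightarrow> bool" where
  "plane_curve W F d A \<longleftrightarrow> form d F \<and> squarefree_on W F \<and> A = points W \<inter> zeros F"

text \<open>A polynomial \<open>h\<close> in \<open>s\<close> and \<open>t\<close> is represented as a polynomial in \<open>t\<close> with coefficients in
  \<open>\<complex>[s]\<close>. Its order is the degree of its lowest nonzero homogeneous part, which is the multiplicity
  of the curve \<open>h = 0\<close> at the origin.\<close>

definition order_at_origin :: "complex poly poly \<Rightarrow> nat" where
  "order_at_origin h = (LEAST m. \<exists>i j. i + j = m \<and> coeff (coeff h j) i \<noteq> 0)"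

definition local_equation ::
    "(complex ^ 4 \<Rightarrow> complex) \<Rightarrow> complex ^ 4 \<Rightarrow> complex ^ 4 \<Rightarrow> complex ^ 4 \<Rightarrow> complex poly poly \<Rightarrow> bool"
  where
  "local_equation F v e f h \<longleftrightarrow> (\<forall>s t. poly (poly h [:t:]) s = F (v + s *s e + t *s f))"

definition has_multiplicity ::
    "(complex ^ 4) set \<Rightarrow> (complex ^ 4 \<Rightarrow> complex) \<Rightarrow> 4 projective \<Rightarrow> nat \<Rightarrow> bool" where
  "has_multiplicity W F x m \<longleftrightarrow> (\<exists>v e f h.
     line_of x = vec.span {v} \<and> W = vec.span {v, e, f} \<and>
     local_equation F v e f h \<and> m = order_at_origin h)"

text \<open>The multiplicity of the strict transform of a plane curve, under the blow-up of its plane in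
  \<open>x\<close>, at the point of the exceptional curve given by the line \<open>l\<close> through \<open>x\<close>. In the chart
  \<open>(s, t) \<mapsto> (s, s t)\<close>, where \<open>t = 0\<close> is the line \<open>l\<close>, this point is the origin, and the strict
  transform has the equation \<open>g(s, t) = h(s, s t) / s\<^sup>m\<close> with \<open>m\<close> the multiplicity at \<open>x\<close>.\<close>

definition has_infinitely_near_multiplicity ::
    "(complex ^ 4) set \<Rightarrow> (complex ^ 4 \<Rightarrow> complex) \<Rightarrow> 4 projective \<Rightarrow> (complex ^ 4) set \<Rightarrow> nat \<Rightarrow> bool"
  where
  "has_infinitely_near_multiplicity W F x l m \<longleftrightarrow> (\<exists>v e f h g.
     line_of x = vec.span {v} \<and> l = vec.span {v, e} \<and> W = vec.span {v, e, f} \<and>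
     local_equation F v e f h \<and>
     pcompose h [:0, [:0, 1:]:] = smult (monom 1 (order_at_origin h)) g \<and>
     m = order_at_origin g)"

text \<open>The multiplicity at a point of the blow-up of the strict transform of a plane curve.\<close>

fun has_multiplicity_blowup ::
    "camera \<Rightarrow> camera \<Rightarrow> (complex ^ 4) set \<Rightarrow> (complex ^ 4 \<Rightarrow> complex) \<Rightarrow>
     4 projective \<times> 3 projective \<times> 3 projective \<Rightarrow> nat \<Rightarrow> bool" where
  "has_multiplicity_blowup P\<^sub>1 P\<^sub>2 W F (x, u, w) m \<longleftrightarrow>
    (if x = center P\<^sub>1 then
       has_infinitely_near_multiplicity W F x {v. cmatrix P\<^sub>1 *v v \<in> line_of u} m
     else if x = center P\<^sub>2 then
       has_infinitely_near_multiplicity W F x {v. cmatrix P\<^sub>2 *v v \<in> line_of w} m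
     else has_multiplicity W F x m)"

text \<open>Let the quadric consist of the plane \<open>W\<close> with the epipolar lines and the plane \<open>W'\<close>. A curve
  \<open>C\<close> on it is the union of a plane curve \<open>A\<close> in \<open>W\<close> and a plane curve \<open>A'\<close> in \<open>W'\<close>, which are the
  one-dimensional parts of \<open>C \<inter> W\<close> and \<open>C \<inter> W'\<close>: if \<open>C\<close> contains the line \<open>W \<inter> W'\<close>, then so do
  both of them.

  The degree \<open>a\<close> and all three multiplicities are those of \<open>A\<close>. The intersection point of the
  epipolar lines always lies on \<open>W'\<close> too, but a branch of \<open>A'\<close> through it does not count for
  \<open>c\<^sub>0\<close>: on \<open>W'\<close> the birational map of the quadrics is a linear isomorphism.

  The intersection of the epipolar lines is that of the preimages of the two epipoles in the
  blow-up. If one camera center lies on \<open>W \<inter> W'\<close>, the epipolar lines meet in this center, and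
  \<open>c\<^sub>0\<close> is the multiplicity in an infinitely near point of it. Otherwise they meet outside the
  centers, and \<open>c\<^sub>0\<close> is the multiplicity of \<open>A\<close> in their common point.\<close>

definition curve_type ::
    "camera \<Rightarrow> camera \<Rightarrow> camera \<Rightarrow> camera \<Rightarrow> 4 projective set \<Rightarrow> int \<times> int \<times> int \<times> int \<times> int \<Rightarrow> bool"
  where
  "curve_type P\<^sub>1 P\<^sub>2 Q\<^sub>1 Q\<^sub>2 C = (\<lambda>(a, b, c\<^sub>0, c\<^sub>1, c\<^sub>2).
     \<exists>W W' F F' A A' d d' m\<^sub>0 m\<^sub>1 m\<^sub>2 z u w.
       is_plane W \<and> is_plane W' \<and> W \<noteq> W' \<and>
       quadric P\<^sub>1 P\<^sub>2 Q\<^sub>1 Q\<^sub>2 = points W \<union> points W' \<and>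
       \<not> {center P\<^sub>1, center P\<^sub>2} \<subseteq> points W \<inter> points W' \<and>
       epipolar_line1 P\<^sub>1 P\<^sub>2 Q\<^sub>1 Q\<^sub>2 \<subseteq> points W \<and>
       epipolar_line2 P\<^sub>1 P\<^sub>2 Q\<^sub>1 Q\<^sub>2 \<subseteq> points W \<and>
       C = A \<union> A' \<and>
       plane_curve W F d A \<and> finite (C \<inter> points W - A) \<and>
       plane_curve W' F' d' A' \<and> finite (C \<inter> points W' - A') \<and>
       (z, u, w) \<in> blowup P\<^sub>1 P\<^sub>2 \<and>
       u = picture Q\<^sub>1 (center Q\<^sub>2) \<and> w = picture Q\<^sub>2 (center Q\<^sub>1) \<and>
       has_multiplicity_blowup P\<^sub>1 P\<^sub>2 W F (z, u, w) m\<^sub>0 \<and>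
       has_multiplicity W F (center P\<^sub>1) m\<^sub>1 \<and>
       has_multiplicity W F (center P\<^sub>2) m\<^sub>2 \<and>
       a = int d \<and> b = int d' \<and> c\<^sub>0 = int m\<^sub>0 \<and> c\<^sub>1 = int m\<^sub>1 \<and> c\<^sub>2 = int m\<^sub>2)"

end

theory Submission
  imports Defs "HOL-Computational_Algebra.Fundamental_Theorem_Algebra"
begin

text \<open>On the plane \<open>W'\<close> without the epipolar lines the birational map of the quadrics is induced by a linear
  isomorphism. On the plane \<open>W\<close> with the epipolar lines it is a quadratic Cremona transformation: let
  \<open>s\<close>, \<open>t\<close>, \<open>u\<close> be linear forms on \<open>W\<close> that vanish on \<open>g\<^sub>P\<^sub>2\<close>, on \<open>g\<^sub>P\<^sub>1\<close> and on the line spanned by the centers;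
  scaled suitably, and with the corresponding forms on the plane of \<open>Q\<close>, the map is
  \<open>(s, t, u) \<mapsto> (t u, s u, s t)\<close>. Its base points are the two centers and the intersection of the epipolar
  lines, and the type is transformed as degree and multiplicities always are under such a map. If a center lies
  on both planes, then, up to exchanging the two cameras, \<open>s\<close> and \<open>u\<close> are proportional, one base point is infinitely near to this center, and in
  other coordinates the map is \<open>(t, x, u) \<mapsto> (u\<^sup>2, t x, t u)\<close>.

  Multiplicities are read off as orders of vanishing along a generic line through the point, and, at an infinitely
  near point, along generic parabolas tangent to the given direction. The strict transform is squarefree because
  the map is an involution up to a monomial factor, and it is the Zariski closure of the image since a curve that
  does not contain an exceptional line has no isolated points on it.\<close>

subsection \<open>Forms\<close>

text \<open>The coordinates come from linear algebra. Functionals that vanish on both centers of a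
  pair descend to both images, and the fundamental form of the pair is a multiple of the 2 by 2
  determinant of two of them. When S_P splits, the two pairs can share one functional: F_P and F_Q
  are multiples of \<alpha>1 \<omega>2 - \<omega>1 \<alpha>2 and \<beta>1 \<omega>2 - \<omega>1
  \<beta>2, and S_P is \<omega>1 (\<beta>1 - \<beta>2) = 0. The views of a conjugate of x are those
  of x times scalars l and m with l \<beta>1 = m \<beta>2 and l \<omega>1 = m \<omega>1. Where
  \<omega>1 is nonzero this forces l = m, a linear map; where \<omega>1 = 0 it gives l : m =
  \<beta>2 : \<beta>1, a quadratic map.

  Two features of the encoding shape the rest. Forms are functions, so divisibility, cancellation
  and squarefreeness are derived from values: by induction on forms, restriction to lines and
  continuity. And a multiplicity refers to some unspecified local coordinates, so each use needs a
  description independent of them; generic orders supply it.\<close>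

lemma finite_exponents: "finite {\<alpha> :: 'n::finite \<Rightarrow> nat. (\<Sum>i\<in>UNIV. \<alpha> i) = d}"
proof (rule finite_subset)
  show "{\<alpha> :: 'n \<Rightarrow> nat. (\<Sum>i\<in>UNIV. \<alpha> i) = d} \<subseteq> PiE UNIV (\<lambda>_. {..d})"
    by (auto simp: PiE_UNIV_domain intro!: member_le_sum)
qed (simp add: finite_PiE)

lemma form_zero: "form d (\<lambda>x. 0)"
  unfolding form_def by (rule exI[of _ "\<lambda>_. 0"]) simp

lemma form_add: "form d F \<Longrightarrow> form d G \<Longrightarrow> form d (\<lambda>x. F x + G x)"
  unfolding form_def
  by (elim exE, rename_tac c c', rule_tac x = "\<lambda>\<alpha>. c \<alpha> + c' \<alpha>" in exI)
     (simp add: sum.distrib distrib_right)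

lemma form_scale: "form d F \<Longrightarrow> form d (\<lambda>x. k * F x)"
  unfolding form_def
  by (elim exE, rename_tac c, rule_tac x = "\<lambda>\<alpha>. k * c \<alpha>" in exI)
     (simp add: sum_distrib_left mult.assoc)

lemma form_sum: "(\<And>i. i \<in> I \<Longrightarrow> form d (F i)) \<Longrightarrow> form d (\<lambda>x. \<Sum>i\<in>I. F i x)"
  by (induction I rule: infinite_finite_induct) (auto simp: form_zero form_add)

lemma form_monomial:
  fixes \<alpha> :: "'n::finite \<Rightarrow> nat"
  assumes "(\<Sum>i\<in>UNIV. \<alpha> i) = d"
  shows "form d (\<lambda>x. k * (\<Prod>i\<in>UNIV. (x $ i) ^ \<alpha> i))"
  unfolding form_def
proof (intro exI allI)
  fix x :: "complex ^ 'n"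
  have "(\<Sum>\<beta> | (\<Sum>i\<in>UNIV. \<beta> i) = d. (if \<beta> = \<alpha> then k else 0) * (\<Prod>i\<in>UNIV. (x $ i) ^ \<beta> i))
    = (\<Sum>\<beta> | (\<Sum>i\<in>UNIV. \<beta> i) = d. if \<beta> = \<alpha> then k * (\<Prod>i\<in>UNIV. (x $ i) ^ \<beta> i) else 0)"
    by (intro sum.cong) auto
  also have "\<dots> = k * (\<Prod>i\<in>UNIV. (x $ i) ^ \<alpha> i)"
    using assms by (subst sum.delta) (auto simp: finite_exponents)
  finally show "k * (\<Prod>i\<in>UNIV. (x $ i) ^ \<alpha> i) =
    (\<Sum>\<beta> | (\<Sum>i\<in>UNIV. \<beta> i) = d. (if \<beta> = \<alpha> then k else 0) * (\<Prod>i\<in>UNIV. (x $ i) ^ \<beta> i))"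
    by simp
qed

lemma form_const: "form 0 (\<lambda>x :: complex ^ 'n::finite. k)"
  using form_monomial[of "\<lambda>_ :: 'n. 0" 0 k] by simp

lemma monomial_step:
  fixes \<alpha> :: "'n::finite \<Rightarrow> nat" and x :: "complex ^ 'n"
  assumes "\<alpha> = \<beta>(i := Suc (\<beta> i))"
  shows "(\<Sum>i\<in>UNIV. \<alpha> i) = Suc (\<Sum>i\<in>UNIV. \<beta> i)"
    and "(\<Prod>i\<in>UNIV. (x $ i) ^ \<alpha> i) = x $ i * (\<Prod>i\<in>UNIV. (x $ i) ^ \<beta> i)"
  using assms by (simp_all add: sum.remove[of UNIV i] prod.remove[of UNIV i])

lemma form_coord_mult:
  assumes "form d F"
  shows "form (Suc d) (\<lambda>x. x $ i * F x)"
proof -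
  obtain c where c: "\<And>x. F x = (\<Sum>\<alpha> | (\<Sum>i\<in>UNIV. \<alpha> i) = d. c \<alpha> * (\<Prod>i\<in>UNIV. (x $ i) ^ \<alpha> i))"
    using assms unfolding form_def by blast
  have "form (Suc d) (\<lambda>x. \<Sum>\<alpha> | (\<Sum>i\<in>UNIV. \<alpha> i) = d.
      c \<alpha> * (\<Prod>j\<in>UNIV. (x $ j) ^ (\<alpha>(i := Suc (\<alpha> i))) j))"
    by (intro form_sum form_monomial) (use monomial_step(1)[OF refl] in auto)
  then show ?thesis
    unfolding c sum_distrib_left monomial_step(2)[OF refl] by (simp add: mult_ac)
qed

text \<open>Constants, sums and multiplication by a coordinate generate all forms, so closure
  properties need no calculation with exponent functions. The degree is part of the induction
  predicate because it grows in the last case.\<close>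

lemma form_induct [consumes 1, case_names const add coord]:
  fixes F :: "complex ^ 'n::finite \<Rightarrow> complex"
  assumes "form d F"
    and const: "\<And>c. Q 0 (\<lambda>x. c)"
    and add: "\<And>d F G. form d F \<Longrightarrow> form d G \<Longrightarrow> Q d F \<Longrightarrow> Q d G \<Longrightarrow> Q d (\<lambda>x. F x + G x)"
    and coord: "\<And>d F i. form d F \<Longrightarrow> Q d F \<Longrightarrow> Q (Suc d) (\<lambda>x. x $ i * F x)"
  shows "Q d F"
proof -
  have mono: "Q d (\<lambda>x. c * (\<Prod>i\<in>UNIV. (x $ i) ^ \<alpha> i))" if "(\<Sum>i\<in>UNIV. \<alpha> i) = d" for d \<alpha> c
    using that
  proof (induction d arbitrary: \<alpha>)
    case 0
    then show ?case using const[of c] by simp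
  next
    case (Suc d)
    then obtain i where i: "\<alpha> i > 0"
      by (metis Suc_neq_Zero bot_nat_0.not_eq_extremum sum.neutral)
    define \<beta> where "\<beta> = \<alpha>(i := \<alpha> i - 1)"
    have eq: "\<alpha> = \<beta>(i := Suc (\<beta> i))" using i by (auto simp: \<beta>_def)
    have s: "(\<Sum>i\<in>UNIV. \<beta> i) = d" using monomial_step(1)[OF eq] Suc.prems by simp
    have "Q (Suc d) (\<lambda>x. x $ i * (c * (\<Prod>i\<in>UNIV. (x $ i) ^ \<beta> i)))"
      by (intro coord Suc.IH form_monomial s)
    then show ?case unfolding monomial_step(2)[OF eq] by (simp add: mult_ac)
  qed
  obtain c where c: "F = (\<lambda>x. \<Sum>\<alpha> | (\<Sum>i\<in>UNIV. \<alpha> i) = d. c \<alpha> * (\<Prod>i\<in>UNIV. (x $ i) ^ \<alpha> i))"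
    using assms(1) unfolding form_def by blast
  obtain k :: 'n where True by simp
  \<comment> \<open>The empty sum must be available in degree \<open>d\<close>: it is 0 times the
    \<open>d\<close>-th power of one fixed coordinate.\<close>
  have z: "Q d (\<lambda>x. 0)" using mono[of "\<lambda>i. if i = k then d else 0" d 0] by simp
  have "S \<subseteq> {\<alpha>. (\<Sum>i\<in>UNIV. \<alpha> i) = d} \<Longrightarrow>
      Q d (\<lambda>x. \<Sum>\<alpha>\<in>S. c \<alpha> * (\<Prod>i\<in>UNIV. (x $ i) ^ \<alpha> i))" if "finite S" for S
    using that
  proof (induction S)
    case empty
    then show ?case using z by simp
  next
    case (insert \<alpha> S)
    then show ?case
      by (simp, intro add mono form_sum form_monomial) auto
  qed
  then show ?thesis unfolding c using finite_exponents by blast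
qed

lemma form_mult: "form d F \<Longrightarrow> form e G \<Longrightarrow> form (d + e) (\<lambda>x. F x * G x)"
proof (induction rule: form_induct)
  case (const c)
  then show ?case by (simp add: form_scale)
next
  case (add d F G)
  then show ?case using form_add by (simp add: distrib_right)
next
  case (coord d F i)
  then show ?case using form_coord_mult[of "d + e" _ i] by (simp add: mult.assoc)
qed

lemma form_power: "form d F \<Longrightarrow> form (n * d) (\<lambda>x. F x ^ n)"
  by (induction n) (auto simp: form_const intro: form_mult)

lemma form_coord: "form 1 (\<lambda>x. x $ i)"
  using form_coord_mult[OF form_const[of 1], of i] by simp

lemma form_subst:
  assumes "form d F" and g: "\<And>i. form k (\<lambda>x. g x $ i)"
  shows "form (d * k) (\<lambda>x. F (g x))"
  using assms(1)
proof (induction rule: form_induct)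
  case (const c)
  then show ?case by (simp add: form_const)
next
  case (add d F G)
  then show ?case using form_add by blast
next
  case (coord d F i)
  then show ?case using form_mult[OF g] by simp
qed

lemma form_matrix: "form 1 (\<lambda>x. (M *v x) $ i)"
  unfolding matrix_vector_mult_def vec_lambda_beta
  by (intro form_sum form_scale form_coord)

lemma form_homogeneous: "form d F \<Longrightarrow> F (c *s x) = c ^ d * F x"
  by (induction rule: form_induct) (auto simp: algebra_simps)

lemma form_zero_at_0: "form d F \<Longrightarrow> d > 0 \<Longrightarrow> F 0 = 0"
  using form_homogeneous[of d F 0 0] by (simp add: power_0_left)

lemma form_0_const: "form 0 F \<Longrightarrow> F x = F y"
  using form_homogeneous[of 0 F 0 x] form_homogeneous[of 0 F 0 y] by simp

lemma continuous_form: "form d F \<Longrightarrow> isCont F x"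
proof (induction rule: form_induct)
  case (const c)
  then show ?case by simp
next
  case (add d F G)
  then show ?case by (intro continuous_intros)
next
  case (coord d F i)
  have "isCont (\<lambda>x. x $ i) x" by (intro continuous_intros)
  with coord show ?case by (intro continuous_intros)
qed

lemma form_1_linear:
  assumes "form 1 L"
  shows "L (x + y) = L x + L y" and "L (c *s x) = c * L x"
proof -
  have "form d L \<Longrightarrow> d = 1 \<longrightarrow> (\<forall>x y. L (x + y) = L x + L y)" for d L
  proof (induction rule: form_induct)
    case (coord d F i)
    then show ?case by (metis One_nat_def Suc_inject distrib_right form_0_const vector_add_component)
  qed (auto simp: algebra_simps)
  with assms show "L (x + y) = L x + L y" by blast
  show "L (c *s x) = c * L x" using form_homogeneous[OF assms, of c x] by simp
qed

lemma form_poly: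
  assumes "form d F" and g: "\<And>i. \<exists>p. \<forall>\<tau>. g \<tau> $ i = poly p \<tau>"
  shows "\<exists>p. \<forall>\<tau>. F (g \<tau>) = poly p \<tau>"
  using assms(1)
proof (induction rule: form_induct)
  case (const c)
  show ?case by (intro exI[of _ "[:c:]"]) simp
next
  case (add d F G)
  then show ?case by (metis poly_add)
next
  case (coord d F i)
  then show ?case using g[of i] by (metis poly_mult)
qed

text \<open>The coefficient of degree \<open>d\<close> is the value at the direction
  \<open>e\<close> and does not involve the base point \<open>w\<close>. This makes the leading
  coefficient uniform in a family of parallel lines.\<close>

lemma form_line_poly:
  assumes "form d F"
  shows "\<exists>p. (\<forall>\<sigma>. poly p \<sigma> = F (w + \<sigma> *s e)) \<and> degree p \<le> d \<and> coeff p d = F e"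
  using assms
proof (induction rule: form_induct)
  case (const c)
  show ?case by (intro exI[of _ "[:c:]"]) simp
next
  case (add d F G)
  then obtain p q where "\<forall>\<sigma>. poly p \<sigma> = F (w + \<sigma> *s e)" "degree p \<le> d" "coeff p d = F e"
    "\<forall>\<sigma>. poly q \<sigma> = G (w + \<sigma> *s e)" "degree q \<le> d" "coeff q d = G e" by blast
  then show ?case by (intro exI[of _ "p + q"]) (auto intro: degree_add_le)
next
  case (coord d F i)
  then obtain p where p: "\<forall>\<sigma>. poly p \<sigma> = F (w + \<sigma> *s e)" "degree p \<le> d" "coeff p d = F e"
    by blast
  have "degree ([:w $ i, e $ i:] * p) \<le> Suc d"
    using degree_mult_le[of "[:w $ i, e $ i:]" p] p(2) degree_pCons_le[of "w $ i" "[:e $ i:]"] by simp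
  moreover have "coeff p (Suc d) = 0" using p(2) by (simp add: coeff_eq_0)
  ultimately show ?case using p
    by (intro exI[of _ "[:w $ i, e $ i:] * p"]) (auto simp: algebra_simps)
qed

lemma form_local_equation:
  assumes "form d F"
  shows "\<exists>h. local_equation F v e f h"
  using assms unfolding local_equation_def
proof (induction rule: form_induct)
  case (const c)
  show ?case by (intro exI[of _ "[:[:c:]:]"]) simp
next
  case (add d F G)
  then obtain p q where "\<forall>s t. poly (poly p [:t:]) s = F (v + s *s e + t *s f)"
    "\<forall>s t. poly (poly q [:t:]) s = G (v + s *s e + t *s f)" by blast
  then show ?case by (intro exI[of _ "p + q"]) simp
next
  case (coord d F i)
  then obtain p where "\<forall>s t. poly (poly p [:t:]) s = F (v + s *s e + t *s f)" by blast
  then show ?case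
    by (intro exI[of _ "[:[:v $ i, e $ i:], [:f $ i:]:] * p"]) (auto simp: algebra_simps)
qed

text \<open>On the line that joins a point with \<open>F\<close> nonzero to a point with
  \<open>G\<close> nonzero, both forms restrict to nonzero polynomials in one variable, and their
  product has a nonzero value. This replaces the absence of zero divisors, also on a
  subspace.\<close>

lemma form_mult_eq_0:
  assumes "form d F" "form e G" and "\<And>x y c. x \<in> W \<Longrightarrow> y \<in> W \<Longrightarrow> x + c *s (y - x) \<in> W"
    and "x \<in> W" "F x \<noteq> 0" "y \<in> W" "G y \<noteq> 0"
  obtains z where "z \<in> W" "F z \<noteq> 0" "G z \<noteq> 0"
proof -
  obtain p q where p: "\<forall>\<sigma>. poly p \<sigma> = F (x + \<sigma> *s (y - x))"
    and q: "\<forall>\<sigma>. poly q \<sigma> = G (x + \<sigma> *s (y - x))"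
    using form_line_poly[OF assms(1), of x "y - x"] form_line_poly[OF assms(2), of x "y - x"] by blast
  have "poly p 0 \<noteq> 0" "poly q 1 \<noteq> 0" using assms(5,7) p q by simp_all
  then have "p * q \<noteq> 0" by auto
  then obtain \<sigma> where "poly (p * q) \<sigma> \<noteq> 0" using poly_all_0_iff_0 by blast
  then have "F (x + \<sigma> *s (y - x)) \<noteq> 0" "G (x + \<sigma> *s (y - x)) \<noteq> 0" using p q by auto
  then show thesis using that assms(3)[OF assms(4,6)] by blast
qed

text \<open>The first term is \<open>F\<close> with the coordinate \<open>i\<close> set to 0, and
  the rest is divisible by this coordinate. Degree 0 is separate because the cofactor would have
  degree -1.\<close>

lemma form_split:
  fixes F :: "complex ^ 'n::finite \<Rightarrow> complex"
  assumes "form d F"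
  shows "(d = 0 \<longrightarrow> (\<forall>v. F v = F (v - v $ i *s axis i 1))) \<and>
    (\<forall>e. d = Suc e \<longrightarrow> (\<exists>R. form e R \<and> (\<forall>v. F v = F (v - v $ i *s axis i 1) + v $ i * R v)))"
  using assms
proof (induction rule: form_induct)
  case (const c)
  show ?case by simp
next
  case (add d F G)
  show ?case
  proof (intro conjI impI allI)
    fix v assume "d = 0"
    then show "F v + G v = F (v - v $ i *s axis i 1) + G (v - v $ i *s axis i 1)"
      using add.IH by (intro arg_cong2[of _ _ _ _ "(+)"]) blast+
  next
    fix e assume "d = Suc e"
    then obtain R R' where "form e R" "\<forall>v. F v = F (v - v $ i *s axis i 1) + v $ i * R v"
      "form e R'" "\<forall>v. G v = G (v - v $ i *s axis i 1) + v $ i * R' v"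
      using add.IH by blast
    note R = this
    have "F v + G v = F (v - v $ i *s axis i 1) + G (v - v $ i *s axis i 1) + v $ i * (R v + R' v)" for v
      by (subst R(2)[rule_format], subst R(4)[rule_format]) (simp only: algebra_simps)
    then show "\<exists>R. form e R \<and> (\<forall>v. F v + G v =
      F (v - v $ i *s axis i 1) + G (v - v $ i *s axis i 1) + v $ i * R v)"
      using form_add[OF R(1,3)] by (intro exI[of _ "\<lambda>v. R v + R' v"] conjI allI)
  qed
next
  case (coord d F j)
  have i0: "(v - v $ i *s axis i 1) $ j = (if i = j then 0 else v $ j)" for v :: "complex ^ 'n"
    by (simp add: axis_def)
  have "\<exists>R. form d R \<and> (\<forall>v. v $ j * F v =
      (v - v $ i *s axis i 1) $ j * F (v - v $ i *s axis i 1) + v $ i * R v)"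
  proof (cases "i = j")
    case True
    then show ?thesis using coord.hyps unfolding i0 by auto
  next
    case ij: False
    show ?thesis
    proof (cases d)
      case 0
      then have "F v = F (v - v $ i *s axis i 1)" for v using coord.IH by blast
      then show ?thesis using ij unfolding i0
        by (intro exI[of _ "\<lambda>v. 0"] conjI allI form_zero) (metis add.right_neutral mult_zero_right)
    next
      case (Suc e)
      then obtain R where R: "form e R" "\<forall>v. F v = F (v - v $ i *s axis i 1) + v $ i * R v"
        using coord.IH by blast
      have "v $ j * F v = v $ j * F (v - v $ i *s axis i 1) + v $ i * (v $ j * R v)" for v
        by (subst R(2)[rule_format]) (simp add: algebra_simps)
      then show ?thesis using R(1) ij Suc unfolding i0
        by (intro exI[of _ "\<lambda>v. v $ j * R v"] conjI allI) (simp_all only: if_False form_coord_mult)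
    qed
  qed
  then show ?case by simp
qed

text \<open>The part of \<open>form_split\<close> that is free of the coordinate vanishes by
  assumption. The nonzero value at \<open>w\<close> excludes degree 0, where there is no
  quotient.\<close>

lemma form_divide:
  assumes "form d F" and "\<And>v. v $ i = 0 \<Longrightarrow> F v = 0" and "F w \<noteq> 0"
  obtains e R where "d = Suc e" "form e R" "\<And>v. F v = v $ i * R v"
proof (cases d)
  case 0
  have "F w = F 0" using form_0_const assms(1) 0 by blast
  then show ?thesis using assms(2)[of 0] assms(3) by simp
next
  case (Suc e)
  then obtain R where "form e R" "\<forall>v. F v = F (v - v $ i *s axis i 1) + v $ i * R v"
    using form_split[OF assms(1), of i] by blast
  moreover have "F (v - v $ i *s axis i 1) = 0" for v
    by (rule assms(2)) simp
  ultimately show ?thesis using that Suc by simp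
qed

text \<open>Off the hyperplane the coordinate cancels, and a point of the hyperplane is a limit of
  points off it along the axis \<open>i\<close>.\<close>

lemma form_cancel_coord:
  fixes F G :: "complex ^ 'n::finite \<Rightarrow> complex"
  assumes "form d F" "form e G" and eq: "\<And>v. v $ i * F v = v $ i * G v"
  shows "F v = G v"
proof -
  have tend: "((\<lambda>\<tau>. H (v + \<tau> *s axis i 1)) \<longlongrightarrow> H v) (at 0)" if H: "form n H" for n and H :: "complex ^ 'n \<Rightarrow> complex"
  proof -
    obtain p where p: "\<forall>\<sigma>. poly p \<sigma> = H (v + \<sigma> *s axis i 1)" using form_line_poly[OF H] by blast
    have "(poly p \<longlongrightarrow> poly p 0) (at 0)" using poly_isCont isContD by blast
    moreover have "poly p = (\<lambda>\<sigma>. H (v + \<sigma> *s axis i 1))" using p by auto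
    ultimately show ?thesis by simp
  qed
  have "eventually (\<lambda>\<tau>. \<tau> \<noteq> - (v $ i)) (at (0 :: complex))"
    using eventually_neq_at_within by blast
  then have "eventually (\<lambda>\<tau>. F (v + \<tau> *s axis i 1) = G (v + \<tau> *s axis i 1)) (at 0)"
  proof eventually_elim
    case (elim \<tau>)
    then have "(v + \<tau> *s axis i 1) $ i \<noteq> 0" by (auto simp: add_eq_0_iff)
    then show ?case using eq[of "v + \<tau> *s axis i 1"] by (metis mult_left_cancel)
  qed
  then have "((\<lambda>\<tau>. G (v + \<tau> *s axis i 1)) \<longlongrightarrow> F v) (at 0)"
    using tend[OF assms(1)] tendsto_cong by fast
  then show ?thesis using tend[OF assms(2)] tendsto_unique by (metis trivial_limit_at)
qed

text \<open>The constant term is, up to sign, the leading coefficient times the product of the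
  roots. Used contrapositively: a small value at 0 forces a small root.\<close>

lemma poly_small_root_bound:
  fixes p :: "complex poly"
  assumes "r \<ge> 0" "\<And>z. poly p z = 0 \<Longrightarrow> r \<le> cmod z"
  shows "cmod (lead_coeff p) * r ^ degree p \<le> cmod (poly p 0)"
  using assms(2)
proof (induction "degree p" arbitrary: p)
  case 0
  then obtain a where "p = [:a:]" by (metis degree_eq_zeroE)
  then show ?case by simp
next
  case (Suc n)
  then have "\<not> constant (poly p)" by (simp add: constant_degree)
  then obtain z where z: "poly p z = 0" using fundamental_theorem_of_algebra by blast
  then obtain q where q: "p = [:- z, 1:] * q" unfolding poly_eq_0_iff_dvd by (elim dvdE)
  have q0: "q \<noteq> 0" using Suc.hyps(2) q by auto
  have dp: "degree p = Suc (degree q)" unfolding q using q0 by (subst degree_mult_eq) auto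
  have "cmod (lead_coeff q) * r ^ degree q \<le> cmod (poly q 0)"
    using Suc.hyps dp Suc.prems q by auto
  moreover have "r \<le> cmod z" using Suc.prems z by blast
  ultimately have "r * (cmod (lead_coeff q) * r ^ degree q) \<le> cmod z * cmod (poly q 0)"
    using assms(1) by (intro mult_mono) auto
  moreover have "lead_coeff p = lead_coeff q" unfolding q lead_coeff_mult by simp
  moreover have "cmod (poly p 0) = cmod z * cmod (poly q 0)" unfolding q by (simp add: norm_mult)
  ultimately show ?case unfolding dp by (simp add: mult_ac)
qed

text \<open>No point of a hypersurface \<open>G = 0\<close> is isolated from the complement of a hyperplane \<open>L = 0\<close>
  on which \<open>G\<close> does not vanish identically: the polynomial \<open>\<sigma> \<mapsto> G (v + \<tau> f + \<sigma> e)\<close> has the leading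
  coefficient \<open>G e \<noteq> 0\<close>, which does not depend on \<open>\<tau>\<close>, so it has a small root for small \<open>\<tau>\<close>.\<close>

lemma form_vanishes_by_density:
  fixes G K L :: "complex ^ 'n::finite \<Rightarrow> complex"
  assumes G: "form d G" and K: "form k K" and L: "form 1 L"
    and e: "L e = 0" "G e \<noteq> 0" and f: "L f \<noteq> 0"
    and van: "\<And>w. G w = 0 \<Longrightarrow> L w \<noteq> 0 \<Longrightarrow> K w = 0"
    and v: "G v = 0"
  shows "K v = 0"
proof (rule ccontr)
  assume Kv: "K v \<noteq> 0"
  then have Lv: "L v = 0" using van v by blast
  have "isCont K v" using continuous_form K by blast
  then have "eventually (\<lambda>w. K w \<noteq> 0) (at v)"
    using Kv tendsto_imp_eventually_ne isCont_def by blast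
  then obtain r where r: "r > 0" "\<And>w. dist w v < r \<Longrightarrow> K w \<noteq> 0"
    using Kv unfolding eventually_at by (metis UNIV_I)
  define N where "N = norm e + 1"
  have N: "N > 0" unfolding N_def by (simp add: add_nonneg_pos)
  have sc: "norm (c *s x) = cmod c * norm x" for c and x :: "complex ^ 'n"
    by (simp add: norm_vec_def L2_set_right_distrib norm_mult)
  \<comment> \<open>The ball of radius \<open>r\<close> around \<open>v\<close> is split evenly:
    |\<sigma>| < \<rho> keeps the displacement along \<open>e\<close> below r/2, and the bound on
    \<tau> does the same along \<open>f\<close>. Adding 1 to the norms keeps the divisors
    positive.\<close>
  define \<rho> where "\<rho> = r / (2 * N)"
  have \<rho>: "\<rho> > 0" using r(1) N by (simp add: \<rho>_def)
  obtain p where p: "\<forall>\<sigma>. poly p \<sigma> = G (v + \<sigma> *s f)" using form_line_poly[OF G] by blast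
  have "(poly p \<longlongrightarrow> poly p 0) (at 0)" using poly_isCont isContD by blast
  moreover have "poly p 0 = 0" using p v by simp
  ultimately have "eventually (\<lambda>\<tau>. cmod (poly p \<tau>) < cmod (G e) * \<rho> ^ d) (at 0)"
    using order_tendstoD(2)[OF tendsto_norm, of "poly p" 0 "at 0" "cmod (G e) * \<rho> ^ d"] e(2) \<rho> by simp
  moreover have "eventually (\<lambda>\<tau> :: complex. dist \<tau> 0 < r / (2 * (norm f + 1))) (at 0)"
    using r(1) unfolding eventually_at
    by (intro exI[of _ "r / (2 * (norm f + 1))"]) (auto intro!: divide_pos_pos add_nonneg_pos)
  moreover have "eventually (\<lambda>\<tau> :: complex. \<tau> \<noteq> 0) (at 0)" by (rule eventually_neq_at_within)
  ultimately have "eventually (\<lambda>\<tau>. cmod (poly p \<tau>) < cmod (G e) * \<rho> ^ d \<and>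
      dist \<tau> 0 < r / (2 * (norm f + 1)) \<and> \<tau> \<noteq> 0) (at 0)"
    by eventually_elim blast
  then have "\<exists>\<tau>. cmod (poly p \<tau>) < cmod (G e) * \<rho> ^ d \<and>
      dist \<tau> 0 < r / (2 * (norm f + 1)) \<and> \<tau> \<noteq> 0"
    by (rule eventually_happens'[rotated]) simp
  then obtain \<tau> where \<tau>: "cmod (G (v + \<tau> *s f)) < cmod (G e) * \<rho> ^ d"
    "cmod \<tau> < r / (2 * (norm f + 1))" "\<tau> \<noteq> 0"
    using p by auto
  obtain q where q: "\<forall>\<sigma>. poly q \<sigma> = G (v + \<tau> *s f + \<sigma> *s e)" "degree q \<le> d" "coeff q d = G e"
    using form_line_poly[OF G] by blast
  have dq: "degree q = d" using q(2,3) e(2) le_degree by (metis le_antisym)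
  have "\<exists>z. poly q z = 0 \<and> cmod z < \<rho>"
  proof (rule ccontr)
    assume "\<not> ?thesis"
    then have "cmod (lead_coeff q) * \<rho> ^ degree q \<le> cmod (poly q 0)"
      using \<rho> by (intro poly_small_root_bound) (auto simp: not_less)
    then show False using \<tau>(1) q dq by simp
  qed
  then obtain \<sigma> where \<sigma>: "G (v + \<tau> *s f + \<sigma> *s e) = 0" "cmod \<sigma> < \<rho>" using q(1) by auto
  let ?w = "v + \<tau> *s f + \<sigma> *s e"
  have "L ?w \<noteq> 0" using \<tau>(3) Lv e(1) f by (simp add: form_1_linear[OF L])
  then have "K ?w = 0" using van \<sigma>(1) by blast
  moreover have "dist ?w v < r"
  proof -
    have "norm (\<tau> *s f) \<le> cmod \<tau> * (norm f + 1)" unfolding sc by (intro mult_left_mono) auto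
    moreover have "norm f + 1 > 0" by (simp add: add_nonneg_pos)
    then have "cmod \<tau> * (norm f + 1) < r / 2" using \<tau>(2) by (simp add: pos_less_divide_eq algebra_simps)
    ultimately have "norm (\<tau> *s f) < r / 2" by linarith
    moreover have "norm (\<sigma> *s e) \<le> cmod \<sigma> * N" unfolding sc N_def by (intro mult_left_mono) auto
    moreover have "cmod \<sigma> * N < r / 2" using \<sigma>(2) N by (simp add: \<rho>_def field_simps)
    ultimately have "norm (\<tau> *s f + \<sigma> *s e) < r"
      using norm_triangle_ineq[of "\<tau> *s f" "\<sigma> *s e"] by linarith
    then show ?thesis by (simp add: dist_norm add.assoc)
  qed
  ultimately show False using r(2) by blast
qed

subsection \<open>Orders of vanishing\<close>

text \<open>A function that vanishes identically near 0 has no order, so having one also certifies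
  nonvanishing. The limit needs no expansion of \<open>g\<close> into a power series.\<close>

definition has_order :: "(complex \<Rightarrow> complex) \<Rightarrow> nat \<Rightarrow> bool" where
  "has_order g m \<longleftrightarrow> (\<exists>c. c \<noteq> 0 \<and> ((\<lambda>\<tau>. g \<tau> / \<tau> ^ m) \<longlongrightarrow> c) (at 0))"

lemma has_order_mult:
  assumes "has_order g m" "has_order h n"
  shows "has_order (\<lambda>\<tau>. g \<tau> * h \<tau>) (m + n)"
proof -
  obtain c c' where "c \<noteq> 0" "((\<lambda>\<tau>. g \<tau> / \<tau> ^ m) \<longlongrightarrow> c) (at 0)"
    "c' \<noteq> 0" "((\<lambda>\<tau>. h \<tau> / \<tau> ^ n) \<longlongrightarrow> c') (at 0)"
    using assms unfolding has_order_def by blast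
  then show ?thesis
    using tendsto_mult[of "\<lambda>\<tau>. g \<tau> / \<tau> ^ m" c "at 0" "\<lambda>\<tau>. h \<tau> / \<tau> ^ n" c']
    unfolding has_order_def by (intro exI[of _ "c * c'"]) (simp add: power_add)
qed

lemma has_order_unique:
  assumes "has_order g m" "has_order g n"
  shows "m = n"
proof -
  have False if "m < n" "has_order g m" "has_order g n" for m n
  proof -
    obtain c c' where c: "c \<noteq> 0" "((\<lambda>\<tau>. g \<tau> / \<tau> ^ m) \<longlongrightarrow> c) (at 0)"
      "((\<lambda>\<tau>. g \<tau> / \<tau> ^ n) \<longlongrightarrow> c') (at 0)"
      using \<open>has_order g m\<close> \<open>has_order g n\<close> unfolding has_order_def by blast
    have "((\<lambda>\<tau>. g \<tau> / \<tau> ^ n * \<tau> ^ (n - m)) \<longlongrightarrow> c' * 0 ^ (n - m)) (at 0)"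
      by (intro tendsto_intros c)
    moreover have "eventually (\<lambda>\<tau>. g \<tau> / \<tau> ^ n * \<tau> ^ (n - m) = g \<tau> / \<tau> ^ m) (at 0)"
      using eventually_neq_at_within[of 0]
      by eventually_elim (use \<open>m < n\<close> in \<open>simp add: power_diff field_simps\<close>)
    ultimately have "((\<lambda>\<tau>. g \<tau> / \<tau> ^ m) \<longlongrightarrow> 0) (at 0)"
      using \<open>m < n\<close> tendsto_cong by (fastforce simp: power_0_left)
    then show False using c(1,2) tendsto_unique by (metis trivial_limit_at)
  qed
  with assms show ?thesis by (metis linorder_neqE_nat)
qed

lemma has_order_monomial: "c \<noteq> 0 \<Longrightarrow> has_order (\<lambda>\<tau>. c * \<tau> ^ n) n"
proof -
  assume "c \<noteq> 0"
  have "eventually (\<lambda>\<tau>. c * \<tau> ^ n / \<tau> ^ n = c) (at (0 :: complex))"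
    using eventually_neq_at_within[of 0] by eventually_elim simp
  with \<open>c \<noteq> 0\<close> show ?thesis unfolding has_order_def
    by (intro exI[of _ c]) (auto intro: tendsto_eventually)
qed

lemma has_order_0: "isCont g 0 \<Longrightarrow> g 0 \<noteq> 0 \<Longrightarrow> has_order g 0"
  unfolding has_order_def isCont_def by auto

lemma has_order_scale:
  assumes "c \<noteq> 0" "has_order g m"
  shows "has_order (\<lambda>\<tau>. g (c * \<tau>)) m"
proof -
  obtain l where l: "l \<noteq> 0" "((\<lambda>\<tau>. g \<tau> / \<tau> ^ m) \<longlongrightarrow> l) (at 0)"
    using assms(2) unfolding has_order_def by blast
  have "filterlim (\<lambda>\<tau>. c * \<tau>) (at 0) (at 0)"
    using assms(1) by (auto simp: filterlim_at eventually_at intro!: tendsto_eq_intros exI[of _ 1])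
  from tendsto_compose_filtermap filterlim_compose[OF l(2) this]
  have "((\<lambda>\<tau>. g (c * \<tau>) / (c * \<tau>) ^ m * c ^ m) \<longlongrightarrow> l * c ^ m) (at 0)"
    by (intro tendsto_intros)
  then show ?thesis using l(1) assms(1) unfolding has_order_def
    by (intro exI[of _ "l * c ^ m"]) (simp add: power_mult_distrib field_simps)
qed

text \<open>The order of the polynomial \<open>h(s, t)\<close> when \<open>s\<close> has weight 1 and \<open>t\<close> has weight \<open>k\<close>. With \<open>k = 1\<close>
  it is the multiplicity at the origin, with \<open>k = 2\<close> it is the sum of the multiplicity at the origin
  and that at the infinitely near point in the direction \<open>t = 0\<close>.\<close>

definition has_weight :: "nat \<Rightarrow> complex poly poly \<Rightarrow> nat \<Rightarrow> bool" where
  "has_weight k h m \<longleftrightarrow> (\<exists>i j. i + k * j = m \<and> coeff (coeff h j) i \<noteq> 0) \<and>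
     (\<forall>i j. coeff (coeff h j) i \<noteq> 0 \<longrightarrow> m \<le> i + k * j)"

lemma has_weight_order_at_origin:
  assumes "h \<noteq> 0"
  shows "has_weight 1 h (order_at_origin h)"
proof -
  obtain j where "coeff h j \<noteq> 0" using assms by (metis leading_coeff_neq_0)
  then obtain i where "coeff (coeff h j) i \<noteq> 0" by (metis leading_coeff_neq_0)
  then have ex: "\<exists>i' j'. i' + j' = i + j \<and> coeff (coeff h j') i' \<noteq> 0" by blast
  show ?thesis unfolding has_weight_def order_at_origin_def
    using LeastI[of "\<lambda>m. \<exists>i j. i + j = m \<and> coeff (coeff h j) i \<noteq> 0", OF ex]
      Least_le[of "\<lambda>m. \<exists>i j. i + j = m \<and> coeff (coeff h j) i \<noteq> 0"] by auto
qed

text \<open>With s of order 1 and t of order k in \<tau>, the monomial s^i t^j has order at least i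
  + k j, so after division by \<tau>^m only the terms of weight exactly m survive in the
  limit.\<close>

lemma has_weight_tendsto:
  assumes h: "has_weight k h m"
    and s: "((\<lambda>\<tau>. s \<tau> / \<tau>) \<longlongrightarrow> s0) (at 0)" and t: "((\<lambda>\<tau>. t \<tau> / \<tau> ^ k) \<longlongrightarrow> t0) (at 0)"
  shows "((\<lambda>\<tau>. poly (poly h [:t \<tau>:]) (s \<tau>) / \<tau> ^ m) \<longlongrightarrow>
    (\<Sum>j\<le>degree h. \<Sum>i\<le>degree (coeff h j).
      if i + k * j = m then coeff (coeff h j) i * s0 ^ i * t0 ^ j else 0)) (at 0)"
proof -
  have eq: "poly (poly h [:y:]) x / z = (\<Sum>j\<le>degree h. \<Sum>i\<le>degree (coeff h j).
      coeff (coeff h j) i * x ^ i * y ^ j / z)" for x y z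
    unfolding poly_altdef[of h] poly_sum poly_mult poly_power sum_divide_distrib
    by (simp add: poly_altdef sum_distrib_right sum_divide_distrib)
  show ?thesis
    unfolding eq
  proof (intro tendsto_sum)
    fix i j
    let ?c = "coeff (coeff h j) i"
    show "((\<lambda>\<tau>. ?c * s \<tau> ^ i * t \<tau> ^ j / \<tau> ^ m) \<longlongrightarrow>
      (if i + k * j = m then ?c * s0 ^ i * t0 ^ j else 0)) (at 0)"
    proof (cases "?c = 0")
      case False
      then have m: "m \<le> i + k * j" using h unfolding has_weight_def by blast
      have "((\<lambda>\<tau>. ?c * (s \<tau> / \<tau>) ^ i * (t \<tau> / \<tau> ^ k) ^ j * \<tau> ^ (i + k * j - m)) \<longlongrightarrow>
        ?c * s0 ^ i * t0 ^ j * 0 ^ (i + k * j - m)) (at 0)"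
        by (intro tendsto_intros s t)
      moreover have "eventually (\<lambda>\<tau>. ?c * (s \<tau> / \<tau>) ^ i * (t \<tau> / \<tau> ^ k) ^ j * \<tau> ^ (i + k * j - m)
        = ?c * s \<tau> ^ i * t \<tau> ^ j / \<tau> ^ m) (at 0)"
        using eventually_neq_at_within[of 0]
        by eventually_elim (simp add: power_diff[OF _ m] power_divide power_add power_mult)
      ultimately have "((\<lambda>\<tau>. ?c * s \<tau> ^ i * t \<tau> ^ j / \<tau> ^ m) \<longlongrightarrow>
        ?c * s0 ^ i * t0 ^ j * 0 ^ (i + k * j - m)) (at 0)"
        using tendsto_cong by fast
      moreover have "?c * s0 ^ i * t0 ^ j * 0 ^ (i + k * j - m) =
          (if i + k * j = m then ?c * s0 ^ i * t0 ^ j else 0)"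
        using m by (simp add: power_0_left)
      ultimately show ?thesis by simp
    qed simp
  qed
qed

text \<open>Dehomogenizing the part of lowest weight leaves a nonzero polynomial in one variable, so
  this part vanishes for only finitely many values of t0 / s0^k with s0 nonzero.\<close>

lemma has_weight_leading_form:
  assumes h: "has_weight k h m"
  obtains P :: "complex poly" where "P \<noteq> 0"
    "\<And>s0 t0. s0 \<noteq> 0 \<Longrightarrow> (\<Sum>j\<le>degree h. \<Sum>i\<le>degree (coeff h j).
      if i + k * j = m then coeff (coeff h j) i * s0 ^ i * t0 ^ j else 0) = s0 ^ m * poly P (t0 / s0 ^ k)"
proof -
  \<comment> \<open>The guard is needed because the subtraction in the index is truncated.\<close>
  define c where "c j = (if k * j \<le> m then coeff (coeff h j) (m - k * j) else 0)" for j
  define P where "P = (\<Sum>j\<le>degree h. monom (c j) j)"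
  obtain i j where ij: "i + k * j = m" "coeff (coeff h j) i \<noteq> 0" using h unfolding has_weight_def by blast
  have "j \<le> degree h" using ij(2) by (metis coeff_0 coeff_eq_0 not_le)
  then have "coeff P j = c j" unfolding P_def by (simp add: coeff_sum)
  moreover have "c j \<noteq> 0" using ij by (auto simp: c_def)
  ultimately have "P \<noteq> 0" by auto
  moreover have "(\<Sum>j\<le>degree h. \<Sum>i\<le>degree (coeff h j).
      if i + k * j = m then coeff (coeff h j) i * s0 ^ i * t0 ^ j else 0) = s0 ^ m * poly P (t0 / s0 ^ k)"
    if s0: "s0 \<noteq> 0" for s0 t0
  proof -
    have "(\<Sum>i\<le>degree (coeff h j). if i + k * j = m then coeff (coeff h j) i * s0 ^ i * t0 ^ j else 0)
      = s0 ^ m * (c j * (t0 / s0 ^ k) ^ j)" for j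
    proof (cases "k * j \<le> m")
      case True
      have "(\<Sum>i\<le>degree (coeff h j). if i + k * j = m then coeff (coeff h j) i * s0 ^ i * t0 ^ j else 0)
        = (\<Sum>i\<le>degree (coeff h j). if i = m - k * j then coeff (coeff h j) i * s0 ^ i * t0 ^ j else 0)"
        using True by (intro sum.cong) auto
      also have "\<dots> = coeff (coeff h j) (m - k * j) * s0 ^ (m - k * j) * t0 ^ j"
        by (auto simp: coeff_eq_0)
      also have "\<dots> = s0 ^ m * (c j * (t0 / s0 ^ k) ^ j)"
        using True s0 by (simp add: c_def power_diff power_divide power_mult)
      finally show ?thesis .
    next
      case False
      then show ?thesis by (auto simp: c_def intro!: sum.neutral)
    qed
    then show ?thesis by (simp add: P_def poly_sum poly_monom sum_distrib_left)
  qed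
  ultimately show thesis using that by blast
qed

text \<open>The path in the basis \<open>b1\<close>, \<open>b2\<close>, \<open>b3\<close> is
  expanded in \<open>v\<close>, \<open>e\<close>, \<open>f\<close> and divided by its coefficient at
  \<open>v\<close>, which tends to \<kappa>. Its affine coordinates then have the leading
  coefficients S \<beta> and T \<beta>. The order is m unless S \<beta> = 0 or T \<beta> / S
  \<beta>^k is a root of the leading polynomial, and this excludes finitely many \<beta>.\<close>

lemma local_equation_generic_order:
  assumes F: "form d F" and h: "local_equation F v e f h" and w: "has_weight k h m"
    and b: "b1 = \<kappa> *s v" "b2 = x0 *s v + x1 *s e + x2 *s f" "b3 = y0 *s v + y1 *s e + y2 *s f"
    and \<kappa>: "\<kappa> \<noteq> 0" and ker: "x1 * y2 - x2 * y1 \<noteq> 0" and k: "k = 1 \<or> k = 2 \<and> x2 = 0"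
  shows "finite {\<beta>. \<not> has_order (\<lambda>\<tau>. F (b1 + \<tau> *s b2 + (\<beta> * \<tau> ^ k) *s b3)) m}"
proof -
  obtain P where P: "P \<noteq> 0" "\<And>s0 t0. s0 \<noteq> 0 \<Longrightarrow> (\<Sum>j\<le>degree h. \<Sum>i\<le>degree (coeff h j).
      if i + k * j = m then coeff (coeff h j) i * s0 ^ i * t0 ^ j else 0) = s0 ^ m * poly P (t0 / s0 ^ k)"
    by (rule has_weight_leading_form[OF w]) blast
  \<comment> \<open>The limits of s/\<tau> and t/\<tau>^k. For k = 2 the contribution of
    \<open>b3\<close> to s has order 2 and drops out, and t has order 2 only because
    \<open>x2\<close> = 0.\<close>
  define S where "S \<beta> = (x1 + (if k = 1 then \<beta> * y1 else 0)) / \<kappa>" for \<beta>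
  define T where "T \<beta> = ((if k = 1 then x2 else 0) + \<beta> * y2) / \<kappa>" for \<beta>
  have ord: "has_order (\<lambda>\<tau>. F (b1 + \<tau> *s b2 + (\<beta> * \<tau> ^ k) *s b3)) m"
    if S: "S \<beta> \<noteq> 0" and T: "poly P (T \<beta> / S \<beta> ^ k) \<noteq> 0" for \<beta>
  proof -
    define c where "c \<tau> = \<kappa> + \<tau> * x0 + \<beta> * \<tau> ^ k * y0" for \<tau>
    define s where "s \<tau> = (\<tau> * x1 + \<beta> * \<tau> ^ k * y1) / c \<tau>" for \<tau>
    define t where "t \<tau> = (\<tau> * x2 + \<beta> * \<tau> ^ k * y2) / c \<tau>" for \<tau>
    have "(c \<longlongrightarrow> \<kappa> + 0 * x0 + \<beta> * 0 ^ k * y0) (at 0)"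
      unfolding c_def by (intro tendsto_intros)
    then have c: "(c \<longlongrightarrow> \<kappa>) (at 0)" using k by (auto simp: power_0_left)
    then have c0: "eventually (\<lambda>\<tau>. c \<tau> \<noteq> 0) (at 0)" using \<kappa> tendsto_imp_eventually_ne by blast
    have s_eq: "s \<tau> = \<tau> * ((x1 + \<beta> * \<tau> ^ (k - 1) * y1) / c \<tau>)" for \<tau>
      using k by (auto simp: s_def algebra_simps power2_eq_square add_divide_distrib)
    have t_eq: "t \<tau> = \<tau> ^ k * (((if k = 1 then x2 else 0) + \<beta> * y2) / c \<tau>)" for \<tau>
      using k by (auto simp: t_def algebra_simps add_divide_distrib)
    have "((\<lambda>\<tau>. (x1 + \<beta> * \<tau> ^ (k - 1) * y1) / c \<tau>) \<longlongrightarrow> (x1 + \<beta> * 0 ^ (k - 1) * y1) / \<kappa>) (at 0)"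
      by (intro tendsto_intros c \<kappa>)
    moreover have "(x1 + \<beta> * 0 ^ (k - 1) * y1) / \<kappa> = S \<beta>" using k by (auto simp: S_def)
    moreover have "eventually (\<lambda>\<tau>. (x1 + \<beta> * \<tau> ^ (k - 1) * y1) / c \<tau> = s \<tau> / \<tau>) (at 0)"
      using eventually_neq_at_within[of 0]
      by eventually_elim (simp add: s_eq)
    ultimately have s: "((\<lambda>\<tau>. s \<tau> / \<tau>) \<longlongrightarrow> S \<beta>) (at 0)" using tendsto_cong by fastforce
    have "((\<lambda>\<tau>. ((if k = 1 then x2 else 0) + \<beta> * y2) / c \<tau>) \<longlongrightarrow> T \<beta>) (at 0)"
      unfolding T_def by (intro tendsto_intros c \<kappa>)
    moreover have "eventually (\<lambda>\<tau>. ((if k = 1 then x2 else 0) + \<beta> * y2) / c \<tau> = t \<tau> / \<tau> ^ k) (at 0)"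
      using eventually_neq_at_within[of 0]
      by eventually_elim (simp add: t_eq)
    ultimately have t: "((\<lambda>\<tau>. t \<tau> / \<tau> ^ k) \<longlongrightarrow> T \<beta>) (at 0)" using tendsto_cong by fastforce
    have "((\<lambda>\<tau>. c \<tau> ^ d * (poly (poly h [:t \<tau>:]) (s \<tau>) / \<tau> ^ m)) \<longlongrightarrow>
        \<kappa> ^ d * (S \<beta> ^ m * poly P (T \<beta> / S \<beta> ^ k))) (at 0)"
      using has_weight_tendsto[OF w s t] unfolding P(2)[OF S]
      by (intro tendsto_intros c) auto
    moreover have "eventually (\<lambda>\<tau>. c \<tau> ^ d * (poly (poly h [:t \<tau>:]) (s \<tau>) / \<tau> ^ m) =
        F (b1 + \<tau> *s b2 + (\<beta> * \<tau> ^ k) *s b3) / \<tau> ^ m) (at 0)"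
      using c0
    proof eventually_elim
      case (elim \<tau>)
      have "b1 + \<tau> *s b2 + (\<beta> * \<tau> ^ k) *s b3 = c \<tau> *s (v + s \<tau> *s e + t \<tau> *s f)"
      proof -
        have "c \<tau> * s \<tau> = \<tau> * x1 + \<beta> * \<tau> ^ k * y1" "c \<tau> * t \<tau> = \<tau> * x2 + \<beta> * \<tau> ^ k * y2"
          using elim by (simp_all add: s_def t_def)
        then have "c \<tau> *s (v + s \<tau> *s e + t \<tau> *s f) = c \<tau> *s v +
            (\<tau> * x1 + \<beta> * \<tau> ^ k * y1) *s e + (\<tau> * x2 + \<beta> * \<tau> ^ k * y2) *s f"
          by (simp add: vec.scale_right_distrib)
        then show ?thesis unfolding b c_def by (simp add: vec_eq_iff algebra_simps)
      qed
      have "poly (poly h [:t \<tau>:]) (s \<tau>) = F (v + s \<tau> *s e + t \<tau> *s f)"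
        using h unfolding local_equation_def by blast
      then show ?case unfolding \<open>b1 + \<tau> *s b2 + (\<beta> * \<tau> ^ k) *s b3 = _\<close> form_homogeneous[OF F] by simp
    qed
    ultimately have "((\<lambda>\<tau>. F (b1 + \<tau> *s b2 + (\<beta> * \<tau> ^ k) *s b3) / \<tau> ^ m) \<longlongrightarrow>
        \<kappa> ^ d * (S \<beta> ^ m * poly P (T \<beta> / S \<beta> ^ k))) (at 0)"
      using tendsto_cong by fast
    then show ?thesis using S T \<kappa> unfolding has_order_def
      by (intro exI[of _ "\<kappa> ^ d * (S \<beta> ^ m * poly P (T \<beta> / S \<beta> ^ k))"]) simp
  qed
  have fin1: "finite {\<beta>. S \<beta> = 0}"
  proof (rule finite_subset)
    show "{\<beta>. S \<beta> = 0} \<subseteq> {- x1 / y1}"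
    proof
      fix \<beta> assume "\<beta> \<in> {\<beta>. S \<beta> = 0}"
      then have "x1 + (if k = 1 then \<beta> * y1 else 0) = 0" using \<kappa> by (simp add: S_def)
      then have "\<beta> * y1 = - x1" "y1 \<noteq> 0" using k ker by (auto simp: add_eq_0_iff)
      then show "\<beta> \<in> {- x1 / y1}" by (metis nonzero_mult_div_cancel_right singleton_iff)
    qed
  qed simp
  \<comment> \<open>For k = 1 the quotient is a Moebius function of \<beta> whose determinant is the
    minor in \<open>ker\<close>, up to scaling; for k = 2 it is linear in \<beta>.\<close>
  have inj: "inj_on (\<lambda>\<beta>. T \<beta> / S \<beta> ^ k) {\<beta>. S \<beta> \<noteq> 0}"
  proof (rule inj_onI, clarsimp)
    fix \<beta> \<beta>' assume *: "S \<beta> \<noteq> 0" "S \<beta>' \<noteq> 0" "T \<beta> / S \<beta> ^ k = T \<beta>' / S \<beta>' ^ k"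
    show "\<beta> = \<beta>'"
      using k
    proof
      assume k: "k = 1"
      then have "(x2 + \<beta> * y2) * (x1 + \<beta>' * y1) = (x2 + \<beta>' * y2) * (x1 + \<beta> * y1)"
        using * \<kappa> by (simp add: S_def T_def frac_eq_eq)
      then have "(\<beta> - \<beta>') * (x1 * y2 - x2 * y1) = 0" by (simp add: algebra_simps)
      then show ?thesis using ker by simp
    next
      assume "k = 2 \<and> x2 = 0"
      then show ?thesis using * \<kappa> ker by (auto simp: S_def T_def)
    qed
  qed
  have "finite ((\<lambda>\<beta>. T \<beta> / S \<beta> ^ k) -` {z. poly P z = 0} \<inter> {\<beta>. S \<beta> \<noteq> 0})"
    by (rule finite_vimage_IntI[OF _ inj]) (simp add: P(1) poly_roots_finite)
  then have "finite ({\<beta>. S \<beta> = 0} \<union> ((\<lambda>\<beta>. T \<beta> / S \<beta> ^ k) -` {z. poly P z = 0} \<inter> {\<beta>. S \<beta> \<noteq> 0}))"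
    using fin1 by blast
  then show ?thesis by (rule rev_finite_subset) (use ord in auto)
qed

subsection \<open>Multiplicities\<close>

lemma span1_iff: "x \<in> vec.span {a} \<longleftrightarrow> (\<exists>p. x = p *s a)"
  by (auto simp: vec.span_singleton)

lemma span2_iff: "x \<in> vec.span {a, b} \<longleftrightarrow> (\<exists>p q. x = p *s a + q *s b)"
  unfolding vec.span_insert[of a] mem_Collect_eq span1_iff diff_eq_eq by (simp add: add.commute)

lemma span3_iff: "x \<in> vec.span {a, b, c} \<longleftrightarrow> (\<exists>p q r. x = p *s a + q *s b + r *s c)"
  unfolding vec.span_insert[of a] mem_Collect_eq span2_iff
    diff_eq_eq by (simp add: add_ac)

lemma dim_span2_le: "vec.dim (vec.span {a, b :: complex ^ 'n::finite}) \<le> 2"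
  using vec.dim_le_card'[of "{a, b}"] card_insert_le_m1[of 2 "{b}" a] by (auto simp: card_insert_if split: if_splits)

lemma plane_basis_independent:
  fixes a b c :: "complex ^ 'n::finite"
  assumes "vec.dim (vec.span {a, b, c}) = 3" and eq: "p *s a + q *s b + r *s c = 0"
  shows "p = 0 \<and> q = 0 \<and> r = 0"
proof -
  have key: "p = 0" if dim: "vec.dim (vec.span {a, b, c}) = 3" and eq: "p *s a + q *s b + r *s c = 0"
    for p q r and a b c :: "complex ^ 'n"
  proof (rule ccontr)
    assume p: "p \<noteq> 0"
    have "p *s a = - q *s b + - r *s c" using eq by (simp add: vec_eq_iff) (simp add: algebra_simps eq_neg_iff_add_eq_0)
    then have "a = (1 / p) *s (- q *s b + - r *s c)" using p by (metis vec.scale_one vec.scale_scale divide_self_if times_divide_eq_left mult_1)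
    then have "a \<in> vec.span {b, c}"
      by (metis span2_iff vec.span_scale)
    then have "vec.span {a, b, c} = vec.span {b, c}" by (rule vec.span_redundant)
    then show False using dim dim_span2_le[of b c] by simp
  qed
  show ?thesis
    using key[of a b c p q r] key[of b a c q p r] key[of c a b r p q] assms
    by (simp add: insert_commute add_ac)
qed

text \<open>The generic order depends only on the point and, for k = 2, on the tangent line, since
  two bases adapted to the same data differ by a change of the shape treated above.\<close>

lemma generic_order_in_basis:
  fixes F :: "complex ^ 4 \<Rightarrow> complex"
  assumes F: "form d F" and h: "local_equation F v e f h" and w: "has_weight k h m"
    and dim: "vec.dim W = 3" and W: "W = vec.span {v, e, f}" "W = vec.span {b1, b2, b3}"
    and x: "vec.span {v} = vec.span {b1}"
    and k: "k = 1 \<or> k = 2 \<and> vec.span {v, e} = vec.span {b1, b2}"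
  shows "finite {\<beta>. \<not> has_order (\<lambda>\<tau>. F (b1 + \<tau> *s b2 + (\<beta> * \<tau> ^ k) *s b3)) m}"
proof -
  note ind = plane_basis_independent[of b1 b2 b3] plane_basis_independent[of v e f]
  have dims: "vec.dim (vec.span {b1, b2, b3}) = 3" "vec.dim (vec.span {v, e, f}) = 3" using dim W by simp_all
  have "b1 \<in> vec.span {v}" using x vec.span_superset[of "{b1}"] by simp
  then obtain \<kappa> where \<kappa>: "b1 = \<kappa> *s v" using span1_iff by blast
  have \<kappa>0: "\<kappa> \<noteq> 0"
  proof
    assume "\<kappa> = 0"
    then have "1 *s b1 + 0 *s b2 + 0 *s b3 = 0" using \<kappa> by simp
    from ind(1)[OF dims(1) this] show False by simp
  qed
  have "b2 \<in> W" "b3 \<in> W" using W(2) vec.span_superset[of "{b1, b2, b3}"] by auto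
  then obtain x0 x1 x2 y0 y1 y2 where b2: "b2 = x0 *s v + x1 *s e + x2 *s f"
    and b3: "b3 = y0 *s v + y1 *s e + y2 *s f" unfolding W(1) span3_iff by blast
  have zero: "p = 0 \<and> q = 0" if "p *s b2 + q *s b3 = r *s v" for p q r
  proof -
    have "(- r / \<kappa>) *s b1 = - (r *s v)" using \<kappa> \<kappa>0 by simp
    then have "(- r / \<kappa>) *s b1 + p *s b2 + q *s b3 = 0" by (simp only: add.assoc that) simp
    then show ?thesis using ind(1) dims by blast
  qed
  \<comment> \<open>As \<open>b1\<close> is a multiple of \<open>v\<close>, a vanishing minor would
    yield a combination of \<open>b2\<close> and \<open>b3\<close> that lies on \<open>v\<close>,
    against independence.\<close>
  have ker: "x1 * y2 - x2 * y1 \<noteq> 0"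
  proof
    assume *: "x1 * y2 - x2 * y1 = 0"
    have "y2 *s b2 + (- x2) *s b3 = (y2 * x0 - x2 * y0) *s v + (x1 * y2 - x2 * y1) *s e"
      unfolding b2 b3 by (simp add: vec_eq_iff algebra_simps)
    then have "y2 *s b2 + (- x2) *s b3 = (y2 * x0 - x2 * y0) *s v" unfolding * by simp
    from zero[OF this] have 1: "y2 = 0" "x2 = 0" by simp_all
    have "y1 *s b2 + (- x1) *s b3 = (y1 * x0 - x1 * y0) *s v"
      unfolding b2 b3 1 by (simp add: vec_eq_iff algebra_simps)
    from zero[OF this] have "x1 = 0" by simp
    then have "1 *s b2 + 0 *s b3 = x0 *s v" using 1 b2 by simp
    from zero[OF this] show False by simp
  qed
  have "k = 1 \<or> k = 2 \<and> x2 = 0"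
    using k
  proof (elim disjE conjE disjI1)
    assume k: "k = 2" and "vec.span {v, e} = vec.span {b1, b2}"
    then have "b2 \<in> vec.span {v, e}" using vec.span_superset[of "{b1, b2}"] by simp
    then obtain p q where "b2 = p *s v + q *s e" using span2_iff by blast
    then have "(x0 - p) *s v + (x1 - q) *s e + x2 *s f = 0"
      unfolding b2 by (simp add: vec_eq_iff algebra_simps)
    then have "x2 = 0" using ind(2) dims by blast
    then show "k = 1 \<or> k = 2 \<and> x2 = 0" using k by blast
  qed
  then show ?thesis by (rule local_equation_generic_order[OF F h w \<kappa> b2 b3 \<kappa>0 ker])
qed

text \<open>A local equation sees only the affine chart where the coefficient of \<open>v\<close> is
  1. If it is zero, \<open>F\<close> vanishes on the line w + \<sigma> v except possibly at the one
  point outside the chart, and a polynomial with infinitely many zeros vanishes there too.\<close>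

lemma local_equation_nonzero:
  assumes F: "form d F" and h: "local_equation F v e f h" and w: "w \<in> vec.span {v, e, f}" "F w \<noteq> 0"
  shows "h \<noteq> 0"
proof
  assume h0: "h = 0"
  obtain a b c where abc: "w = a *s v + b *s e + c *s f" using w(1) span3_iff by blast
  obtain p where p: "\<forall>\<sigma>. poly p \<sigma> = F (w + \<sigma> *s v)" using form_line_poly[OF F] by blast
  have "poly p \<sigma> = 0" if "\<sigma> \<noteq> - a" for \<sigma>
  proof -
    have a: "a + \<sigma> \<noteq> 0" using that by (metis add_eq_0_iff)
    then have "w + \<sigma> *s v = (a + \<sigma>) *s (v + (b / (a + \<sigma>)) *s e + (c / (a + \<sigma>)) *s f)"
      unfolding abc by (simp add: vec.scale_right_distrib vec.scale_left_distrib add_ac)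
    then have "poly p \<sigma> = (a + \<sigma>) ^ d * F (v + (b / (a + \<sigma>)) *s e + (c / (a + \<sigma>)) *s f)"
      by (simp only: p form_homogeneous[OF F])
    moreover have "F (v + s *s e + t *s f) = 0" for s t
      using h unfolding local_equation_def h0 by simp
    ultimately show ?thesis by simp
  qed
  then have "UNIV - {- a} \<subseteq> {z. poly p z = 0}" by blast
  moreover have "infinite (UNIV - {- a})" by (simp add: infinite_UNIV_char_0)
  ultimately have "p = 0" using poly_roots_finite finite_subset by blast
  then show False using p[rule_format, of 0] w(2) by simp
qed

lemma has_multiplicity_generic_order:
  assumes F: "form d F" and mult: "has_multiplicity W F x m"
    and w: "w \<in> W" "F w \<noteq> 0" and dim: "vec.dim W = 3"
    and b: "line_of x = vec.span {b1}" "W = vec.span {b1, b2, b3}"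
  shows "finite {\<beta>. \<not> has_order (\<lambda>\<tau>. F (b1 + \<tau> *s b2 + (\<beta> * \<tau>) *s b3)) m}"
proof -
  obtain v e f h where v: "line_of x = vec.span {v}" "W = vec.span {v, e, f}"
    and h: "local_equation F v e f h" and m: "m = order_at_origin h"
    using mult unfolding has_multiplicity_def by blast
  have "h \<noteq> 0" using local_equation_nonzero[OF F h] w v(2) by blast
  from generic_order_in_basis[OF F h has_weight_order_at_origin[OF this] dim v(2) b(2), folded m]
  show ?thesis using v(1) b(1) by simp
qed

lemma has_multiplicity_exists:
  assumes "form d F" "line_of x = vec.span {b1}" "W = vec.span {b1, b2, b3}"
  obtains m where "has_multiplicity W F x m"
proof -
  obtain h where "local_equation F b1 b2 b3 h" using form_local_equation[OF assms(1)] by blast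
  then show thesis using assms that unfolding has_multiplicity_def by blast
qed

text \<open>Some multiplicity n exists, and order n occurs for all but finitely many \<beta>. An
  infinite set of \<beta> with order m therefore contains one with both orders, which must
  agree.\<close>

lemma has_multiplicityI:
  assumes F: "form d F" and w: "w \<in> W" "F w \<noteq> 0" and dim: "vec.dim W = 3"
    and b: "line_of x = vec.span {b1}" "W = vec.span {b1, b2, b3}"
    and inf: "infinite {\<beta>. has_order (\<lambda>\<tau>. F (b1 + \<tau> *s b2 + (\<beta> * \<tau>) *s b3)) m}"
  shows "has_multiplicity W F x m"
proof -
  obtain n where n: "has_multiplicity W F x n" using has_multiplicity_exists[OF F b] .
  have "infinite ({\<beta>. has_order (\<lambda>\<tau>. F (b1 + \<tau> *s b2 + (\<beta> * \<tau>) *s b3)) m} -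
      {\<beta>. \<not> has_order (\<lambda>\<tau>. F (b1 + \<tau> *s b2 + (\<beta> * \<tau>) *s b3)) n})"
    using inf has_multiplicity_generic_order[OF F n w dim b] by (rule Diff_infinite_finite[rotated])
  then obtain \<beta> where "has_order (\<lambda>\<tau>. F (b1 + \<tau> *s b2 + (\<beta> * \<tau>) *s b3)) m"
    "has_order (\<lambda>\<tau>. F (b1 + \<tau> *s b2 + (\<beta> * \<tau>) *s b3)) n"
    by (metis (mono_tags, lifting) DiffE finite.emptyI equals0I mem_Collect_eq)
  then show ?thesis using n has_order_unique by blast
qed

text \<open>Substituting s t for t multiplies the coefficient of t^j by s^j; dividing by s^m then
  shifts the exponent of s to i + j - m.\<close>

lemma coeff_blowup:
  fixes g h :: "complex poly poly"
  assumes g: "pcompose h [:0, [:0, 1:]:] = smult (monom 1 m) g"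
  shows "coeff (coeff g j) l = (if j \<le> l + m then coeff (coeff h j) (l + m - j) else 0)"
proof -
  have "coeff (smult (monom 1 m) g) j = monom 1 j * coeff h j"
    unfolding g[symmetric] by (simp add: coeff_pcompose_linear monom_altdef)
  then have "coeff (monom 1 m * coeff g j) (l + m) = coeff (monom 1 j * coeff h j) (l + m)" by simp
  then show ?thesis by (simp add: coeff_monom_mult)
qed

text \<open>A monomial s^i t^j of \<open>h\<close> becomes s^(i+j-m) t^j in \<open>g\<close>, of
  total degree i + 2 j - m. The lowest degree n of \<open>g\<close> thus corresponds to the lowest
  value m + n of i + 2 j.\<close>

lemma has_weight_blowup:
  assumes h: "has_weight 1 h m" and g: "pcompose h [:0, [:0, 1:]:] = smult (monom 1 m) g"
    and n: "has_weight 1 g n"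
  shows "has_weight 2 h (m + n)"
proof -
  obtain l j where lj: "l + j = n" "coeff (coeff g j) l \<noteq> 0" using n unfolding has_weight_def by auto
  then have "j \<le> l + m" "coeff (coeff h j) (l + m - j) \<noteq> 0"
    using coeff_blowup[OF g] by (metis (full_types))+
  then have "\<exists>i j. i + 2 * j = m + n \<and> coeff (coeff h j) i \<noteq> 0"
    using lj by (intro exI[of _ "l + m - j"] exI[of _ j]) auto
  moreover have "m + n \<le> i + 2 * j" if ij: "coeff (coeff h j) i \<noteq> 0" for i j
  proof -
    have m: "m \<le> i + j" using h ij unfolding has_weight_def by auto
    then have "coeff (coeff g j) (i + j - m) = coeff (coeff h j) i" using coeff_blowup[OF g] by simp
    then have "n \<le> i + j - m + j" using n ij unfolding has_weight_def by auto
    then show ?thesis using m by simp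
  qed
  ultimately show ?thesis unfolding has_weight_def by blast
qed

lemma has_infinitely_near_multiplicity_generic_order:
  assumes F: "form d F" and inf: "has_infinitely_near_multiplicity W F x l m"
    and mult: "has_multiplicity W F x m1"
    and w: "w \<in> W" "F w \<noteq> 0" and dim: "vec.dim W = 3"
    and b: "line_of x = vec.span {b1}" "W = vec.span {b1, b2, b3}" "l = vec.span {b1, b2}"
  shows "finite {\<beta>. \<not> has_order (\<lambda>\<tau>. F (b1 + \<tau> *s b2 + (\<beta> * \<tau>\<^sup>2) *s b3)) (m1 + m)}"
proof -
  obtain v e f h g where v: "line_of x = vec.span {v}" "l = vec.span {v, e}" "W = vec.span {v, e, f}"
    and h: "local_equation F v e f h" and g: "pcompose h [:0, [:0, 1:]:] = smult (monom 1 (order_at_origin h)) g"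
    and m: "m = order_at_origin g"
    using inf unfolding has_infinitely_near_multiplicity_def by blast
  have h0: "h \<noteq> 0" using local_equation_nonzero[OF F h] w v(3) by blast
  have g0: "g \<noteq> 0"
  proof
    assume "g = 0"
    then have "coeff h j * [:0, 1:] ^ j = 0" for j
      using coeff_pcompose_linear[of h "[:0, 1:]" j] g by (simp add: mult.commute)
    then have "coeff h j = 0" for j by simp
    then show False using h0 by (simp add: poly_eq_iff)
  qed
  \<comment> \<open>The infinitely near multiplicity comes with local coordinates of its own. Their
    order at the origin and \<open>m1\<close> are both generic orders along the same lines, hence
    equal.\<close>
  have "has_multiplicity W F x (order_at_origin h)" unfolding has_multiplicity_def using v h by blast
  then have fin: "finite {\<beta>. \<not> has_order (\<lambda>\<tau>. F (b1 + \<tau> *s b2 + (\<beta> * \<tau>) *s b3)) (order_at_origin h)}"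
    using has_multiplicity_generic_order[OF F _ w dim b(1,2)] by blast
  have "finite ({\<beta>. \<not> has_order (\<lambda>\<tau>. F (b1 + \<tau> *s b2 + (\<beta> * \<tau>) *s b3)) (order_at_origin h)} \<union>
      {\<beta>. \<not> has_order (\<lambda>\<tau>. F (b1 + \<tau> *s b2 + (\<beta> * \<tau>) *s b3)) m1})"
    using fin has_multiplicity_generic_order[OF F mult w dim b(1,2)] by blast
  then obtain \<beta> where "has_order (\<lambda>\<tau>. F (b1 + \<tau> *s b2 + (\<beta> * \<tau>) *s b3)) (order_at_origin h)"
    "has_order (\<lambda>\<tau>. F (b1 + \<tau> *s b2 + (\<beta> * \<tau>) *s b3)) m1"
    using ex_new_if_finite[OF infinite_UNIV_char_0] by (metis (mono_tags, lifting) UnCI mem_Collect_eq)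
  then have m1: "order_at_origin h = m1" by (rule has_order_unique)
  have "has_weight 2 h (m1 + m)"
    using has_weight_blowup[OF has_weight_order_at_origin[OF h0] g has_weight_order_at_origin[OF g0]] m m1 by simp
  from generic_order_in_basis[OF F h this dim v(3) b(2)] show ?thesis using v b by simp
qed

lemma has_infinitely_near_multiplicity_exists:
  assumes F: "form d F" and w: "w \<in> W" "F w \<noteq> 0"
    and b: "line_of x = vec.span {b1}" "W = vec.span {b1, b2, b3}" "l = vec.span {b1, b2}"
  obtains m where "has_infinitely_near_multiplicity W F x l m"
proof -
  obtain h where h: "local_equation F b1 b2 b3 h" using form_local_equation[OF F] by blast
  have "h \<noteq> 0" using local_equation_nonzero[OF F h] w b(2) by blast
  then have wt: "has_weight 1 h (order_at_origin h)" by (rule has_weight_order_at_origin)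
  \<comment> \<open>A term s^i t^j of \<open>h\<close> acquires the power i + j of s, and this is at
    least the order at the origin.\<close>
  have "[:monom 1 (order_at_origin h):] dvd pcompose h [:0, [:0, 1:]:]"
    unfolding const_poly_dvd_iff
  proof
    fix j
    have "monom 1 (order_at_origin h) dvd monom 1 j * coeff h j"
      unfolding monom_1_dvd_iff' coeff_monom_mult
      using wt unfolding has_weight_def by (auto simp: le_diff_conv) (metis le_antisym nat_less_le not_less le_add_diff_inverse2)
    then show "monom 1 (order_at_origin h) dvd coeff (pcompose h [:0, [:0, 1:]:]) j"
      by (simp add: coeff_pcompose_linear monom_altdef)
  qed
  then obtain g where "pcompose h [:0, [:0, 1:]:] = smult (monom 1 (order_at_origin h)) g"
    by (auto elim!: dvdE)
  then show thesis using that h b unfolding has_infinitely_near_multiplicity_def by blast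
qed

lemma has_infinitely_near_multiplicityI:
  assumes F: "form d F" and mult: "has_multiplicity W F x m1"
    and w: "w \<in> W" "F w \<noteq> 0" and dim: "vec.dim W = 3"
    and b: "line_of x = vec.span {b1}" "W = vec.span {b1, b2, b3}" "l = vec.span {b1, b2}"
    and inf: "infinite {\<beta>. has_order (\<lambda>\<tau>. F (b1 + \<tau> *s b2 + (\<beta> * \<tau>\<^sup>2) *s b3)) m}"
  obtains n where "has_infinitely_near_multiplicity W F x l n" "m = m1 + n"
proof -
  obtain n where n: "has_infinitely_near_multiplicity W F x l n"
    using has_infinitely_near_multiplicity_exists[OF F w b] .
  have "infinite ({\<beta>. has_order (\<lambda>\<tau>. F (b1 + \<tau> *s b2 + (\<beta> * \<tau>\<^sup>2) *s b3)) m} -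
      {\<beta>. \<not> has_order (\<lambda>\<tau>. F (b1 + \<tau> *s b2 + (\<beta> * \<tau>\<^sup>2) *s b3)) (m1 + n)})"
    using inf has_infinitely_near_multiplicity_generic_order[OF F n mult w dim b]
    by (rule Diff_infinite_finite[rotated])
  then obtain \<beta> where "has_order (\<lambda>\<tau>. F (b1 + \<tau> *s b2 + (\<beta> * \<tau>\<^sup>2) *s b3)) m"
    "has_order (\<lambda>\<tau>. F (b1 + \<tau> *s b2 + (\<beta> * \<tau>\<^sup>2) *s b3)) (m1 + n)"
    by (metis (mono_tags, lifting) DiffE finite.emptyI equals0I mem_Collect_eq)
  then show thesis using n has_order_unique that by blast
qed

subsection \<open>Strict transforms under quadratic involutions\<close>

lemma form_prod: "(\<And>i. i \<in> I \<Longrightarrow> form (n i) (F i)) \<Longrightarrow> form (\<Sum>i\<in>I. n i) (\<lambda>x. \<Prod>i\<in>I. F i x)"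
  by (induction I rule: infinite_finite_induct) (auto simp: form_const intro: form_mult)

text \<open>\<open>E\<close> will index the coordinate lines that the quadratic map contracts: all
  three, or the first and the third when a center lies on both planes.\<close>

definition monomial_in :: "3 set \<Rightarrow> (3 \<Rightarrow> nat) \<Rightarrow> complex ^ 3 \<Rightarrow> complex" where
  "monomial_in E n v = (\<Prod>i\<in>E. (v $ i) ^ n i)"

lemma form_monomial_in: "form (\<Sum>i\<in>E. n i) (monomial_in E n)"
proof -
  have "form n (\<lambda>v. v $ i ^ n)" for n and i :: 3 using form_power[OF form_coord, of n i] by simp
  then show ?thesis unfolding monomial_in_def by (rule form_prod)
qed

lemma monomial_in_nonzero: "(\<And>i. i \<in> E \<Longrightarrow> v $ i \<noteq> 0) \<Longrightarrow> monomial_in E n v \<noteq> 0"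
  unfolding monomial_in_def by simp

lemma monomial_in_Suc:
  "i \<in> E \<Longrightarrow> monomial_in E (n(i := Suc (n i))) v = v $ i * monomial_in E n v"
  unfolding monomial_in_def by (simp add: prod.remove[of E i])

lemma sum_upd_Suc: "i \<in> E \<Longrightarrow> (\<Sum>j\<in>E. (n(i := Suc (n i))) j) = Suc (\<Sum>j\<in>E. n j)" for E :: "3 set"
  by (simp add: sum.remove[of E i])

definition vanishes_on_no_line :: "3 set \<Rightarrow> (complex ^ 3 \<Rightarrow> complex) \<Rightarrow> bool" where
  "vanishes_on_no_line E F \<longleftrightarrow> (\<forall>i\<in>E. \<exists>v. v $ i = 0 \<and> F v \<noteq> 0)"

text \<open>Coordinates in \<open>E\<close> are divided out as long as possible; each division
  lowers the degree. Applied to the pullback of a form, the remaining factor is the equation of the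
  strict transform.\<close>

lemma form_extract_monomial:
  assumes "form d F" "F w \<noteq> 0"
  obtains n e G where "\<And>v. F v = monomial_in E n v * G v" "form e G" "d = e + (\<Sum>i\<in>E. n i)"
    "vanishes_on_no_line E G"
proof -
  have "\<exists>n e G. (\<forall>v. F v = monomial_in E n v * G v) \<and> form e G \<and> d = e + (\<Sum>i\<in>E. n i) \<and>
    vanishes_on_no_line E G"
    using assms
  proof (induction d arbitrary: F)
    case 0
    have "F 0 \<noteq> 0" using 0 form_0_const by metis
    then show ?case using 0(1)
      by (intro exI[of _ "\<lambda>_. 0"] exI[of _ 0] exI[of _ F])
        (auto simp: monomial_in_def vanishes_on_no_line_def intro!: exI[of _ 0])
  next
    case (Suc d)
    show ?case
    proof (cases "vanishes_on_no_line E F")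
      case True
      then show ?thesis using Suc.prems(1)
        by (intro exI[of _ "\<lambda>_. 0"] exI[of _ "Suc d"] exI[of _ F]) (auto simp: monomial_in_def)
    next
      case False
      then obtain i where i: "i \<in> E" "\<And>v. v $ i = 0 \<Longrightarrow> F v = 0"
        unfolding vanishes_on_no_line_def by blast
      from form_divide[OF Suc.prems(1) i(2) Suc.prems(2)]
      obtain R where R: "form d R" "\<And>v. F v = v $ i * R v" by (metis nat.inject)
      then have "R w \<noteq> 0" using Suc.prems(2) by auto
      from Suc.IH[OF R(1) this]
      obtain n e G where "\<forall>v. R v = monomial_in E n v * G v" "form e G" "d = e + (\<Sum>i\<in>E. n i)"
        "vanishes_on_no_line E G" by blast
      then show ?thesis
        using i(1) by (intro exI[of _ "n(i := Suc (n i))"] exI[of _ e] exI[of _ G])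
          (simp only: monomial_in_Suc sum_upd_Suc R(2), simp)
    qed
  qed
  then show thesis using that by blast
qed

text \<open>A coordinate that divides H^2 K but not H divides K. Unique factorization is avoided: on
  the line where the coordinate is 0, nonzero values of \<open>H\<close> and \<open>K\<close> would
  occur at a common point, while the other side vanishes there.\<close>

lemma square_divides_cancel_monomial:
  assumes "form d F" "F w \<noteq> 0" "form h H" "form k K" "vanishes_on_no_line E H"
    and "\<And>v. monomial_in E n v * F v = (H v)\<^sup>2 * K v"
  obtains k' K' where "form k' K'" "\<And>v. F v = (H v)\<^sup>2 * K' v"
proof -
  have "\<exists>k' K'. form k' K' \<and> (\<forall>v. F v = (H v)\<^sup>2 * K' v)"
    using assms(4,6)
  proof (induction "\<Sum>i\<in>E. n i" arbitrary: n k K)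
    case 0
    then have "monomial_in E n v = 1" for v unfolding monomial_in_def by (simp add: prod.neutral)
    then show ?case using 0 by auto
  next
    case (Suc m)
    then obtain i where i: "i \<in> E" "n i > 0" by (metis Suc_neq_Zero gr_zeroI sum.neutral)
    define n' where "n' = n(i := n i - 1)"
    have n: "n = n'(i := Suc (n' i))" using i(2) by (simp add: n'_def)
    have m: "m = (\<Sum>j\<in>E. n' j)" using Suc.hyps(2) sum_upd_Suc[OF i(1), of n'] n by simp
    have K0: "K v = 0" if v: "v $ i = 0" for v
    proof (rule ccontr)
      assume Kv: "K v \<noteq> 0"
      obtain u where u: "u $ i = 0" "H u \<noteq> 0" using assms(5) i(1) unfolding vanishes_on_no_line_def by blast
      obtain z where "z $ i = 0" "H z \<noteq> 0" "K z \<noteq> 0"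
        using form_mult_eq_0[OF assms(3) Suc.prems(1), of "{v. v $ i = 0}" u v] u v Kv by auto
      then show False using Suc.prems(2)[of z] i by (auto simp: n monomial_in_Suc)
    qed
    \<comment> \<open>A point where the left side, and hence \<open>K\<close>, is nonzero; division
      by the coordinate needs one.\<close>
    obtain w' where w': "monomial_in E n w' \<noteq> 0" "F w' \<noteq> 0"
    proof (rule form_mult_eq_0[OF form_monomial_in[where n = n and E = E] assms(1), of UNIV "\<chi> i. 1" w])
      show "monomial_in E n (\<chi> i. 1) \<noteq> 0" by (simp add: monomial_in_nonzero)
    qed (use assms(2) in auto)
    then have "K w' \<noteq> 0" using Suc.prems(2)[of w'] by auto
    then obtain e R where "k = Suc e" and R: "form e R" "\<And>v. K v = v $ i * R v"
      using form_divide[OF Suc.prems(1) K0] by metis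
    have "monomial_in E n' v * F v = (H v)\<^sup>2 * R v" for v
    proof (rule form_cancel_coord)
      show "form ((\<Sum>j\<in>E. n' j) + d) (\<lambda>v. monomial_in E n' v * F v)"
        by (intro form_mult form_monomial_in assms)
      show "form (2 * h + e) (\<lambda>v. (H v)\<^sup>2 * R v)" by (intro form_mult form_power assms R)
      show "v $ i * (monomial_in E n' v * F v) = v $ i * ((H v)\<^sup>2 * R v)" for v
        using Suc.prems(2)[of v] monomial_in_Suc[OF i(1), of n' v] n R(2)[of v] by (simp add: mult_ac)
    qed
    then show ?case using Suc.hyps(1)[OF m R(1)] by blast
  qed
  then show thesis using that by blast
qed

text \<open>The lines are removed one at a time by density with respect to a single hyperplane.
  Multiplying \<open>K\<close> by the product of the remaining coordinates makes the conclusion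
  trivial on the lines not yet treated, and this factor can be cancelled at the end.\<close>

lemma form_vanishes_by_torus_density:
  assumes F: "form d F" "vanishes_on_no_line E F" and K: "form k K"
    and van: "\<And>v. F v = 0 \<Longrightarrow> (\<And>i. i \<in> E \<Longrightarrow> v $ i \<noteq> 0) \<Longrightarrow> K v = 0" and v: "F v = 0"
  shows "K v = 0"
proof -
  have "finite E" by simp
  then have "vanishes_on_no_line E F \<Longrightarrow>
     (\<forall>v. F v = 0 \<longrightarrow> (\<forall>i\<in>E. v $ i \<noteq> 0) \<longrightarrow> K v = 0) \<Longrightarrow> \<forall>v. F v = 0 \<longrightarrow> K v = 0"
  proof (induction E rule: finite_induct)
    case (insert i E)
    have E: "vanishes_on_no_line E F" using insert.prems unfolding vanishes_on_no_line_def by blast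
    have "K v = 0" if v: "F v = 0" and vE: "\<forall>i\<in>E. v $ i \<noteq> 0" for v
    proof -
      obtain e where e: "e $ i = 0" "F e \<noteq> 0"
        using insert.prems(1) unfolding vanishes_on_no_line_def by blast
      have "K v * monomial_in E (\<lambda>_. 1) v = 0"
      proof (rule form_vanishes_by_density[OF F(1) form_mult[OF K form_monomial_in] form_coord e _ _ v])
        show "axis i (1 :: complex) $ i \<noteq> 0" by simp
        fix w assume w: "F w = 0" "w $ i \<noteq> 0"
        show "K w * monomial_in E (\<lambda>_. 1) w = 0"
        proof (cases "\<forall>j\<in>E. w $ j \<noteq> 0")
          case True
          then show ?thesis using insert.prems(2) w by simp
        next
          case False
          then show ?thesis by (auto simp: monomial_in_def)
        qed
      qed
      moreover have "monomial_in E (\<lambda>_. 1) v \<noteq> 0" using vE by (simp add: monomial_in_nonzero)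
      ultimately show ?thesis by simp
    qed
    then show ?case using insert.IH[OF E] by blast
  qed simp
  then show ?thesis using assms by blast
qed

definition squarefree_form :: "(complex ^ 'n::finite \<Rightarrow> complex) \<Rightarrow> bool" where
  "squarefree_form F \<longleftrightarrow> (\<exists>v. F v \<noteq> 0) \<and>
    \<not> (\<exists>d e H K. d > 0 \<and> form d H \<and> form e K \<and> (\<forall>v. F v = (H v)\<^sup>2 * K v))"

text \<open>Common to the standard Cremona transformation and its degeneration. The factor
  \<open>monomial_in E \<mu>\<close> is nonzero wherever the coordinates in \<open>E\<close> are, so
  on this open set \<kappa> is a projective involution.\<close>

locale quadratic_involution =
  fixes E :: "3 set" and \<kappa> :: "complex ^ 3 \<Rightarrow> complex ^ 3" and \<mu> :: "3 \<Rightarrow> nat"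
  assumes form_map: "form 2 (\<lambda>v. \<kappa> v $ i)"
    and involution: "\<kappa> (\<kappa> v) = monomial_in E \<mu> v *s v"
    and torus: "(\<And>i. i \<in> E \<Longrightarrow> v $ i \<noteq> 0) \<Longrightarrow> j \<in> E \<Longrightarrow> \<kappa> v $ j \<noteq> 0"
    and nonempty: "E \<noteq> {}"
begin

lemma torus_point:
  assumes "form d F" "F w \<noteq> 0"
  obtains z where "F z \<noteq> 0" "\<And>i. i \<in> E \<Longrightarrow> z $ i \<noteq> 0"
proof (rule form_mult_eq_0[OF assms(1) form_monomial_in[where E = E and n = "\<lambda>_. 1"], of UNIV w "\<chi> i. 1"])
  show "monomial_in E (\<lambda>_. 1) (\<chi> i. 1) \<noteq> 0" by (simp add: monomial_in_nonzero)
  fix z assume "F z \<noteq> 0" "monomial_in E (\<lambda>_. 1) z \<noteq> 0"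
  then show thesis using that by (simp add: monomial_in_def)
qed (use assms(2) in auto)

lemma form_comp: "form d F \<Longrightarrow> form (d * 2) (\<lambda>v. F (\<kappa> v))"
  by (rule form_subst[OF _ form_map])

lemma form_comp_comp: "form d F \<Longrightarrow> F (\<kappa> (\<kappa> v)) = monomial_in E (\<lambda>i. d * \<mu> i) v * F v"
  unfolding involution form_homogeneous
  by (simp add: monomial_in_def prod_power_distrib power_mult mult.commute flip: power_mult)

lemma form_comp_nonzero:
  assumes "form d F" "F w \<noteq> 0"
  obtains w' where "F (\<kappa> w') \<noteq> 0"
proof -
  obtain z where "F z \<noteq> 0" "\<And>i. i \<in> E \<Longrightarrow> z $ i \<noteq> 0" by (rule torus_point[OF assms]) (rule that)
  then have "F (\<kappa> (\<kappa> z)) \<noteq> 0" using form_comp_comp[OF assms(1)] by (simp add: monomial_in_nonzero)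
  then show thesis using that by blast
qed

lemma nonzero: "vanishes_on_no_line E F \<Longrightarrow> \<exists>v. F v \<noteq> 0"
  using nonempty unfolding vanishes_on_no_line_def by blast

lemma strict_transform_exists:
  assumes "form d F" "vanishes_on_no_line E F"
  obtains n e G where "\<And>v. F (\<kappa> v) = monomial_in E n v * G v" "form e G"
    "d * 2 = e + (\<Sum>i\<in>E. n i)" "vanishes_on_no_line E G"
proof -
  obtain w where "F w \<noteq> 0" using nonzero assms(2) by blast
  then obtain w' where "F (\<kappa> w') \<noteq> 0" using form_comp_nonzero assms(1) by blast
  from form_extract_monomial[OF form_comp[OF assms(1)] this, of E] show thesis using that by metis
qed

context
  fixes d e F G n
  assumes F: "form d F" "vanishes_on_no_line E F" and G: "form e G" "vanishes_on_no_line E G"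
    and eq: "\<And>v. F (\<kappa> v) = monomial_in E n v * G v"
begin

lemma strict_transform_zero_iff: "(\<And>i. i \<in> E \<Longrightarrow> v $ i \<noteq> 0) \<Longrightarrow> G v = 0 \<longleftrightarrow> F (\<kappa> v) = 0"
  using eq monomial_in_nonzero by simp

text \<open>Off the contracted lines F (\<kappa> (\<kappa> v)) is a multiple of F v, and \<kappa> v
  is again off them, where \<open>G\<close> vanishes together with the pullback of \<open>F\<close>.
  Density extends this to the points of the lines.\<close>

lemma strict_transform_zero:
  assumes "F v = 0"
  shows "G (\<kappa> v) = 0"
proof (rule form_vanishes_by_torus_density[OF F form_comp[OF G(1)] _ assms])
  fix v assume v: "F v = 0" "\<And>i. i \<in> E \<Longrightarrow> v $ i \<noteq> 0"
  have "F (\<kappa> (\<kappa> v)) = 0" using form_comp_comp[OF F(1)] v(1) by simp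
  then show "G (\<kappa> v) = 0" using strict_transform_zero_iff torus v(2) by blast
qed

text \<open>Pulling a factorization G = H^2 K back along \<kappa> shows that, up to monomials, the
  square of the strict transform of \<open>H\<close> divides \<open>F\<close>. So that transform is
  constant, and \<open>H\<close> has no zero off the contracted lines. As \<open>G\<close> contains
  none of these lines, neither does \<open>H\<close>, which leaves no room for a nonconstant
  \<open>H\<close>.\<close>

lemma strict_transform_squarefree:
  assumes "squarefree_form F"
  shows "squarefree_form G"
  unfolding squarefree_form_def
proof (intro conjI notI)
  show "\<exists>v. G v \<noteq> 0" using nonzero G(2) by blast
  assume "\<exists>d e H K. d > 0 \<and> form d H \<and> form e K \<and> (\<forall>v. G v = (H v)\<^sup>2 * K v)"
  then obtain h k H K where h: "h > 0" and H: "form h H" and K: "form k K"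
    and HK: "\<And>v. G v = (H v)\<^sup>2 * K v" by blast
  obtain w where w: "G w \<noteq> 0" using nonzero G(2) by blast
  then have "H w \<noteq> 0" using HK by auto
  then obtain w' where "H (\<kappa> w') \<noteq> 0" using form_comp_nonzero H by blast
  from form_extract_monomial[OF form_comp[OF H] this]
  obtain r h1 H1 where H1: "\<And>v. H (\<kappa> v) = monomial_in E r v * H1 v" "form h1 H1" "vanishes_on_no_line E H1"
    by metis
  define K1 where "K1 v = monomial_in E n (\<kappa> v) * ((monomial_in E r v)\<^sup>2 * K (\<kappa> v))" for v
  have K1: "form ((\<Sum>i\<in>E. n i) * 2 + (2 * (\<Sum>i\<in>E. r i) + k * 2)) K1"
    unfolding K1_def by (intro form_mult form_comp form_power form_monomial_in K)
  have cancel: "monomial_in E (\<lambda>i. d * \<mu> i) v * F v = (H1 v)\<^sup>2 * K1 v" for v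
    unfolding form_comp_comp[OF F(1), symmetric] eq HK H1(1) K1_def by (simp add: power_mult_distrib mult_ac)
  obtain u where u: "F u \<noteq> 0" using nonzero F(2) by blast
  obtain k2 K2 where K2: "form k2 K2" "\<And>v. F v = (H1 v)\<^sup>2 * K2 v"
    by (rule square_divides_cancel_monomial[OF F(1) u H1(2) K1 H1(3) cancel]) (rule that)
  have "h1 = 0"
  proof (rule ccontr)
    assume "h1 \<noteq> 0"
    then have "\<exists>d e H K. d > 0 \<and> form d H \<and> form e K \<and> (\<forall>v. F v = (H v)\<^sup>2 * K v)"
      using H1(2) K2 by (intro exI[of _ h1] exI[of _ k2] exI[of _ H1] exI[of _ K2]) simp
    then show False using assms unfolding squarefree_form_def by (rule notE[OF conjunct2, rotated])
  qed
  then have H1_const: "H1 u = H1 v" for u v using H1(2) form_0_const by blast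
  have H1_nz: "H1 v \<noteq> 0" for v using H1_const nonzero[OF H1(3)] by metis
  have Hnz: "H v \<noteq> 0" if v: "\<And>i. i \<in> E \<Longrightarrow> v $ i \<noteq> 0" for v
  proof
    assume "H v = 0"
    then have "H (\<kappa> (\<kappa> v)) = 0" using form_comp_comp[OF H] by simp
    then show False using H1(1) H1_nz monomial_in_nonzero torus v by (metis mult_eq_0_iff)
  qed
  have "vanishes_on_no_line E H"
    using G(2) HK unfolding vanishes_on_no_line_def by (metis mult_zero_left power_zero_numeral)
  \<comment> \<open>With the constant 1 in the place of \<open>K\<close> the density hypothesis is
    vacuous, and the zero of \<open>H\<close> at the origin yields 1 = 0.\<close>
  from form_vanishes_by_torus_density[OF H this form_const[of 1], of 0] Hnz form_zero_at_0[OF H h]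
  show False by (metis one_neq_zero)
qed

end

end

subsection \<open>Orders of a strict transform\<close>

text \<open>The direction \<open>f\<close> itself is not of the shape e + \<beta> f; there the value
  is the coefficient of degree \<open>d\<close> of the restricted polynomial, so that polynomial is
  nonzero in this case too.\<close>

lemma form_line_cofinite:
  assumes F: "form d F" and nz: "F (p *s e + q *s f) \<noteq> 0"
  shows "\<forall>\<^sub>F \<beta> in cofinite. F (e + \<beta> *s f) \<noteq> 0"
proof -
  obtain P where P: "\<forall>\<sigma>. poly P \<sigma> = F (e + \<sigma> *s f)" "coeff P d = F f"
    using form_line_poly[OF F] by metis
  have "P \<noteq> 0"
  proof
    assume P0: "P = 0"
    show False
    proof (cases "p = 0")
      case True
      then show ?thesis using nz P(2) P0 form_homogeneous[OF F, of q f] by simp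
    next
      case False
      then have "p *s e + q *s f = p *s (e + (q / p) *s f)" by (simp add: vec.scale_right_distrib)
      then have "F (p *s e + q *s f) = p ^ d * poly P (q / p)" by (simp only: form_homogeneous[OF F] P(1))
      then show ?thesis using nz P0 by simp
    qed
  qed
  then have "finite {\<beta>. poly P \<beta> = 0}" by (rule poly_roots_finite)
  then show ?thesis using P(1) by (simp add: eventually_cofinite)
qed

text \<open>Curried arguments allow the coordinates to be permuted and specialized by plain
  instantiation.\<close>

definition ternary :: "nat \<Rightarrow> (complex \<Rightarrow> complex \<Rightarrow> complex \<Rightarrow> complex) \<Rightarrow> bool" where
  "ternary d f \<longleftrightarrow> form d (\<lambda>v :: complex ^ 3. f (v $ 1) (v $ 2) (v $ 3))"

lemma form_vector_3:
  assumes "form k a" "form k b" "form k c"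
  shows "form k (\<lambda>v. (vector [a v, b v, c v] :: complex ^ 3) $ i)"
  using exhaust_3[of i] assms by auto

lemma ternary_permute:
  assumes "ternary d f"
  shows "ternary d (\<lambda>a b c. f b a c)" "ternary d (\<lambda>a b c. f a c b)" "ternary d (\<lambda>a b c. f c b a)"
    "ternary d (\<lambda>a b c. f b c a)" "ternary d (\<lambda>a b c. f c a b)"
  using form_subst[OF assms[unfolded ternary_def] form_vector_3[OF form_coord form_coord form_coord]]
  unfolding ternary_def by (simp_all only: vector_3 mult_1_right)

lemma ternary_homogeneous: "ternary d f \<Longrightarrow> f (k * a) (k * b) (k * c) = k ^ d * f a b c"
  unfolding ternary_def using form_homogeneous[of d _ k "vector [a, b, c]"] by fastforce

lemma ternary_isCont:
  assumes "ternary d f"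
  shows "isCont (\<lambda>\<tau>. f (poly p \<tau>) (poly q \<tau>) (poly r \<tau>)) x"
proof -
  have "\<exists>P. \<forall>\<tau>. (vector [poly p \<tau>, poly q \<tau>, poly r \<tau>] :: complex ^ 3) $ i = poly P \<tau>" for i
    using exhaust_3[of i] by auto
  from form_poly[OF assms[unfolded ternary_def] this]
  obtain P where "\<forall>\<tau>. f (poly p \<tau>) (poly q \<tau>) (poly r \<tau>) = poly P \<tau>" by auto
  then show ?thesis by (simp add: poly_isCont)
qed

lemma ternary_line_cofinite:
  assumes f: "ternary d f" and nz: "f 0 b c \<noteq> 0"
  shows "\<forall>\<^sub>F \<beta> in cofinite. f 0 \<beta> 1 \<noteq> 0" "\<forall>\<^sub>F \<beta> in cofinite. f 0 1 \<beta> \<noteq> 0"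
  using form_line_cofinite[OF f[unfolded ternary_def], of c "vector [0, 0, 1]" b "vector [0, 1, 0]"]
    form_line_cofinite[OF f[unfolded ternary_def], of b "vector [0, 1, 0]" c "vector [0, 0, 1]"] nz
  by simp_all

lemma cofinite_nonzero: "\<forall>\<^sub>F \<beta> in cofinite. \<beta> \<noteq> (0 :: complex)"
  by (simp add: eventually_cofinite)

lemma cofinite_inverse:
  assumes "\<forall>\<^sub>F \<beta> in cofinite. Q (\<beta> :: complex)"
  shows "\<forall>\<^sub>F \<beta> in cofinite. Q (1 / \<beta>)"
proof -
  have "finite ((\<lambda>\<beta>. 1 / \<beta>) ` {\<beta>. \<not> Q \<beta>})" using assms by (simp add: eventually_cofinite)
  then show ?thesis unfolding eventually_cofinite
    by (rule rev_finite_subset) (auto intro!: image_eqI[where x = "1 / x" for x])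
qed

lemma has_order_cmult: "c \<noteq> 0 \<Longrightarrow> has_order g m \<Longrightarrow> has_order (\<lambda>\<tau>. c * g \<tau>) m"
  using has_order_mult[OF has_order_monomial[of c 0]] by simp

lemma has_order_cmult_iff: "c \<noteq> 0 \<Longrightarrow> has_order (\<lambda>\<tau>. c * g \<tau>) m \<longleftrightarrow> has_order g m"
  using has_order_cmult[of c g m] has_order_cmult[of "1 / c" "\<lambda>\<tau>. c * g \<tau>" m] by auto

lemma has_order_cancel:
  assumes g: "isCont g 0" and c: "c \<noteq> 0" and ord: "has_order (\<lambda>\<tau>. c * \<tau> ^ n * g \<tau>) m"
  shows "n \<le> m" "has_order g (m - n)"
proof -
  obtain l where l: "l \<noteq> 0" "((\<lambda>\<tau>. c * \<tau> ^ n * g \<tau> / \<tau> ^ m) \<longlongrightarrow> l) (at 0)"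
    using ord unfolding has_order_def by blast
  show nm: "n \<le> m"
  proof (rule ccontr)
    assume "\<not> n \<le> m"
    then have nm: "m < n" by simp
    have "((\<lambda>\<tau>. c * \<tau> ^ (n - m) * g \<tau>) \<longlongrightarrow> c * 0 ^ (n - m) * g 0) (at 0)"
      using g unfolding isCont_def by (intro tendsto_intros)
    moreover have "eventually (\<lambda>\<tau>. c * \<tau> ^ (n - m) * g \<tau> = c * \<tau> ^ n * g \<tau> / \<tau> ^ m) (at 0)"
      using eventually_neq_at_within[of 0] by eventually_elim (use nm in \<open>simp add: power_diff\<close>)
    ultimately have "((\<lambda>\<tau>. c * \<tau> ^ n * g \<tau> / \<tau> ^ m) \<longlongrightarrow> 0) (at 0)"
      using nm tendsto_cong by (fastforce simp: power_0_left)
    then show False using l tendsto_unique by (metis trivial_limit_at)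
  qed
  have "((\<lambda>\<tau>. c * \<tau> ^ n * g \<tau> / \<tau> ^ m / c) \<longlongrightarrow> l / c) (at 0)"
    by (intro tendsto_intros l c)
  moreover have "eventually (\<lambda>\<tau>. c * \<tau> ^ n * g \<tau> / \<tau> ^ m / c = g \<tau> / \<tau> ^ (m - n)) (at 0)"
    using eventually_neq_at_within[of 0]
    by eventually_elim (use nm c in \<open>simp add: power_diff\<close>)
  ultimately have "((\<lambda>\<tau>. g \<tau> / \<tau> ^ (m - n)) \<longlongrightarrow> l / c) (at 0)"
    using tendsto_cong by fast
  then show "has_order g (m - n)" using l(1) c unfolding has_order_def by (intro exI[of _ "l / c"]) simp
qed

context
  fixes f g :: "complex \<Rightarrow> complex \<Rightarrow> complex \<Rightarrow> complex" and d e i j k :: nat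
  assumes f: "ternary d f" and g: "ternary e g"
    and eq: "\<And>a b c. f (b * c) (a * c) (a * b) = a ^ i * b ^ j * c ^ k * g a b c"
begin

text \<open>The line (1, \<tau>, \<beta> \<tau>) is, up to the factor \<beta>, the image of (\<beta>
  \<tau>, \<beta>, 1), which crosses the contracted line a = 0 at a general point. Only the factor
  a^i contributes to the order.\<close>

lemma cremona_order_source:
  assumes "g 0 b c \<noteq> 0"
  shows "\<forall>\<^sub>F \<beta> in cofinite. has_order (\<lambda>\<tau>. f 1 \<tau> (\<beta> * \<tau>)) i"
  using ternary_line_cofinite(1)[OF g assms] cofinite_nonzero
proof eventually_elim
  case (elim \<beta>)
  have "isCont (\<lambda>\<tau>. g (\<beta> * \<tau>) \<beta> 1) 0"
    using ternary_isCont[OF g, of _ "[:0, \<beta>:]" "[:\<beta>:]" "[:1:]"] by (simp add: mult.commute)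
  then have "has_order (\<lambda>\<tau>. (\<beta> ^ i * \<beta> ^ j) * \<tau> ^ i * g (\<beta> * \<tau>) \<beta> 1) (i + 0)"
    using elim by (intro has_order_mult has_order_monomial has_order_0) auto
  moreover have "(\<beta> ^ i * \<beta> ^ j) * \<tau> ^ i * g (\<beta> * \<tau>) \<beta> 1 = \<beta> ^ d * f 1 \<tau> (\<beta> * \<tau>)" for \<tau>
    using eq[of \<beta> 1 "\<beta> * \<tau>"] ternary_homogeneous[OF f, of \<beta> 1 \<tau> "\<beta> * \<tau>"]
    by (simp add: power_mult_distrib mult_ac)
  ultimately show ?case using has_order_cmult_iff[of "\<beta> ^ d"] elim by simp
qed

text \<open>The image of (1, \<tau>, \<beta> \<tau>) is \<tau> times (\<beta> \<tau>, \<beta>, 1).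
  Homogeneity gives \<tau>^d on the side of \<open>f\<close>, of which b^j c^k accounts for
  \<tau>^(j+k).\<close>

lemma cremona_order_target:
  assumes "f 0 b c \<noteq> 0"
  shows "\<forall>\<^sub>F \<beta> in cofinite. j + k \<le> d \<and> has_order (\<lambda>\<tau>. g 1 \<tau> (\<beta> * \<tau>)) (d - (j + k))"
  using ternary_line_cofinite(1)[OF f assms] cofinite_nonzero
proof eventually_elim
  case (elim \<beta>)
  have "isCont (\<lambda>\<tau>. f (\<beta> * \<tau>) \<beta> 1) 0"
    using ternary_isCont[OF f, of _ "[:0, \<beta>:]" "[:\<beta>:]" "[:1:]"] by (simp add: mult.commute)
  then have "has_order (\<lambda>\<tau>. 1 * \<tau> ^ d * f (\<beta> * \<tau>) \<beta> 1) (d + 0)"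
    using elim by (intro has_order_mult has_order_monomial has_order_0) auto
  moreover have "1 * \<tau> ^ d * f (\<beta> * \<tau>) \<beta> 1 = \<beta> ^ k * \<tau> ^ (j + k) * g 1 \<tau> (\<beta> * \<tau>)" for \<tau>
    using eq[of \<tau> "\<beta> * \<tau>" 1] ternary_homogeneous[OF f, of \<tau> "\<beta> * \<tau>" \<beta> 1]
    by (simp add: power_mult_distrib power_add mult_ac)
  ultimately have "has_order (\<lambda>\<tau>. \<beta> ^ k * \<tau> ^ (j + k) * g 1 \<tau> (\<beta> * \<tau>)) d" by simp
  moreover have "isCont (\<lambda>\<tau>. g 1 \<tau> (\<beta> * \<tau>)) 0"
    using ternary_isCont[OF g, of _ "[:1:]" "[:0, 1:]" "[:0, \<beta>:]"] by (simp add: mult.commute)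
  ultimately show ?case using has_order_cancel[of "\<lambda>\<tau>. g 1 \<tau> (\<beta> * \<tau>)" "\<beta> ^ k"] elim by simp
qed

end

text \<open>The degeneration of the quadratic Cremona transformation in which one of the three base points
  is infinitely near to another.\<close>

context
  fixes f g :: "complex \<Rightarrow> complex \<Rightarrow> complex \<Rightarrow> complex" and d e i k :: nat
  assumes f: "ternary d f" and g: "ternary e g"
    and eq: "\<And>a b c. f (c\<^sup>2) (a * b) (a * c) = a ^ i * c ^ k * g a b c"
begin

lemma degenerate_order_source_simple:
  assumes "g 0 b c \<noteq> 0"
  shows "\<forall>\<^sub>F \<beta> in cofinite. has_order (\<lambda>\<tau>. f 1 (\<beta> * \<tau>) \<tau>) i"
  using ternary_line_cofinite(1)[OF g assms]
proof eventually_elim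
  case (elim \<beta>)
  have "isCont (\<lambda>\<tau>. g \<tau> \<beta> 1) 0"
    using ternary_isCont[OF g, of _ "[:0, 1:]" "[:\<beta>:]" "[:1:]"] by simp
  then have "has_order (\<lambda>\<tau>. 1 * \<tau> ^ i * g \<tau> \<beta> 1) (i + 0)"
    using elim by (intro has_order_mult has_order_monomial has_order_0) auto
  moreover have "1 * \<tau> ^ i * g \<tau> \<beta> 1 = f 1 (\<beta> * \<tau>) \<tau>" for \<tau>
    using eq[of 1 \<tau> \<beta>] by (simp add: mult_ac)
  ultimately show ?case by simp
qed

lemma degenerate_order_target_simple:
  assumes "f 0 b c \<noteq> 0"
  shows "\<forall>\<^sub>F \<beta> in cofinite. k \<le> d \<and> has_order (\<lambda>\<tau>. g 1 (\<beta> * \<tau>) \<tau>) (d - k)"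
  using ternary_line_cofinite(1)[OF f assms]
proof eventually_elim
  case (elim \<beta>)
  have "isCont (\<lambda>\<tau>. f \<tau> \<beta> 1) 0"
    using ternary_isCont[OF f, of _ "[:0, 1:]" "[:\<beta>:]" "[:1:]"] by simp
  then have "has_order (\<lambda>\<tau>. 1 * \<tau> ^ d * f \<tau> \<beta> 1) (d + 0)"
    using elim by (intro has_order_mult has_order_monomial has_order_0) auto
  moreover have "1 * \<tau> ^ d * f \<tau> \<beta> 1 = 1 * \<tau> ^ k * g 1 (\<beta> * \<tau>) \<tau>" for \<tau>
    using eq[of \<tau> 1 "\<beta> * \<tau>"] ternary_homogeneous[OF f, of \<tau> \<tau> \<beta> 1]
    by (simp add: power2_eq_square mult_ac)
  ultimately have "has_order (\<lambda>\<tau>. 1 * \<tau> ^ k * g 1 (\<beta> * \<tau>) \<tau>) d" by simp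
  moreover have "isCont (\<lambda>\<tau>. g 1 (\<beta> * \<tau>) \<tau>) 0"
    using ternary_isCont[OF g, of _ "[:1:]" "[:0, \<beta>:]" "[:0, 1:]"] by (simp add: mult.commute)
  ultimately show ?case using has_order_cancel[of "\<lambda>\<tau>. g 1 (\<beta> * \<tau>) \<tau>" 1] by simp
qed

text \<open>The line (\<beta> \<tau>, 1, \<tau>) goes to \<beta> \<tau> times (\<tau> / \<beta>, 1,
  \<tau>): lines through this base point are permuted by inverting \<beta>. The order
  \<open>m\<close> of \<open>f\<close> is a datum here because the exponent k also counts the
  infinitely near point.\<close>

lemma degenerate_order_double:
  assumes "\<forall>\<^sub>F \<beta> in cofinite. has_order (\<lambda>\<tau>. f (\<beta> * \<tau>) 1 \<tau>) m"
  shows "\<forall>\<^sub>F \<beta> in cofinite. i + k \<le> d + m \<and> has_order (\<lambda>\<tau>. g (\<beta> * \<tau>) 1 \<tau>) (d + m - (i + k))"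
  using cofinite_inverse[OF assms] cofinite_nonzero
proof eventually_elim
  case (elim \<beta>)
  have "has_order (\<lambda>\<tau>. f (1 / \<beta> * (1 / \<beta> * (\<beta> * \<tau>))) 1 (1 / \<beta> * (\<beta> * \<tau>))) m"
    using has_order_scale[of "\<beta> * (1 / \<beta>)", OF _ elim(1)] elim(2) by simp
  then have "has_order (\<lambda>\<tau>. f (1 / \<beta> * \<tau>) 1 \<tau>) m" using elim(2) by simp
  then have "has_order (\<lambda>\<tau>. f (1 / \<beta> * \<tau>) 1 \<tau>) m" using elim(2) by simp
  then have "has_order (\<lambda>\<tau>. \<beta> ^ d * \<tau> ^ d * f (1 / \<beta> * \<tau>) 1 \<tau>) (d + m)"
    using elim(2) by (intro has_order_mult has_order_monomial) auto
  moreover have "\<beta> ^ d * \<tau> ^ d * f (1 / \<beta> * \<tau>) 1 \<tau> = \<beta> ^ i * \<tau> ^ (i + k) * g (\<beta> * \<tau>) 1 \<tau>" for \<tau>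
    using eq[of \<tau> "\<beta> * \<tau>" 1] ternary_homogeneous[OF f, of "\<beta> * \<tau>" "1 / \<beta> * \<tau>" 1 \<tau>] elim(2)
    by (simp add: power_mult_distrib power_add power2_eq_square mult_ac)
  ultimately have "has_order (\<lambda>\<tau>. \<beta> ^ i * \<tau> ^ (i + k) * g (\<beta> * \<tau>) 1 \<tau>) (d + m)" by simp
  moreover have "isCont (\<lambda>\<tau>. g (\<beta> * \<tau>) 1 \<tau>) 0"
    using ternary_isCont[OF g, of _ "[:0, \<beta>:]" "[:1:]" "[:0, 1:]"] by (simp add: mult.commute)
  ultimately show ?case
    using has_order_cancel[of "\<lambda>\<tau>. g (\<beta> * \<tau>) 1 \<tau>" "\<beta> ^ i"] elim(2) by simp
qed

text \<open>The parabola (\<beta> \<tau>^2, 1, \<tau>) is, up to the factor \<beta>, the image of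
  the line (1, \<beta>, \<beta> \<tau>), which crosses the contracted line c = 0 at a general
  point.\<close>

lemma degenerate_order_source_near:
  assumes "g a b 0 \<noteq> 0"
  shows "\<forall>\<^sub>F \<beta> in cofinite. has_order (\<lambda>\<tau>. f (\<beta> * \<tau>\<^sup>2) 1 \<tau>) k"
  using ternary_line_cofinite(2)[OF ternary_permute(4)[OF g] assms] cofinite_nonzero
proof eventually_elim
  case (elim \<beta>)
  have "isCont (\<lambda>\<tau>. g 1 \<beta> (\<beta> * \<tau>)) 0"
    using ternary_isCont[OF g, of _ "[:1:]" "[:\<beta>:]" "[:0, \<beta>:]"] by (simp add: mult.commute)
  then have "has_order (\<lambda>\<tau>. \<beta> ^ k * \<tau> ^ k * g 1 \<beta> (\<beta> * \<tau>)) (k + 0)"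
    using elim by (intro has_order_mult has_order_monomial has_order_0) auto
  moreover have "\<beta> ^ k * \<tau> ^ k * g 1 \<beta> (\<beta> * \<tau>) = \<beta> ^ d * f (\<beta> * \<tau>\<^sup>2) 1 \<tau>" for \<tau>
    using eq[of "\<beta> * \<tau>" 1 \<beta>] ternary_homogeneous[OF f, of \<beta> "\<beta> * \<tau>\<^sup>2" 1 \<tau>]
    by (simp add: power_mult_distrib power2_eq_square mult_ac)
  ultimately show ?case using has_order_cmult_iff[of "\<beta> ^ d"] elim(2) by simp
qed

text \<open>The parabola (\<beta> \<tau>^2, 1, \<tau>) goes to \<tau>^2 times (1, \<beta>, \<beta>
  \<tau>). Homogeneity gives order 2 d, and a^i c^k has order 2 i + k along the parabola.\<close>

lemma degenerate_order_target_near: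
  assumes "f a b 0 \<noteq> 0"
  shows "\<forall>\<^sub>F \<beta> in cofinite. 2 * i + k \<le> 2 * d \<and>
    has_order (\<lambda>\<tau>. g (\<beta> * \<tau>\<^sup>2) 1 \<tau>) (2 * d - (2 * i + k))"
  using ternary_line_cofinite(2)[OF ternary_permute(4)[OF f] assms] cofinite_nonzero
proof eventually_elim
  case (elim \<beta>)
  have "isCont (\<lambda>\<tau>. f 1 \<beta> (\<beta> * \<tau>)) 0"
    using ternary_isCont[OF f, of _ "[:1:]" "[:\<beta>:]" "[:0, \<beta>:]"] by (simp add: mult.commute)
  then have "has_order (\<lambda>\<tau>. 1 * \<tau> ^ (2 * d) * f 1 \<beta> (\<beta> * \<tau>)) (2 * d + 0)"
    using elim by (intro has_order_mult has_order_monomial has_order_0) auto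
  moreover have "1 * \<tau> ^ (2 * d) * f 1 \<beta> (\<beta> * \<tau>) = \<beta> ^ i * \<tau> ^ (2 * i + k) * g (\<beta> * \<tau>\<^sup>2) 1 \<tau>" for \<tau>
    using eq[of \<tau> "\<beta> * \<tau>\<^sup>2" 1] ternary_homogeneous[OF f, of "\<tau>\<^sup>2" 1 \<beta> "\<beta> * \<tau>"]
    by (simp add: power_mult_distrib power_add power_mult power2_eq_square mult_ac)
  ultimately have "has_order (\<lambda>\<tau>. \<beta> ^ i * \<tau> ^ (2 * i + k) * g (\<beta> * \<tau>\<^sup>2) 1 \<tau>) (2 * d)" by simp
  moreover have "isCont (\<lambda>\<tau>. g (\<beta> * \<tau>\<^sup>2) 1 \<tau>) 0"
    using ternary_isCont[OF g, of _ "[:0, 0, \<beta>:]" "[:1:]" "[:0, 1:]"]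
    by (simp add: power2_eq_square mult_ac)
  ultimately show ?case
    using has_order_cancel[of "\<lambda>\<tau>. g (\<beta> * \<tau>\<^sup>2) 1 \<tau>" "\<beta> ^ i"] elim(2) by simp
qed

end

subsection \<open>Points of projective space\<close>

text \<open>Homogeneous coordinates. For the zero vector the span has dimension 0 and the value is
  unspecified, hence the nonzero assumptions throughout.\<close>

definition pt :: "complex ^ 'n::finite \<Rightarrow> 'n projective" where
  "pt v = point_of (vec.span {v})"

lemma dim_span_singleton: "v \<noteq> 0 \<Longrightarrow> vec.dim (vec.span {v :: complex ^ 'n::finite}) = 1"
  by (simp add: vec.dim_eq_card_independent)

lemma line_of_pt: "v \<noteq> 0 \<Longrightarrow> line_of (pt v) = vec.span {v}"
  unfolding pt_def by (rule point_of_inverse) (simp add: dim_span_singleton vec.subspace_span)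

lemma dim_1_span:
  assumes "vec.subspace L" "vec.dim L = 1"
  obtains v :: "complex ^ 'n::finite" where "v \<noteq> 0" "L = vec.span {v}"
proof -
  obtain B where B: "B \<subseteq> L" "vec.independent B" "L \<subseteq> vec.span B" "card B = vec.dim L"
    using vec.basis_exists by blast
  obtain v where v: "B = {v}" using B(4) assms(2) card_1_singletonE by metis
  have "v \<noteq> 0" using B(2) v by (metis vec.dependent_zero insertI1)
  moreover have "L = vec.span {v}" using B assms(1) v by (metis vec.span_subspace)
  ultimately show thesis using that by blast
qed

lemma pt_exhaust:
  obtains v where "v \<noteq> 0" "x = pt v"
proof -
  have "vec.subspace (line_of x)" "vec.dim (line_of x) = 1" using line_of[of x] by auto
  then obtain v where "v \<noteq> 0" "line_of x = vec.span {v}" by (rule dim_1_span)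
  moreover then have "x = pt v" unfolding pt_def by (metis line_of_inverse)
  ultimately show thesis using that by blast
qed

lemma pt_eq_iff:
  assumes "v \<noteq> 0" "w \<noteq> 0"
  shows "pt v = pt w \<longleftrightarrow> (\<exists>c. c \<noteq> 0 \<and> w = c *s v)"
proof
  assume "pt v = pt w"
  then have "vec.span {v} = vec.span {w}" using line_of_pt assms by metis
  then have "w \<in> vec.span {v}" using vec.span_superset[of "{w}"] by simp
  then obtain c where "w = c *s v" using span1_iff by blast
  then show "\<exists>c. c \<noteq> 0 \<and> w = c *s v" using assms(2) by (metis vec.scale_zero_left)
next
  assume "\<exists>c. c \<noteq> 0 \<and> w = c *s v"
  then obtain c where c: "c \<noteq> 0" "w = c *s v" by blast
  have "vec.span {v} = vec.span {w}"
  proof (intro set_eqI iffI)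
    fix x assume "x \<in> vec.span {v}"
    then obtain p where "x = p *s v" using span1_iff by blast
    then have "x = (p / c) *s w" using c by simp
    then show "x \<in> vec.span {w}" using span1_iff by blast
  next
    fix x assume "x \<in> vec.span {w}"
    then obtain p where "x = p *s w" using span1_iff by blast
    then have "x = (p * c) *s v" using c by simp
    then show "x \<in> vec.span {v}" using span1_iff by blast
  qed
  then show "pt v = pt w" unfolding pt_def by simp
qed

lemma pt_scale: "c \<noteq> 0 \<Longrightarrow> v \<noteq> 0 \<Longrightarrow> pt (c *s v) = pt v"
  using pt_eq_iff[of v "c *s v"] by auto

lemma pt_in_points: "vec.subspace W \<Longrightarrow> v \<noteq> 0 \<Longrightarrow> pt v \<in> points W \<longleftrightarrow> v \<in> W"
  unfolding points_def by (auto simp: line_of_pt span1_iff vec.subspace_scale intro: vec.span_base)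

lemma pt_in_zeros: "form d F \<Longrightarrow> v \<noteq> 0 \<Longrightarrow> pt v \<in> zeros F \<longleftrightarrow> F v = 0"
  unfolding zeros_def by (auto simp: line_of_pt span1_iff form_homogeneous intro: vec.span_base)

lemma pt_in_zariski_closure:
  fixes v :: "complex ^ 'n::finite"
  assumes "v \<noteq> 0"
  shows "pt v \<in> zariski_closure X \<longleftrightarrow>
    (\<forall>d F. form d F \<longrightarrow> (\<forall>w. w \<noteq> 0 \<longrightarrow> pt w \<in> X \<longrightarrow> F w = 0) \<longrightarrow> F v = 0)"
proof -
  have "X \<subseteq> zeros F \<longleftrightarrow> (\<forall>w. w \<noteq> 0 \<longrightarrow> pt w \<in> X \<longrightarrow> F w = 0)" if F: "form d F" for d and F :: "complex ^ 'n \<Rightarrow> complex"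
  proof
    assume "X \<subseteq> zeros F"
    then show "\<forall>w. w \<noteq> 0 \<longrightarrow> pt w \<in> X \<longrightarrow> F w = 0" using pt_in_zeros[OF F] by blast
  next
    assume *: "\<forall>w. w \<noteq> 0 \<longrightarrow> pt w \<in> X \<longrightarrow> F w = 0"
    show "X \<subseteq> zeros F"
    proof
      fix x assume "x \<in> X"
      obtain w where "w \<noteq> 0" "x = pt w" by (rule pt_exhaust)
      with * \<open>x \<in> X\<close> show "x \<in> zeros F" using pt_in_zeros[OF F] by blast
    qed
  qed
  note key = this
  show ?thesis
  proof
    assume v: "pt v \<in> zariski_closure X"
    show "\<forall>d F. form d F \<longrightarrow> (\<forall>w. w \<noteq> 0 \<longrightarrow> pt w \<in> X \<longrightarrow> F w = 0) \<longrightarrow> F v = 0"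
    proof (intro allI impI)
      fix d and F :: "complex ^ 'n \<Rightarrow> complex"
      assume F: "form d F" and "\<forall>w. w \<noteq> 0 \<longrightarrow> pt w \<in> X \<longrightarrow> F w = 0"
      then have "X \<subseteq> zeros F" using key by blast
      then have "pt v \<in> zeros F" using v F unfolding zariski_closure_def by blast
      then show "F v = 0" using pt_in_zeros[OF F assms] by blast
    qed
  next
    assume *: "\<forall>d F. form d F \<longrightarrow> (\<forall>w. w \<noteq> 0 \<longrightarrow> pt w \<in> X \<longrightarrow> F w = 0) \<longrightarrow> F v = 0"
    show "pt v \<in> zariski_closure X" unfolding zariski_closure_def
    proof (rule InterI, clarify)
      fix F d assume F: "form d F" and "X \<subseteq> zeros F"
      then have "F v = 0" using * key[OF F] by blast
      then show "pt v \<in> zeros F" using pt_in_zeros[OF F assms] by blast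
    qed
  qed
qed

subsection \<open>Bases and planes\<close>

definition column_matrix :: "('n::finite \<Rightarrow> complex ^ 'm::finite) \<Rightarrow> complex ^ 'n ^ 'm" where
  "column_matrix b = (\<chi> i j. b j $ i)"

lemma column_matrix_mult: "column_matrix b *v x = (\<Sum>j\<in>UNIV. x $ j *s b j)"
  by (simp add: column_matrix_def matrix_vector_mult_def vec_eq_iff mult.commute)

lemma column_matrix_left_inverse:
  fixes b :: "'n::finite \<Rightarrow> complex ^ 'm::finite"
  assumes "\<And>x. (\<Sum>j\<in>UNIV. x $ j *s b j) = 0 \<Longrightarrow> x = 0"
  obtains N where "\<And>x. N *v (\<Sum>j\<in>UNIV. x $ j *s b j) = x"
proof -
  obtain N where "N ** column_matrix b = mat 1"
    using assms matrix_left_invertible_ker[of "column_matrix b"] unfolding column_matrix_mult by blast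
  then have "N *v (column_matrix b *v x) = x" for x by (simp add: matrix_vector_mul_assoc)
  then show thesis using that unfolding column_matrix_mult by blast
qed

lemma dual_basis_4:
  fixes b1 b2 b3 b4 :: "complex ^ 4"
  assumes ind: "\<And>x1 x2 x3 x4. x1 *s b1 + x2 *s b2 + x3 *s b3 + x4 *s b4 = 0 \<Longrightarrow> x1 = 0 \<and> x2 = 0 \<and> x3 = 0 \<and> x4 = 0"
  obtains c1 c2 c3 c4 where "form 1 c1" "form 1 c2" "form 1 c3" "form 1 c4"
    "\<And>v. v = c1 v *s b1 + c2 v *s b2 + c3 v *s b3 + c4 v *s b4"
    "\<And>x1 x2 x3 x4. c1 (x1 *s b1 + x2 *s b2 + x3 *s b3 + x4 *s b4) = x1"
    "\<And>x1 x2 x3 x4. c2 (x1 *s b1 + x2 *s b2 + x3 *s b3 + x4 *s b4) = x2"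
    "\<And>x1 x2 x3 x4. c3 (x1 *s b1 + x2 *s b2 + x3 *s b3 + x4 *s b4) = x3"
    "\<And>x1 x2 x3 x4. c4 (x1 *s b1 + x2 *s b2 + x3 *s b3 + x4 *s b4) = x4"
proof -
  define b :: "4 \<Rightarrow> complex ^ 4" where "b i = (if i = 1 then b1 else if i = 2 then b2 else if i = 3 then b3 else b4)" for i
  have b: "b 1 = b1" "b 2 = b2" "b 3 = b3" "b 4 = b4" by (simp_all add: b_def)
  have "\<exists>N. N ** column_matrix b = mat 1"
    unfolding matrix_left_invertible_ker column_matrix_mult sum_4 b
  proof (intro allI impI)
    fix x :: "complex ^ 4"
    assume "x $ 1 *s b1 + x $ 2 *s b2 + x $ 3 *s b3 + x $ 4 *s b4 = 0"
    from ind[OF this] show "x = 0" by (simp add: vec_eq_iff forall_4)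
  qed
  then obtain N where N: "N ** column_matrix b = mat 1" by blast
  then have N': "column_matrix b ** N = mat 1" using matrix_left_right_inverse by blast
  have 1: "v = (N *v v) $ 1 *s b1 + (N *v v) $ 2 *s b2 + (N *v v) $ 3 *s b3 + (N *v v) $ 4 *s b4" for v
  proof -
    have "v = column_matrix b *v (N *v v)" by (simp add: matrix_vector_mul_assoc N')
    then show ?thesis unfolding column_matrix_mult sum_4 b .
  qed
  have 2: "N *v (x1 *s b1 + x2 *s b2 + x3 *s b3 + x4 *s b4) = (\<chi> i. if i = 1 then x1 else if i = 2 then x2 else if i = 3 then x3 else x4)"
    (is "_ = ?x") for x1 x2 x3 x4
  proof -
    have "N *v (column_matrix b *v ?x) = ?x" by (simp add: matrix_vector_mul_assoc N)
    then show ?thesis unfolding column_matrix_mult sum_4 b by simp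
  qed
  show thesis
    by (rule that[of "\<lambda>v. (N *v v) $ 1" "\<lambda>v. (N *v v) $ 2" "\<lambda>v. (N *v v) $ 3" "\<lambda>v. (N *v v) $ 4"])
      (rule form_matrix 1 | simp add: 2)+
qed

lemma span3_independent:
  fixes a b c :: "complex ^ 'n::finite"
  assumes "a \<noteq> 0" "b \<notin> vec.span {a}" "c \<notin> vec.span {a, b}"
  shows "vec.dim (vec.span {a, b, c}) = 3"
proof -
  have "b \<noteq> a" "c \<noteq> a" "c \<noteq> b" using assms by (auto intro: vec.span_base)
  moreover have "vec.independent {c, b, a}"
    using assms by (intro vec.independent_insertI) (simp_all add: insert_commute vec.independent_empty)
  ultimately show ?thesis
    by (metis card_3_iff insert_commute vec.dim_eq_card_independent vec.dim_span)
qed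

lemma span_eq_of_dim:
  assumes "vec.subspace (W :: (complex ^ 'n::finite) set)" "S \<subseteq> W" "vec.dim (vec.span S) = vec.dim W"
  shows "W = vec.span S"
  using vec.subspace_dim_equal[of "vec.span S" W] assms vec.span_minimal by (metis order_refl vec.subspace_span)

lemma plane_basis_extend:
  assumes W: "vec.subspace W" "vec.dim W = 3" and "p \<in> W" "q \<in> W" "p \<noteq> 0" "q \<notin> vec.span {p}"
  obtains e :: "complex ^ 4" where "W = vec.span {p, q, e}"
proof -
  have "\<not> W \<subseteq> vec.span {p, q}"
    using vec.dim_subset[of W "vec.span {p, q}"] dim_span2_le[of p q] W(2) by auto
  then obtain e where e: "e \<in> W" "e \<notin> vec.span {p, q}" by blast
  have "vec.dim (vec.span {p, q, e}) = 3" using span3_independent assms e(2) by blast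
  then have "W = vec.span {p, q, e}" using span_eq_of_dim[OF W(1), of "{p, q, e}"] assms e W(2) by simp
  then show thesis by (rule that)
qed

lemma plane_dual_basis:
  assumes W: "vec.subspace W" "vec.dim W = 3" and pq: "p \<in> W" "q \<in> W" "p \<noteq> 0" "q \<notin> vec.span {p}"
  obtains e e' :: "complex ^ 4" and c1 c2 c3 c4 where
    "W = vec.span {p, q, e}" "W = {v. c4 v = 0}"
    "form 1 c1" "form 1 c2" "form 1 c3" "form 1 c4"
    "\<And>v. v = c1 v *s p + c2 v *s q + c3 v *s e + c4 v *s e'"
    "\<And>x1 x2 x3 x4. c1 (x1 *s p + x2 *s q + x3 *s e + x4 *s e') = x1"
    "\<And>x1 x2 x3 x4. c2 (x1 *s p + x2 *s q + x3 *s e + x4 *s e') = x2"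
    "\<And>x1 x2 x3 x4. c3 (x1 *s p + x2 *s q + x3 *s e + x4 *s e') = x3"
    "\<And>x1 x2 x3 x4. c4 (x1 *s p + x2 *s q + x3 *s e + x4 *s e') = x4"
proof -
  obtain e where e: "W = vec.span {p, q, e}" using plane_basis_extend[OF W pq] by blast
  have "vec.dim (UNIV :: (complex ^ 4) set) = CARD(4)" by (rule vec_dim_card)
  then have "W \<noteq> UNIV" using W(2) by auto
  then obtain e' where e': "e' \<notin> W" by blast
  have ind: "x1 = 0 \<and> x2 = 0 \<and> x3 = 0 \<and> x4 = 0"
    if eq: "x1 *s p + x2 *s q + x3 *s e + x4 *s e' = 0" for x1 x2 x3 x4
  proof -
    have "x4 = 0"
    proof (rule ccontr)
      assume x4: "x4 \<noteq> 0"
      have "x4 *s e' = - (x1 *s p + x2 *s q + x3 *s e)" using eq by (metis add.commute add_eq_0_iff2)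
      then have "x4 *s e' \<in> W" unfolding e
        by (metis span3_iff vec.span_neg)
      then have "(1 / x4) *s (x4 *s e') \<in> W" using W(1) by (rule vec.subspace_scale[rotated])
      then show False using e' x4 by simp
    qed
    then show ?thesis using eq plane_basis_independent[of p q e x1 x2 x3] W(2) e by simp
  qed
  obtain c1 c2 c3 c4 where c: "form 1 c1" "form 1 c2" "form 1 c3" "form 1 c4"
    "\<And>v. v = c1 v *s p + c2 v *s q + c3 v *s e + c4 v *s e'"
    "\<And>x1 x2 x3 x4. c1 (x1 *s p + x2 *s q + x3 *s e + x4 *s e') = x1"
    "\<And>x1 x2 x3 x4. c2 (x1 *s p + x2 *s q + x3 *s e + x4 *s e') = x2"
    "\<And>x1 x2 x3 x4. c3 (x1 *s p + x2 *s q + x3 *s e + x4 *s e') = x3"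
    "\<And>x1 x2 x3 x4. c4 (x1 *s p + x2 *s q + x3 *s e + x4 *s e') = x4"
    by (rule dual_basis_4[OF ind]) (assumption | rule that)+
  have "v \<in> W \<longleftrightarrow> c4 v = 0" for v
  proof
    assume "v \<in> W"
    then obtain x y z where "v = x *s p + y *s q + z *s e + 0 *s e'" unfolding e span3_iff by auto
    then show "c4 v = 0" using c(9) by metis
  next
    assume "c4 v = 0"
    then have "v = c1 v *s p + c2 v *s q + c3 v *s e" using c(5)[of v] by simp
    then show "v \<in> W" unfolding e span3_iff by blast
  qed
  then have "W = {v. c4 v = 0}" by blast
  from that[OF e this c] show thesis .
qed

subsection \<open>Cameras and fundamental forms\<close>

text \<open>The rank condition concerns the real matrix; a real right inverse remains one over the
  complex numbers.\<close>

lemma cmatrix_surj: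
  assumes "is_camera P"
  obtains R where "cmatrix P ** R = mat 1"
proof -
  have "surj ((*v) P)" using assms full_rank_surjective[of P] unfolding is_camera_def by simp
  then obtain R where "P ** R = mat 1" using matrix_right_invertible_surjective by blast
  then have "complex_of_real ((P ** R) $ i $ j) = complex_of_real ((mat 1 :: real ^ 3 ^ 3) $ i $ j)" for i j by simp
  then have "cmatrix P ** map_matrix complex_of_real R = mat 1"
    unfolding vec_eq_iff cmatrix_def matrix_matrix_mult_def mat_def by (simp add: if_distrib cong: if_cong)
  then show thesis by (rule that)
qed

lemma cmatrix_onto: "is_camera P \<Longrightarrow> \<exists>v. cmatrix P *v v = x"
  by (metis cmatrix_surj matrix_vector_mul_assoc matrix_vector_mul_lid)

text \<open>The 4-dimensional space is the direct sum of the kernel and the 3-dimensional range of a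
  right inverse.\<close>

lemma dim_kernel_cmatrix:
  assumes "is_camera P"
  shows "vec.dim {v. cmatrix P *v v = 0} = 1"
proof -
  obtain R where R: "cmatrix P ** R = mat 1" using cmatrix_surj[OF assms] .
  then have inv: "cmatrix P *v (R *v x) = x" for x by (simp add: matrix_vector_mul_assoc)
  let ?K = "{v. cmatrix P *v v = 0}" and ?I = "range ((*v) R)"
  have d3: "vec.dim (UNIV :: (complex ^ 3) set) = CARD(3)" and d4: "vec.dim (UNIV :: (complex ^ 4) set) = CARD(4)"
    by (rule vec_dim_card)+
  have sK: "vec.subspace ?K"
    unfolding vec.subspace_def by (auto simp: matrix_vector_right_distrib matrix_vector_mult_scaleR vec.scale)
  have sI: "vec.subspace ?I" using vec.subspace_image matrix_vector_mul_linear_gen vec.subspace_UNIV by blast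
  have "inj ((*v) R)" by (metis injI inv)
  then have dI: "vec.dim ?I = 3"
    using vec.dim_image_eq[OF matrix_vector_mul_linear_gen, of R UNIV] d3 by simp
  have "{x + y |x y. x \<in> ?K \<and> y \<in> ?I} = UNIV"
  proof -
    have "v - R *v (cmatrix P *v v) \<in> ?K" for v by (simp add: matrix_vector_mult_diff_distrib inv)
    then have "\<exists>x y. v = x + y \<and> x \<in> ?K \<and> y \<in> ?I" for v
      by (intro exI[of _ "v - R *v (cmatrix P *v v)"] exI[of _ "R *v (cmatrix P *v v)"]) simp
    then show ?thesis by blast
  qed
  moreover have "?K \<inter> ?I = {0}" using inv by (auto simp: image_iff) (metis matrix_vector_mult_0_right)
  ultimately show ?thesis using vec.dim_sums_Int[OF sK sI] dI d4 by simp
qed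

lemma center_eq_pt:
  assumes "is_camera P"
  obtains p where "p \<noteq> 0" "center P = pt p" "\<And>v. cmatrix P *v v = 0 \<longleftrightarrow> (\<exists>c. v = c *s p)"
proof -
  have "vec.subspace {v. cmatrix P *v v = 0}"
    unfolding vec.subspace_def by (auto simp: matrix_vector_right_distrib vec.scale)
  from dim_1_span[OF this dim_kernel_cmatrix[OF assms]]
  obtain p where p: "p \<noteq> 0" "{v. cmatrix P *v v = 0} = vec.span {p}" by blast
  then have "cmatrix P *v v = 0 \<longleftrightarrow> (\<exists>c. v = c *s p)" for v using span1_iff by blast
  moreover have "center P = pt p" unfolding center_def pt_def p(2) ..
  ultimately show thesis using that p(1) by blast
qed

section \<open>The 6 by 6 determinant of a pair of cameras\<close>

lemma exhaust_6:
  fixes x :: 6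
  shows "x = 1 \<or> x = 2 \<or> x = 3 \<or> x = 4 \<or> x = 5 \<or> x = 6"
proof (induct x)
  case (of_int z)
  then have "z = 0 \<or> z = 1 \<or> z = 2 \<or> z = 3 \<or> z = 4 \<or> z = 5" by fastforce
  then show ?case by auto
qed

lemma forall_6: "(\<forall>i::6. Q i) \<longleftrightarrow> Q 1 \<and> Q 2 \<and> Q 3 \<and> Q 4 \<and> Q 5 \<and> Q 6"
  by (metis exhaust_6)

lemma UNIV_6: "UNIV = {1, 2, 3, 4, 5, 6 :: 6}"
  using exhaust_6 by auto

lemma sum_6: "sum f (UNIV :: 6 set) = f 1 + f 2 + f 3 + f 4 + f 5 + f 6"
  unfolding UNIV_6 by (simp add: ac_simps)

lemma vector_6:
  "(vector [a, b, c, d, e, f] :: 'a::zero ^ 6) $ 1 = a"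
  "(vector [a, b, c, d, e, f] :: 'a::zero ^ 6) $ 2 = b"
  "(vector [a, b, c, d, e, f] :: 'a::zero ^ 6) $ 3 = c"
  "(vector [a, b, c, d, e, f] :: 'a::zero ^ 6) $ 4 = d"
  "(vector [a, b, c, d, e, f] :: 'a::zero ^ 6) $ 5 = e"
  "(vector [a, b, c, d, e, f] :: 'a::zero ^ 6) $ 6 = f"
  unfolding vector_def by simp_all

definition joint_matrix :: "complex ^ 4 ^ 3 \<Rightarrow> complex ^ 4 ^ 3 \<Rightarrow> complex ^ 3 \<Rightarrow> complex ^ 3 \<Rightarrow> complex ^ 6 ^ 6" where
  "joint_matrix A B x y = vector
      [vector [A$1$1, A$1$2, A$1$3, A$1$4, x$1, 0],
       vector [A$2$1, A$2$2, A$2$3, A$2$4, x$2, 0],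
       vector [A$3$1, A$3$2, A$3$3, A$3$4, x$3, 0],
       vector [B$1$1, B$1$2, B$1$3, B$1$4, 0, y$1],
       vector [B$2$1, B$2$2, B$2$3, B$2$4, 0, y$2],
       vector [B$3$1, B$3$2, B$3$3, B$3$4, 0, y$3]]"

lemma fundamental_form_det: "fundamental_form P Q x y = det (joint_matrix (cmatrix P) (cmatrix Q) x y)"
  unfolding fundamental_form_def joint_matrix_def Let_def ..

lemma joint_matrix_kernel:
  "joint_matrix A B x y *v z = 0 \<longleftrightarrow>
    A *v vector [z$1, z$2, z$3, z$4] + z$5 *s x = 0 \<and> B *v vector [z$1, z$2, z$3, z$4] + z$6 *s y = 0"
  unfolding vec_eq_iff forall_6 forall_3 joint_matrix_def matrix_vector_mult_def
  by (simp add: vector_6 sum_6 sum_4 vector_def[of "[z$1, z$2, z$3, z$4]"] mult.commute add.assoc)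

text \<open>A kernel vector of the 6 by 6 matrix is a vector \<open>v\<close> together with minus
  the scalars \<sigma> and \<rho>. The form thus vanishes exactly if \<open>x\<close> and
  \<open>y\<close> are views of a common vector, degenerate scalars included; all later uses go
  through this criterion instead of the determinant.\<close>

lemma fundamental_form_eq_0_iff:
  "fundamental_form P Q x y = 0 \<longleftrightarrow> (\<exists>v \<sigma> \<rho>. (v \<noteq> 0 \<or> \<sigma> \<noteq> 0 \<or> \<rho> \<noteq> 0) \<and>
     cmatrix P *v v = \<sigma> *s x \<and> cmatrix Q *v v = \<rho> *s y)"
proof -
  let ?M = "joint_matrix (cmatrix P) (cmatrix Q) x y"
  have v4: "(vector [a, b, c, d] :: complex ^ 4) $ 1 = a" "(vector [a, b, c, d] :: complex ^ 4) $ 2 = b"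
    "(vector [a, b, c, d] :: complex ^ 4) $ 3 = c" "(vector [a, b, c, d] :: complex ^ 4) $ 4 = d" for a b c d
    unfolding vector_def by simp_all
  have "fundamental_form P Q x y = 0 \<longleftrightarrow> (\<exists>z. z \<noteq> 0 \<and> ?M *v z = 0)"
    unfolding fundamental_form_det
    using invertible_det_nz[of ?M] invertible_left_inverse[of ?M] matrix_left_invertible_ker[of ?M] by blast
  also have "\<dots> \<longleftrightarrow> (\<exists>v \<sigma> \<rho>. (v \<noteq> 0 \<or> \<sigma> \<noteq> 0 \<or> \<rho> \<noteq> 0) \<and>
     cmatrix P *v v = \<sigma> *s x \<and> cmatrix Q *v v = \<rho> *s y)"
  proof
    assume "\<exists>z. z \<noteq> 0 \<and> ?M *v z = 0"
    then obtain z where z: "z \<noteq> 0" "?M *v z = 0" by blast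
    let ?v = "vector [z$1, z$2, z$3, z$4] :: complex ^ 4"
    have "?v \<noteq> 0 \<or> - z$5 \<noteq> 0 \<or> - z$6 \<noteq> 0"
      using z(1) by (auto simp: vec_eq_iff forall_6 forall_4 v4)
    moreover have "cmatrix P *v ?v = (- z$5) *s x" "cmatrix Q *v ?v = (- z$6) *s y"
      using z(2) unfolding joint_matrix_kernel by (simp_all add: eq_neg_iff_add_eq_0)
    ultimately show "\<exists>v \<sigma> \<rho>. (v \<noteq> 0 \<or> \<sigma> \<noteq> 0 \<or> \<rho> \<noteq> 0) \<and>
      cmatrix P *v v = \<sigma> *s x \<and> cmatrix Q *v v = \<rho> *s y" by blast
  next
    assume "\<exists>v \<sigma> \<rho>. (v \<noteq> 0 \<or> \<sigma> \<noteq> 0 \<or> \<rho> \<noteq> 0) \<and> cmatrix P *v v = \<sigma> *s x \<and> cmatrix Q *v v = \<rho> *s y"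
    then obtain v \<sigma> \<rho> where v: "v \<noteq> 0 \<or> \<sigma> \<noteq> 0 \<or> \<rho> \<noteq> 0"
      "cmatrix P *v v = \<sigma> *s x" "cmatrix Q *v v = \<rho> *s y" by blast
    let ?z = "vector [v$1, v$2, v$3, v$4, - \<sigma>, - \<rho>] :: complex ^ 6"
    have "?z \<noteq> 0" using v(1) by (auto simp: vec_eq_iff forall_6 forall_4 vector_6)
    moreover have "vector [v$1, v$2, v$3, v$4] = v" by (simp add: vec_eq_iff forall_4 v4)
    then have "?M *v ?z = 0" unfolding joint_matrix_kernel vector_6 by (simp add: v)
    ultimately show "\<exists>z. z \<noteq> 0 \<and> ?M *v z = 0" by blast
  qed
  finally show ?thesis .
qed

lemma fundamental_form_swap_eq_0: "fundamental_form Q P y x = 0 \<longleftrightarrow> fundamental_form P Q x y = 0"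
  unfolding fundamental_form_eq_0_iff by blast

text \<open>Transposition makes the columns with \<open>x\<close> and \<open>y\<close> into rows, in
  which the determinant is linear.\<close>

lemma fundamental_form_columns:
  "fundamental_form P Q x y = det (\<chi> i. if i = 5 then vector [x$1, x$2, x$3, 0, 0, 0]
     else transpose (joint_matrix (cmatrix P) (cmatrix Q) 0 y) $ i)"
  "fundamental_form P Q x y = det (\<chi> i. if i = 6 then vector [0, 0, 0, y$1, y$2, y$3]
     else transpose (joint_matrix (cmatrix P) (cmatrix Q) x 0) $ i)"
proof -
  have "transpose (joint_matrix (cmatrix P) (cmatrix Q) x y) = (\<chi> i. if i = 5 then vector [x$1, x$2, x$3, 0, 0, 0]
     else transpose (joint_matrix (cmatrix P) (cmatrix Q) 0 y) $ i)"
    "transpose (joint_matrix (cmatrix P) (cmatrix Q) x y) = (\<chi> i. if i = 6 then vector [0, 0, 0, y$1, y$2, y$3]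
     else transpose (joint_matrix (cmatrix P) (cmatrix Q) x 0) $ i)"
    unfolding vec_eq_iff forall_6 transpose_def joint_matrix_def by (simp_all add: vector_6)
  then show
    "fundamental_form P Q x y = det (\<chi> i. if i = 5 then vector [x$1, x$2, x$3, 0, 0, 0]
       else transpose (joint_matrix (cmatrix P) (cmatrix Q) 0 y) $ i)"
    "fundamental_form P Q x y = det (\<chi> i. if i = 6 then vector [0, 0, 0, y$1, y$2, y$3]
       else transpose (joint_matrix (cmatrix P) (cmatrix Q) x 0) $ i)"
    unfolding fundamental_form_det by (metis det_transpose)+
qed

lemma fundamental_form_bilinear:
  "fundamental_form P Q (x + x') y = fundamental_form P Q x y + fundamental_form P Q x' y"
  "fundamental_form P Q (k *s x) y = k * fundamental_form P Q x y"
  "fundamental_form P Q x (y + y') = fundamental_form P Q x y + fundamental_form P Q x y'"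
  "fundamental_form P Q x (k *s y) = k * fundamental_form P Q x y"
proof -
  let ?u = "\<lambda>x :: complex ^ 3. vector [x$1, x$2, x$3, 0, 0, 0] :: complex ^ 6"
  let ?v = "\<lambda>x :: complex ^ 3. vector [0, 0, 0, x$1, x$2, x$3] :: complex ^ 6"
  have u: "?u (x + x') = ?u x + ?u x'" "?u (k *s x) = k *s ?u x"
    and v: "?v (x + x') = ?v x + ?v x'" "?v (k *s x) = k *s ?v x" for x x' k
    unfolding vec_eq_iff forall_6 by (simp_all add: vector_6)
  show "fundamental_form P Q (x + x') y = fundamental_form P Q x y + fundamental_form P Q x' y"
    unfolding fundamental_form_columns(1)[of P Q _ y] u by (rule det_row_add)
  show "fundamental_form P Q (k *s x) y = k * fundamental_form P Q x y"
    unfolding fundamental_form_columns(1)[of P Q _ y] u by (rule det_row_mul)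
  show "fundamental_form P Q x (y + y') = fundamental_form P Q x y + fundamental_form P Q x y'"
    unfolding fundamental_form_columns(2)[of P Q x] v by (rule det_row_add)
  show "fundamental_form P Q x (k *s y) = k * fundamental_form P Q x y"
    unfolding fundamental_form_columns(2)[of P Q x] v by (rule det_row_mul)
qed

text \<open>Let e complete the centers to a basis of \<open>W\<close>, and let e' lie outside
  \<open>W\<close>. The last two dual coordinates vanish on both centers, so they descend to both
  images. The fundamental form vanishes if one argument is the image of the other camera's center,
  so it depends on these two coordinates alone; it also vanishes on the two views of one vector, so
  it is alternating in them and a multiple of their determinant.\<close>

lemma camera_pair_functionals:
  assumes cam: "is_camera P1" "is_camera P2" and ne: "center P1 \<noteq> center P2"
    and W: "vec.subspace W" "vec.dim W = 3" "center P1 \<in> points W" "center P2 \<in> points W"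
  obtains \<alpha>1 \<omega>1 \<alpha>2 \<omega>2 k where
    "form 1 \<alpha>1" "form 1 \<omega>1" "form 1 \<alpha>2" "form 1 \<omega>2"
    "\<And>x. \<alpha>1 (cmatrix P1 *v x) = \<alpha>2 (cmatrix P2 *v x)"
    "\<And>x. \<omega>1 (cmatrix P1 *v x) = \<omega>2 (cmatrix P2 *v x)"
    "\<exists>X. \<alpha>1 X = 1 \<and> \<omega>1 X = 0" "\<exists>X. \<alpha>1 X = 0 \<and> \<omega>1 X = 1"
    "\<exists>X. \<alpha>2 X = 1 \<and> \<omega>2 X = 0" "\<exists>X. \<alpha>2 X = 0 \<and> \<omega>2 X = 1"
    "k \<noteq> 0" "\<And>X Y. fundamental_form P1 P2 X Y = k * (\<alpha>1 X * \<omega>2 Y - \<omega>1 X * \<alpha>2 Y)"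
    "W = {x. \<omega>1 (cmatrix P1 *v x) = 0}"
proof -
  let ?A = "\<lambda>x. cmatrix P1 *v x" and ?B = "\<lambda>x. cmatrix P2 *v x"
  obtain p1 where p1: "p1 \<noteq> 0" "center P1 = pt p1" "\<And>v. ?A v = 0 \<longleftrightarrow> (\<exists>c. v = c *s p1)"
    by (rule center_eq_pt[OF cam(1)]) (rule that)
  obtain p2 where p2: "p2 \<noteq> 0" "center P2 = pt p2" "\<And>v. ?B v = 0 \<longleftrightarrow> (\<exists>c. v = c *s p2)"
    by (rule center_eq_pt[OF cam(2)]) (rule that)
  have pW: "p1 \<in> W" "p2 \<in> W" using W pt_in_points p1 p2 by auto
  have p12: "p2 \<notin> vec.span {p1}"
  proof
    assume "p2 \<in> vec.span {p1}"
    then obtain c where "p2 = c *s p1" using span1_iff by blast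
    then have "pt p1 = pt p2" using p2(1) pt_eq_iff[OF p1(1) p2(1)] by (metis vec.scale_zero_left)
    then show False using ne p1(2) p2(2) by simp
  qed
  obtain e e' c1 c2 c3 c4 where W_eq: "W = {v. c4 v = 0}"
    and c: "form 1 c3" "form 1 c4"
    and rep: "\<And>v. v = c1 v *s p1 + c2 v *s p2 + c3 v *s e + c4 v *s e'"
    and c3: "\<And>x1 x2 x3 x4. c3 (x1 *s p1 + x2 *s p2 + x3 *s e + x4 *s e') = x3"
    and c4: "\<And>x1 x2 x3 x4. c4 (x1 *s p1 + x2 *s p2 + x3 *s e + x4 *s e') = x4"
    by (rule plane_dual_basis[OF W(1,2) pW p1(1) p12]) (rule that)
  obtain R1 where R1: "cmatrix P1 ** R1 = mat 1" using cmatrix_surj[OF cam(1)] .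
  obtain R2 where R2: "cmatrix P2 ** R2 = mat 1" using cmatrix_surj[OF cam(2)] .
  have inv: "?A (R1 *v X) = X" "?B (R2 *v X) = X" for X
    by (simp_all add: matrix_vector_mul_assoc R1 R2)
  have p0: "c3 (c *s p1) = 0" "c3 (c *s p2) = 0" "c4 (c *s p1) = 0" "c4 (c *s p2) = 0" for c
    using c3[of c 0 0 0] c3[of 0 c 0 0] c4[of c 0 0 0] c4[of 0 c 0 0] by simp_all
  \<comment> \<open>The right inverses choose preimages; \<open>c3\<close> and \<open>c4\<close> do
    not depend on the choice because they vanish on the kernels.\<close>
  define \<alpha>1 where "\<alpha>1 X = c3 (R1 *v X)" for X
  define \<omega>1 where "\<omega>1 X = c4 (R1 *v X)" for X
  define \<alpha>2 where "\<alpha>2 X = c3 (R2 *v X)" for X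
  define \<omega>2 where "\<omega>2 X = c4 (R2 *v X)" for X
  have forms: "form 1 \<alpha>1" "form 1 \<omega>1" "form 1 \<alpha>2" "form 1 \<omega>2"
    unfolding \<alpha>1_def \<omega>1_def \<alpha>2_def \<omega>2_def
    using form_subst[OF c(1) form_matrix] form_subst[OF c(2) form_matrix] by simp_all
  have diff1: "L (R1 *v ?A x) = L x" if L: "form 1 L" "\<And>c. L (c *s p1) = 0" for L x
  proof -
    have "?A (x - R1 *v ?A x) = 0" by (simp add: matrix_vector_mult_diff_distrib inv)
    then obtain k where "x - R1 *v ?A x = k *s p1" using p1(3) by blast
    then have "x = R1 *v ?A x + k *s p1" by (simp add: algebra_simps)
    then show ?thesis using form_1_linear(1)[OF L(1)] L(2) by (metis add.right_neutral)
  qed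
  have diff2: "L (R2 *v ?B x) = L x" if L: "form 1 L" "\<And>c. L (c *s p2) = 0" for L x
  proof -
    have "?B (x - R2 *v ?B x) = 0" by (simp add: matrix_vector_mult_diff_distrib inv)
    then obtain k where "x - R2 *v ?B x = k *s p2" using p2(3) by blast
    then have "x = R2 *v ?B x + k *s p2" by (simp add: algebra_simps)
    then show ?thesis using form_1_linear(1)[OF L(1)] L(2) by (metis add.right_neutral)
  qed
  have val: "\<alpha>1 (?A x) = c3 x" "\<omega>1 (?A x) = c4 x" "\<alpha>2 (?B x) = c3 x" "\<omega>2 (?B x) = c4 x" for x
    unfolding \<alpha>1_def \<omega>1_def \<alpha>2_def \<omega>2_def using diff1 diff2 c p0 by blast+
  have e: "c3 e = 1" "c4 e = 0" "c3 e' = 0" "c4 e' = 1"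
    using c3[of 0 0 1 0] c4[of 0 0 1 0] c3[of 0 0 0 1] c4[of 0 0 0 1] by simp_all
  let ?F = "fundamental_form P1 P2"
  define k where "k = ?F (?A e) (?B e')"
  have F0: "?F (?A v) (?B v) = 0" for v
  proof (cases "v = 0")
    case True
    then show ?thesis using fundamental_form_bilinear(2)[of P1 P2 0 0 0] by simp
  next
    case False
    then show ?thesis unfolding fundamental_form_eq_0_iff
      by (intro exI[of _ v] exI[of _ 1]) simp
  qed
  have Fl: "?F (c *s ?A p2) Y = 0" for c Y
  proof -
    have "?B p2 = 0" using p2(3)[of p2] by (metis vec.scale_one)
    then have "?F (?A p2) Y = 0" unfolding fundamental_form_eq_0_iff
      using p2(1) by (intro exI[of _ p2] exI[of _ 1] exI[of _ 0]) simp
    then show ?thesis by (simp add: fundamental_form_bilinear)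
  qed
  have Fr: "?F X (c *s ?B p1) = 0" for c X
  proof -
    have "?A p1 = 0" using p1(3)[of p1] by (metis vec.scale_one)
    then have "?F X (?B p1) = 0" unfolding fundamental_form_eq_0_iff
      using p1(1) by (intro exI[of _ p1] exI[of _ 0] exI[of _ 1]) simp
    then show ?thesis by (simp add: fundamental_form_bilinear)
  qed
  \<comment> \<open>Polarization: the form vanishes on the two views of e, of e' and of e +
    e'.\<close>
  have anti: "?F (?A e') (?B e) = - k"
    using F0[of "e + e'"] F0[of e] F0[of e'] unfolding k_def
    by (simp add: matrix_vector_right_distrib fundamental_form_bilinear eq_neg_iff_add_eq_0 add.commute)
  have A: "?A v = c2 v *s ?A p2 + c3 v *s ?A e + c4 v *s ?A e'" for v
  proof -
    have "?A p1 = 0" using p1(3) by (metis vec.scale_one)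
    then show ?thesis
      by (subst rep[of v]) (simp add: matrix_vector_right_distrib vec.scale)
  qed
  have B: "?B v = c1 v *s ?B p1 + c3 v *s ?B e + c4 v *s ?B e'" for v
  proof -
    have "?B p2 = 0" using p2(3) by (metis vec.scale_one)
    then show ?thesis
      by (subst rep[of v]) (simp add: matrix_vector_right_distrib vec.scale)
  qed
  have F: "?F X Y = k * (\<alpha>1 X * \<omega>2 Y - \<omega>1 X * \<alpha>2 Y)" for X Y
  proof -
    obtain v w where vw: "?A v = X" "?B w = Y" using cmatrix_onto cam by metis
    have "?F X Y = k * (c3 v * c4 w - c4 v * c3 w)"
      unfolding vw[symmetric] A[of v] B[of w]
      by (simp add: fundamental_form_bilinear(1,3) Fl Fr)
         (simp add: fundamental_form_bilinear(2,4) F0 anti k_def[symmetric] algebra_simps)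
    then show ?thesis unfolding vw[symmetric] val .
  qed
  \<comment> \<open>If k = 0, some \<open>v\<close> is seen as a multiple of e by the first camera
    and of e' by the second. Comparing coordinates, both multiples are 0, so \<open>v\<close> would
    be on both centers.\<close>
  have "k \<noteq> 0"
  proof
    assume "k = 0"
    then obtain v \<sigma> \<rho> where v: "v \<noteq> 0 \<or> \<sigma> \<noteq> 0 \<or> \<rho> \<noteq> 0" "?A v = \<sigma> *s ?A e" "?B v = \<rho> *s ?B e'"
      unfolding k_def fundamental_form_eq_0_iff by blast
    have "c3 v = \<alpha>1 (\<sigma> *s ?A e)" "c4 v = \<omega>1 (\<sigma> *s ?A e)" "c3 v = \<alpha>2 (\<rho> *s ?B e')" "c4 v = \<omega>2 (\<rho> *s ?B e')"
      using val v(2,3) by metis+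
    then have "c3 v = \<sigma> * 1" "c4 v = \<sigma> * 0" "c3 v = \<rho> * 0" "c4 v = \<rho> * 1"
      by (simp_all only: form_1_linear(2)[OF forms(1)] form_1_linear(2)[OF forms(2)]
          form_1_linear(2)[OF forms(3)] form_1_linear(2)[OF forms(4)] val e)
    then have \<sigma>: "c3 v = \<sigma>" "c4 v = 0" "c3 v = 0" "c4 v = \<rho>" by simp_all
    then have "?A v = 0" "?B v = 0" using v(2,3) by simp_all
    then obtain x y where xy: "v = x *s p1" "v = y *s p2" using p1(3) p2(3) by blast
    have "v = 0"
    proof (rule ccontr)
      assume "v \<noteq> 0"
      then have "y \<noteq> 0" using xy by auto
      then have "p2 = (x / y) *s p1" using xy by (metis (no_types) vec.scale_scale vec.scale_one divide_self_if times_divide_eq_left mult_1 mult.commute)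
      then show False using p12 span1_iff by blast
    qed
    then show False using v(1) \<sigma> by simp
  qed
  moreover have "\<exists>X. \<alpha>1 X = 1 \<and> \<omega>1 X = 0" "\<exists>X. \<alpha>1 X = 0 \<and> \<omega>1 X = 1"
    "\<exists>X. \<alpha>2 X = 1 \<and> \<omega>2 X = 0" "\<exists>X. \<alpha>2 X = 0 \<and> \<omega>2 X = 1"
    using val e by metis+
  ultimately show thesis
    using that[OF forms] val F W_eq by simp
qed

subsection \<open>Two pairs of views\<close>

lemma functional_pair_kernel:
  fixes L M :: "complex ^ 3 \<Rightarrow> complex"
  assumes "form 1 L" "form 1 M" and "\<exists>X. L X = 1 \<and> M X = 0" "\<exists>X. L X = 0 \<and> M X = 1"
    and X: "X \<noteq> 0" "L X = 0" "M X = 0" and Y: "L Y = 0" "M Y = 0"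
  obtains c where "Y = c *s X"
proof -
  obtain U V where U: "L U = 1" "M U = 0" and V: "L V = 0" "M V = 1" using assms(3,4) by blast
  note lin = form_1_linear[OF assms(1)] form_1_linear[OF assms(2)]
  have "\<not> Y \<notin> vec.span {X}"
  proof
    assume n: "Y \<notin> vec.span {X}"
    have "U \<notin> vec.span {X, Y}"
    proof
      assume "U \<in> vec.span {X, Y}"
      then obtain p q where "U = p *s X + q *s Y" using span2_iff by blast
      then show False using U X Y by (simp add: lin)
    qed
    then have "vec.dim (vec.span {X, Y, U}) = 3" using span3_independent[OF X(1) n] by blast
    moreover have "vec.dim (UNIV :: (complex ^ 3) set) = CARD(3)" by (rule vec_dim_card)
    ultimately have "UNIV = vec.span {X, Y, U}" using span_eq_of_dim[of UNIV "{X, Y, U}"] by simp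
    then obtain p q r where "V = p *s X + q *s Y + r *s U" using span3_iff by blast
    then show False using U V X Y by (simp add: lin)
  qed
  then show thesis using that span1_iff by blast
qed

lemma functional_triple_onto:
  fixes L M N :: "complex ^ 3 \<Rightarrow> complex"
  assumes L: "form 1 L" "form 1 M" "form 1 N" and "\<exists>X. L X = 1 \<and> N X = 0" "\<exists>X. L X = 0 \<and> N X = 1"
    and reg: "\<And>X. L X = 0 \<Longrightarrow> M X = 0 \<Longrightarrow> N X = 0 \<Longrightarrow> X = 0"
  obtains X where "L X = l" "M X = m" "N X = n"
proof -
  obtain U V where U: "L U = 1" "N U = 0" and V: "L V = 0" "N V = 1" using assms(4,5) by blast
  note lin = form_1_linear[OF L(1)] form_1_linear[OF L(2)] form_1_linear[OF L(3)]
  have dim3: "vec.dim (UNIV :: (complex ^ 3) set) = CARD(3)" by (rule vec_dim_card)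
  have "vec.span {U, V} \<noteq> UNIV"
  proof
    assume "vec.span {U, V} = UNIV"
    then show False using dim_span2_le[of U V] dim3 by simp
  qed
  then obtain Z where Z: "Z \<notin> vec.span {U, V}" by blast
  define T where "T = Z - L Z *s U - N Z *s V"
  have T: "L T = 0" "N T = 0"
  proof -
    have "T + (L Z *s U + N Z *s V) = Z" by (simp add: T_def)
    then have "L Z = L (T + (L Z *s U + N Z *s V))" "N Z = N (T + (L Z *s U + N Z *s V))" by simp_all
    then show "L T = 0" "N T = 0" unfolding lin U V by simp_all
  qed
  have "M T \<noteq> 0"
  proof
    assume "M T = 0"
    then have "T = 0" using reg T by blast
    then have "Z = L Z *s U + N Z *s V" by (simp add: T_def algebra_simps)
    then show False using Z span2_iff by blast
  qed
  then show thesis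
    by (intro that[of "l *s U + n *s V + ((m - l * M U - n * M V) / M T) *s T"]) (simp_all add: lin U V T)
qed

lemma functional_kernel_plane:
  fixes L :: "complex ^ 4 \<Rightarrow> complex"
  assumes L: "form 1 L" and e: "L e \<noteq> 0"
  shows "is_plane {x. L x = 0}"
proof -
  note lin = form_1_linear[OF L]
  have sub: "vec.subspace {x. L x = 0}"
    unfolding vec.subspace_def using lin(2)[of 0 0] by (simp add: lin)
  have e0: "e \<noteq> 0" using e lin(2)[of 0 0] by auto
  have "{x + y |x y. x \<in> {x. L x = 0} \<and> y \<in> vec.span {e}} = UNIV"
  proof -
    have "\<exists>x y. v = x + y \<and> x \<in> {x. L x = 0} \<and> y \<in> vec.span {e}" for v
    proof (intro exI conjI)
      show "v = (v + (- (L v / L e)) *s e) + (L v / L e) *s e" by simp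
      have "L (v + (- (L v / L e)) *s e) = L v + (- (L v / L e)) * L e" by (simp only: lin)
      then show "v + (- (L v / L e)) *s e \<in> {x. L x = 0}" using e by simp
      show "(L v / L e) *s e \<in> vec.span {e}" using span1_iff by blast
    qed
    then show ?thesis by blast
  qed
  moreover have "{x. L x = 0} \<inter> vec.span {e} = {0}"
    using e lin(2)[of 0 0] by (auto simp: span1_iff lin)
  moreover have "vec.dim (UNIV :: (complex ^ 4) set) = CARD(4)" by (rule vec_dim_card)
  ultimately have "vec.dim {x. L x = 0} = 3"
    using vec.dim_sums_Int[OF sub vec.subspace_span, of "{e}"] dim_span_singleton[OF e0] by simp
  then show ?thesis using sub unfolding is_plane_def by blast
qed

lemma form_diff: "form d F \<Longrightarrow> form d G \<Longrightarrow> form d (\<lambda>x. F x - G x)"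
  using form_add[OF _ form_scale[of d G "-1"]] by simp

section \<open>Pictures, quadrics and conjugacy in homogeneous coordinates\<close>

lemma picture_pt:
  assumes "cmatrix P *v v \<noteq> 0"
  shows "picture P (pt v) = pt (cmatrix P *v v)"
proof -
  have "v \<noteq> 0" using assms by auto
  have "(\<lambda>v. cmatrix P *v v) ` vec.span {v} = vec.span {cmatrix P *v v}"
  proof (intro set_eqI iffI)
    fix x assume "x \<in> (\<lambda>v. cmatrix P *v v) ` vec.span {v}"
    then obtain y where y: "y \<in> vec.span {v}" "x = cmatrix P *v y" by blast
    from y(1) obtain c where "y = c *s v" using span1_iff by blast
    then have "x = cmatrix P *v (c *s v)" using y(2) by simp
    then show "x \<in> vec.span {cmatrix P *v v}" unfolding vec.scale span1_iff by blast
  next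
    fix x assume "x \<in> vec.span {cmatrix P *v v}"
    then obtain c where "x = c *s (cmatrix P *v v)" using span1_iff by blast
    then have "x = cmatrix P *v (c *s v)" by (simp add: vec.scale)
    moreover have "c *s v \<in> vec.span {v}" using span1_iff by blast
    ultimately show "x \<in> (\<lambda>v. cmatrix P *v v) ` vec.span {v}" by blast
  qed
  then show ?thesis unfolding picture_def line_of_pt[OF \<open>v \<noteq> 0\<close>] by (simp add: pt_def)
qed

lemma pt_eq_center_iff:
  assumes "is_camera P" "v \<noteq> 0"
  shows "pt v = center P \<longleftrightarrow> cmatrix P *v v = 0"
proof -
  obtain p where p: "p \<noteq> 0" "center P = pt p" "\<And>v. cmatrix P *v v = 0 \<longleftrightarrow> (\<exists>c. v = c *s p)"
    by (rule center_eq_pt[OF assms(1)]) (rule that)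
  show ?thesis unfolding p(2,3) using pt_eq_iff[OF p(1) assms(2)] assms(2) by (metis vec.scale_zero_left)
qed

lemma pt_in_quadric_iff:
  assumes "v \<noteq> 0"
  shows "pt v \<in> quadric P1 P2 Q1 Q2 \<longleftrightarrow> fundamental_form Q1 Q2 (cmatrix P1 *v v) (cmatrix P2 *v v) = 0"
  unfolding quadric_def zeros_def line_of_pt[OF assms] mem_Collect_eq
  by (auto simp: span1_iff vec.scale fundamental_form_bilinear intro: vec.span_base dest!: bspec[of _ _ v])

text \<open>Proportional views already place both points on the quadrics: each vector, with its two
  scalars, is a witness that the fundamental form of its own pair vanishes on the views of the other
  vector.\<close>

lemma conjugate_pt_iff:
  assumes cam: "is_camera P1" "is_camera P2" "is_camera Q1" "is_camera Q2" and v: "v \<noteq> 0" and w: "w \<noteq> 0"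
  shows "conjugate P1 P2 Q1 Q2 (pt v) (pt w) \<longleftrightarrow> cmatrix P1 *v v \<noteq> 0 \<and> cmatrix P2 *v v \<noteq> 0 \<and>
    (\<exists>l m. l \<noteq> 0 \<and> m \<noteq> 0 \<and> cmatrix Q1 *v w = l *s (cmatrix P1 *v v) \<and> cmatrix Q2 *v w = m *s (cmatrix P2 *v v))"
    (is "?l \<longleftrightarrow> ?r")
proof
  assume ?l
  then have *: "cmatrix P1 *v v \<noteq> 0" "cmatrix P2 *v v \<noteq> 0" "cmatrix Q1 *v w \<noteq> 0" "cmatrix Q2 *v w \<noteq> 0"
    "picture P1 (pt v) = picture Q1 (pt w)" "picture P2 (pt v) = picture Q2 (pt w)"
    unfolding conjugate_def using pt_eq_center_iff cam v w by blast+
  then show ?r by (simp add: picture_pt pt_eq_iff) blast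
next
  assume r: ?r
  then obtain l m where lm: "l \<noteq> 0" "m \<noteq> 0" "cmatrix Q1 *v w = l *s (cmatrix P1 *v v)" "cmatrix Q2 *v w = m *s (cmatrix P2 *v v)"
    by blast
  have 1: "cmatrix Q1 *v w \<noteq> 0" "cmatrix Q2 *v w \<noteq> 0" using r lm by simp_all
  have "picture P1 (pt v) = picture Q1 (pt w)" "picture P2 (pt v) = picture Q2 (pt w)"
    using r lm 1 by (simp_all add: picture_pt pt_scale)
  moreover have "fundamental_form Q1 Q2 (cmatrix P1 *v v) (cmatrix P2 *v v) = 0"
    unfolding fundamental_form_eq_0_iff using lm w by blast
  moreover have "fundamental_form P1 P2 (cmatrix Q1 *v w) (cmatrix Q2 *v w) = 0"
    unfolding fundamental_form_eq_0_iff using lm v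
    by (intro exI[of _ v] exI[of _ "1 / l"] exI[of _ "1 / m"]) simp
  ultimately show ?l
    unfolding conjugate_def using r 1 pt_eq_center_iff cam v w pt_in_quadric_iff by blast
qed

text \<open>In suitable linear forms, scaled by \<open>a\<close> and \<open>b\<close>, the joint images of the two pairs of cameras are
  \<open>\<alpha>1 X = \<alpha>2 Y, \<omega>1 X = \<omega>2 Y\<close> and \<open>\<beta>1 X = \<beta>2 Y, \<omega>1 X = \<omega>2 Y\<close>. The quadric of the first pair is then the union of
  the plane \<open>\<omega>1 X = 0\<close>, which contains the epipolar lines, and the plane \<open>\<beta>1 X = \<beta>2 Y\<close>.
  The last assumption says that the center of the second camera is not on both planes.\<close>

locale two_views =
  fixes P1 P2 Q1 Q2 :: camera and a b :: complex
    and \<alpha>1 \<beta>1 \<omega>1 \<alpha>2 \<beta>2 \<omega>2 :: "complex ^ 3 \<Rightarrow> complex"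
  assumes cameras: "is_camera P1" "is_camera P2" "is_camera Q1" "is_camera Q2"
    and centers: "center P1 \<noteq> center P2" "center Q1 \<noteq> center Q2"
    and scalars: "a \<noteq> 0" "b \<noteq> 0"
    and forms: "form 1 \<alpha>1" "form 1 \<beta>1" "form 1 \<omega>1" "form 1 \<alpha>2" "form 1 \<beta>2" "form 1 \<omega>2"
    and A_rel: "\<alpha>1 (cmatrix P1 *v x) = \<alpha>2 (a *s (cmatrix P2 *v x))"
      "\<omega>1 (cmatrix P1 *v x) = \<omega>2 (a *s (cmatrix P2 *v x))"
    and B_rel: "\<beta>1 (cmatrix Q1 *v x) = \<beta>2 (b *s (cmatrix Q2 *v x))"
      "\<omega>1 (cmatrix Q1 *v x) = \<omega>2 (b *s (cmatrix Q2 *v x))"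
    and ind\<alpha>: "\<exists>X. \<alpha>1 X = 1 \<and> \<omega>1 X = 0" "\<exists>X. \<alpha>1 X = 0 \<and> \<omega>1 X = 1"
      "\<exists>X. \<alpha>2 X = 1 \<and> \<omega>2 X = 0" "\<exists>X. \<alpha>2 X = 0 \<and> \<omega>2 X = 1"
    and ind\<beta>: "\<exists>X. \<beta>1 X = 1 \<and> \<omega>1 X = 0" "\<exists>X. \<beta>1 X = 0 \<and> \<omega>1 X = 1"
      "\<exists>X. \<beta>2 X = 1 \<and> \<omega>2 X = 0" "\<exists>X. \<beta>2 X = 0 \<and> \<omega>2 X = 1"
    and quadric_P: "fundamental_form Q1 Q2 (cmatrix P1 *v x) (cmatrix P2 *v x) = 0 \<longleftrightarrow>
      \<omega>1 (cmatrix P1 *v x) = 0 \<or> \<beta>1 (cmatrix P1 *v x) = \<beta>2 (a *s (cmatrix P2 *v x))"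
    and quadric_Q: "fundamental_form P1 P2 (cmatrix Q1 *v x) (cmatrix Q2 *v x) = 0 \<longleftrightarrow>
      \<omega>1 (cmatrix Q1 *v x) = 0 \<or> \<alpha>1 (cmatrix Q1 *v x) = \<alpha>2 (b *s (cmatrix Q2 *v x))"
    and regular1: "\<alpha>1 X = 0 \<Longrightarrow> \<beta>1 X = 0 \<Longrightarrow> \<omega>1 X = 0 \<Longrightarrow> X = 0"
begin

text \<open>Exchanging the pairs exchanges \<alpha> with \<beta> and \<open>a\<close> with
  \<open>b\<close> and fixes \<omega>. Every statement about the space of \<open>P\<close> thereby
  yields one for \<open>Q\<close>, including which centers lie on both planes.\<close>

lemma symmetric: "two_views Q1 Q2 P1 P2 b a \<beta>1 \<alpha>1 \<omega>1 \<beta>2 \<alpha>2 \<omega>2"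
proof qed (use cameras centers scalars forms A_rel B_rel ind\<alpha> ind\<beta> quadric_P quadric_Q regular1 in simp_all)

lemmas linear_forms =
  form_1_linear[OF forms(1)] form_1_linear[OF forms(2)] form_1_linear[OF forms(3)]
  form_1_linear[OF forms(4)] form_1_linear[OF forms(5)] form_1_linear[OF forms(6)]

lemma forms_0: "\<alpha>1 0 = 0" "\<beta>1 0 = 0" "\<omega>1 0 = 0" "\<alpha>2 0 = 0" "\<beta>2 0 = 0" "\<omega>2 0 = 0"
  using forms form_zero_at_0[of 1] by simp_all

abbreviation "A1 x \<equiv> cmatrix P1 *v x"
abbreviation "A2 x \<equiv> a *s (cmatrix P2 *v x)"
abbreviation "B1 x \<equiv> cmatrix Q1 *v x"
abbreviation "B2 x \<equiv> b *s (cmatrix Q2 *v x)"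

lemmas A_simps = matrix_vector_right_distrib vec.scale vec.scale_right_distrib vec.scale_left_commute

lemma A_forms: "form 1 (\<lambda>x. \<alpha>1 (A1 x))" "form 1 (\<lambda>x. \<beta>1 (A1 x))" "form 1 (\<lambda>x. \<omega>1 (A1 x))"
  "form 1 (\<lambda>x. \<alpha>2 (A2 x))" "form 1 (\<lambda>x. \<beta>2 (A2 x))" "form 1 (\<lambda>x. \<omega>2 (A2 x))"
proof -
  have "form 1 (\<lambda>x. (A2 x) $ i)" for i using form_scale[OF form_matrix, of a] by simp
  then show "form 1 (\<lambda>x. \<alpha>1 (A1 x))" "form 1 (\<lambda>x. \<beta>1 (A1 x))" "form 1 (\<lambda>x. \<omega>1 (A1 x))"
    "form 1 (\<lambda>x. \<alpha>2 (A2 x))" "form 1 (\<lambda>x. \<beta>2 (A2 x))" "form 1 (\<lambda>x. \<omega>2 (A2 x))"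
    using forms form_subst[of 1 _ 1 A1, OF _ form_matrix] form_subst[of 1 _ 1 A2] by simp_all
qed

lemma center_vectors:
  obtains p1 p2 where "p1 \<noteq> 0" "p2 \<noteq> 0" "center P1 = pt p1" "center P2 = pt p2"
    "\<And>v. A1 v = 0 \<longleftrightarrow> (\<exists>c. v = c *s p1)" "\<And>v. A2 v = 0 \<longleftrightarrow> (\<exists>c. v = c *s p2)"
    "A1 p1 = 0" "A2 p2 = 0" "A1 p2 \<noteq> 0" "A2 p1 \<noteq> 0"
proof -
  obtain p1 where p1: "p1 \<noteq> 0" "center P1 = pt p1" "\<And>v. A1 v = 0 \<longleftrightarrow> (\<exists>c. v = c *s p1)"
    by (rule center_eq_pt[OF cameras(1)]) (rule that)
  obtain p2 where p2: "p2 \<noteq> 0" "center P2 = pt p2" "\<And>v. cmatrix P2 *v v = 0 \<longleftrightarrow> (\<exists>c. v = c *s p2)"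
    by (rule center_eq_pt[OF cameras(2)]) (rule that)
  have z: "A2 v = 0 \<longleftrightarrow> cmatrix P2 *v v = 0" for v using scalars by simp
  have 1: "A1 p1 = 0" "A2 p2 = 0" unfolding z p1(3) p2(3) by (metis vec.scale_one)+
  have "pt p2 = center P1 \<longleftrightarrow> A1 p2 = 0" "pt p1 = center P2 \<longleftrightarrow> cmatrix P2 *v p1 = 0"
    using pt_eq_center_iff cameras p1 p2 by blast+
  then have "A1 p2 \<noteq> 0" "A2 p1 \<noteq> 0" unfolding z using centers p1(2) p2(2) by auto
  then show thesis using that[OF p1(1) p2(1) p1(2) p2(2) p1(3) p2(3)[folded z]] 1 by blast
qed

lemma A_injective: "A1 x = 0 \<Longrightarrow> A2 x = 0 \<Longrightarrow> x = 0"
proof -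
  assume "A1 x = 0" "A2 x = 0"
  obtain p1 p2 where p: "\<And>v. A1 v = 0 \<longleftrightarrow> (\<exists>c. v = c *s p1)" "A2 p1 \<noteq> 0"
    by (rule center_vectors) (rule that)
  then obtain c where c: "x = c *s p1" using \<open>A1 x = 0\<close> by blast
  then have "c *s A2 p1 = 0" using \<open>A2 x = 0\<close> by (simp add: A_simps scalars)
  then have "c = 0" using p(2) by (simp only: vec.scale_eq_0_iff) blast
  then show ?thesis using c by simp
qed

lemma A_eqI:
  assumes "A1 x = A1 y" "A2 x = A2 y"
  shows "x = y"
proof -
  have "A1 (x - y) = 0" "A2 (x - y) = 0"
    using assms by (simp_all add: matrix_vector_mult_diff_distrib vec.scale_right_diff_distrib)
  then show ?thesis using A_injective by force
qed

text \<open>A preimage of \<open>X\<close> under the first camera may be changed by multiples of the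
  first center, and the second view of that center spans the common kernel of \<alpha>2 and
  \<omega>2. So the two relations describe the joint image completely.\<close>

lemma A_onto:
  assumes "\<alpha>1 X = \<alpha>2 Y" "\<omega>1 X = \<omega>2 Y"
  obtains x where "A1 x = X" "A2 x = Y"
proof -
  obtain p1 p2 where p: "A1 p1 = 0" "A2 p1 \<noteq> 0" by (rule center_vectors) (rule that)
  obtain x where x: "A1 x = X" using cmatrix_onto cameras(1) by blast
  have Y: "Y = (Y - A2 x) + A2 x" by simp
  have "\<alpha>2 Y = \<alpha>2 (Y - A2 x) + \<alpha>2 (A2 x)" "\<omega>2 Y = \<omega>2 (Y - A2 x) + \<omega>2 (A2 x)"
    by (subst Y, simp only: linear_forms)+
  then have "\<alpha>2 (Y - A2 x) = 0" "\<omega>2 (Y - A2 x) = 0" using assms x A_rel[of x] by simp_all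
  moreover have "\<alpha>2 (A2 p1) = 0" "\<omega>2 (A2 p1) = 0" using A_rel[of p1] p(1) forms_0 by simp_all
  ultimately obtain c where "Y - A2 x = c *s A2 p1"
    using functional_pair_kernel[OF forms(4,6) ind\<alpha>(3,4) p(2)] by metis
  then have "A2 (x + c *s p1) = Y" by (simp add: A_simps algebra_simps)
  moreover have "A1 (x + c *s p1) = X" using x p(1) by (simp add: A_simps)
  ultimately show thesis using that by blast
qed

section \<open>The two planes of the quadric\<close>

definition plane :: "(complex ^ 4) set" where "plane = {x. \<omega>1 (A1 x) = 0}"
definition plane' :: "(complex ^ 4) set" where "plane' = {x. \<beta>1 (A1 x) = \<beta>2 (A2 x)}"

lemma is_plane_plane: "is_plane plane"
proof -
  obtain X where X: "\<omega>1 X = 1" using ind\<alpha>(2) by blast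
  obtain x where "A1 x = X" using cmatrix_onto cameras(1) by blast
  then have "\<omega>1 (A1 x) \<noteq> 0" using X by simp
  then show ?thesis unfolding plane_def by (rule functional_kernel_plane[OF A_forms(3)])
qed

lemma center_in_plane: "center P1 \<in> points plane" "center P2 \<in> points plane"
proof -
  obtain p1 p2 where p: "p1 \<noteq> 0" "p2 \<noteq> 0" "center P1 = pt p1" "center P2 = pt p2" "A1 p1 = 0" "A2 p2 = 0"
    by (rule center_vectors) (rule that)
  have "vec.subspace plane" using is_plane_plane is_plane_def by blast
  moreover have "\<omega>1 (A1 p1) = 0" "\<omega>1 (A1 p2) = 0" using p(5,6) A_rel(2)[of p2] by (simp_all only: forms_0)
  ultimately show "center P1 \<in> points plane" "center P2 \<in> points plane"
    using p(1-4) by (simp_all add: pt_in_points plane_def)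
qed

lemma second_center: "\<exists>p. p \<noteq> 0 \<and> center P2 = pt p \<and> \<beta>1 (A1 p) \<noteq> \<beta>2 (A2 p)"
proof -
  obtain p1 p2 where p: "p2 \<noteq> 0" "center P2 = pt p2" "A2 p2 = 0" "A1 p2 \<noteq> 0"
    by (rule center_vectors) (rule that)
  have "\<alpha>1 (A1 p2) = 0" "\<omega>1 (A1 p2) = 0" using A_rel[of p2] p(3) forms_0 by simp_all
  then have "\<beta>1 (A1 p2) \<noteq> 0" using regular1 p(4) by blast
  moreover have "\<beta>2 (A2 p2) = 0" unfolding p(3) by (rule forms_0)
  ultimately have "\<beta>1 (A1 p2) \<noteq> \<beta>2 (A2 p2)" by simp
  then show ?thesis using p by blast
qed

lemma is_plane_plane': "is_plane plane'"
proof -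
  obtain p where "\<beta>1 (A1 p) \<noteq> \<beta>2 (A2 p)" using second_center by blast
  then have "\<beta>1 (A1 p) - \<beta>2 (A2 p) \<noteq> 0" by simp
  from functional_kernel_plane[OF form_diff[OF A_forms(2,5)] this]
  show ?thesis unfolding plane'_def by simp
qed

lemma center_notin_plane': "center P2 \<notin> points plane'"
proof -
  have "vec.subspace plane'" using is_plane_plane' is_plane_def by blast
  then show ?thesis using second_center by (auto simp: pt_in_points plane'_def)
qed

lemma planes_neq: "plane \<noteq> plane'"
  using center_in_plane(2) center_notin_plane' by metis

lemma quadric_eq: "quadric P1 P2 Q1 Q2 = points plane \<union> points plane'"
proof (rule set_eqI)
  fix x :: "4 projective"
  obtain v where v: "v \<noteq> 0" "x = pt v" by (rule pt_exhaust)
  have "vec.subspace plane" "vec.subspace plane'" using is_plane_plane is_plane_plane' is_plane_def by blast+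
  then show "x \<in> quadric P1 P2 Q1 Q2 \<longleftrightarrow> x \<in> points plane \<union> points plane'"
    unfolding v(2) using v(1) quadric_P[of v]
    by (simp add: pt_in_quadric_iff pt_in_points plane_def plane'_def)
qed

section \<open>Epipoles, epipolar lines and the line of the centers as zero sets of
  functionals\<close>

lemma epipole:
  obtains e1 e2 where "e1 \<noteq> 0" "e2 \<noteq> 0" "picture Q1 (center Q2) = pt e1" "picture Q2 (center Q1) = pt e2"
    "\<beta>1 e1 = 0" "\<omega>1 e1 = 0" "\<beta>2 e2 = 0" "\<omega>2 e2 = 0"
proof -
  obtain q1 q2 where q: "center Q1 = pt q1" "center Q2 = pt q2" "B1 q1 = 0" "B2 q2 = 0" "B1 q2 \<noteq> 0" "B2 q1 \<noteq> 0"
    by (rule two_views.center_vectors[OF symmetric]) (rule that)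
  have 1: "cmatrix Q2 *v q1 \<noteq> 0" using q(6) by auto
  have "picture Q2 (center Q1) = pt (B2 q1)" unfolding q(1) picture_pt[OF 1] using pt_scale[OF scalars(2) 1] by simp
  moreover have "picture Q1 (center Q2) = pt (B1 q2)" unfolding q(2) picture_pt[OF q(5)] ..
  \<comment> \<open>The relations \<open>B_rel\<close> equate values of functionals on the two
    views, and each center is invisible to one of the two cameras.\<close>
  moreover have "\<beta>1 (B1 q2) = 0" "\<omega>1 (B1 q2) = 0" "\<beta>2 (B2 q1) = 0" "\<omega>2 (B2 q1) = 0"
    using B_rel[of q2] B_rel[of q1] q forms_0 by simp_all
  ultimately show thesis using that q by blast
qed

lemma on_epipolar_line1:
  assumes "(\<lambda>v. A1 v) ` line_of (pt x) \<subseteq> line_of (picture Q1 (center Q2))" "x \<noteq> 0"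
  shows "\<beta>1 (A1 x) = 0" "\<omega>1 (A1 x) = 0"
proof -
  obtain e1 e2 where e: "e1 \<noteq> 0" "picture Q1 (center Q2) = pt e1" "\<beta>1 e1 = 0" "\<omega>1 e1 = 0"
    by (rule epipole) (rule that)
  have "A1 x \<in> vec.span {e1}"
    using assms e vec.span_base[of x "{x}"] by (auto simp: line_of_pt)
  then obtain c where "A1 x = c *s e1" using span1_iff by blast
  then show "\<beta>1 (A1 x) = 0" "\<omega>1 (A1 x) = 0" using e by (simp_all add: linear_forms)
qed

lemma on_epipolar_line2:
  assumes "(\<lambda>v. cmatrix P2 *v v) ` line_of (pt x) \<subseteq> line_of (picture Q2 (center Q1))" "x \<noteq> 0"
  shows "\<beta>2 (A2 x) = 0" "\<omega>2 (A2 x) = 0"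
proof -
  obtain e1 e2 where e: "e2 \<noteq> 0" "picture Q2 (center Q1) = pt e2" "\<beta>2 e2 = 0" "\<omega>2 e2 = 0"
    by (rule epipole) (rule that)
  have "cmatrix P2 *v x \<in> vec.span {e2}"
    using assms e vec.span_base[of x "{x}"] by (auto simp: line_of_pt)
  then obtain c where "cmatrix P2 *v x = c *s e2" using span1_iff by blast
  then show "\<beta>2 (A2 x) = 0" "\<omega>2 (A2 x) = 0" using e by (simp_all add: linear_forms)
qed

lemma epipolar_line1_equations:
  "x \<noteq> 0 \<Longrightarrow> pt x \<in> epipolar_line1 P1 P2 Q1 Q2 \<Longrightarrow> \<beta>1 (A1 x) = 0 \<and> \<omega>1 (A1 x) = 0"
  unfolding epipolar_line1_def blowup_def using on_epipolar_line1 by blast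

lemma epipolar_line2_equations:
  "x \<noteq> 0 \<Longrightarrow> pt x \<in> epipolar_line2 P1 P2 Q1 Q2 \<Longrightarrow> \<beta>2 (A2 x) = 0 \<and> \<omega>2 (A2 x) = 0"
  unfolding epipolar_line2_def blowup_def using on_epipolar_line2 by blast

lemma epipolar_lines_in_plane:
  "epipolar_line1 P1 P2 Q1 Q2 \<subseteq> points plane" "epipolar_line2 P1 P2 Q1 Q2 \<subseteq> points plane"
proof -
  have sub: "vec.subspace plane" using is_plane_plane is_plane_def by blast
  show "epipolar_line1 P1 P2 Q1 Q2 \<subseteq> points plane"
  proof
    fix y assume y: "y \<in> epipolar_line1 P1 P2 Q1 Q2"
    obtain x where x: "x \<noteq> 0" "y = pt x" by (rule pt_exhaust)
    then show "y \<in> points plane"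
      using epipolar_line1_equations y pt_in_points[OF sub] by (simp add: plane_def)
  qed
  show "epipolar_line2 P1 P2 Q1 Q2 \<subseteq> points plane"
  proof
    fix y assume y: "y \<in> epipolar_line2 P1 P2 Q1 Q2"
    obtain x where x: "x \<noteq> 0" "y = pt x" by (rule pt_exhaust)
    then show "y \<in> points plane"
      using epipolar_line2_equations y pt_in_points[OF sub] A_rel(2)[of x] by (simp add: plane_def)
  qed
qed

lemma line_through_equations:
  assumes "x \<noteq> 0" "pt x \<in> line_through (center P1) (center P2)"
  shows "\<alpha>1 (A1 x) = 0 \<and> \<omega>1 (A1 x) = 0"
proof -
  obtain p1 p2 where p: "p1 \<noteq> 0" "p2 \<noteq> 0" "center P1 = pt p1" "center P2 = pt p2" "A1 p1 = 0" "A2 p2 = 0"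
    by (rule center_vectors) (rule that)
  have sub: "vec.subspace {x. \<alpha>1 (A1 x) = 0 \<and> \<omega>1 (A1 x) = 0}"
    unfolding vec.subspace_def using forms_0 by (simp add: A_simps linear_forms)
  have "\<alpha>1 (A1 p2) = 0 \<and> \<omega>1 (A1 p2) = 0" using A_rel[of p2] p(6) forms_0 by simp
  then have "vec.span {p1} \<union> vec.span {p2} \<subseteq> {x. \<alpha>1 (A1 x) = 0 \<and> \<omega>1 (A1 x) = 0}"
    using p(5) forms_0 by (auto simp: span1_iff A_simps linear_forms)
  then have "vec.span (vec.span {p1} \<union> vec.span {p2}) \<subseteq> {x. \<alpha>1 (A1 x) = 0 \<and> \<omega>1 (A1 x) = 0}"
    by (rule vec.span_minimal[OF _ sub])
  moreover have "x \<in> vec.span (vec.span {p1} \<union> vec.span {p2})"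
    using assms unfolding line_through_def p(3,4) line_of_pt[OF p(1)] line_of_pt[OF p(2)]
    using pt_in_points[OF vec.subspace_span] by blast
  ultimately show ?thesis by blast
qed

lemma line_of_epipole1: "{v. A1 v \<in> line_of (picture Q1 (center Q2))} = {v. \<beta>1 (A1 v) = 0 \<and> \<omega>1 (A1 v) = 0}"
proof -
  obtain e1 e2 where e: "e1 \<noteq> 0" "picture Q1 (center Q2) = pt e1" "\<beta>1 e1 = 0" "\<omega>1 e1 = 0"
    by (rule epipole) (rule that)
  have "X \<in> vec.span {e1} \<longleftrightarrow> \<beta>1 X = 0 \<and> \<omega>1 X = 0" for X
    using functional_pair_kernel[OF forms(2,3) ind\<beta>(1,2) e(1,3,4), of X] e(3,4)
    by (auto simp: span1_iff linear_forms)
  then show ?thesis using e by (simp add: line_of_pt)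
qed

lemma line_of_epipole2: "X \<in> line_of (picture Q2 (center Q1)) \<longleftrightarrow> \<beta>2 X = 0 \<and> \<omega>2 X = 0"
proof -
  obtain e1 e2 where e: "e2 \<noteq> 0" "picture Q2 (center Q1) = pt e2" "\<beta>2 e2 = 0" "\<omega>2 e2 = 0"
    by (rule epipole) (rule that)
  show ?thesis
    using functional_pair_kernel[OF forms(5,6) ind\<beta>(3,4) e(1,3,4), of X] e
    by (auto simp: line_of_pt span1_iff linear_forms)
qed

lemma epipolar_intersection:
  assumes "x \<noteq> 0" "(pt x, u, w) \<in> blowup P1 P2" "u = picture Q1 (center Q2)" "w = picture Q2 (center Q1)"
  shows "\<beta>1 (A1 x) = 0" "\<omega>1 (A1 x) = 0" "\<beta>2 (A2 x) = 0"
  using assms on_epipolar_line1[of x] on_epipolar_line2[of x] unfolding blowup_def by auto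

lemma epipolar_intersection_in_blowup:
  assumes "x \<noteq> 0" "\<beta>1 (A1 x) = 0" "\<omega>1 (A1 x) = 0" "\<beta>2 (A2 x) = 0"
  shows "(pt x, picture Q1 (center Q2), picture Q2 (center Q1)) \<in> blowup P1 P2"
proof -
  have "\<beta>1 (A1 (c *s x)) = 0 \<and> \<omega>1 (A1 (c *s x)) = 0" for c
    using assms by (simp add: A_simps linear_forms)
  then have "A1 (c *s x) \<in> line_of (picture Q1 (center Q2))" for c using line_of_epipole1 by blast
  moreover have "\<omega>2 (A2 x) = 0" using assms A_rel(2)[of x] by simp
  then have "\<beta>2 (cmatrix P2 *v (c *s x)) = 0 \<and> \<omega>2 (cmatrix P2 *v (c *s x)) = 0" for c
    using assms(4) scalars by (simp add: A_simps linear_forms)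
  then have "cmatrix P2 *v (c *s x) \<in> line_of (picture Q2 (center Q1))" for c using line_of_epipole2 by blast
  ultimately show ?thesis unfolding blowup_def by (auto simp: line_of_pt[OF assms(1)] span1_iff)
qed

section \<open>Conjugate points and the graph of the birational map\<close>

lemma conjugate_iff:
  assumes "v \<noteq> 0" "w \<noteq> 0"
  shows "conjugate P1 P2 Q1 Q2 (pt v) (pt w) \<longleftrightarrow> A1 v \<noteq> 0 \<and> A2 v \<noteq> 0 \<and>
    (\<exists>l m. l \<noteq> 0 \<and> m \<noteq> 0 \<and> B1 w = l *s A1 v \<and> B2 w = m *s A2 v)"
proof -
  have "(\<exists>m. m \<noteq> 0 \<and> cmatrix Q2 *v w = m *s (cmatrix P2 *v v)) \<longleftrightarrow> (\<exists>m. m \<noteq> 0 \<and> B2 w = m *s A2 v)"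
  proof (intro iffI; elim exE conjE)
    fix m assume "m \<noteq> 0" "cmatrix Q2 *v w = m *s (cmatrix P2 *v v)"
    then show "\<exists>m. m \<noteq> 0 \<and> B2 w = m *s A2 v"
      using scalars by (intro exI[of _ "b * m / a"]) simp
  next
    fix m assume m: "m \<noteq> 0" "B2 w = m *s A2 v"
    have "cmatrix Q2 *v w = (1 / b) *s B2 w" using scalars by simp
    then show "\<exists>m. m \<noteq> 0 \<and> cmatrix Q2 *v w = m *s (cmatrix P2 *v v)"
      unfolding m(2) using scalars m(1) by (intro exI[of _ "m * a / b"]) simp
  qed
  then show ?thesis
    unfolding conjugate_pt_iff[OF cameras assms] using scalars by auto
qed

lemma B_eqI: "B1 x = B1 y \<Longrightarrow> B2 x = B2 y \<Longrightarrow> x = y"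
  by (rule two_views.A_eqI[OF symmetric])

lemma B_onto:
  assumes "\<beta>1 X = \<beta>2 Y" "\<omega>1 X = \<omega>2 Y"
  obtains x where "B1 x = X" "B2 x = Y"
  by (rule two_views.A_onto[OF symmetric assms])

text \<open>These conditions on the ratio l : m are what the joint image of \<open>Q\<close>
  imposes. If \<omega>1 is nonzero they force l = m and so \<beta>1 = \<beta>2; if \<omega>1 = 0
  they give l : m = \<beta>2 : \<beta>1 as long as the \<beta>-values are nonzero.\<close>

lemma conjugate_relations:
  assumes "B1 w = l *s A1 v" "B2 w = m *s A2 v"
  shows "l * \<beta>1 (A1 v) = m * \<beta>2 (A2 v)" "l * \<omega>1 (A1 v) = m * \<omega>1 (A1 v)"
  using B_rel[of w] A_rel(2)[of v] unfolding assms linear_forms by simp_all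

text \<open>A vector is determined by its two views, so the conjugate point is unique as soon as the
  ratio l : m is.\<close>

lemma psi_graphI:
  assumes v: "A1 v \<noteq> 0" "A2 v \<noteq> 0" and l: "l \<noteq> 0" "m \<noteq> 0" and w: "B1 w = l *s A1 v" "B2 w = m *s A2 v"
    and uniq: "\<And>l' m'. l' \<noteq> 0 \<Longrightarrow> m' \<noteq> 0 \<Longrightarrow> l' * \<beta>1 (A1 v) = m' * \<beta>2 (A2 v) \<Longrightarrow>
      l' * \<omega>1 (A1 v) = m' * \<omega>1 (A1 v) \<Longrightarrow> l' * m = m' * l"
  shows "w \<noteq> 0" "(pt v, pt w) \<in> psi_graph P1 P2 Q1 Q2"
proof -
  have v0: "v \<noteq> 0" using v by auto
  show w0: "w \<noteq> 0"
  proof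
    assume "w = 0"
    then have "l *s A1 v = 0" using w(1) by simp
    then show False using l v by simp
  qed
  have "y = pt w" if y: "conjugate P1 P2 Q1 Q2 (pt v) y" for y
  proof -
    obtain w' where w': "w' \<noteq> 0" "y = pt w'" by (rule pt_exhaust)
    then obtain l' m' where lm: "l' \<noteq> 0" "m' \<noteq> 0" "B1 w' = l' *s A1 v" "B2 w' = m' *s A2 v"
      using y conjugate_iff[OF v0 w'(1)] by blast
    then have "l' * m = m' * l" using uniq conjugate_relations by blast
    then have m': "m' = l' / l * m" using l by (simp add: field_simps)
    have "w' = (l' / l) *s w"
    proof (rule B_eqI)
      show "B1 w' = B1 ((l' / l) *s w)" using l w lm by (simp add: A_simps)
      have "B2 ((l' / l) *s w) = (l' / l) *s B2 w" by (simp add: A_simps)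
      then show "B2 w' = B2 ((l' / l) *s w)" unfolding w(2) lm(4) m' by simp
    qed
    then show ?thesis unfolding w'(2) using pt_scale[of "l' / l", OF _ w0] l lm(1) by simp
  qed
  moreover have "conjugate P1 P2 Q1 Q2 (pt v) (pt w)" using conjugate_iff[OF v0 w0] v l w by blast
  ultimately show "(pt v, pt w) \<in> psi_graph P1 P2 Q1 Q2" unfolding psi_graph_def by blast
qed

lemma psi_graph_plane:
  assumes "\<omega>1 (A1 v) = 0" "\<beta>1 (A1 v) \<noteq> 0" "\<beta>2 (A2 v) \<noteq> 0"
    and w: "B1 w = \<beta>2 (A2 v) *s A1 v" "B2 w = \<beta>1 (A1 v) *s A2 v"
  shows "w \<noteq> 0" "(pt v, pt w) \<in> psi_graph P1 P2 Q1 Q2"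
proof -
  have "A1 v \<noteq> 0" "A2 v \<noteq> 0" using assms forms_0 by auto
  from psi_graphI[OF this assms(3,2) w] show "w \<noteq> 0" "(pt v, pt w) \<in> psi_graph P1 P2 Q1 Q2" by blast+
qed

lemma psi_graph_plane':
  assumes "\<beta>1 (A1 v) = \<beta>2 (A2 v)" "\<omega>1 (A1 v) \<noteq> 0 \<or> \<beta>1 (A1 v) \<noteq> 0" and w: "B1 w = A1 v" "B2 w = A2 v"
  shows "w \<noteq> 0" "(pt v, pt w) \<in> psi_graph P1 P2 Q1 Q2"
proof -
  have 1: "A1 v \<noteq> 0" "A2 v \<noteq> 0" using assms A_rel(2)[of v] forms_0 by auto
  have w': "B1 w = 1 *s A1 v" "B2 w = 1 *s A2 v" using w by simp_all
  have uniq: "l * 1 = m * 1" if "l \<noteq> 0" "m \<noteq> 0" "l * \<beta>1 (A1 v) = m * \<beta>2 (A2 v)"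
    "l * \<omega>1 (A1 v) = m * \<omega>1 (A1 v)" for l m
    using that(3,4) assms(1,2) by auto
  show "w \<noteq> 0" "(pt v, pt w) \<in> psi_graph P1 P2 Q1 Q2"
    by (rule psi_graphI[OF 1 one_neq_zero one_neq_zero w' uniq]; assumption)+
qed

text \<open>If \<omega>1 and \<beta>1 both vanish at the first view, then \<omega>2 and \<beta>2
  vanish at the second, and the conditions on l : m are empty. The conjugate is then not unique,
  which excludes the intersection of the epipolar lines; the remaining possibilities are read off
  from the relations.\<close>

lemma psi_graph_cases:
  assumes v: "v \<noteq> 0" and y: "(pt v, y) \<in> psi_graph P1 P2 Q1 Q2"
  shows "\<omega>1 (A1 v) = 0 \<and> \<beta>1 (A1 v) \<noteq> 0 \<and> \<beta>2 (A2 v) \<noteq> 0 \<or> \<omega>1 (A1 v) \<noteq> 0 \<and> \<beta>1 (A1 v) = \<beta>2 (A2 v)"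
proof -
  obtain w where w: "w \<noteq> 0" "y = pt w" by (rule pt_exhaust)
  have conj: "conjugate P1 P2 Q1 Q2 (pt v) (pt w)" using y w(2) unfolding psi_graph_def by simp
  then obtain l m where lm: "l \<noteq> 0" "m \<noteq> 0" "B1 w = l *s A1 v" "B2 w = m *s A2 v" and A: "A1 v \<noteq> 0" "A2 v \<noteq> 0"
    using conjugate_iff[OF v w(1)] by blast
  note rel = conjugate_relations[OF lm(3,4)]
  have "\<not> (\<omega>1 (A1 v) = 0 \<and> \<beta>1 (A1 v) = 0)"
  proof
    assume 0: "\<omega>1 (A1 v) = 0 \<and> \<beta>1 (A1 v) = 0"
    then have 00: "\<omega>2 (A2 v) = 0" "\<beta>2 (A2 v) = 0" using A_rel(2)[of v] rel(1) lm by auto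
    have 1: "\<beta>1 (l *s A1 v) = \<beta>2 ((2 * m) *s A2 v)" "\<omega>1 (l *s A1 v) = \<omega>2 ((2 * m) *s A2 v)"
      using 0 00 by (simp_all only: linear_forms mult_zero_right)
    \<comment> \<open>Doubling \<open>m\<close> changes the ratio of the two scalars and so produces
      a second conjugate; any scalar other than 0 and 1 would serve.\<close>
    obtain w' where w': "B1 w' = l *s A1 v" "B2 w' = (2 * m) *s A2 v"
      by (rule B_onto[OF 1]) (rule that)
    have w'0: "w' \<noteq> 0"
    proof
      assume "w' = 0"
      then have "l *s A1 v = 0" using w'(1) by simp
      then show False using lm(1) A by simp
    qed
    have "conjugate P1 P2 Q1 Q2 (pt v) (pt w')"
    proof -
      have "\<exists>l m. l \<noteq> 0 \<and> m \<noteq> 0 \<and> B1 w' = l *s A1 v \<and> B2 w' = m *s A2 v"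
        using lm(1,2) w' by (intro exI[of _ l] exI[of _ "2 * m"]) simp
      then show ?thesis using conjugate_iff[OF v w'0] A by blast
    qed
    then have "pt w' = y" using y unfolding psi_graph_def by simp
    then have "pt w = pt w'" using w(2) by simp
    then obtain c where c: "w' = c *s w" using pt_eq_iff[OF w(1) w'0] by blast
    have "(c * l) *s A1 v = l *s A1 v" using w'(1) c lm(3) by (simp add: A_simps)
    then have "c * l = l" using A(1) by (simp only: vec.scale_cancel_right) simp
    then have c1: "c = 1" using lm(1) by simp
    have "m *s A2 v = (2 * m) *s A2 v" using w'(2) lm(4) c c1 by simp
    then show False using A(2) lm(2) by (simp only: vec.scale_cancel_right) simp
  qed
  then show ?thesis using rel lm(1,2) by auto
qed

end

subsection \<open>Curves in parametrized planes\<close>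

definition comb :: "complex ^ 4 \<Rightarrow> complex ^ 4 \<Rightarrow> complex ^ 4 \<Rightarrow> complex ^ 3 \<Rightarrow> complex ^ 4" where
  "comb b1 b2 b3 v = v $ 1 *s b1 + v $ 2 *s b2 + v $ 3 *s b3"

lemma comb_scale: "comb b1 b2 b3 (c *s v) = c *s comb b1 b2 b3 v"
  by (simp add: comb_def vec.scale_right_distrib)

lemma comb_0: "comb b1 b2 b3 0 = 0"
  by (simp add: comb_def)

lemma form_comb:
  assumes "form d F"
  shows "form d (\<lambda>v. F (comb b1 b2 b3 v))"
proof -
  have "form 1 (\<lambda>v. comb b1 b2 b3 v $ i)" for i
    unfolding comb_def vector_add_component vector_smult_component
    by (intro form_add) (simp_all only: mult.commute[of _ "_ $ i"] form_scale[OF form_coord])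
  from form_subst[OF assms this] show ?thesis by simp
qed

lemma mem_span_comb: "x \<in> vec.span {b1, b2, b3} \<longleftrightarrow> (\<exists>v. x = comb b1 b2 b3 v)"
proof
  assume "x \<in> vec.span {b1, b2, b3}"
  then obtain p q r where "x = p *s b1 + q *s b2 + r *s b3" unfolding span3_iff by blast
  then show "\<exists>v. x = comb b1 b2 b3 v"
    by (intro exI[of _ "vector [p, q, r]"]) (simp add: comb_def)
qed (auto simp: span3_iff comb_def)

lemma comb_inverse:
  assumes "vec.dim (vec.span {b1, b2, b3}) = 3"
  obtains N :: "complex ^ 4 ^ 3" where "\<And>v. N *v comb b1 b2 b3 v = v"
proof -
  define b :: "3 \<Rightarrow> complex ^ 4" where "b i = (if i = 1 then b1 else if i = 2 then b2 else b3)" for i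
  have b: "(\<Sum>j\<in>UNIV. x $ j *s b j) = comb b1 b2 b3 x" for x
    by (simp add: sum_3 b_def comb_def)
  have "x = 0" if "(\<Sum>j\<in>UNIV. x $ j *s b j) = 0" for x
    using that plane_basis_independent[OF assms, of "x $ 1" "x $ 2" "x $ 3"]
    unfolding b comb_def by (simp add: vec_eq_iff forall_3)
  then obtain N where "\<And>x. N *v (\<Sum>j\<in>UNIV. x $ j *s b j) = x"
    using column_matrix_left_inverse[of b] by blast
  then show thesis using that unfolding b by blast
qed

lemma comb_extend:
  assumes "vec.dim (vec.span {b1, b2, b3}) = 3" "form e G"
  obtains F where "form e F" "\<And>v. F (comb b1 b2 b3 v) = G v"
proof -
  obtain N :: "complex ^ 4 ^ 3" where N: "\<And>v. N *v comb b1 b2 b3 v = v"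
    by (rule comb_inverse[OF assms(1)]) (rule that)
  have "form (e * 1) (\<lambda>x. G (N *v x))" by (rule form_subst[OF assms(2) form_matrix])
  then show thesis using that[of "\<lambda>x. G (N *v x)"] N by simp
qed

text \<open>Factors on the plane are restrictions of ambient forms, and every form in three
  variables extends to the ambient space by composition with a left inverse of the
  parametrization.\<close>

lemma squarefree_on_comb:
  assumes "W = vec.span {b1, b2, b3}" "vec.dim W = 3"
  shows "squarefree_on W F \<longleftrightarrow> squarefree_form (\<lambda>v. F (comb b1 b2 b3 v))"
proof -
  have dim: "vec.dim (vec.span {b1, b2, b3}) = 3" using assms by simp
  have W: "(\<forall>x\<in>W. Q x) \<longleftrightarrow> (\<forall>v. Q (comb b1 b2 b3 v))" for Q
    unfolding assms(1) Ball_def mem_span_comb by blast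
  have "(\<exists>v\<in>W. F v \<noteq> 0) \<longleftrightarrow> (\<exists>v. F (comb b1 b2 b3 v) \<noteq> 0)" using W[of "\<lambda>x. F x = 0"] by blast
  moreover have "(\<exists>d e H K. d > 0 \<and> form d H \<and> form e K \<and> (\<forall>v\<in>W. F v = (H v)\<^sup>2 * K v)) \<longleftrightarrow>
    (\<exists>d e H K. d > 0 \<and> form d H \<and> form e K \<and> (\<forall>v. F (comb b1 b2 b3 v) = (H v)\<^sup>2 * K v))" (is "?l \<longleftrightarrow> ?r")
  proof
    assume ?l
    then obtain d e H K where "d > 0" "form d H" "form e K" "\<forall>v\<in>W. F v = (H v)\<^sup>2 * K v" by blast
    then show ?r unfolding W
      by (intro exI[of _ d] exI[of _ e] exI[of _ "\<lambda>v. H (comb b1 b2 b3 v)"] exI[of _ "\<lambda>v. K (comb b1 b2 b3 v)"])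
        (simp add: form_comb)
  next
    assume ?r
    then obtain d e H K where *: "d > 0" "form d H" "form e K" "\<forall>v. F (comb b1 b2 b3 v) = (H v)\<^sup>2 * K v" by blast
    obtain H' where H': "form d H'" "\<And>v. H' (comb b1 b2 b3 v) = H v"
      by (rule comb_extend[OF dim *(2)]) (rule that)
    obtain K' where K': "form e K'" "\<And>v. K' (comb b1 b2 b3 v) = K v"
      by (rule comb_extend[OF dim *(3)]) (rule that)
    show ?l unfolding W using * H' K'
      by (intro exI[of _ d] exI[of _ e] exI[of _ H'] exI[of _ K']) simp
  qed
  ultimately show ?thesis unfolding squarefree_on_def squarefree_form_def by (simp only:)
qed

lemma points_kernel: "points {x. L x = 0} = zeros L"
  unfolding points_def zeros_def by blast

lemma zeros_mult:
  assumes "form d F" "form e G"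
  shows "zeros (\<lambda>x. F x * G x) = zeros F \<union> zeros G"
proof (rule set_eqI)
  fix x :: "'a projective"
  obtain v where v: "v \<noteq> 0" "x = pt v" by (rule pt_exhaust)
  show "x \<in> zeros (\<lambda>x. F x * G x) \<longleftrightarrow> x \<in> zeros F \<union> zeros G"
    unfolding v(2) using v(1) pt_in_zeros[OF form_mult[OF assms]] pt_in_zeros[OF assms(1)] pt_in_zeros[OF assms(2)]
    by simp
qed

text \<open>By distributivity the right side is an intersection of four sets, each the zero set of a
  product of two forms.\<close>

lemma zariski_closure_subset_union:
  assumes F: "form d1 F1" "form d2 F2" "form d3 F3" "form d4 F4"
    and X: "X \<subseteq> zeros F1 \<inter> zeros F2 \<union> zeros F3 \<inter> zeros F4"
  shows "zariski_closure X \<subseteq> zeros F1 \<inter> zeros F2 \<union> zeros F3 \<inter> zeros F4"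
proof -
  have sub: "zariski_closure X \<subseteq> zeros F \<union> zeros G"
    if "form d F" "form e G" "X \<subseteq> zeros F \<union> zeros G" for d e F G
    using form_mult[OF that(1,2)] that(3) zeros_mult[OF that(1,2)] unfolding zariski_closure_def by blast
  show ?thesis
    using sub[OF F(1) F(3)] sub[OF F(1) F(4)] sub[OF F(2) F(3)] sub[OF F(2) F(4)] X by blast
qed

lemma pt_in_plane_curve:
  assumes "vec.subspace W" "plane_curve W F d A" "v \<noteq> 0"
  shows "pt v \<in> A \<longleftrightarrow> v \<in> W \<and> F v = 0"
  using assms pt_in_points pt_in_zeros unfolding plane_curve_def by blast

lemma psi_graph_unique:
  "(x, y) \<in> psi_graph P1 P2 Q1 Q2 \<Longrightarrow> (x, y') \<in> psi_graph P1 P2 Q1 Q2 \<Longrightarrow> y = y'"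
  unfolding psi_graph_def by simp

text \<open>The vector map \<open>g\<close> induces a map on points: a representative is chosen for
  each point of \<open>S\<close>, and homogeneity of \<open>g\<close> makes the choice immaterial.
  \<open>Y\<close> is then inside the image of a finite set.\<close>

lemma finite_points_transport:
  fixes Y :: "'n::finite projective set" and S :: "4 projective set"
  assumes "finite S"
    and "\<And>y. y \<in> Y \<Longrightarrow> \<exists>v. comb w1 w2 w3 v \<noteq> 0 \<and> pt (comb w1 w2 w3 v) \<in> S \<and> g v \<noteq> 0 \<and> y = pt (g v)"
    and N: "\<And>v. N *v comb w1 w2 w3 v = v" and g: "\<And>c v. g (c *s v) = c *s g v"
  shows "finite Y"
proof (rule finite_subset)
  let ?h = "\<lambda>x. pt (g (N *v (SOME u. u \<noteq> 0 \<and> pt u = x)))"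
  show "finite (?h ` S)" using assms(1) by blast
  show "Y \<subseteq> ?h ` S"
  proof
    fix y assume "y \<in> Y"
    then obtain v where v: "comb w1 w2 w3 v \<noteq> 0" "pt (comb w1 w2 w3 v) \<in> S" "g v \<noteq> 0" "y = pt (g v)"
      using assms(2) by blast
    let ?u = "SOME u. u \<noteq> 0 \<and> pt u = pt (comb w1 w2 w3 v)"
    have "?u \<noteq> 0 \<and> pt ?u = pt (comb w1 w2 w3 v)" 
      by (rule someI[of "\<lambda>u. u \<noteq> 0 \<and> pt u = pt (comb w1 w2 w3 v)" "comb w1 w2 w3 v"]) (simp add: v(1))
    then have u: "?u \<noteq> 0" "pt (comb w1 w2 w3 v) = pt ?u" by simp_all
    then obtain c where c: "c \<noteq> 0" "?u = c *s comb w1 w2 w3 v" using pt_eq_iff[OF v(1) u(1)] by blast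
    have "N *v ?u = c *s v" unfolding c(2) by (simp add: vec.scale N)
    then have "?h (pt (comb w1 w2 w3 v)) = y" using g pt_scale[OF c(1) v(3)] v(4) by simp
    then show "y \<in> ?h ` S" using v(2) by blast
  qed
qed

text \<open>Everything that the generic and the degenerate case share. The equations
  \<open>\<kappa>_B\<close> say that \<kappa> multiplies the first view by \<beta>2 and the second
  by \<beta>1, which is conjugacy on the plane \<omega>1 = 0. The contracted lines are \<beta>1 = 0
  and \<beta>2 = 0, the epipolar lines, and \<alpha>1 = 0, the line of the centers; \<open>E\<close>
  has only two elements when two of them coincide.\<close>

locale parametrized_views = two_views P1 P2 Q1 Q2 a b \<alpha>1 \<beta>1 \<omega>1 \<alpha>2 \<beta>2 \<omega>2 + quadratic_involution E \<kappa> \<mu>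
  for P1 P2 Q1 Q2 :: camera and a b :: complex
    and \<alpha>1 \<beta>1 \<omega>1 \<alpha>2 \<beta>2 \<omega>2 :: "complex ^ 3 \<Rightarrow> complex"
    and E :: "3 set" and \<kappa> :: "complex ^ 3 \<Rightarrow> complex ^ 3" and \<mu> :: "3 \<Rightarrow> nat" +
  fixes b1 b2 b3 b1' b2' b3' :: "complex ^ 4"
  assumes plane_span: "plane = vec.span {b1, b2, b3}"
    and planeQ_span: "{y. \<omega>1 (cmatrix Q1 *v y) = 0} = vec.span {b1', b2', b3'}"
    and \<kappa>_B: "cmatrix Q1 *v comb b1' b2' b3' (\<kappa> v) =
        \<beta>2 (a *s (cmatrix P2 *v comb b1 b2 b3 v)) *s (cmatrix P1 *v comb b1 b2 b3 v)"
      "b *s (cmatrix Q2 *v comb b1' b2' b3' (\<kappa> v)) =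
        \<beta>1 (cmatrix P1 *v comb b1 b2 b3 v) *s (a *s (cmatrix P2 *v comb b1 b2 b3 v))"
    and torus_iff: "(\<forall>i\<in>E. v $ i \<noteq> 0) \<longleftrightarrow> \<beta>1 (cmatrix P1 *v comb b1 b2 b3 v) \<noteq> 0 \<and>
      \<beta>2 (a *s (cmatrix P2 *v comb b1 b2 b3 v)) \<noteq> 0 \<and> \<alpha>1 (cmatrix P1 *v comb b1 b2 b3 v) \<noteq> 0"
    and exceptional_line: "i \<in> E \<Longrightarrow> (\<forall>v. \<beta>1 (cmatrix P1 *v comb b1 b2 b3 v) = 0 \<longrightarrow> v $ i = 0) \<or>
      (\<forall>v. \<beta>2 (a *s (cmatrix P2 *v comb b1 b2 b3 v)) = 0 \<longrightarrow> v $ i = 0) \<or>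
      (\<forall>v. \<alpha>1 (cmatrix P1 *v comb b1 b2 b3 v) = 0 \<longrightarrow> v $ i = 0)"
begin

abbreviation "planeQ \<equiv> {y. \<omega>1 (B1 y) = 0}"
abbreviation "planeQ' \<equiv> {y. \<alpha>1 (B1 y) = \<alpha>2 (B2 y)}"

lemma planeQ_eq: "two_views.plane Q1 \<omega>1 = planeQ" "two_views.plane' Q1 Q2 b \<alpha>1 \<alpha>2 = planeQ'"
  unfolding two_views.plane_def[OF symmetric] two_views.plane'_def[OF symmetric] by simp_all

lemma planes: "vec.subspace plane" "vec.dim plane = 3" "vec.subspace plane'" "vec.dim plane' = 3"
  "vec.subspace planeQ" "vec.dim planeQ = 3" "vec.subspace planeQ'" "vec.dim planeQ' = 3"
  using is_plane_plane is_plane_plane' two_views.is_plane_plane[OF symmetric]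
    two_views.is_plane_plane'[OF symmetric] unfolding is_plane_def planeQ_eq by blast+

lemma form_B: "form 1 (\<lambda>y. \<omega>1 (B1 y))" "form 1 (\<lambda>y. \<alpha>1 (B1 y) - \<alpha>2 (B2 y))"
  using two_views.A_forms[OF symmetric] form_diff by blast+

lemma points_planeQ: "points planeQ = zeros (\<lambda>y. \<omega>1 (B1 y))"
  "points planeQ' = zeros (\<lambda>y. \<alpha>1 (B1 y) - \<alpha>2 (B2 y))"
  using points_kernel[of "\<lambda>y. \<omega>1 (B1 y)"] points_kernel[of "\<lambda>y. \<alpha>1 (B1 y) - \<alpha>2 (B2 y)"] by simp_all

text \<open>On the second plane \<beta>1 = \<beta>2 holds in addition to \<omega>1 = \<omega>2, so
  the two views of a vector are also views of a vector in the space of \<open>Q\<close>. Using the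
  same parameters on both sides, conjugacy becomes the identity.\<close>

lemma plane'_basis:
  obtains w1 w2 w3 y1 y2 y3 where "plane' = vec.span {w1, w2, w3}" "planeQ' = vec.span {y1, y2, y3}"
    "\<And>v. B1 (comb y1 y2 y3 v) = A1 (comb w1 w2 w3 v)" "\<And>v. B2 (comb y1 y2 y3 v) = A2 (comb w1 w2 w3 v)"
proof -
  have "\<not> plane' \<subseteq> vec.span {}" using vec.dim_subset[of plane' "vec.span {}"] planes(4) by auto
  then obtain w1 where w1: "w1 \<in> plane'" "w1 \<noteq> 0" by auto
  have "\<not> plane' \<subseteq> vec.span {w1}"
    using vec.dim_subset[of plane' "vec.span {w1}"] dim_span_singleton[OF w1(2)] planes(4) by auto
  then obtain w2 where w2: "w2 \<in> plane'" "w2 \<notin> vec.span {w1}" by auto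
  obtain w3 where w3: "plane' = vec.span {w1, w2, w3}"
    by (rule plane_basis_extend[OF planes(3,4) w1(1) w2(1) w1(2) w2(2)]) (rule that)
  have w3': "w3 \<in> plane'" unfolding w3 by (rule vec.span_base) simp
  have ex: "\<exists>y. B1 y = A1 w \<and> B2 y = A2 w" if w: "w \<in> plane'" for w
  proof -
    have "\<beta>1 (A1 w) = \<beta>2 (A2 w)" "\<omega>1 (A1 w) = \<omega>2 (A2 w)" using w A_rel(2)[of w] by (simp_all add: plane'_def)
    then obtain y where "B1 y = A1 w" "B2 y = A2 w" by (rule B_onto)
    then show ?thesis by blast
  qed
  obtain y1 y2 y3 where y: "B1 y1 = A1 w1" "B2 y1 = A2 w1" "B1 y2 = A1 w2" "B2 y2 = A2 w2" "B1 y3 = A1 w3" "B2 y3 = A2 w3"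
    using ex[OF w1(1)] ex[OF w2(1)] ex[OF w3'] by blast
  have B: "B1 (comb y1 y2 y3 v) = A1 (comb w1 w2 w3 v)" "B2 (comb y1 y2 y3 v) = A2 (comb w1 w2 w3 v)" for v
    by (simp_all only: comb_def matrix_vector_right_distrib vec.scale vec.scale_right_distrib
        vec.scale_left_commute[of b] vec.scale_left_commute[of a] y)
  have ind: "v = 0" if "comb y1 y2 y3 v = 0" for v
  proof -
    have "A1 (comb w1 w2 w3 v) = 0" "A2 (comb w1 w2 w3 v) = 0" using B[of v] that by simp_all
    then have "comb w1 w2 w3 v = 0" by (rule A_injective)
    moreover have "vec.dim (vec.span {w1, w2, w3}) = 3" using planes(4) w3 by simp
    ultimately have "v $ 1 = 0 \<and> v $ 2 = 0 \<and> v $ 3 = 0"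
      unfolding comb_def by (intro plane_basis_independent[of w1 w2 w3])
    then show ?thesis by (simp add: vec_eq_iff forall_3)
  qed
  have in': "comb y1 y2 y3 v \<in> planeQ'" for v
    using B[of v] A_rel(1)[of "comb w1 w2 w3 v"] by simp
  have yQ: "y1 \<in> planeQ'" "y2 \<in> planeQ'" "y3 \<in> planeQ'"
    using in'[of "vector [1, 0, 0]"] in'[of "vector [0, 1, 0]"] in'[of "vector [0, 0, 1]"]
    by (simp_all add: comb_def)
  have "vec.dim (vec.span {y1, y2, y3}) = 3"
  proof (rule span3_independent)
    show "y1 \<noteq> 0" using ind[of "vector [1, 0, 0]"] by (auto simp: comb_def vec_eq_iff forall_3)
    show "y2 \<notin> vec.span {y1}"
    proof
      assume "y2 \<in> vec.span {y1}"
      then obtain p where "y2 = p *s y1" using span1_iff by blast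
      then show False using ind[of "vector [- p, 1, 0]"] by (auto simp: comb_def vec_eq_iff forall_3)
    qed
    show "y3 \<notin> vec.span {y1, y2}"
    proof
      assume "y3 \<in> vec.span {y1, y2}"
      then obtain p q where "y3 = p *s y1 + q *s y2" using span2_iff by blast
      then show False using ind[of "vector [- p, - q, 1]"] by (auto simp: comb_def vec_eq_iff forall_3)
    qed
  qed
  then have "planeQ' = vec.span {y1, y2, y3}"
    using span_eq_of_dim[OF planes(7), of "{y1, y2, y3}"] yQ planes(8) by simp
  from that[OF w3 this B] show thesis .
qed

text \<open>The set has at most one point: the second view lies in the one-dimensional common kernel
  of \<gamma>2 and \<omega>2, and after scaling the first views agree by \<open>reg\<close>. The
  letters \<gamma> and \<delta> stand for \<beta> and \<alpha> in either order.\<close>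

lemma intersection_point_unique:
  assumes \<gamma>: "form 1 \<gamma>1" "form 1 \<gamma>2" and ind1: "\<exists>X. \<gamma>1 X = 1 \<and> \<omega>1 X = 0" "\<exists>X. \<gamma>1 X = 0 \<and> \<omega>1 X = 1"
    and ind2: "\<exists>X. \<gamma>2 X = 1 \<and> \<omega>2 X = 0" "\<exists>X. \<gamma>2 X = 0 \<and> \<omega>2 X = 1"
    and \<delta>: "form 1 \<delta>1" "form 1 \<delta>2"
    and reg: "\<And>X. \<gamma>1 X = 0 \<Longrightarrow> \<delta>1 X = 0 \<Longrightarrow> \<omega>1 X = 0 \<Longrightarrow> X = 0"
  shows "finite {pt x | x. x \<noteq> 0 \<and> \<gamma>1 (A1 x) = 0 \<and> \<omega>1 (A1 x) = 0 \<and> \<gamma>2 (A2 x) = 0 \<and> \<delta>1 (A1 x) = \<delta>2 (A2 x)}"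
    (is "finite {pt x | x. ?Q x}")
proof -
  have "pt x = pt y" if x: "?Q x" and y: "?Q y" for x y
  proof -
    have nz: "A2 z \<noteq> 0" if z: "?Q z" for z
    proof
      assume 0: "A2 z = 0"
      have "\<delta>2 (A2 z) = 0" unfolding 0 using form_zero_at_0[OF \<delta>(2)] by simp
      then have "A1 z = 0" using reg z by auto
      then show False using A_injective 0 z by blast
    qed
    have "\<omega>2 (A2 x) = 0" "\<omega>2 (A2 y) = 0" using x y A_rel(2)[of x] A_rel(2)[of y] by auto
    then obtain c where c: "A2 y = c *s A2 x"
      using functional_pair_kernel[OF \<gamma>(2) forms(6) ind2 nz[OF x], of "A2 y"] x y by blast
    have c0: "c \<noteq> 0" using c nz[OF y] by (metis vec.scale_zero_left)
    have "A2 (c *s x) = A2 y" unfolding c by (simp add: A_simps)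
    moreover have "A1 y = A1 (c *s x)"
    proof -
      let ?d = "A1 y + (- c) *s A1 x"
      have "\<delta>1 (A1 y) = c * \<delta>1 (A1 x)" using x y c form_1_linear(2)[OF \<delta>(2)] by simp
      then have "\<gamma>1 ?d = 0" "\<delta>1 ?d = 0" "\<omega>1 ?d = 0"
        using x y by (simp_all only: form_1_linear[OF \<gamma>(1)] form_1_linear[OF \<delta>(1)] form_1_linear[OF forms(3)]) simp_all
      then have "?d = 0" by (rule reg)
      then show ?thesis by (simp add: A_simps)
    qed
    ultimately have "y = c *s x" using A_eqI by metis
    then show ?thesis using x c0 pt_scale by metis
  qed
  then have "\<exists>p. {pt x | x. ?Q x} \<subseteq> {p}"
    by (cases "\<exists>x. ?Q x") blast+
  then show ?thesis using finite_subset by blast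
qed

lemma pt_in_zeros_comb:
  "form k H \<Longrightarrow> comb c1 c2 c3 v \<noteq> 0 \<Longrightarrow> pt (comb c1 c2 c3 v) \<in> points (vec.span {c1, c2, c3}) \<inter> zeros H \<longleftrightarrow>
    H (comb c1 c2 c3 v) = 0"
  using pt_in_points[OF vec.subspace_span, of "comb c1 c2 c3 v"] mem_span_comb pt_in_zeros by blast

lemma psi_graph_comb:
  assumes "\<beta>1 (A1 (comb b1 b2 b3 v)) \<noteq> 0" "\<beta>2 (A2 (comb b1 b2 b3 v)) \<noteq> 0"
  shows "comb b1' b2' b3' (\<kappa> v) \<noteq> 0"
    "(pt (comb b1 b2 b3 v), pt (comb b1' b2' b3' (\<kappa> v))) \<in> psi_graph P1 P2 Q1 Q2"
proof -
  have "comb b1 b2 b3 v \<in> plane" unfolding plane_span mem_span_comb by blast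
  then have "\<omega>1 (A1 (comb b1 b2 b3 v)) = 0" by (simp add: plane_def)
  from psi_graph_plane[OF this assms \<kappa>_B] show "comb b1' b2' b3' (\<kappa> v) \<noteq> 0"
    "(pt (comb b1 b2 b3 v), pt (comb b1' b2' b3' (\<kappa> v))) \<in> psi_graph P1 P2 Q1 Q2" by blast+
qed

context
  fixes F F' :: "complex ^ 4 \<Rightarrow> complex" and d d' :: nat and A A' C :: "4 projective set"
  assumes A: "plane_curve plane F d A" and A': "plane_curve plane' F' d' A'" and C: "C = A \<union> A'"
begin

lemma curve_forms: "form d F" "form d' F'"
  using A A' unfolding plane_curve_def by blast+

lemma exceptional_lines_not_in_curve:
  assumes "\<not> epipolar_line1 P1 P2 Q1 Q2 \<subseteq> C" "\<not> epipolar_line2 P1 P2 Q1 Q2 \<subseteq> C"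
    "\<not> line_through (center P1) (center P2) \<subseteq> C"
  shows "vanishes_on_no_line E (\<lambda>v. F (comb b1 b2 b3 v))"
  unfolding vanishes_on_no_line_def
proof
  fix i assume i: "i \<in> E"
  have key: "\<exists>v. L (comb b1 b2 b3 v) = 0 \<and> F (comb b1 b2 b3 v) \<noteq> 0"
    if nl: "\<not> l \<subseteq> C" and l: "\<And>x. x \<noteq> 0 \<Longrightarrow> pt x \<in> l \<Longrightarrow> L x = 0 \<and> \<omega>1 (A1 x) = 0" for l and L :: "complex ^ 4 \<Rightarrow> complex"
  proof -
    obtain y where y: "y \<in> l" "y \<notin> C" using nl by blast
    obtain x where x: "x \<noteq> 0" "y = pt x" by (rule pt_exhaust)
    have Lx: "L x = 0" and xp: "x \<in> plane" using l x y(1) by (simp_all add: plane_def)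
    have "F x \<noteq> 0" using pt_in_plane_curve[OF planes(1) A x(1)] y(2) x(2) C xp by blast
    moreover obtain v where "x = comb b1 b2 b3 v" using xp unfolding plane_span mem_span_comb by blast
    ultimately show ?thesis using Lx by blast
  qed
  have 1: "\<exists>v. \<beta>1 (A1 (comb b1 b2 b3 v)) = 0 \<and> F (comb b1 b2 b3 v) \<noteq> 0"
    by (rule key[OF assms(1)]) (rule epipolar_line1_equations)
  have 2: "\<exists>v. \<beta>2 (A2 (comb b1 b2 b3 v)) = 0 \<and> F (comb b1 b2 b3 v) \<noteq> 0"
    by (rule key[OF assms(2)]) (use epipolar_line2_equations A_rel(2) in simp)
  have 3: "\<exists>v. \<alpha>1 (A1 (comb b1 b2 b3 v)) = 0 \<and> F (comb b1 b2 b3 v) \<noteq> 0"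
    by (rule key[OF assms(3)]) (rule line_through_equations)
  show "\<exists>v. v $ i = 0 \<and> F (comb b1 b2 b3 v) \<noteq> 0"
    using exceptional_line[OF i] 1 2 3 by blast
qed

context
  fixes n :: "3 \<Rightarrow> nat" and e :: nat and G :: "complex ^ 3 \<Rightarrow> complex" and FQ FQ' :: "complex ^ 4 \<Rightarrow> complex"
    and w1 w2 w3 y1 y2 y3 :: "complex ^ 4"
  assumes no_line: "vanishes_on_no_line E (\<lambda>v. F (comb b1 b2 b3 v))"
    and G: "form e G" "vanishes_on_no_line E G"
    and eq: "\<And>v. F (comb b1 b2 b3 (\<kappa> v)) = monomial_in E n v * G v"
    and FQ: "form e FQ" "\<And>v. FQ (comb b1' b2' b3' v) = G v"
    and w_span: "plane' = vec.span {w1, w2, w3}" and y_span: "planeQ' = vec.span {y1, y2, y3}"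
    and wy: "\<And>v. B1 (comb y1 y2 y3 v) = A1 (comb w1 w2 w3 v)" "\<And>v. B2 (comb y1 y2 y3 v) = A2 (comb w1 w2 w3 v)"
    and FQ': "form d' FQ'" "\<And>v. FQ' (comb y1 y2 y3 v) = F' (comb w1 w2 w3 v)"
begin

section \<open>The conjugate curve as the union of two plane curves\<close>

abbreviation "AQ \<equiv> points planeQ \<inter> zeros FQ"
abbreviation "AQ' \<equiv> points planeQ' \<inter> zeros FQ'"

lemma f_form: "form d (\<lambda>v. F (comb b1 b2 b3 v))"
  by (rule form_comb) (rule curve_forms)

lemma plane_curves_Q: "plane_curve planeQ FQ e AQ" "plane_curve planeQ' FQ' d' AQ'"
proof -
  have "squarefree_form (\<lambda>v. F (comb b1 b2 b3 v))"
    using A squarefree_on_comb[OF plane_span planes(2)] unfolding plane_curve_def by blast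
  then have "squarefree_form G" by (rule strict_transform_squarefree[OF f_form no_line G eq])
  then have "squarefree_on planeQ FQ" using squarefree_on_comb[OF planeQ_span planes(6)] FQ(2) by simp
  then show "plane_curve planeQ FQ e AQ" unfolding plane_curve_def using FQ(1) by blast
  have "squarefree_form (\<lambda>v. F' (comb w1 w2 w3 v))"
    using A' squarefree_on_comb[OF w_span planes(4)] unfolding plane_curve_def by blast
  then have "squarefree_on planeQ' FQ'" using squarefree_on_comb[OF y_span planes(8)] FQ'(2) by simp
  then show "plane_curve planeQ' FQ' d' AQ'" unfolding plane_curve_def using FQ'(1) by blast
qed

lemma pt_comb_in_A: "comb b1 b2 b3 v \<noteq> 0 \<Longrightarrow> pt (comb b1 b2 b3 v) \<in> A \<longleftrightarrow> F (comb b1 b2 b3 v) = 0"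
  using pt_in_zeros_comb[OF curve_forms(1)] A unfolding plane_curve_def plane_span by blast

lemma pt_comb_in_A': "comb w1 w2 w3 v \<noteq> 0 \<Longrightarrow> pt (comb w1 w2 w3 v) \<in> A' \<longleftrightarrow> F' (comb w1 w2 w3 v) = 0"
  using pt_in_zeros_comb[OF curve_forms(2)] A' unfolding plane_curve_def w_span by blast

lemma pt_comb_in_AQ: "comb b1' b2' b3' v \<noteq> 0 \<Longrightarrow> pt (comb b1' b2' b3' v) \<in> AQ \<longleftrightarrow> G v = 0"
  using pt_in_zeros_comb[OF FQ(1)] FQ(2) unfolding planeQ_span by simp

lemma pt_comb_in_AQ': "comb y1 y2 y3 v \<noteq> 0 \<Longrightarrow> pt (comb y1 y2 y3 v) \<in> AQ' \<longleftrightarrow> F' (comb w1 w2 w3 v) = 0"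
  using pt_in_zeros_comb[OF FQ'(1)] FQ'(2) unfolding y_span by simp

lemma psi_graph_comb':
  assumes "\<omega>1 (A1 (comb w1 w2 w3 v)) \<noteq> 0 \<or> \<beta>1 (A1 (comb w1 w2 w3 v)) \<noteq> 0"
  shows "comb y1 y2 y3 v \<noteq> 0" "(pt (comb w1 w2 w3 v), pt (comb y1 y2 y3 v)) \<in> psi_graph P1 P2 Q1 Q2"
proof -
  have "comb w1 w2 w3 v \<in> plane'" unfolding w_span mem_span_comb by blast
  then have "\<beta>1 (A1 (comb w1 w2 w3 v)) = \<beta>2 (A2 (comb w1 w2 w3 v))" by (simp add: plane'_def)
  from psi_graph_plane'[OF this assms wy] show "comb y1 y2 y3 v \<noteq> 0"
    "(pt (comb w1 w2 w3 v), pt (comb y1 y2 y3 v)) \<in> psi_graph P1 P2 Q1 Q2" by blast+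
qed

lemma conjugate_curve_subset: "conjugate_curve P1 P2 Q1 Q2 C \<subseteq> AQ \<union> AQ'"
proof -
  have "psi_graph P1 P2 Q1 Q2 `` C \<subseteq> AQ \<union> AQ'"
  proof
    fix y assume "y \<in> psi_graph P1 P2 Q1 Q2 `` C"
    then obtain p where p: "p \<in> C" "(p, y) \<in> psi_graph P1 P2 Q1 Q2" by blast
    obtain x where x: "x \<noteq> 0" "p = pt x" by (rule pt_exhaust)
    have psi: "(pt x, y) \<in> psi_graph P1 P2 Q1 Q2" using p x by simp
    have A_case: "y \<in> AQ" if "p \<in> A"
    proof -
      have xp: "x \<in> plane" "F x = 0" using that pt_in_plane_curve[OF planes(1) A x(1)] x(2) by blast+
      then have nz: "\<beta>1 (A1 x) \<noteq> 0" "\<beta>2 (A2 x) \<noteq> 0" using psi_graph_cases[OF x(1) psi] by (auto simp: plane_def)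
      obtain v where v: "x = comb b1 b2 b3 v" using xp(1) unfolding plane_span mem_span_comb by blast
      note c = psi_graph_comb[of v, folded v, OF nz]
      have "y = pt (comb b1' b2' b3' (\<kappa> v))" using psi_graph_unique[OF psi c(2)] .
      moreover have "G (\<kappa> v) = 0" using strict_transform_zero[OF f_form no_line G eq] xp(2) v by blast
      ultimately show ?thesis using pt_comb_in_AQ[OF c(1)] by simp
    qed
    have A'_case: "y \<in> AQ'" if "p \<in> A'"
    proof -
      have xp: "x \<in> plane'" "F' x = 0" using that pt_in_plane_curve[OF planes(3) A' x(1)] x(2) by blast+
      then have nz: "\<omega>1 (A1 x) \<noteq> 0 \<or> \<beta>1 (A1 x) \<noteq> 0" using psi_graph_cases[OF x(1) psi] by (auto simp: plane'_def)
      obtain v where v: "x = comb w1 w2 w3 v" using xp(1) unfolding w_span mem_span_comb by blast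
      note c = psi_graph_comb'[of v, folded v, OF nz]
      have "y = pt (comb y1 y2 y3 v)" using psi_graph_unique[OF psi c(2)] .
      then show ?thesis using pt_comb_in_AQ'[OF c(1)] xp(2) v by simp
    qed
    show "y \<in> AQ \<union> AQ'" using p(1) C A_case A'_case by blast
  qed
  then show ?thesis
    unfolding conjugate_curve_def points_planeQ
    by (rule zariski_closure_subset_union[OF form_B(1) FQ(1) form_B(2) FQ'(1)])
qed

text \<open>A zero \<open>z\<close> of \<open>G\<close> off the contracted lines is, up to scaling,
  \<kappa> (\<kappa> z), hence the image of the point of the curve with parameter \<kappa> z. The
  zeros of \<open>G\<close> on the contracted lines are reached by density.\<close>

lemma AQ_subset: "AQ \<subseteq> conjugate_curve P1 P2 Q1 Q2 C"
proof
  fix y assume y: "y \<in> AQ"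
  obtain u where u: "u \<noteq> 0" "y = pt u" by (rule pt_exhaust)
  have "u \<in> planeQ" using y u pt_in_points[OF planes(5) u(1)] by simp
  then obtain v where v: "u = comb b1' b2' b3' v" unfolding planeQ_span mem_span_comb by blast
  have Gv: "G v = 0" using pt_comb_in_AQ[of v] y u v by simp
  show "y \<in> conjugate_curve P1 P2 Q1 Q2 C"
    unfolding conjugate_curve_def u(2) pt_in_zariski_closure[OF u(1)]
  proof (intro allI impI)
    fix k and K :: "complex ^ 4 \<Rightarrow> complex"
    assume K: "form k K" and van: "\<forall>w. w \<noteq> 0 \<longrightarrow> pt w \<in> psi_graph P1 P2 Q1 Q2 `` C \<longrightarrow> K w = 0"
    have "K (comb b1' b2' b3' v) = 0"
    proof (rule form_vanishes_by_torus_density[OF G form_comb[OF K] _ Gv])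
      fix z assume z: "G z = 0" "\<And>i. i \<in> E \<Longrightarrow> z $ i \<noteq> 0"
      let ?x = "comb b1 b2 b3 (\<kappa> z)"
      have nz: "\<beta>1 (A1 ?x) \<noteq> 0" "\<beta>2 (A2 ?x) \<noteq> 0" using torus_iff[of "\<kappa> z"] torus[OF z(2)] by blast+
      then have x0: "?x \<noteq> 0" using forms_0 by auto
      note c = psi_graph_comb[OF nz]
      have "F ?x = 0" using eq z(1) by simp
      then have "pt ?x \<in> C" using pt_comb_in_A[OF x0] C by blast
      then have "K (comb b1' b2' b3' (\<kappa> (\<kappa> z))) = 0" using van c by blast
      then have "monomial_in E \<mu> z ^ k * K (comb b1' b2' b3' z) = 0"
        unfolding involution comb_scale form_homogeneous[OF K] .
      then show "K (comb b1' b2' b3' z) = 0" using monomial_in_nonzero z(2) by simp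
    qed
    then show "K u = 0" using v by simp
  qed
qed

text \<open>On the second plane the map is linear and undefined at most where \<omega>1 and \<beta>1
  both vanish. Density is applied with a line \<open>L\<close> through this point on which
  \<open>F'\<close> does not vanish identically.\<close>

lemma AQ'_subset: "AQ' \<subseteq> conjugate_curve P1 P2 Q1 Q2 C"
proof
  fix y assume y: "y \<in> AQ'"
  obtain u where u: "u \<noteq> 0" "y = pt u" by (rule pt_exhaust)
  have "u \<in> planeQ'" using y u pt_in_points[OF planes(7) u(1)] by simp
  then obtain v where v: "u = comb y1 y2 y3 v" unfolding y_span mem_span_comb by blast
  have Fv: "F' (comb w1 w2 w3 v) = 0" using pt_comb_in_AQ'[of v] y u v by simp
  have onto: "\<exists>v. \<omega>1 (A1 (comb w1 w2 w3 v)) = l \<and> \<beta>1 (A1 (comb w1 w2 w3 v)) = m" for l m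
  proof -
    obtain S T where S: "\<beta>2 S = 1" "\<omega>2 S = 0" and T: "\<beta>2 T = 0" "\<omega>2 T = 1" using ind\<beta>(3,4) by blast
    let ?Y = "m *s S + l *s T"
    have Y: "\<beta>2 ?Y = m" "\<omega>2 ?Y = l" by (simp_all add: linear_forms S T)
    obtain X where X: "\<alpha>1 X = \<alpha>2 ?Y" "\<beta>1 X = m" "\<omega>1 X = l"
      by (rule functional_triple_onto[OF forms(1,2,3) ind\<alpha>(1,2) regular1]) (assumption | rule that)+
    have rel: "\<alpha>1 X = \<alpha>2 ?Y" "\<omega>1 X = \<omega>2 ?Y" using X Y by simp_all
    obtain x where x: "A1 x = X" "A2 x = ?Y" by (rule A_onto[OF rel]) (rule that)
    have "x \<in> plane'" using x X Y by (simp add: plane'_def)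
    then obtain v where "x = comb w1 w2 w3 v" unfolding w_span mem_span_comb by blast
    then show ?thesis using x X by blast
  qed
  have "\<exists>v\<in>plane'. F' v \<noteq> 0" using A' unfolding plane_curve_def squarefree_on_def by blast
  then obtain v0 where v0: "F' (comb w1 w2 w3 v0) \<noteq> 0" unfolding w_span using mem_span_comb[of _ w1 w2 w3] by metis
  define m1 where "m1 v = \<omega>1 (A1 (comb w1 w2 w3 v))" for v
  define m2 where "m2 v = \<beta>1 (A1 (comb w1 w2 w3 v))" for v
  have m: "form 1 m1" "form 1 m2" unfolding m1_def m2_def using form_comb[OF A_forms(3)] form_comb[OF A_forms(2)] by blast+
  \<comment> \<open>The coefficients are chosen so that \<open>L\<close> vanishes at
    \<open>v0\<close>, where \<open>F'\<close> is nonzero. If both \<open>m1\<close> and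
    \<open>m2\<close> vanish there, any nontrivial choice works.\<close>
  obtain p q where pq: "p * m1 v0 + q * m2 v0 = 0" "p \<noteq> 0 \<or> q \<noteq> 0"
  proof (cases "m1 v0 = 0")
    case True
    then show ?thesis using that[of 1 0] by simp
  next
    case False
    then show ?thesis using that[of "- m2 v0" "m1 v0"] by (simp add: mult.commute)
  qed
  define L where "L v = p * m1 v + q * m2 v" for v
  have L: "form 1 L" unfolding L_def by (intro form_add form_scale m)
  obtain f where f: "L f \<noteq> 0"
  proof (cases "p = 0")
    case True
    obtain f where "m1 f = 0" "m2 f = 1" using onto unfolding m1_def m2_def by blast
    then show ?thesis using that[of f] True pq(2) by (simp add: L_def)
  next
    case False
    obtain f where "m1 f = 1" "m2 f = 0" using onto unfolding m1_def m2_def by blast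
    then show ?thesis using that[of f] False by (simp add: L_def)
  qed
  show "y \<in> conjugate_curve P1 P2 Q1 Q2 C"
    unfolding conjugate_curve_def u(2) pt_in_zariski_closure[OF u(1)]
  proof (intro allI impI)
    fix k and K :: "complex ^ 4 \<Rightarrow> complex"
    assume K: "form k K" and van: "\<forall>w. w \<noteq> 0 \<longrightarrow> pt w \<in> psi_graph P1 P2 Q1 Q2 `` C \<longrightarrow> K w = 0"
    have "K (comb y1 y2 y3 v) = 0"
    proof (rule form_vanishes_by_density[OF form_comb[OF curve_forms(2)] form_comb[OF K] L _ v0 f _ Fv])
      show "L v0 = 0" unfolding L_def by (rule pq)
      fix z assume z: "F' (comb w1 w2 w3 z) = 0" "L z \<noteq> 0"
      then have nz: "\<omega>1 (A1 (comb w1 w2 w3 z)) \<noteq> 0 \<or> \<beta>1 (A1 (comb w1 w2 w3 z)) \<noteq> 0"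
        unfolding L_def m1_def m2_def by auto
      then have x0: "comb w1 w2 w3 z \<noteq> 0" using forms_0 by auto
      then have "pt (comb w1 w2 w3 z) \<in> C" using pt_comb_in_A' z(1) C by blast
      then show "K (comb y1 y2 y3 z) = 0" using van psi_graph_comb'[OF nz] by blast
    qed
    then show "K u = 0" using v by simp
  qed
qed

lemma conjugate_curve_eq: "conjugate_curve P1 P2 Q1 Q2 C = AQ \<union> AQ'"
  using conjugate_curve_subset AQ_subset AQ'_subset by blast

text \<open>On the line of intersection of the two planes both descriptions of the birational map agree,
  except at the points of the exceptional lines.\<close>

lemma finite_exceptional_points:
  "finite {pt x | x. x \<noteq> 0 \<and> x \<in> plane \<and> x \<in> plane' \<and> (\<beta>1 (A1 x) = 0 \<or> \<alpha>1 (A1 x) = 0)}"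
proof (rule finite_subset)
  let ?S = "{pt x | x. x \<noteq> 0 \<and> \<beta>1 (A1 x) = 0 \<and> \<omega>1 (A1 x) = 0 \<and> \<beta>2 (A2 x) = 0 \<and> \<alpha>1 (A1 x) = \<alpha>2 (A2 x)}"
  let ?T = "{pt x | x. x \<noteq> 0 \<and> \<alpha>1 (A1 x) = 0 \<and> \<omega>1 (A1 x) = 0 \<and> \<alpha>2 (A2 x) = 0 \<and> \<beta>1 (A1 x) = \<beta>2 (A2 x)}"
  have "finite ?S" by (rule intersection_point_unique[OF forms(2,5) ind\<beta> forms(1,4)]) (rule regular1)
  moreover have "finite ?T" by (rule intersection_point_unique[OF forms(1,4) ind\<alpha> forms(2,5)]) (rule regular1)
  ultimately show "finite (?S \<union> ?T)" by blast
  show "{pt x | x. x \<noteq> 0 \<and> x \<in> plane \<and> x \<in> plane' \<and> (\<beta>1 (A1 x) = 0 \<or> \<alpha>1 (A1 x) = 0)} \<subseteq> ?S \<union> ?T"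
    using A_rel(1) unfolding plane_def plane'_def by auto
qed

context
  assumes fin: "finite (C \<inter> points plane - A)" "finite (C \<inter> points plane' - A')"
begin

text \<open>An excess point comes from the other component and therefore lies on both planes of
  \<open>Q\<close>. Its preimage lies on both planes of \<open>P\<close>, where the two descriptions
  of the map agree off finitely many exceptional points. So it is exceptional or comes from an
  excess point of \<open>C\<close>, of which there are finitely many.\<close>

lemma finite_conjugate_curve_Q:
  "finite (conjugate_curve P1 P2 Q1 Q2 C \<inter> points planeQ - AQ)"
  "finite (conjugate_curve P1 P2 Q1 Q2 C \<inter> points planeQ' - AQ')"
proof -
  let ?S = "{pt x | x. x \<noteq> 0 \<and> x \<in> plane \<and> x \<in> plane' \<and> (\<beta>1 (A1 x) = 0 \<or> \<alpha>1 (A1 x) = 0)}"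
  have "vec.dim (vec.span {w1, w2, w3}) = 3" using w_span planes(4) by simp
  then obtain N :: "complex ^ 4 ^ 3" where N: "\<And>v. N *v comb w1 w2 w3 v = v"
    by (rule comb_inverse) (rule that)
  have point: "\<exists>v. comb w1 w2 w3 v \<noteq> 0 \<and> comb y1 y2 y3 v \<noteq> 0 \<and> y = pt (comb y1 y2 y3 v) \<and>
      comb w1 w2 w3 v \<in> plane \<and> comb w1 w2 w3 v \<in> plane'" if y: "y \<in> points planeQ" "y \<in> points planeQ'" for y
  proof -
    obtain u where u: "u \<noteq> 0" "y = pt u" by (rule pt_exhaust)
    have uQ: "u \<in> planeQ" "u \<in> planeQ'" using y u pt_in_points[OF planes(5) u(1)] pt_in_points[OF planes(7) u(1)] by simp_all
    obtain v where v: "u = comb y1 y2 y3 v" using uQ(2) unfolding y_span mem_span_comb by blast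
    have "comb w1 w2 w3 v \<noteq> 0" using u(1) v N[of v] by (auto simp: comb_0)
    moreover have "comb w1 w2 w3 v \<in> plane" using uQ(1) v wy(1)[of v] by (simp add: plane_def)
    moreover have "comb w1 w2 w3 v \<in> plane'" unfolding w_span mem_span_comb by blast
    ultimately show ?thesis using u v by blast
  qed
  show "finite (conjugate_curve P1 P2 Q1 Q2 C \<inter> points planeQ - AQ)"
  proof (rule finite_points_transport[OF _ _ N, of "?S \<union> (C \<inter> points plane - A)" _ "comb y1 y2 y3"])
    show "finite (?S \<union> (C \<inter> points plane - A))" using fin(1) finite_exceptional_points by blast
    fix y assume y: "y \<in> conjugate_curve P1 P2 Q1 Q2 C \<inter> points planeQ - AQ"
    then have yQ: "y \<in> points planeQ" "y \<in> points planeQ'" "y \<in> AQ'" "y \<notin> AQ" unfolding conjugate_curve_eq by blast+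
    obtain v where v: "comb w1 w2 w3 v \<noteq> 0" "comb y1 y2 y3 v \<noteq> 0" "y = pt (comb y1 y2 y3 v)"
      "comb w1 w2 w3 v \<in> plane" "comb w1 w2 w3 v \<in> plane'" using point[OF yQ(1,2)] by blast
    let ?x = "comb w1 w2 w3 v"
    have "F' ?x = 0" using pt_comb_in_AQ'[OF v(2)] yQ(3) v(3) by simp
    then have xC: "pt ?x \<in> C" using pt_comb_in_A'[OF v(1)] C by blast
    have "pt ?x \<in> ?S \<union> (C \<inter> points plane - A)"
    proof (cases "\<beta>1 (A1 ?x) = 0 \<or> pt ?x \<notin> A")
      case True
      then show ?thesis using v xC pt_in_points[OF planes(1) v(1)] by blast
    next
      case False
      then have nz: "\<beta>1 (A1 ?x) \<noteq> 0" "\<beta>2 (A2 ?x) \<noteq> 0" using v(5) by (simp_all add: plane'_def)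
      obtain v1 where v1: "?x = comb b1 b2 b3 v1" using v(4) unfolding plane_span mem_span_comb by blast
      note c = psi_graph_comb[of v1, folded v1, OF nz]
      have "y = pt (comb b1' b2' b3' (\<kappa> v1))"
        using psi_graph_unique[OF c(2), of y] psi_graph_comb'(2)[of v] nz(1) v(3) by metis
      moreover have "F (comb b1 b2 b3 v1) = 0" using False pt_comb_in_A[of v1] v1 v(1) by simp
      then have "G (\<kappa> v1) = 0" using strict_transform_zero[OF f_form no_line G eq] by blast
      ultimately have "y \<in> AQ" using pt_comb_in_AQ[OF c(1)] by simp
      then show ?thesis using yQ(4) by blast
    qed
    then show "\<exists>v. comb w1 w2 w3 v \<noteq> 0 \<and> pt (comb w1 w2 w3 v) \<in> ?S \<union> (C \<inter> points plane - A) \<and>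
      comb y1 y2 y3 v \<noteq> 0 \<and> y = pt (comb y1 y2 y3 v)" using v by blast
  qed (rule comb_scale)
  show "finite (conjugate_curve P1 P2 Q1 Q2 C \<inter> points planeQ' - AQ')"
  proof (rule finite_points_transport[OF _ _ N, of "?S \<union> (C \<inter> points plane' - A')" _ "comb y1 y2 y3"])
    show "finite (?S \<union> (C \<inter> points plane' - A'))" using fin(2) finite_exceptional_points by blast
    fix y assume y: "y \<in> conjugate_curve P1 P2 Q1 Q2 C \<inter> points planeQ' - AQ'"
    then have yQ: "y \<in> points planeQ" "y \<in> points planeQ'" "y \<in> AQ" "y \<notin> AQ'" unfolding conjugate_curve_eq by blast+
    obtain v where v: "comb w1 w2 w3 v \<noteq> 0" "comb y1 y2 y3 v \<noteq> 0" "y = pt (comb y1 y2 y3 v)"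
      "comb w1 w2 w3 v \<in> plane" "comb w1 w2 w3 v \<in> plane'" using point[OF yQ(1,2)] by blast
    let ?x = "comb w1 w2 w3 v"
    have nA': "pt ?x \<notin> A'" using pt_comb_in_AQ'[OF v(2)] yQ(4) v(3) pt_comb_in_A'[OF v(1)] by simp
    have "pt ?x \<in> ?S \<union> (C \<inter> points plane' - A')"
    proof (cases "\<beta>1 (A1 ?x) = 0 \<or> \<alpha>1 (A1 ?x) = 0")
      case True
      then show ?thesis using v by blast
    next
      case False
      then have nz: "\<beta>1 (A1 ?x) \<noteq> 0" "\<beta>2 (A2 ?x) \<noteq> 0" "\<alpha>1 (A1 ?x) \<noteq> 0" using v(5) by (simp_all add: plane'_def)
      obtain v1 where v1: "?x = comb b1 b2 b3 v1" using v(4) unfolding plane_span mem_span_comb by blast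
      have tor: "\<And>i. i \<in> E \<Longrightarrow> v1 $ i \<noteq> 0" using torus_iff[of v1] nz v1 by simp
      note c = psi_graph_comb[of v1, folded v1, OF nz(1,2)]
      have "y = pt (comb b1' b2' b3' (\<kappa> v1))"
        using psi_graph_unique[OF c(2), of y] psi_graph_comb'(2)[of v] nz(1) v(3) by metis
      then have "G (\<kappa> v1) = 0" using pt_comb_in_AQ[OF c(1)] yQ(3) by simp
      then have "F (comb b1 b2 b3 (\<kappa> (\<kappa> v1))) = 0" using eq by simp
      then have "monomial_in E \<mu> v1 ^ d * F ?x = 0"
        unfolding involution comb_scale form_homogeneous[OF curve_forms(1)] v1 .
      then have "F ?x = 0" using monomial_in_nonzero[of E v1 \<mu>] tor by simp
      then have "pt ?x \<in> C" using pt_comb_in_A[of v1] v1 v(1) C by simp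
      then show ?thesis using nA' pt_in_points[OF planes(3) v(1)] v(5) by blast
    qed
    then show "\<exists>v. comb w1 w2 w3 v \<noteq> 0 \<and> pt (comb w1 w2 w3 v) \<in> ?S \<union> (C \<inter> points plane' - A') \<and>
      comb y1 y2 y3 v \<noteq> 0 \<and> y = pt (comb y1 y2 y3 v)" using v by blast
  qed (rule comb_scale)
qed

end

end

end

end

subsection \<open>Multiplicities of a strict transform\<close>

lemma dual_basis_of_plane:
  fixes c1 c2 c3 :: "complex ^ 4 \<Rightarrow> complex"
  assumes W: "vec.subspace W" "vec.dim W = 3" and c: "form 1 c1" "form 1 c2" "form 1 c3"
    and ker: "\<And>x. x \<in> W \<Longrightarrow> c1 x = 0 \<Longrightarrow> c2 x = 0 \<Longrightarrow> c3 x = 0 \<Longrightarrow> x = 0"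
  obtains b1 b2 b3 where "W = vec.span {b1, b2, b3}" "\<And>v. c1 (comb b1 b2 b3 v) = v $ 1"
    "\<And>v. c2 (comb b1 b2 b3 v) = v $ 2" "\<And>v. c3 (comb b1 b2 b3 v) = v $ 3"
proof -
  have "\<not> W \<subseteq> vec.span {}" using vec.dim_subset[of W "vec.span {}"] W by auto
  then obtain w1 where w1: "w1 \<in> W" "w1 \<noteq> 0" by auto
  have "\<not> W \<subseteq> vec.span {w1}"
    using vec.dim_subset[of W "vec.span {w1}"] dim_span_singleton[OF w1(2)] W by auto
  then obtain w2 where w2: "w2 \<in> W" "w2 \<notin> vec.span {w1}" by auto
  obtain w3 where w3: "W = vec.span {w1, w2, w3}"
    by (rule plane_basis_extend[OF W w1(1) w2(1) w1(2) w2(2)]) (rule that)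
  define b :: "3 \<Rightarrow> complex ^ 3" where
    "b j = (let w = if j = 1 then w1 else if j = 2 then w2 else w3 in vector [c1 w, c2 w, c3 w])" for j
  note lin = form_1_linear[OF c(1)] form_1_linear[OF c(2)] form_1_linear[OF c(3)]
  have M: "column_matrix b *v x = vector [c1 (comb w1 w2 w3 x), c2 (comb w1 w2 w3 x), c3 (comb w1 w2 w3 x)]" for x
    by (simp add: column_matrix_mult sum_3 b_def Let_def vec_eq_iff forall_3 comb_def lin)
  have "\<exists>N. N ** column_matrix b = mat 1"
    unfolding matrix_left_invertible_ker
  proof (intro allI impI)
    fix x assume "column_matrix b *v x = 0"
    then have "c1 (comb w1 w2 w3 x) = 0" "c2 (comb w1 w2 w3 x) = 0" "c3 (comb w1 w2 w3 x) = 0"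
      unfolding M by (simp_all add: vec_eq_iff forall_3)
    moreover have "comb w1 w2 w3 x \<in> W" unfolding w3 mem_span_comb by blast
    ultimately have "comb w1 w2 w3 x = 0" using ker by blast
    moreover have "vec.dim (vec.span {w1, w2, w3}) = 3" using W(2) w3 by simp
    ultimately have "x $ 1 = 0 \<and> x $ 2 = 0 \<and> x $ 3 = 0"
      unfolding comb_def by (intro plane_basis_independent[of w1 w2 w3])
    then show "x = 0" by (simp add: vec_eq_iff forall_3)
  qed
  then obtain N where "column_matrix b ** N = mat 1" using matrix_left_right_inverse by blast
  then have N: "column_matrix b *v (N *v x) = x" for x by (simp add: matrix_vector_mul_assoc)
  define e where "e i = comb w1 w2 w3 (N *v axis i 1)" for i
  have val: "c1 (e i) = axis i 1 $ 1" "c2 (e i) = axis i 1 $ 2" "c3 (e i) = axis i 1 $ 3" for i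
  proof -
    have *: "vector [c1 (e i), c2 (e i), c3 (e i)] = (axis i 1 :: complex ^ 3)"
      unfolding e_def M[symmetric] N ..
    show "c1 (e i) = axis i 1 $ 1" "c2 (e i) = axis i 1 $ 2" "c3 (e i) = axis i 1 $ 3"
      unfolding *[symmetric] by simp_all
  qed
  have eW: "e i \<in> W" for i unfolding e_def w3 mem_span_comb by blast
  have coord: "c1 (comb (e 1) (e 2) (e 3) v) = v $ 1" "c2 (comb (e 1) (e 2) (e 3) v) = v $ 2"
    "c3 (comb (e 1) (e 2) (e 3) v) = v $ 3" for v
    by (simp_all add: comb_def lin val axis_def)
  have "W = vec.span {e 1, e 2, e 3}"
  proof
    show "vec.span {e 1, e 2, e 3} \<subseteq> W" using eW by (intro vec.span_minimal W) auto
    show "W \<subseteq> vec.span {e 1, e 2, e 3}"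
    proof
      fix x assume x: "x \<in> W"
      let ?y = "comb (e 1) (e 2) (e 3) (vector [c1 x, c2 x, c3 x])"
      have y: "?y \<in> W" unfolding comb_def
        using eW W(1) by (simp add: vec.subspace_add vec.subspace_scale)
      let ?d = "x + (- 1) *s ?y"
      have "?d \<in> W" using x y W(1) by (intro vec.subspace_add vec.subspace_scale)
      moreover have "c1 ?d = 0" "c2 ?d = 0" "c3 ?d = 0" by (simp_all only: lin coord) simp_all
      ultimately have "?d = 0" by (rule ker)
      then have "x = ?y" by simp
      then show "x \<in> vec.span {e 1, e 2, e 3}" using mem_span_comb by blast
    qed
  qed
  then show thesis using that coord by blast
qed

lemma eventually_cofinite_infinite:
  "\<forall>\<^sub>F \<beta> in cofinite. Q (\<beta> :: complex) \<Longrightarrow> infinite {\<beta>. Q \<beta>}"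
  using infinite_UNIV_char_0[where ?'a = complex] finite_UnI[of "{\<beta>. Q \<beta>}" "{\<beta>. \<not> Q \<beta>}"]
  by (auto simp: eventually_cofinite Un_def)

lemma cofinite_order_unique:
  assumes "\<forall>\<^sub>F \<beta> in cofinite. has_order (g \<beta>) m" "\<forall>\<^sub>F \<beta> in cofinite. has_order (g (\<beta> :: complex)) n"
  shows "m = n"
proof -
  from eventually_cofinite_infinite[OF eventually_conj[OF assms]]
  obtain \<beta> where "has_order (g \<beta>) m" "has_order (g \<beta>) n"
    by (metis (mono_tags, lifting) finite.emptyI equals0I mem_Collect_eq)
  then show ?thesis by (rule has_order_unique)
qed

lemma ternary_comb:
  fixes F :: "complex ^ 4 \<Rightarrow> complex"
  assumes "form d F"
  shows "ternary d (\<lambda>a b c. F (a *s b1 + b *s b2 + c *s b3))"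
  using form_comb[OF assms, of b1 b2 b3] unfolding ternary_def comb_def .

context
  fixes W W' :: "(complex ^ 4) set" and F G :: "complex ^ 4 \<Rightarrow> complex"
    and b1 b2 b3 b1' b2' b3' :: "complex ^ 4" and d e :: nat
  assumes F: "form d F" and G: "form e G" and dim: "vec.dim W = 3" "vec.dim W' = 3"
    and W: "W = vec.span {b1, b2, b3}" and W': "W' = vec.span {b1', b2', b3'}"
begin

lemma basis_nonzero: "b1 \<noteq> 0" "b2 \<noteq> 0" "b1' \<noteq> 0" "b2' \<noteq> 0"
  using plane_basis_independent[of b1 b2 b3 1 0 0] plane_basis_independent[of b1 b2 b3 0 1 0]
    plane_basis_independent[of b1' b2' b3' 1 0 0] plane_basis_independent[of b1' b2' b3' 0 1 0] dim W W'
  by auto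

lemma multiplicity_eq_order:
  assumes "has_multiplicity W F (pt b1) m" and w: "w \<in> W" "F w \<noteq> 0"
    and ord: "\<forall>\<^sub>F \<beta> in cofinite. has_order (\<lambda>\<tau>. F (b1 + \<tau> *s b2 + (\<beta> * \<tau>) *s b3)) n"
  shows "m = n"
proof -
  have "\<forall>\<^sub>F \<beta> in cofinite. has_order (\<lambda>\<tau>. F (b1 + \<tau> *s b2 + (\<beta> * \<tau>) *s b3)) m"
    using has_multiplicity_generic_order[OF F assms(1) w dim(1) line_of_pt[OF basis_nonzero(1)] W]
    by (simp add: eventually_cofinite)
  from this ord show ?thesis by (rule cofinite_order_unique)
qed

text \<open>Stated at the first base point; permuting the bases gives the other two. The
  nonvanishing assumptions concern the opposite lines b1-coordinate = 0, and make a general line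
  through the base point reveal the exact order.\<close>

lemma cremona_multiplicity:
  assumes eq: "\<And>a b c. F ((b * c) *s b1 + (a * c) *s b2 + (a * b) *s b3) =
      a ^ i * b ^ j * c ^ k * G (a *s b1' + b *s b2' + c *s b3')"
    and nz: "F (x *s b2 + y *s b3) \<noteq> 0" "G (x' *s b2' + y' *s b3') \<noteq> 0"
  shows "has_multiplicity W F (pt b1) m \<Longrightarrow> m = i"
    and "j + k \<le> d" and "has_multiplicity W' G (pt b1') (d - (j + k))"
proof -
  note t = ternary_comb[OF F, of b1 b2 b3] ternary_comb[OF G, of b1' b2' b3']
  have nz': "F (0 *s b1 + x *s b2 + y *s b3) \<noteq> 0" "G (0 *s b1' + x' *s b2' + y' *s b3') \<noteq> 0" using nz by simp_all
  have w: "x *s b2 + y *s b3 \<in> W" "x' *s b2' + y' *s b3' \<in> W'"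
    unfolding W W' span3_iff by (intro exI[of _ 0] exI[of _ x] exI[of _ x'] exI[of _ y] exI[of _ y']; simp)+
  have src: "\<forall>\<^sub>F \<beta> in cofinite. has_order (\<lambda>\<tau>. F (b1 + \<tau> *s b2 + (\<beta> * \<tau>) *s b3)) i"
    using cremona_order_source[OF t eq nz'(2)] by simp
  then show "has_multiplicity W F (pt b1) m \<Longrightarrow> m = i" using multiplicity_eq_order w nz by blast
  have tgt: "\<forall>\<^sub>F \<beta> in cofinite. j + k \<le> d \<and> has_order (\<lambda>\<tau>. G (b1' + \<tau> *s b2' + (\<beta> * \<tau>) *s b3')) (d - (j + k))"
    using cremona_order_target[OF t eq nz'(1)] by simp
  then show "j + k \<le> d" by (simp add: eventually_conj_iff infinite_UNIV_char_0 eventually_cofinite split: if_splits)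
  show "has_multiplicity W' G (pt b1') (d - (j + k))"
    using eventually_cofinite_infinite[OF tgt[unfolded eventually_conj_iff, THEN conjunct2]]
    by (rule has_multiplicityI[OF G w(2) nz(2) dim(2) line_of_pt[OF basis_nonzero(3)] W'])
qed

text \<open>The simple base point is \<open>b1\<close>; at \<open>b2\<close> a second one is
  infinitely near in the direction of \<open>b3\<close>. A parabola in this direction has order
  \<open>m\<close> + \<open>m'\<close> at the curve, and the comparison gives k = m + m'. With this
  the three target multiplicities are \<open>d\<close> minus pairs of source multiplicities, as in
  the generic case.\<close>

lemma degenerate_multiplicity:
  assumes eq: "\<And>a b c. F ((c\<^sup>2) *s b1 + (a * b) *s b2 + (a * c) *s b3) =
      a ^ i * c ^ k * G (a *s b1' + b *s b2' + c *s b3')"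
    and nz: "F (x *s b2 + y *s b3) \<noteq> 0" "G (x' *s b2' + y' *s b3') \<noteq> 0"
    and nz3: "F (x1 *s b1 + y1 *s b2) \<noteq> 0" "G (x1' *s b1' + y1' *s b2') \<noteq> 0"
    and l: "l = vec.span {b2, b3}" "l' = vec.span {b2', b3'}"
    and m: "has_multiplicity W F (pt b2) m" "has_infinitely_near_multiplicity W F (pt b2) l m'"
  shows "has_multiplicity W F (pt b1) m'' \<Longrightarrow> m'' = i"
    and "has_multiplicity W' G (pt b1') (d - k)"
    and "has_multiplicity W' G (pt b2') (d + m - (i + k))"
    and "has_infinitely_near_multiplicity W' G (pt b2') l' (d - (i + m))"
    and "k = m + m'" and "k \<le> d" and "i + k \<le> d + m" and "i + m \<le> d"
proof -
  note t = ternary_comb[OF F, of b1 b2 b3] ternary_comb[OF G, of b1' b2' b3']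
  have nz': "F (0 *s b1 + x *s b2 + y *s b3) \<noteq> 0" "G (0 *s b1' + x' *s b2' + y' *s b3') \<noteq> 0"
    "F (x1 *s b1 + y1 *s b2 + 0 *s b3) \<noteq> 0" "G (x1' *s b1' + y1' *s b2' + 0 *s b3') \<noteq> 0"
    using nz nz3 by simp_all
  have w: "x *s b2 + y *s b3 \<in> W" "x' *s b2' + y' *s b3' \<in> W'"
    unfolding W W' span3_iff by (intro exI[of _ 0] exI[of _ x] exI[of _ x'] exI[of _ y] exI[of _ y']; simp)+
  have perm: "W = vec.span {b1, b3, b2}" "W = vec.span {b2, b3, b1}"
    "W' = vec.span {b1', b3', b2'}" "W' = vec.span {b2', b3', b1'}"
    unfolding W W' by (simp_all add: insert_commute)
  have src: "\<forall>\<^sub>F \<beta> in cofinite. has_order (\<lambda>\<tau>. F (b1 + \<tau> *s b3 + (\<beta> * \<tau>) *s b2)) i"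
    using degenerate_order_source_simple[OF t eq nz'(2)] by (simp add: add_ac)
  have mult: "\<forall>\<^sub>F \<beta> in cofinite. has_order (\<lambda>\<tau>. F (b1 + \<tau> *s b3 + (\<beta> * \<tau>) *s b2)) m''" if "has_multiplicity W F (pt b1) m''"
    using has_multiplicity_generic_order[OF F that w(1) nz(1) dim(1) line_of_pt[OF basis_nonzero(1)] perm(1)]
    by (simp add: eventually_cofinite)
  show "has_multiplicity W F (pt b1) m'' \<Longrightarrow> m'' = i" by (rule cofinite_order_unique[OF mult src])
  have tgt: "\<forall>\<^sub>F \<beta> in cofinite. k \<le> d \<and> has_order (\<lambda>\<tau>. G (b1' + \<tau> *s b3' + (\<beta> * \<tau>) *s b2')) (d - k)"
    using degenerate_order_target_simple[OF t eq nz'(1)] by (simp add: add_ac)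
  then show "k \<le> d" by (simp add: eventually_conj_iff infinite_UNIV_char_0 eventually_cofinite split: if_splits)
  show "has_multiplicity W' G (pt b1') (d - k)"
    using eventually_cofinite_infinite[OF tgt[unfolded eventually_conj_iff, THEN conjunct2]]
    by (rule has_multiplicityI[OF G w(2) nz(2) dim(2) line_of_pt[OF basis_nonzero(3)] perm(3)])
  have "\<forall>\<^sub>F \<beta> in cofinite. has_order (\<lambda>\<tau>. F (b2 + \<tau> *s b3 + (\<beta> * \<tau>) *s b1)) m"
    using has_multiplicity_generic_order[OF F m(1) w(1) nz(1) dim(1) line_of_pt[OF basis_nonzero(2)] perm(2)]
    by (simp add: eventually_cofinite)
  then have dbl: "\<forall>\<^sub>F \<beta> in cofinite. i + k \<le> d + m \<and>
      has_order (\<lambda>\<tau>. G (b2' + \<tau> *s b3' + (\<beta> * \<tau>) *s b1')) (d + m - (i + k))"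
    using degenerate_order_double[OF t eq, of m] by (simp add: add_ac)
  then show ik: "i + k \<le> d + m" by (simp add: eventually_conj_iff infinite_UNIV_char_0 eventually_cofinite split: if_splits)
  show M1: "has_multiplicity W' G (pt b2') (d + m - (i + k))"
    using eventually_cofinite_infinite[OF dbl[unfolded eventually_conj_iff, THEN conjunct2]]
    by (rule has_multiplicityI[OF G w(2) nz(2) dim(2) line_of_pt[OF basis_nonzero(4)] perm(4)])
  have "\<forall>\<^sub>F \<beta> in cofinite. has_order (\<lambda>\<tau>. F (b2 + \<tau> *s b3 + (\<beta> * \<tau>\<^sup>2) *s b1)) (m + m')"
    using has_infinitely_near_multiplicity_generic_order[OF F m(2,1) w(1) nz(1) dim(1)
      line_of_pt[OF basis_nonzero(2)] perm(2) l(1)]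
    by (simp add: eventually_cofinite)
  moreover have "\<forall>\<^sub>F \<beta> in cofinite. has_order (\<lambda>\<tau>. F (b2 + \<tau> *s b3 + (\<beta> * \<tau>\<^sup>2) *s b1)) k"
    using degenerate_order_source_near[OF t eq nz'(4)] by (simp add: add_ac)
  ultimately have "m + m' = k" by (rule cofinite_order_unique)
  then show k: "k = m + m'" ..
  have near: "\<forall>\<^sub>F \<beta> in cofinite. 2 * i + k \<le> 2 * d \<and>
      has_order (\<lambda>\<tau>. G (b2' + \<tau> *s b3' + (\<beta> * \<tau>\<^sup>2) *s b1')) (2 * d - (2 * i + k))"
    using degenerate_order_target_near[OF t eq nz'(3)] by (simp add: add_ac)
  then have ik2: "2 * i + k \<le> 2 * d" by (simp add: eventually_conj_iff infinite_UNIV_char_0 eventually_cofinite split: if_splits)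
  have "infinite {\<beta>. has_order (\<lambda>\<tau>. G (b2' + \<tau> *s b3' + (\<beta> * \<tau>\<^sup>2) *s b1')) (2 * d - (2 * i + k))}"
    using eventually_cofinite_infinite[OF near[unfolded eventually_conj_iff, THEN conjunct2]] .
  then obtain n where n: "has_infinitely_near_multiplicity W' G (pt b2') l' n"
    "2 * d - (2 * i + k) = d + m - (i + k) + n"
    by (rule has_infinitely_near_multiplicityI[OF G M1 w(2) nz(2) dim(2) line_of_pt[OF basis_nonzero(4)] perm(4) l(2)])
  show "i + m \<le> d" using n(2) ik ik2 by linarith
  \<comment> \<open>The parabola counts both points, so the multiplicity at the point itself is
    subtracted: k cancels in (2 d - 2 i - k) - (d + m - i - k).\<close>
  have "n = d - (i + m)" using n(2) ik ik2 by linarith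
  then show "has_infinitely_near_multiplicity W' G (pt b2') l' (d - (i + m))" using n(1) by simp
qed

end

subsection \<open>Types of curves\<close>

lemma quadric_swap: "quadric P2 P1 Q2 Q1 = quadric P1 P2 Q1 Q2"
  unfolding quadric_def zeros_def fundamental_form_swap_eq_0 ..

lemma blowup_swap: "(x, w, u) \<in> blowup P2 P1 \<longleftrightarrow> (x, u, w) \<in> blowup P1 P2"
  unfolding blowup_def by auto

lemma epipolar_line_swap:
  "epipolar_line1 P2 P1 Q2 Q1 = epipolar_line2 P1 P2 Q1 Q2"
  "epipolar_line2 P2 P1 Q2 Q1 = epipolar_line1 P1 P2 Q1 Q2"
  unfolding epipolar_line1_def epipolar_line2_def blowup_swap[of _ _ _ P2 P1] by blast+

text \<open>At its center a camera maps the line of vectors to 0, so the component \<open>u\<close>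
  of the blow-up is unrestricted and may be the epipole.\<close>

lemma center_on_epipolar_line1:
  assumes "is_camera P1" "is_camera P2" "center P1 \<noteq> center P2"
  shows "center P1 \<in> epipolar_line1 P1 P2 Q1 Q2"
proof -
  obtain p where p: "p \<noteq> 0" "center P1 = pt p" "\<And>v. cmatrix P1 *v v = 0 \<longleftrightarrow> (\<exists>c. v = c *s p)"
    by (rule center_eq_pt[OF assms(1)]) (rule that)
  have p0: "cmatrix P1 *v p = 0" using p(3) by (metis vec.scale_one)
  have nz: "cmatrix P2 *v p \<noteq> 0" using pt_eq_center_iff[OF assms(2) p(1)] p(2) assms(3) by simp
  have "vec.subspace (line_of u)" for u :: "3 projective" using line_of[of u] by simp
  then have "0 \<in> line_of u" for u :: "3 projective" by (rule vec.subspace_0)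
  then have "(pt p, picture Q1 (center Q2), pt (cmatrix P2 *v p)) \<in> blowup P1 P2"
    unfolding blowup_def using p0 by (auto simp: line_of_pt p(1) nz span1_iff vec.scale)
  then show ?thesis unfolding epipolar_line1_def p(2) by blast
qed

lemma center_on_epipolar_line2:
  assumes "is_camera P1" "is_camera P2" "center P1 \<noteq> center P2"
  shows "center P2 \<in> epipolar_line2 P1 P2 Q1 Q2"
  using center_on_epipolar_line1[OF assms(2,1) assms(3)[symmetric], of Q2 Q1]
  unfolding epipolar_line_swap(1)[of P2 P1 Q2 Q1] .

context two_views
begin

lemma curve_typeI:
  assumes "plane_curve plane F d A" "plane_curve plane' F' d' A'" "C = A \<union> A'"
    and "finite (C \<inter> points plane - A)" "finite (C \<inter> points plane' - A')"
    and "x \<noteq> 0" "\<beta>1 (A1 x) = 0" "\<omega>1 (A1 x) = 0" "\<beta>2 (A2 x) = 0"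
    and "has_multiplicity_blowup P1 P2 plane F (pt x, picture Q1 (center Q2), picture Q2 (center Q1)) m0"
    and "has_multiplicity plane F (center P1) m1" "has_multiplicity plane F (center P2) m2"
  shows "curve_type P1 P2 Q1 Q2 C (int d, int d', int m0, int m1, int m2)"
proof -
  have "\<not> {center P1, center P2} \<subseteq> points plane \<inter> points plane'" using center_notin_plane' by blast
  moreover note is_plane_plane is_plane_plane' planes_neq quadric_eq epipolar_lines_in_plane
    epipolar_intersection_in_blowup[OF assms(6-9)] assms
  ultimately show ?thesis unfolding curve_type_def prod.case by blast
qed

end

section \<open>The two planes are determined by the quadric and the epipolar lines\<close>

lemma plane_subset_eq:
  assumes "is_plane W" "is_plane V" "W \<subseteq> V"
  shows "W = V"
  using assms vec.subspace_dim_equal[of W V] unfolding is_plane_def by simp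

lemma subspace_subset_union:
  assumes W: "vec.subspace (W :: (complex ^ 'n::finite) set)" and V: "vec.subspace V" "vec.subspace V'"
    and sub: "W \<subseteq> V \<union> V'"
  shows "W \<subseteq> V \<or> W \<subseteq> V'"
proof (rule ccontr)
  assume "\<not> (W \<subseteq> V \<or> W \<subseteq> V')"
  then obtain x y where x: "x \<in> W" "x \<notin> V" and y: "y \<in> W" "y \<notin> V'" by blast
  have xV': "x \<in> V'" and yV: "y \<in> V" using sub x y by blast+
  have "x + y \<in> W" using x y W vec.subspace_add by blast
  then have "x + y \<in> V \<or> x + y \<in> V'" using sub by blast
  then show False
  proof
    assume "x + y \<in> V"
    then have "x + y - y \<in> V" using yV V(1) vec.subspace_diff by blast
    then show False using x by simp
  next
    assume "x + y \<in> V'"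
    then have "x + y - x \<in> V'" using xV' V(2) vec.subspace_diff by blast
    then show False using y by simp
  qed
qed

lemma plane_subset_union:
  assumes W: "is_plane W" and V: "is_plane V" "is_plane V'" and sub: "points W \<subseteq> points V \<union> points V'"
  shows "W = V \<or> W = V'"
proof -
  note s = W[unfolded is_plane_def] V[unfolded is_plane_def]
  have "w \<in> V \<union> V'" if "w \<in> W" for w
  proof (cases "w = 0")
    case True
    then show ?thesis using s(2) vec.subspace_0 by blast
  next
    case False
    then show ?thesis using that sub s pt_in_points by blast
  qed
  then have "W \<subseteq> V \<or> W \<subseteq> V'" using s by (intro subspace_subset_union) auto
  then show ?thesis using plane_subset_eq W V by blast
qed

context two_views
begin

text \<open>The center of \<open>P2\<close> lies on an epipolar line but not on
  \<open>plane'\<close>; this tells the planes apart.\<close>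

lemma planes_unique:
  assumes W: "is_plane W" "is_plane W'" "W \<noteq> W'" and q: "quadric P1 P2 Q1 Q2 = points W \<union> points W'"
    and e: "epipolar_line2 P1 P2 Q1 Q2 \<subseteq> points W"
  shows "W = plane" "W' = plane'"
proof -
  have "points W \<subseteq> points plane \<union> points plane'" "points W' \<subseteq> points plane \<union> points plane'"
    using q quadric_eq by blast+
  then have "W = plane \<or> W = plane'" "W' = plane \<or> W' = plane'"
    using plane_subset_union W is_plane_plane is_plane_plane' by blast+
  moreover have "W \<noteq> plane'" using center_notin_plane' center_on_epipolar_line2[OF cameras(1,2) centers(1)] e by blast
  ultimately show "W = plane" "W' = plane'" using W(3) by blast+
qed

lemma curve_typeE:
  assumes "curve_type P1 P2 Q1 Q2 C (t, t', c0, c1, c2)"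
  obtains F F' A A' d d' m0 m1 m2 x where
    "plane_curve plane F d A" "plane_curve plane' F' d' A'" "C = A \<union> A'"
    "finite (C \<inter> points plane - A)" "finite (C \<inter> points plane' - A')"
    "x \<noteq> 0" "\<beta>1 (A1 x) = 0" "\<omega>1 (A1 x) = 0" "\<beta>2 (A2 x) = 0"
    "has_multiplicity_blowup P1 P2 plane F (pt x, picture Q1 (center Q2), picture Q2 (center Q1)) m0"
    "has_multiplicity plane F (center P1) m1" "has_multiplicity plane F (center P2) m2"
    "t = int d" "t' = int d'" "c0 = int m0" "c1 = int m1" "c2 = int m2"
proof -
  obtain W W' F F' A A' d d' m0 m1 m2 z u w where
     W: "is_plane W" "is_plane W'" "W \<noteq> W'"
       "quadric P1 P2 Q1 Q2 = points W \<union> points W'" "epipolar_line2 P1 P2 Q1 Q2 \<subseteq> points W" and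
     c: "C = A \<union> A'"
       "plane_curve W F d A" "finite (C \<inter> points W - A)"
       "plane_curve W' F' d' A'" "finite (C \<inter> points W' - A')" and
     z: "(z, u, w) \<in> blowup P1 P2"
       "u = picture Q1 (center Q2)" "w = picture Q2 (center Q1)" and
     m: "has_multiplicity_blowup P1 P2 W F (z, u, w) m0"
       "has_multiplicity W F (center P1) m1"
       "has_multiplicity W F (center P2) m2"
       "t = int d" "t' = int d'" "c0 = int m0" "c1 = int m1" "c2 = int m2"
    using assms unfolding curve_type_def prod.case by metis
  note eq = planes_unique[OF W]
  obtain x where x: "x \<noteq> 0" "z = pt x" by (rule pt_exhaust)
  note e = epipolar_intersection[OF x(1) z[unfolded x(2)]]
  show thesis
    by (rule that[OF c(2)[unfolded eq] c(4)[unfolded eq] c(1) c(3)[unfolded eq] c(5)[unfolded eq] x(1) e(1,2,3)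
      m(1)[unfolded eq x(2) z(2,3)] m(2,3)[unfolded eq] m(4-8)])
qed

end

context parametrized_views
begin

lemma conjugate_curve_exists:
  assumes A: "plane_curve plane F d A" and A': "plane_curve plane' F' d' A'" and C: "C = A \<union> A'"
    and fin: "finite (C \<inter> points plane - A)" "finite (C \<inter> points plane' - A')"
    and no_lines: "\<not> epipolar_line1 P1 P2 Q1 Q2 \<subseteq> C" "\<not> epipolar_line2 P1 P2 Q1 Q2 \<subseteq> C"
    "\<not> line_through (center P1) (center P2) \<subseteq> C"
  obtains n e FQ FQ' AQ AQ' where
    "\<And>v. F (comb b1 b2 b3 (\<kappa> v)) = monomial_in E n v * FQ (comb b1' b2' b3' v)"
    "d * 2 = e + (\<Sum>i\<in>E. n i)"
    "vanishes_on_no_line E (\<lambda>v. F (comb b1 b2 b3 v))"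
    "vanishes_on_no_line E (\<lambda>v. FQ (comb b1' b2' b3' v))"
    "plane_curve planeQ FQ e AQ" "plane_curve planeQ' FQ' d' AQ'"
    "conjugate_curve P1 P2 Q1 Q2 C = AQ \<union> AQ'"
    "finite (conjugate_curve P1 P2 Q1 Q2 C \<inter> points planeQ - AQ)"
    "finite (conjugate_curve P1 P2 Q1 Q2 C \<inter> points planeQ' - AQ')"
proof -
  note no_line = exceptional_lines_not_in_curve[OF A A' C no_lines]
  have f: "form d (\<lambda>v. F (comb b1 b2 b3 v))" by (rule form_comb) (rule curve_forms(1)[OF A A' C])
  obtain n e G where G: "\<And>v. F (comb b1 b2 b3 (\<kappa> v)) = monomial_in E n v * G v" "form e G"
    "d * 2 = e + (\<Sum>i\<in>E. n i)" "vanishes_on_no_line E G"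
    by (rule strict_transform_exists[OF f no_line]) (rule that)
  obtain FQ where FQ: "form e FQ" "\<And>v. FQ (comb b1' b2' b3' v) = G v"
    by (rule comb_extend[OF planes(6)[unfolded planeQ_span] G(2)]) (rule that)
  obtain w1 w2 w3 y1 y2 y3 where w: "plane' = vec.span {w1, w2, w3}" "planeQ' = vec.span {y1, y2, y3}"
    "\<And>v. B1 (comb y1 y2 y3 v) = A1 (comb w1 w2 w3 v)" "\<And>v. B2 (comb y1 y2 y3 v) = A2 (comb w1 w2 w3 v)"
    by (rule plane'_basis) (rule that)
  obtain FQ' where FQ': "form d' FQ'" "\<And>v. FQ' (comb y1 y2 y3 v) = F' (comb w1 w2 w3 v)"
    by (rule comb_extend[OF planes(8)[unfolded w(2)] form_comb[OF curve_forms(2)[OF A A' C]]]) (rule that)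
  note args = A A' C no_line G(2) G(4) G(1) FQ w FQ'
  show thesis
  proof (rule that[of n FQ e])
    show "F (comb b1 b2 b3 (\<kappa> v)) = monomial_in E n v * FQ (comb b1' b2' b3' v)" for v
      unfolding FQ(2) by (rule G(1))
    show "vanishes_on_no_line E (\<lambda>v. FQ (comb b1' b2' b3' v))" unfolding FQ(2) by (rule G(4))
  qed (rule G(3) no_line plane_curves_Q[OF args] conjugate_curve_eq[OF args] finite_conjugate_curve_Q[OF args fin])+
qed

end

subsection \<open>The birational map in coordinates\<close>

lemma pt_multiple: "x \<noteq> 0 \<Longrightarrow> x = c *s y \<Longrightarrow> pt x = pt y"
  using pt_scale[of c y] by auto

lemma prod_3: "prod f (UNIV :: 3 set) = f 1 * f 2 * f 3"
  unfolding UNIV_3 by (simp add: mult_ac)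

lemma quadratic_involution_cremona:
  "quadratic_involution UNIV (\<lambda>v. vector [v $ 2 * v $ 3, v $ 1 * v $ 3, v $ 1 * v $ 2]) (\<lambda>_. 1)"
proof
  fix i :: 3
  have "form 2 (\<lambda>v :: complex ^ 3. v $ i * v $ j)" for i j :: 3
    using form_mult[OF form_coord form_coord, of i j] by (simp add: numeral_2_eq_2)
  then show "form 2 (\<lambda>v :: complex ^ 3. vector [v $ 2 * v $ 3, v $ 1 * v $ 3, v $ 1 * v $ 2] $ i)"
    by (intro form_vector_3)
next
  fix v :: "complex ^ 3" and j :: 3
  assume "\<And>i :: 3. i \<in> UNIV \<Longrightarrow> v $ i \<noteq> 0"
  then show "vector [v $ 2 * v $ 3, v $ 1 * v $ 3, v $ 1 * v $ 2] $ j \<noteq> 0"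
    using exhaust_3[of j] by auto
qed (auto simp: monomial_in_def prod_3 vec_eq_iff forall_3)

context two_views
begin

lemma X_eqI: "\<alpha>1 X = \<alpha>1 Y \<Longrightarrow> \<beta>1 X = \<beta>1 Y \<Longrightarrow> \<omega>1 X = \<omega>1 Y \<Longrightarrow> X = Y"
proof -
  assume *: "\<alpha>1 X = \<alpha>1 Y" "\<beta>1 X = \<beta>1 Y" "\<omega>1 X = \<omega>1 Y"
  have "\<alpha>1 (X + (- 1) *s Y) = 0" "\<beta>1 (X + (- 1) *s Y) = 0" "\<omega>1 (X + (- 1) *s Y) = 0"
    by (simp_all only: linear_forms *) simp_all
  then have "X + (- 1) *s Y = 0" by (rule regular1)
  then show ?thesis by simp
qed

lemma center_coordinates:
  obtains p1 p2 where "p1 \<noteq> 0" "center P1 = pt p1" "p1 \<in> plane" "\<alpha>1 (A1 p1) = 0" "\<beta>1 (A1 p1) = 0" "\<alpha>2 (A2 p1) = 0"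
    "p2 \<noteq> 0" "center P2 = pt p2" "p2 \<in> plane" "\<alpha>1 (A1 p2) = 0" "A2 p2 = 0"
proof -
  obtain p1 p2 where p: "p1 \<noteq> 0" "p2 \<noteq> 0" "center P1 = pt p1" "center P2 = pt p2" "A1 p1 = 0" "A2 p2 = 0"
    by (rule center_vectors) (rule that)
  have "\<omega>1 (A1 p1) = 0" "\<alpha>1 (A1 p1) = 0" "\<beta>1 (A1 p1) = 0" unfolding p(5) by (rule forms_0)+
  moreover have "\<alpha>2 (A2 p1) = 0" using A_rel[of p1] calculation by simp
  moreover have "\<omega>1 (A1 p2) = 0" "\<alpha>1 (A1 p2) = 0" unfolding A_rel p(6) by (rule forms_0)+
  ultimately show thesis using p by (intro that[of p1 p2]) (simp_all add: plane_def)
qed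

text \<open>The coordinates are (\<beta>2, \<beta>1, \<alpha>1) on the plane of \<open>P\<close> and
  (\<alpha>2, \<alpha>1, \<beta>1) on that of \<open>Q\<close>. Multiplying the first view by
  \<beta>2 and the second by \<beta>1, and using \<alpha>1 = \<alpha>2 on the views from
  \<open>P\<close>, turns (v1, v2, v3) into (v2 v3, v1 v3, v1 v2).\<close>

lemma conjugate_curve_type_generic:
  assumes regular2: "\<And>Y. \<alpha>2 Y = 0 \<Longrightarrow> \<beta>2 Y = 0 \<Longrightarrow> \<omega>2 Y = 0 \<Longrightarrow> Y = 0"
    and type: "curve_type P1 P2 Q1 Q2 C (t, t', c0, c1, c2)"
    and no_lines: "\<not> epipolar_line1 P1 P2 Q1 Q2 \<subseteq> C" "\<not> epipolar_line2 P1 P2 Q1 Q2 \<subseteq> C"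
    "\<not> line_through (center P1) (center P2) \<subseteq> C"
  shows "curve_type Q1 Q2 P1 P2 (conjugate_curve P1 P2 Q1 Q2 C)
    (2 * t - c0 - c1 - c2, t', t - c1 - c2, t - c0 - c2, t - c0 - c1)"
proof -
  have Y_eqI: "X = Y" if "\<alpha>2 X = \<alpha>2 Y" "\<beta>2 X = \<beta>2 Y" "\<omega>2 X = \<omega>2 Y" for X Y
  proof -
    have "\<alpha>2 (X + (- 1) *s Y) = 0" "\<beta>2 (X + (- 1) *s Y) = 0" "\<omega>2 (X + (- 1) *s Y) = 0"
      by (simp_all only: linear_forms that) simp_all
    then have "X + (- 1) *s Y = 0" by (rule regular2)
    then show ?thesis by simp
  qed
  interpret Q: two_views Q1 Q2 P1 P2 b a \<beta>1 \<alpha>1 \<omega>1 \<beta>2 \<alpha>2 \<omega>2 by (rule symmetric)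
  have ker: "x = 0" if "x \<in> plane" "\<beta>2 (A2 x) = 0" "\<beta>1 (A1 x) = 0" "\<alpha>1 (A1 x) = 0" for x
    using that A_injective[of x] regular1[of "A1 x"] regular2[of "A2 x"] A_rel[of x] by (simp add: plane_def)
  have kerQ: "x = 0" if "x \<in> Q.plane" "\<alpha>2 (B2 x) = 0" "\<alpha>1 (B1 x) = 0" "\<beta>1 (B1 x) = 0" for x
    using that Q.A_injective[of x] regular1[of "B1 x"] regular2[of "B2 x"] B_rel[of x] by (simp add: Q.plane_def)
  have dims: "vec.subspace plane" "vec.dim plane = 3" "vec.subspace Q.plane" "vec.dim Q.plane = 3"
    using is_plane_plane Q.is_plane_plane unfolding is_plane_def by blast+
  obtain b1 b2 b3 where b: "plane = vec.span {b1, b2, b3}" "\<And>v. \<beta>2 (A2 (comb b1 b2 b3 v)) = v $ 1"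
    "\<And>v. \<beta>1 (A1 (comb b1 b2 b3 v)) = v $ 2" "\<And>v. \<alpha>1 (A1 (comb b1 b2 b3 v)) = v $ 3"
    by (rule dual_basis_of_plane[OF dims(1,2) A_forms(5,2,1) ker]) (assumption | rule that)+
  obtain b1' b2' b3' where b': "Q.plane = vec.span {b1', b2', b3'}" "\<And>v. \<alpha>2 (B2 (comb b1' b2' b3' v)) = v $ 1"
    "\<And>v. \<alpha>1 (B1 (comb b1' b2' b3' v)) = v $ 2" "\<And>v. \<beta>1 (B1 (comb b1' b2' b3' v)) = v $ 3"
    by (rule dual_basis_of_plane[OF dims(3,4) Q.A_forms(5,2,1) kerQ]) (assumption | rule that)+
  have inP: "\<omega>1 (A1 (comb b1 b2 b3 v)) = 0" for v
    using mem_span_comb[of "comb b1 b2 b3 v" b1 b2 b3] b(1) by (auto simp: plane_def)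
  have inQ: "\<omega>1 (B1 (comb b1' b2' b3' v)) = 0" for v
    using mem_span_comb[of "comb b1' b2' b3' v" b1' b2' b3'] b'(1) by (auto simp: Q.plane_def)
  define \<kappa> :: "complex ^ 3 \<Rightarrow> complex ^ 3" where "\<kappa> v = vector [v $ 2 * v $ 3, v $ 1 * v $ 3, v $ 1 * v $ 2]" for v
  interpret V: parametrized_views P1 P2 Q1 Q2 a b \<alpha>1 \<beta>1 \<omega>1 \<alpha>2 \<beta>2 \<omega>2 UNIV \<kappa> "\<lambda>_. 1" b1 b2 b3 b1' b2' b3'
  proof (intro parametrized_views.intro parametrized_views_axioms.intro)
    show "two_views P1 P2 Q1 Q2 a b \<alpha>1 \<beta>1 \<omega>1 \<alpha>2 \<beta>2 \<omega>2" by (rule two_views_axioms)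
    show "quadratic_involution UNIV \<kappa> (\<lambda>_. 1)" using quadratic_involution_cremona unfolding \<kappa>_def .
    show "two_views.plane P1 \<omega>1 = vec.span {b1, b2, b3}" by (rule b(1))
    show "{y. \<omega>1 (B1 y) = 0} = vec.span {b1', b2', b3'}" using b'(1) unfolding Q.plane_def .
    fix v
    define X Y where X: "X = A1 (comb b1 b2 b3 v)" and Y: "Y = A2 (comb b1 b2 b3 v)"
    have val: "\<beta>2 Y = v $ 1" "\<beta>1 X = v $ 2" "\<alpha>1 X = v $ 3" "\<omega>1 X = 0" "\<alpha>2 Y = v $ 3" "\<omega>2 Y = 0"
      unfolding X Y A_rel[symmetric] by (rule b inP)+
    define X' Y' where X': "X' = B1 (comb b1' b2' b3' (\<kappa> v))" and Y': "Y' = B2 (comb b1' b2' b3' (\<kappa> v))"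
    have val': "\<alpha>2 Y' = \<kappa> v $ 1" "\<alpha>1 X' = \<kappa> v $ 2" "\<beta>1 X' = \<kappa> v $ 3" "\<omega>1 X' = 0" "\<beta>2 Y' = \<kappa> v $ 3" "\<omega>2 Y' = 0"
      unfolding X' Y' B_rel[symmetric] by (rule b' inQ)+
    have "X' = \<beta>2 Y *s X" by (rule X_eqI) (simp_all add: linear_forms val val' \<kappa>_def)
    then show "B1 (comb b1' b2' b3' (\<kappa> v)) = \<beta>2 (A2 (comb b1 b2 b3 v)) *s A1 (comb b1 b2 b3 v)"
      unfolding X Y X' .
    have "Y' = \<beta>1 X *s Y" by (rule Y_eqI) (simp_all add: linear_forms val val' \<kappa>_def)
    then show "B2 (comb b1' b2' b3' (\<kappa> v)) = \<beta>1 (A1 (comb b1 b2 b3 v)) *s A2 (comb b1 b2 b3 v)"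
      unfolding X Y Y' .
    show "(\<forall>i\<in>UNIV. v $ i \<noteq> 0) \<longleftrightarrow> \<beta>1 (A1 (comb b1 b2 b3 v)) \<noteq> 0 \<and>
      \<beta>2 (A2 (comb b1 b2 b3 v)) \<noteq> 0 \<and> \<alpha>1 (A1 (comb b1 b2 b3 v)) \<noteq> 0"
      by (auto simp: b forall_3)
    show "(\<forall>v. \<beta>1 (A1 (comb b1 b2 b3 v)) = 0 \<longrightarrow> v $ i = 0) \<or>
      (\<forall>v. \<beta>2 (A2 (comb b1 b2 b3 v)) = 0 \<longrightarrow> v $ i = 0) \<or>
      (\<forall>v. \<alpha>1 (A1 (comb b1 b2 b3 v)) = 0 \<longrightarrow> v $ i = 0)" for i
      using exhaust_3[of i] by (auto simp: b)
  qed
  obtain F F' A A' d d' m0 m1 m2 x where F: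
    "plane_curve plane F d A" "plane_curve plane' F' d' A'" "C = A \<union> A'"
    "finite (C \<inter> points plane - A)" "finite (C \<inter> points plane' - A')"
    and x: "x \<noteq> 0" "\<beta>1 (A1 x) = 0" "\<omega>1 (A1 x) = 0" "\<beta>2 (A2 x) = 0"
    and m: "has_multiplicity_blowup P1 P2 plane F (pt x, picture Q1 (center Q2), picture Q2 (center Q1)) m0"
    "has_multiplicity plane F (center P1) m1" "has_multiplicity plane F (center P2) m2"
    and type_eq: "t = int d" "t' = int d'" "c0 = int m0" "c1 = int m1" "c2 = int m2"
    by (rule curve_typeE[OF type]) (rule that)
  obtain n e FQ FQ' AQ AQ' where
    eq: "\<And>v. F (comb b1 b2 b3 (\<kappa> v)) = monomial_in UNIV n v * FQ (comb b1' b2' b3' v)"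
    and deg: "d * 2 = e + (\<Sum>i\<in>UNIV. n i)"
    and nl: "vanishes_on_no_line UNIV (\<lambda>v. F (comb b1 b2 b3 v))"
    "vanishes_on_no_line UNIV (\<lambda>v. FQ (comb b1' b2' b3' v))"
    and CQ: "plane_curve V.planeQ FQ e AQ" "plane_curve V.planeQ' FQ' d' AQ'"
    "conjugate_curve P1 P2 Q1 Q2 C = AQ \<union> AQ'"
    "finite (conjugate_curve P1 P2 Q1 Q2 C \<inter> points V.planeQ - AQ)"
    "finite (conjugate_curve P1 P2 Q1 Q2 C \<inter> points V.planeQ' - AQ')"
    by (rule V.conjugate_curve_exists[OF F no_lines]) (rule that)
  have pq: "V.planeQ = Q.plane" "V.planeQ' = Q.plane'" unfolding Q.plane_def Q.plane'_def by simp_all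
  have Ff: "form d F" "form e FQ" using F(1) CQ(1) unfolding plane_curve_def by blast+
  have eq': "F ((v * w) *s b1 + (u * w) *s b2 + (u * v) *s b3) =
      u ^ n 1 * v ^ n 2 * w ^ n 3 * FQ (u *s b1' + v *s b2' + w *s b3')" for u v w
    using eq[of "vector [u, v, w]"] by (simp add: \<kappa>_def comb_def monomial_in_def prod_3)
  have nz: "\<exists>p q. F (p *s b2 + q *s b3) \<noteq> 0" "\<exists>p q. F (p *s b1 + q *s b3) \<noteq> 0" "\<exists>p q. F (p *s b1 + q *s b2) \<noteq> 0"
    "\<exists>p q. FQ (p *s b2' + q *s b3') \<noteq> 0" "\<exists>p q. FQ (p *s b1' + q *s b3') \<noteq> 0" "\<exists>p q. FQ (p *s b1' + q *s b2') \<noteq> 0"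
    using nl unfolding vanishes_on_no_line_def comb_def by (force simp: forall_3)+
  have bas: "plane = vec.span {b2, b1, b3}" "plane = vec.span {b3, b1, b2}"
    "Q.plane = vec.span {b2', b1', b3'}" "Q.plane = vec.span {b3', b1', b2'}"
    unfolding b(1) b'(1) by (simp_all add: insert_commute)
  \<comment> \<open>The same identity with the second, and next with the third, base point moved to
    the front.\<close>
  have eq2: "F ((v * w) *s b2 + (u * w) *s b1 + (u * v) *s b3) =
      u ^ n 2 * v ^ n 1 * w ^ n 3 * FQ (u *s b2' + v *s b1' + w *s b3')" for u v w
    using eq'[where u = v and v = u and w = w] by (simp add: mult_ac add_ac)
  have eq3: "F ((v * w) *s b3 + (u * w) *s b1 + (u * v) *s b2) =
      u ^ n 3 * v ^ n 1 * w ^ n 2 * FQ (u *s b3' + v *s b1' + w *s b2')" for u v w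
    using eq'[where u = v and v = w and w = u] by (simp add: mult_ac add_ac)
  have val: "\<beta>2 (A2 b2) = 0" "\<beta>2 (A2 b3) = 0" "\<beta>1 (A1 b3) = 0" "\<alpha>1 (A1 b3) = 1" "\<beta>1 (A1 b1) = 0"
    "\<omega>1 (A1 b3) = 0" "\<alpha>1 (A1 b1) = 0"
    using b(2-4)[of "vector [1, 0, 0]"] b(2-4)[of "vector [0, 1, 0]"] b(2-4)[of "vector [0, 0, 1]"]
      inP[of "vector [0, 0, 1]"] by (simp_all add: comb_def)
  have val': "\<alpha>2 (B2 b3') = 0" "\<alpha>1 (B1 b3') = 0" "\<beta>1 (B1 b3') = 1" "\<omega>1 (B1 b3') = 0"
    using b'(2-4)[of "vector [0, 0, 1]"] inQ[of "vector [0, 0, 1]"] by (simp_all add: comb_def)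
  have b3: "b3 \<noteq> 0" "b3' \<noteq> 0" using val(4) val'(3) forms_0 by auto
  have cP: "center P1 = pt b1" "center P2 = pt b2"
  proof -
    obtain p1 p2 where p: "p1 \<noteq> 0" "center P1 = pt p1" "p1 \<in> plane" "\<alpha>1 (A1 p1) = 0" "\<beta>1 (A1 p1) = 0"
      "p2 \<noteq> 0" "center P2 = pt p2" "p2 \<in> plane" "\<alpha>1 (A1 p2) = 0" "A2 p2 = 0"
      by (rule center_coordinates) (rule that)
    obtain v w where v: "p1 = comb b1 b2 b3 v" and w: "p2 = comb b1 b2 b3 w" using p(3,8) b(1) mem_span_comb by metis
    have "\<beta>2 (A2 p2) = 0" unfolding p(10) by (rule forms_0)
    then have "v $ 2 = 0" "v $ 3 = 0" "w $ 1 = 0" "w $ 3 = 0"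
      using b(3,4)[of v] b(2,4)[of w] p(4,5,9) unfolding v w by simp_all
    then have "p1 = v $ 1 *s b1" "p2 = w $ 2 *s b2" unfolding v w by (simp_all add: comb_def)
    then show "center P1 = pt b1" "center P2 = pt b2"
      using pt_multiple[OF p(1)] pt_multiple[OF p(6)] p(2,7) by metis+
  qed
  have cQ: "center Q1 = pt b1'" "center Q2 = pt b2'"
  proof -
    obtain p1 p2 where p: "p1 \<noteq> 0" "center Q1 = pt p1" "p1 \<in> Q.plane" "\<beta>1 (B1 p1) = 0" "\<alpha>1 (B1 p1) = 0"
      "p2 \<noteq> 0" "center Q2 = pt p2" "p2 \<in> Q.plane" "\<beta>1 (B1 p2) = 0" "B2 p2 = 0"
      by (rule Q.center_coordinates) (rule that)
    obtain v w where v: "p1 = comb b1' b2' b3' v" and w: "p2 = comb b1' b2' b3' w" using p(3,8) b'(1) mem_span_comb by metis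
    have "\<alpha>2 (B2 p2) = 0" unfolding p(10) by (rule forms_0)
    then have "v $ 2 = 0" "v $ 3 = 0" "w $ 1 = 0" "w $ 3 = 0"
      using b'(3,4)[of v] b'(2,4)[of w] p(4,5,9) unfolding v w by simp_all
    then have "p1 = v $ 1 *s b1'" "p2 = w $ 2 *s b2'" unfolding v w by (simp_all add: comb_def)
    then show "center Q1 = pt b1'" "center Q2 = pt b2'"
      using pt_multiple[OF p(1)] pt_multiple[OF p(6)] p(2,7) by metis+
  qed
  have xb: "pt x = pt b3"
  proof -
    have "x \<in> plane" using x(3) by (simp add: plane_def)
    then obtain v where v: "x = comb b1 b2 b3 v" unfolding b(1) mem_span_comb by blast
    then have "v $ 1 = 0" "v $ 2 = 0" using b(2,3)[of v] x(2,4) by simp_all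
    then have "x = v $ 3 *s b3" unfolding v by (simp add: comb_def)
    then show ?thesis using x(1) pt_multiple by blast
  qed
  have A_nz: "A1 b3 \<noteq> 0" "cmatrix P2 *v b3 \<noteq> 0" "B1 b3' \<noteq> 0" "cmatrix Q2 *v b3' \<noteq> 0"
    using val(4) val'(3) A_rel(1)[of b3] B_rel(1)[of b3'] forms_0 by auto
  have ne: "pt b3 \<noteq> center P1" "pt b3 \<noteq> center P2" "pt b3' \<noteq> center Q1" "pt b3' \<noteq> center Q2"
    using A_nz pt_eq_center_iff cameras b3 by blast+
  obtain p1 q1 p2 q2 p3 q3 p1' q1' p2' q2' p3' q3' where
    n: "F (p1 *s b2 + q1 *s b3) \<noteq> 0" "F (p2 *s b1 + q2 *s b3) \<noteq> 0" "F (p3 *s b1 + q3 *s b2) \<noteq> 0"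
    "FQ (p1' *s b2' + q1' *s b3') \<noteq> 0" "FQ (p2' *s b1' + q2' *s b3') \<noteq> 0" "FQ (p3' *s b1' + q3' *s b2') \<noteq> 0"
    using nz by blast
  note M1 = cremona_multiplicity[OF Ff dims(2,4) b(1) b'(1) eq' n(1,4)]
  note M2 = cremona_multiplicity[OF Ff dims(2,4) bas(1,3) eq2 n(2,5)]
  note M3 = cremona_multiplicity[OF Ff dims(2,4) bas(2,4) eq3 n(3,6)]
  have mn: "m0 = n 3" "m1 = n 1" "m2 = n 2"
    using m(1) M1(1) M2(1) M3(1) m(2,3)[unfolded cP] ne unfolding xb by simp_all
  have blow: "has_multiplicity_blowup Q1 Q2 Q.plane FQ (pt b3', picture P1 (center P2), picture P2 (center P1)) (d - (n 1 + n 2))"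
    using ne M3(3) by simp
  have ct: "curve_type Q1 Q2 P1 P2 (conjugate_curve P1 P2 Q1 Q2 C)
    (int e, int d', int (d - (n 1 + n 2)), int (d - (n 2 + n 3)), int (d - (n 1 + n 3)))"
    by (rule Q.curve_typeI[OF CQ(1,2)[unfolded pq] CQ(3) CQ(4,5)[unfolded pq] b3(2) val'(2,4,1) blow
      M1(3)[folded cQ] M2(3)[folded cQ]])
  \<comment> \<open>The pullback has degree 2 d, and the removed exponents n 1, n 2, n 3 are
    \<open>m1\<close>, \<open>m2\<close>, \<open>m0\<close>. The bounds from the multiplicity lemma
    turn the truncated differences into integer ones.\<close>
  have ar: "2 * t - c0 - c1 - c2 = int e" "t - c1 - c2 = int (d - (n 1 + n 2))"
    "t - c0 - c2 = int (d - (n 2 + n 3))" "t - c0 - c1 = int (d - (n 1 + n 3))"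
    using deg M1(2) M2(2) M3(2) by (simp_all add: type_eq mn sum_3 of_nat_diff)
  show ?thesis using ct unfolding ar type_eq(2) .
qed

end

section \<open>The case of a center on both planes\<close>

lemma quadratic_involution_degenerate:
  "quadratic_involution {1, 3} (\<lambda>v. vector [(v $ 3)\<^sup>2, v $ 1 * v $ 2, v $ 1 * v $ 3]) (\<lambda>i. if i = 1 then 1 else 2)"
proof
  fix i :: 3
  have "form 2 (\<lambda>v :: complex ^ 3. v $ i * v $ j)" for i j :: 3
    using form_mult[OF form_coord form_coord, of i j] by (simp add: numeral_2_eq_2)
  then show "form 2 (\<lambda>v :: complex ^ 3. vector [(v $ 3)\<^sup>2, v $ 1 * v $ 2, v $ 1 * v $ 3] $ i)"
    unfolding power2_eq_square by (intro form_vector_3)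
qed (auto simp: monomial_in_def vec_eq_iff forall_3 power2_eq_square)

context two_views
begin

text \<open>The common zero \<open>Y0\<close> makes \<beta>2 proportional to \<alpha>2 where
  \<omega>2 = 0. The second epipolar line is then the line of the centers, and it meets the first
  epipolar line in the center of \<open>P1\<close>. On the side of \<open>Q\<close> the same
  happens, since \<open>Y0\<close> enters symmetrically in \<alpha>2 and \<beta>2.\<close>

lemma conjugate_curve_type_degenerate:
  assumes Y0: "Y0 \<noteq> 0" "\<alpha>2 Y0 = 0" "\<beta>2 Y0 = 0" "\<omega>2 Y0 = 0"
    and type: "curve_type P1 P2 Q1 Q2 C (t, t', c0, c1, c2)"
    and no_lines: "\<not> epipolar_line1 P1 P2 Q1 Q2 \<subseteq> C" "\<not> epipolar_line2 P1 P2 Q1 Q2 \<subseteq> C"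
    "\<not> line_through (center P1) (center P2) \<subseteq> C"
  shows "curve_type Q1 Q2 P1 P2 (conjugate_curve P1 P2 Q1 Q2 C)
    (2 * t - c0 - c1 - c2, t', t - c1 - c2, t - c0 - c2, t - c0 - c1)"
proof -
  \<comment> \<open>With \<beta>2 dependent on \<alpha>2, a third coordinate is missing on the
    plane. A coordinate of the second view in which \<open>Y0\<close> is nonzero complements
    \<alpha>2 and \<omega>2.\<close>
  obtain i where i: "Y0 $ i \<noteq> 0" using Y0(1) by (auto simp: vec_eq_iff)
  have multiple: "\<exists>c. Y = c *s Y0" if "\<alpha>2 Y = 0" "\<omega>2 Y = 0" for Y
    using functional_pair_kernel[OF forms(4,6) ind\<alpha>(3,4) Y0(1,2,4) that] by metis
  have regular: "Y = 0" if "\<alpha>2 Y = 0" "Y $ i = 0" "\<omega>2 Y = 0" for Y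
    using multiple[of Y] that i by auto
  have Y_eqI: "X = Y" if "\<alpha>2 X = \<alpha>2 Y" "X $ i = Y $ i" "\<omega>2 X = \<omega>2 Y" for X Y
  proof -
    have "\<alpha>2 (X + (- 1) *s Y) = 0" "\<omega>2 (X + (- 1) *s Y) = 0"
      by (simp_all only: linear_forms that) simp_all
    then have "X + (- 1) *s Y = 0" using that(2) by (intro regular) simp_all
    then show ?thesis by simp
  qed
  obtain T where T: "\<alpha>2 T = 1" "\<omega>2 T = 0" using ind\<alpha>(3) by blast
  \<comment> \<open>The factor of proportionality between \<beta>2 and \<alpha>2 on the kernel of
    \<omega>2.\<close>
  define s where "s = \<beta>2 T"
  have s: "\<beta>2 Y = s * \<alpha>2 Y" if "\<omega>2 Y = 0" for Y
  proof -
    have "\<alpha>2 (Y + (- \<alpha>2 Y) *s T) = 0" "\<omega>2 (Y + (- \<alpha>2 Y) *s T) = 0"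
      by (simp_all only: linear_forms that T) simp_all
    then obtain c where "Y + (- \<alpha>2 Y) *s T = c *s Y0" using multiple by blast
    then have "\<beta>2 (Y + (- \<alpha>2 Y) *s T) = 0" using Y0(3) by (simp add: linear_forms)
    then show ?thesis by (simp only: linear_forms) (simp add: s_def)
  qed
  have s0: "s \<noteq> 0"
  proof
    obtain Y where Y: "\<beta>2 Y = 1" "\<omega>2 Y = 0" using ind\<beta>(3) by blast
    assume "s = 0"
    then show False using s[OF Y(2)] Y(1) by simp
  qed
  interpret Q: two_views Q1 Q2 P1 P2 b a \<beta>1 \<alpha>1 \<omega>1 \<beta>2 \<alpha>2 \<omega>2 by (rule symmetric)
  have ker: "x = 0" if "x \<in> plane" "\<beta>1 (A1 x) = 0" "A2 x $ i = 0" "\<alpha>1 (A1 x) = 0" for x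
  proof (rule A_injective)
    show "A1 x = 0" using that by (intro regular1) (simp_all add: plane_def)
    show "A2 x = 0" using that A_rel[of x] by (intro regular) (simp_all add: plane_def)
  qed
  have kerQ: "x = 0" if "x \<in> Q.plane" "1 / s * \<alpha>1 (B1 x) = 0" "B2 x $ i = 0" "1 / s * \<beta>1 (B1 x) = 0" for x
  proof (rule Q.A_injective)
    show "B1 x = 0" using that s0 by (intro regular1) (simp_all add: Q.plane_def)
    have "\<omega>2 (B2 x) = 0" "\<beta>2 (B2 x) = 0" using that s0 B_rel[of x] by (simp_all add: Q.plane_def)
    then show "B2 x = 0" using that(3) s[of "B2 x"] s0 by (intro regular) simp_all
  qed
  have dims: "vec.subspace plane" "vec.dim plane = 3" "vec.subspace Q.plane" "vec.dim Q.plane = 3"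
    using is_plane_plane Q.is_plane_plane unfolding is_plane_def by blast+
  have coord: "form 1 (\<lambda>x. A2 x $ i)" "form 1 (\<lambda>x. B2 x $ i)"
    using form_scale[OF form_matrix] by simp_all
  obtain b1 b2 b3 where b: "plane = vec.span {b1, b2, b3}" "\<And>v. \<beta>1 (A1 (comb b1 b2 b3 v)) = v $ 1"
    "\<And>v. A2 (comb b1 b2 b3 v) $ i = v $ 2" "\<And>v. \<alpha>1 (A1 (comb b1 b2 b3 v)) = v $ 3"
    by (rule dual_basis_of_plane[OF dims(1,2) A_forms(2) coord(1) A_forms(1) ker]) (assumption | rule that)+
  \<comment> \<open>The first view is multiplied by \<beta>2 = s v3, so \<alpha>1 and \<beta>1 take
    the values s v3^2 and s v1 v3; dividing them by \<open>s\<close> leaves \<kappa> without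
    constants.\<close>
  obtain b1' b2' b3' where b': "Q.plane = vec.span {b1', b2', b3'}"
    "\<And>v. 1 / s * \<alpha>1 (B1 (comb b1' b2' b3' v)) = v $ 1"
    "\<And>v. B2 (comb b1' b2' b3' v) $ i = v $ 2" "\<And>v. 1 / s * \<beta>1 (B1 (comb b1' b2' b3' v)) = v $ 3"
    by (rule dual_basis_of_plane[OF dims(3,4) form_scale[OF Q.A_forms(2)] coord(2) form_scale[OF Q.A_forms(1)] kerQ])
      (assumption | rule that)+
  have b's: "\<alpha>1 (B1 (comb b1' b2' b3' v)) = s * v $ 1" "\<beta>1 (B1 (comb b1' b2' b3' v)) = s * v $ 3" for v
    using b'(2,4)[of v] s0 by (simp_all add: field_simps)
  have inP: "\<omega>1 (A1 (comb b1 b2 b3 v)) = 0" for v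
    using mem_span_comb[of "comb b1 b2 b3 v" b1 b2 b3] b(1) by (auto simp: plane_def)
  have inQ: "\<omega>1 (B1 (comb b1' b2' b3' v)) = 0" for v
    using mem_span_comb[of "comb b1' b2' b3' v" b1' b2' b3'] b'(1) by (auto simp: Q.plane_def)
  define \<kappa> :: "complex ^ 3 \<Rightarrow> complex ^ 3" where "\<kappa> v = vector [(v $ 3)\<^sup>2, v $ 1 * v $ 2, v $ 1 * v $ 3]" for v
  have P: "\<beta>2 (A2 (comb b1 b2 b3 v)) = s * v $ 3" "\<alpha>2 (A2 (comb b1 b2 b3 v)) = v $ 3"
    "\<omega>2 (A2 (comb b1 b2 b3 v)) = 0" for v
    using s[of "A2 (comb b1 b2 b3 v)"] A_rel[of "comb b1 b2 b3 v"] b(4)[of v] inP[of v] by simp_all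
  have Q: "\<alpha>2 (B2 (comb b1' b2' b3' v)) = v $ 3" "\<omega>2 (B2 (comb b1' b2' b3' v)) = 0" for v
    using s[of "B2 (comb b1' b2' b3' v)"] B_rel[of "comb b1' b2' b3' v"] b's(2)[of v] inQ[of v] s0 by simp_all
  interpret V: parametrized_views P1 P2 Q1 Q2 a b \<alpha>1 \<beta>1 \<omega>1 \<alpha>2 \<beta>2 \<omega>2 "{1, 3}" \<kappa> "\<lambda>j. if j = 1 then 1 else 2"
    b1 b2 b3 b1' b2' b3'
  proof (intro parametrized_views.intro parametrized_views_axioms.intro)
    show "two_views P1 P2 Q1 Q2 a b \<alpha>1 \<beta>1 \<omega>1 \<alpha>2 \<beta>2 \<omega>2" by (rule two_views_axioms)
    show "quadratic_involution {1, 3} \<kappa> (\<lambda>j. if j = 1 then 1 else 2)"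
      using quadratic_involution_degenerate unfolding \<kappa>_def .
    show "two_views.plane P1 \<omega>1 = vec.span {b1, b2, b3}" by (rule b(1))
    show "{y. \<omega>1 (B1 y) = 0} = vec.span {b1', b2', b3'}" using b'(1) unfolding Q.plane_def .
    fix v
    define X Y where X: "X = A1 (comb b1 b2 b3 v)" and Y: "Y = A2 (comb b1 b2 b3 v)"
    have val: "\<beta>1 X = v $ 1" "Y $ i = v $ 2" "\<alpha>1 X = v $ 3" "\<omega>1 X = 0" "\<beta>2 Y = s * v $ 3" "\<alpha>2 Y = v $ 3" "\<omega>2 Y = 0"
      unfolding X Y by (rule b inP P)+
    define X' Y' where X': "X' = B1 (comb b1' b2' b3' (\<kappa> v))" and Y': "Y' = B2 (comb b1' b2' b3' (\<kappa> v))"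
    have val': "\<alpha>1 X' = s * \<kappa> v $ 1" "Y' $ i = \<kappa> v $ 2" "\<beta>1 X' = s * \<kappa> v $ 3" "\<omega>1 X' = 0"
      "\<alpha>2 Y' = \<kappa> v $ 3" "\<omega>2 Y' = 0"
      unfolding X' Y' by (rule b's b' inQ Q)+
    have "X' = \<beta>2 Y *s X" by (rule X_eqI) (simp_all add: linear_forms val val' \<kappa>_def power2_eq_square)
    then show "B1 (comb b1' b2' b3' (\<kappa> v)) = \<beta>2 (A2 (comb b1 b2 b3 v)) *s A1 (comb b1 b2 b3 v)"
      unfolding X Y X' .
    have "Y' = \<beta>1 X *s Y" by (rule Y_eqI) (simp_all add: linear_forms val val' \<kappa>_def)
    then show "B2 (comb b1' b2' b3' (\<kappa> v)) = \<beta>1 (A1 (comb b1 b2 b3 v)) *s A2 (comb b1 b2 b3 v)"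
      unfolding X Y Y' .
    show "(\<forall>i\<in>{1, 3}. v $ i \<noteq> 0) \<longleftrightarrow> \<beta>1 (A1 (comb b1 b2 b3 v)) \<noteq> 0 \<and>
      \<beta>2 (A2 (comb b1 b2 b3 v)) \<noteq> 0 \<and> \<alpha>1 (A1 (comb b1 b2 b3 v)) \<noteq> 0"
      unfolding X[symmetric] Y[symmetric] val using s0 by simp
  next
    fix j :: 3
    assume "j \<in> {1, 3}"
    then show "(\<forall>v. \<beta>1 (A1 (comb b1 b2 b3 v)) = 0 \<longrightarrow> v $ j = 0) \<or>
      (\<forall>v. \<beta>2 (A2 (comb b1 b2 b3 v)) = 0 \<longrightarrow> v $ j = 0) \<or>
      (\<forall>v. \<alpha>1 (A1 (comb b1 b2 b3 v)) = 0 \<longrightarrow> v $ j = 0)"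
      by (auto simp: b)
  qed
  obtain F F' A A' d d' m0 m1 m2 x where F:
    "plane_curve plane F d A" "plane_curve plane' F' d' A'" "C = A \<union> A'"
    "finite (C \<inter> points plane - A)" "finite (C \<inter> points plane' - A')"
    and x: "x \<noteq> 0" "\<beta>1 (A1 x) = 0" "\<omega>1 (A1 x) = 0" "\<beta>2 (A2 x) = 0"
    and m: "has_multiplicity_blowup P1 P2 plane F (pt x, picture Q1 (center Q2), picture Q2 (center Q1)) m0"
    "has_multiplicity plane F (center P1) m1" "has_multiplicity plane F (center P2) m2"
    and type_eq: "t = int d" "t' = int d'" "c0 = int m0" "c1 = int m1" "c2 = int m2"
    by (rule curve_typeE[OF type]) (rule that)
  obtain n e FQ FQ' AQ AQ' where
    eq: "\<And>v. F (comb b1 b2 b3 (\<kappa> v)) = monomial_in {1, 3} n v * FQ (comb b1' b2' b3' v)"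
    and deg: "d * 2 = e + (\<Sum>j\<in>{1, 3}. n j)"
    and nl: "vanishes_on_no_line {1, 3} (\<lambda>v. F (comb b1 b2 b3 v))"
    "vanishes_on_no_line {1, 3} (\<lambda>v. FQ (comb b1' b2' b3' v))"
    and CQ: "plane_curve V.planeQ FQ e AQ" "plane_curve V.planeQ' FQ' d' AQ'"
    "conjugate_curve P1 P2 Q1 Q2 C = AQ \<union> AQ'"
    "finite (conjugate_curve P1 P2 Q1 Q2 C \<inter> points V.planeQ - AQ)"
    "finite (conjugate_curve P1 P2 Q1 Q2 C \<inter> points V.planeQ' - AQ')"
    by (rule V.conjugate_curve_exists[OF F no_lines]) (rule that)
  have pq: "V.planeQ = Q.plane" "V.planeQ' = Q.plane'" unfolding Q.plane_def Q.plane'_def by simp_all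
  have Ff: "form d F" "form e FQ" using F(1) CQ(1) unfolding plane_curve_def by blast+
  have eq': "F (w\<^sup>2 *s b1 + (u * v) *s b2 + (u * w) *s b3) = u ^ n 1 * w ^ n 3 * FQ (u *s b1' + v *s b2' + w *s b3')" for u v w
    using eq[of "vector [u, v, w]"] by (simp add: \<kappa>_def comb_def monomial_in_def)
  have "\<exists>p q. F (p *s b2 + q *s b3) \<noteq> 0" "\<exists>p q. FQ (p *s b2' + q *s b3') \<noteq> 0"
    "\<exists>p q. F (p *s b1 + q *s b2) \<noteq> 0" "\<exists>p q. FQ (p *s b1' + q *s b2') \<noteq> 0"
    using nl unfolding vanishes_on_no_line_def comb_def by force+
  then obtain p1 q1 p2 q2 p3 q3 p4 q4 where
    nz: "F (p1 *s b2 + q1 *s b3) \<noteq> 0" "FQ (p2 *s b2' + q2 *s b3') \<noteq> 0"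
    "F (p3 *s b1 + q3 *s b2) \<noteq> 0" "FQ (p4 *s b1' + q4 *s b2') \<noteq> 0"
    by blast
  have cP: "center P1 = pt b2" "center P2 = pt b1"
  proof -
    obtain p1 p2 where p: "p1 \<noteq> 0" "center P1 = pt p1" "p1 \<in> plane" "\<alpha>1 (A1 p1) = 0" "\<beta>1 (A1 p1) = 0"
      "p2 \<noteq> 0" "center P2 = pt p2" "p2 \<in> plane" "\<alpha>1 (A1 p2) = 0" "A2 p2 = 0"
      by (rule center_coordinates) (rule that)
    obtain v w where v: "p1 = comb b1 b2 b3 v" and w: "p2 = comb b1 b2 b3 w" using p(3,8) b(1) mem_span_comb by metis
    have "w $ 2 = 0" using b(3)[of w] unfolding w[symmetric] p(10) by simp
    moreover have "v $ 1 = 0" "v $ 3 = 0" "w $ 3 = 0"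
      using b(2,4)[of v] b(4)[of w] p(4,5,9) unfolding v w by simp_all
    ultimately have "p1 = v $ 2 *s b2" "p2 = w $ 1 *s b1" unfolding v w by (simp_all add: comb_def)
    then show "center P1 = pt b2" "center P2 = pt b1"
      using pt_multiple[OF p(1)] pt_multiple[OF p(6)] p(2,7) by metis+
  qed
  have cQ: "center Q1 = pt b2'" "center Q2 = pt b1'"
  proof -
    obtain p1 p2 where p: "p1 \<noteq> 0" "center Q1 = pt p1" "p1 \<in> Q.plane" "\<beta>1 (B1 p1) = 0" "\<alpha>1 (B1 p1) = 0"
      "p2 \<noteq> 0" "center Q2 = pt p2" "p2 \<in> Q.plane" "\<beta>1 (B1 p2) = 0" "B2 p2 = 0"
      by (rule Q.center_coordinates) (rule that)
    obtain v w where v: "p1 = comb b1' b2' b3' v" and w: "p2 = comb b1' b2' b3' w" using p(3,8) b'(1) mem_span_comb by metis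
    have "w $ 2 = 0" using b'(3)[of w] unfolding w[symmetric] p(10) by simp
    moreover have "v $ 1 = 0" "v $ 3 = 0" "w $ 3 = 0"
      using b's[of v] b's(2)[of w] p(4,5,9) s0 unfolding v w by simp_all
    ultimately have "p1 = v $ 2 *s b2'" "p2 = w $ 1 *s b1'" unfolding v w by (simp_all add: comb_def)
    then show "center Q1 = pt b2'" "center Q2 = pt b1'"
      using pt_multiple[OF p(1)] pt_multiple[OF p(6)] p(2,7) by metis+
  qed
  have xb: "pt x = pt b2"
  proof -
    have "x \<in> plane" using x(3) by (simp add: plane_def)
    then obtain v where v: "x = comb b1 b2 b3 v" unfolding b(1) mem_span_comb by blast
    then have "v $ 1 = 0" "v $ 3 = 0" using b(2)[of v] P(1)[of v] x(2,4) s0 by simp_all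
    then have "x = v $ 2 *s b2" unfolding v by (simp add: comb_def)
    then show ?thesis using x(1) pt_multiple by blast
  qed
  have line: "{v. A1 v \<in> line_of (picture Q1 (center Q2))} = vec.span {b2, b3}"
  proof -
    have "\<beta>1 (A1 y) = 0 \<and> \<omega>1 (A1 y) = 0 \<longleftrightarrow> y \<in> vec.span {b2, b3}" for y
    proof
      assume y: "\<beta>1 (A1 y) = 0 \<and> \<omega>1 (A1 y) = 0"
      then have "y \<in> plane" by (simp add: plane_def)
      then obtain v where v: "y = comb b1 b2 b3 v" unfolding b(1) mem_span_comb by blast
      then have "v $ 1 = 0" using b(2)[of v] y by simp
      then show "y \<in> vec.span {b2, b3}" unfolding v span2_iff by (auto simp: comb_def)
    next
      assume "y \<in> vec.span {b2, b3}"
      then obtain p q where "y = comb b1 b2 b3 (vector [0, p, q])" unfolding span2_iff by (auto simp: comb_def)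
      then show "\<beta>1 (A1 y) = 0 \<and> \<omega>1 (A1 y) = 0" using b(2) inP by simp
    qed
    then show ?thesis unfolding line_of_epipole1 by blast
  qed
  have line': "{v. B1 v \<in> line_of (picture P1 (center P2))} = vec.span {b2', b3'}"
  proof -
    have "\<alpha>1 (B1 y) = 0 \<and> \<omega>1 (B1 y) = 0 \<longleftrightarrow> y \<in> vec.span {b2', b3'}" for y
    proof
      assume y: "\<alpha>1 (B1 y) = 0 \<and> \<omega>1 (B1 y) = 0"
      then have "y \<in> Q.plane" by (simp add: Q.plane_def)
      then obtain v where v: "y = comb b1' b2' b3' v" unfolding b'(1) mem_span_comb by blast
      then have "v $ 1 = 0" using b's(1)[of v] y s0 by simp
      then show "y \<in> vec.span {b2', b3'}" unfolding v span2_iff by (auto simp: comb_def)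
    next
      assume "y \<in> vec.span {b2', b3'}"
      then obtain p q where "y = comb b1' b2' b3' (vector [0, p, q])" unfolding span2_iff by (auto simp: comb_def)
      then show "\<alpha>1 (B1 y) = 0 \<and> \<omega>1 (B1 y) = 0" using b's(1) inQ by simp
    qed
    then show ?thesis unfolding Q.line_of_epipole1 by blast
  qed
  \<comment> \<open>The epipolar lines meet in the center of \<open>P1\<close>, so the multiplicity
    in the blow-up is the infinitely near one, in the direction of the first epipolar line.\<close>
  have near: "has_infinitely_near_multiplicity plane F (pt b2) {v. A1 v \<in> line_of (picture Q1 (center Q2))} m0"
    using m(1) unfolding xb by (simp add: cP(1))
  note M = degenerate_multiplicity[OF Ff dims(2,4) b(1) b'(1) eq' nz line line' m(2)[unfolded cP] near]
  have mn: "m2 = n 1" "n 3 = m1 + m0" using M(1) M(5) m(3)[unfolded cP] by simp_all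
  have blow: "has_multiplicity_blowup Q1 Q2 Q.plane FQ (pt b2', picture P1 (center P2), picture P2 (center P1)) (d - (n 1 + m1))"
    using M(4) by (simp add: cQ(1))
  have b2: "b2' \<noteq> 0"
  proof
    assume "b2' = 0"
    then have "comb b1' b2' b3' (vector [0, 1, 0]) = 0" by (simp add: comb_def)
    then show False using b'(3)[of "vector [0, 1, 0]"] by simp
  qed
  have val': "\<alpha>1 (B1 b2') = 0" "\<omega>1 (B1 b2') = 0" "\<alpha>2 (B2 b2') = 0"
    using b's(1)[of "vector [0, 1, 0]"] inQ[of "vector [0, 1, 0]"] Q(1)[of "vector [0, 1, 0]"]
    by (simp_all add: comb_def)
  have ct: "curve_type Q1 Q2 P1 P2 (conjugate_curve P1 P2 Q1 Q2 C)
    (int e, int d', int (d - (n 1 + m1)), int (d + m1 - (n 1 + n 3)), int (d - n 3))"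
    by (rule Q.curve_typeI[OF CQ(1,2)[unfolded pq] CQ(3) CQ(4,5)[unfolded pq] b2 val' blow
      M(3)[folded cQ] M(2)[folded cQ]])
  \<comment> \<open>Since n 3 = \<open>m1\<close> + \<open>m0\<close> and n 1 = \<open>m2\<close>,
    the expression d + m1 - (n 1 + n 3) is d - m2 - m0.\<close>
  have ar: "2 * t - c0 - c1 - c2 = int e" "t - c1 - c2 = int (d - (n 1 + m1))"
    "t - c0 - c2 = int (d + m1 - (n 1 + n 3))" "t - c0 - c1 = int (d - n 3)"
    using deg M(6-8) mn by (simp_all add: type_eq of_nat_diff)
  show ?thesis using ct unfolding ar type_eq(2) .
qed

end

context two_views
begin

text \<open>A common zero of \<alpha>2, \<beta>2, \<omega>2 is a multiple of the second view of the
  first center, so the cases are whether that center lies on \<open>plane'\<close>.\<close>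

lemma conjugate_curve_type:
  assumes "curve_type P1 P2 Q1 Q2 C (t, t', c0, c1, c2)"
    and "\<not> epipolar_line1 P1 P2 Q1 Q2 \<subseteq> C" "\<not> epipolar_line2 P1 P2 Q1 Q2 \<subseteq> C"
    "\<not> line_through (center P1) (center P2) \<subseteq> C"
  shows "curve_type Q1 Q2 P1 P2 (conjugate_curve P1 P2 Q1 Q2 C)
    (2 * t - c0 - c1 - c2, t', t - c1 - c2, t - c0 - c2, t - c0 - c1)"
proof (cases "\<exists>Y. Y \<noteq> 0 \<and> \<alpha>2 Y = 0 \<and> \<beta>2 Y = 0 \<and> \<omega>2 Y = 0")
  case True
  then show ?thesis using conjugate_curve_type_degenerate assms by blast
next
  case False
  then show ?thesis using conjugate_curve_type_generic assms by blast
qed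

end

subsection \<open>Existence of common linear forms\<close>

lemma cameras_injective:
  assumes "is_camera P1" "is_camera P2" "center P1 \<noteq> center P2"
    and "cmatrix P1 *v x = 0" "cmatrix P2 *v x = 0"
  shows "x = 0"
  using pt_eq_center_iff[OF assms(1), of x] pt_eq_center_iff[OF assms(2), of x] assms(3-5) by auto

text \<open>For X and Y with \<omega>1 X = \<omega>2 Y = 0 and nonzero \<alpha>-values, the form of
  \<open>P\<close> vanishes, so up to scaling they are views of a vector of the plane \<omega>1 = 0,
  where the form of \<open>Q\<close> vanishes by assumption. Adding \<open>X1\<close> and
  \<open>Y1\<close> reaches zero \<alpha>-values by bilinearity.\<close>

lemma fundamental_form_vanishes:
  assumes cam: "is_camera P1" "is_camera P2" and ne: "center P1 \<noteq> center P2"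
    and \<alpha>: "form 1 \<alpha>1" "form 1 \<omega>1" "form 1 \<alpha>2" "form 1 \<omega>2"
    and rel: "\<And>x. \<alpha>1 (cmatrix P1 *v x) = \<alpha>2 (cmatrix P2 *v x)"
    and ind: "\<exists>X. \<alpha>1 X = 1 \<and> \<omega>1 X = 0" "\<exists>Y. \<alpha>2 Y = 1 \<and> \<omega>2 Y = 0"
    and FP: "\<And>X Y. fundamental_form P1 P2 X Y = k * (\<alpha>1 X * \<omega>2 Y - \<omega>1 X * \<alpha>2 Y)"
    and FQ: "\<And>x. \<omega>1 (cmatrix P1 *v x) = 0 \<Longrightarrow> fundamental_form Q1 Q2 (cmatrix P1 *v x) (cmatrix P2 *v x) = 0"
    and XY: "\<omega>1 X = 0" "\<omega>2 Y = 0"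
  shows "fundamental_form Q1 Q2 X Y = 0"
proof -
  let ?F = "fundamental_form Q1 Q2"
  note lin = form_1_linear[OF \<alpha>(1)] form_1_linear[OF \<alpha>(2)] form_1_linear[OF \<alpha>(3)] form_1_linear[OF \<alpha>(4)]
  have gen: "?F X Y = 0" if "\<omega>1 X = 0" "\<omega>2 Y = 0" "\<alpha>1 X \<noteq> 0" "\<alpha>2 Y \<noteq> 0" for X Y
  proof -
    have "fundamental_form P1 P2 X Y = 0" using that by (simp add: FP)
    then obtain v \<sigma> \<rho> where v: "v \<noteq> 0 \<or> \<sigma> \<noteq> 0 \<or> \<rho> \<noteq> 0" "cmatrix P1 *v v = \<sigma> *s X" "cmatrix P2 *v v = \<rho> *s Y"
      unfolding fundamental_form_eq_0_iff by blast
    have eq: "\<sigma> * \<alpha>1 X = \<rho> * \<alpha>2 Y" using rel[of v] unfolding v(2,3) lin .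
    have "\<sigma> \<noteq> 0 \<and> \<rho> \<noteq> 0"
    proof (rule ccontr)
      assume "\<not> (\<sigma> \<noteq> 0 \<and> \<rho> \<noteq> 0)"
      then have "\<sigma> = 0" "\<rho> = 0" using eq that(3,4) by auto
      then show False using v cameras_injective[OF cam ne, of v] by simp
    qed
    moreover have "\<omega>1 (cmatrix P1 *v v) = 0" using that(1) by (simp add: v(2) lin)
    from FQ[OF this] have "\<rho> * (\<sigma> * ?F X Y) = 0" unfolding v(2,3) fundamental_form_bilinear .
    ultimately show ?thesis by simp
  qed
  obtain X1 where X1: "\<alpha>1 X1 = 1" "\<omega>1 X1 = 0" using ind(1) by blast
  obtain Y1 where Y1: "\<alpha>2 Y1 = 1" "\<omega>2 Y1 = 0" using ind(2) by blast
  have gen2: "?F X Y = 0" if "\<omega>1 X = 0" "\<omega>2 Y = 0" "\<alpha>2 Y \<noteq> 0" for X Y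
  proof (cases "\<alpha>1 X = 0")
    case True
    then have "?F (X + X1) Y = 0" "?F X1 Y = 0" using that X1 by (intro gen; simp add: lin)+
    then show ?thesis by (simp add: fundamental_form_bilinear)
  next
    case False
    then show ?thesis using gen that by blast
  qed
  show ?thesis
  proof (cases "\<alpha>2 Y = 0")
    case True
    then have "?F X (Y + Y1) = 0" "?F X Y1 = 0" using XY Y1 by (intro gen2; simp add: lin)+
    then show ?thesis by (simp add: fundamental_form_bilinear)
  next
    case False
    then show ?thesis using gen2 XY by blast
  qed
qed

lemma plane_through_points:
  fixes p q :: "complex ^ 4"
  assumes "p \<noteq> 0"
  obtains V where "vec.subspace V" "vec.dim V = 3" "p \<in> V" "q \<in> V"
proof -
  have d4: "vec.dim (UNIV :: (complex ^ 4) set) = CARD(4)" by (rule vec_dim_card)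
  have ex: "\<exists>r. r \<notin> vec.span {u, v}" for u v :: "complex ^ 4"
  proof (rule ccontr)
    assume "\<nexists>r. r \<notin> vec.span {u, v}"
    then have "vec.span {u, v} = UNIV" by blast
    then show False using dim_span2_le[of u v] d4 by simp
  qed
  obtain q' where q': "q' \<notin> vec.span {p}" "q \<in> vec.span {p, q'}"
  proof (cases "q \<in> vec.span {p}")
    case True
    obtain r where "r \<notin> vec.span {p, p}" using ex by blast
    then show ?thesis using that[of r] True vec.span_mono[of "{p}" "{p, r}"] by auto
  next
    case False
    then show ?thesis using that[of q] vec.span_base[of q "{p, q}"] by simp
  qed
  obtain r where r: "r \<notin> vec.span {p, q'}" using ex by blast
  have "vec.dim (vec.span {p, q', r}) = 3" by (rule span3_independent[OF assms q'(1) r])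
  moreover have "q \<in> vec.span {p, q', r}" using q'(2) vec.span_mono[of "{p, q'}" "{p, q', r}"] by auto
  moreover have "p \<in> vec.span {p, q', r}" by (rule vec.span_base) simp
  ultimately show thesis using that[of "vec.span {p, q', r}"] vec.subspace_span by blast
qed

text \<open>Rank 2 leaves a one-dimensional right kernel, which cannot contain the zeros of one
  functional. An auxiliary plane through both centers brings the form to determinant shape, and
  \<open>Y\<close> is found in the span of the dual vectors \<open>S\<close> and
  \<open>T\<close>.\<close>

lemma fundamental_form_right_kernel:
  assumes cam: "is_camera Q1" "is_camera Q2" and ne: "center Q1 \<noteq> center Q2" and \<omega>: "form 1 \<omega>"
  obtains X Y where "\<omega> Y = 0" "fundamental_form Q1 Q2 X Y \<noteq> 0"
proof -
  obtain p where p: "p \<noteq> 0" "center Q1 = pt p" by (rule pt_exhaust)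
  obtain q where q: "q \<noteq> 0" "center Q2 = pt q" by (rule pt_exhaust)
  obtain V where V: "vec.subspace V" "vec.dim V = 3" "p \<in> V" "q \<in> V" by (rule plane_through_points[OF p(1)]) (rule that)
  have "center Q1 \<in> points V" "center Q2 \<in> points V" using p q V(3,4) pt_in_points[OF V(1) p(1)] pt_in_points[OF V(1) q(1)] by simp_all
  then obtain \<gamma>1 \<delta>1 \<gamma>2 \<delta>2 k where
    "form 1 \<gamma>1" "form 1 \<delta>1" and g: "form 1 \<gamma>2" "form 1 \<delta>2"
    and "\<And>x. \<gamma>1 (cmatrix Q1 *v x) = \<gamma>2 (cmatrix Q2 *v x)"
    "\<And>x. \<delta>1 (cmatrix Q1 *v x) = \<delta>2 (cmatrix Q2 *v x)"
    and ind: "\<exists>X. \<gamma>1 X = 1 \<and> \<delta>1 X = 0" "\<exists>X. \<gamma>1 X = 0 \<and> \<delta>1 X = 1"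
    "\<exists>X. \<gamma>2 X = 1 \<and> \<delta>2 X = 0" "\<exists>X. \<gamma>2 X = 0 \<and> \<delta>2 X = 1"
    and k: "k \<noteq> 0" and FQ: "\<And>X Y. fundamental_form Q1 Q2 X Y = k * (\<gamma>1 X * \<delta>2 Y - \<delta>1 X * \<gamma>2 Y)"
    and "V = {x. \<delta>1 (cmatrix Q1 *v x) = 0}"
    by (rule camera_pair_functionals[OF cam ne V(1,2)]) (rule that)
  obtain S T where S: "\<gamma>2 S = 1" "\<delta>2 S = 0" and T: "\<gamma>2 T = 0" "\<delta>2 T = 1" using ind(3,4) by blast
  obtain U U' where U: "\<gamma>1 U = 1" "\<delta>1 U = 0" and U': "\<gamma>1 U' = 0" "\<delta>1 U' = 1" using ind(1,2) by blast
  note lin = form_1_linear[OF g(1)] form_1_linear[OF g(2)] form_1_linear[OF \<omega>]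
  show thesis
  proof (cases "\<omega> S = 0")
    case True
    then show ?thesis using that[of S U'] k by (simp add: FQ U' S)
  next
    case False
    let ?Y = "\<omega> T *s S + (- \<omega> S) *s T"
    have "\<omega> ?Y = 0" "fundamental_form Q1 Q2 U ?Y = - k * \<omega> S"
      by (simp_all only: FQ lin U S T) simp_all
    then show ?thesis using that[of ?Y U] False k by simp
  qed
qed

lemma proportional_functional:
  fixes \<omega> \<delta> :: "complex ^ 3 \<Rightarrow> complex"
  assumes "form 1 \<omega>" "form 1 \<delta>" and T: "\<omega> T = 1" and ker: "\<And>X. \<omega> X = 0 \<Longrightarrow> \<delta> X = 0" and nz: "\<delta> S \<noteq> 0"
  obtains c where "c \<noteq> 0" "\<And>X. \<delta> X = c * \<omega> X"
proof -
  note lin = form_1_linear[OF assms(1)] form_1_linear[OF assms(2)]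
  have eq: "\<delta> X = \<delta> T * \<omega> X" for X
  proof -
    have "\<omega> (X + (- \<omega> X) *s T) = 0" by (simp only: lin T) simp
    then have "\<delta> (X + (- \<omega> X) *s T) = 0" by (rule ker)
    then show ?thesis by (simp only: lin) simp
  qed
  then have "\<delta> T \<noteq> 0" using nz by (metis mult_zero_left)
  then show thesis using that eq by blast
qed

text \<open>The key point is that the line \<open>\<omega>1 = 0\<close> of the first image contains the epipole \<open>Q\<^sub>1(q\<^sub>2)\<close>, which is the left
  kernel of the fundamental form of \<open>Q\<close>: this form vanishes for \<open>\<omega>1 X = 0, \<omega>2 Y = 0\<close>, so otherwise the whole line
  \<open>\<omega>2 = 0\<close> would be in its right kernel, although it has rank 2.\<close>

lemma common_functionals:
  assumes camP: "is_camera P1" "is_camera P2" and neP: "center P1 \<noteq> center P2"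
    and camQ: "is_camera Q1" "is_camera Q2" and neQ: "center Q1 \<noteq> center Q2"
    and W: "vec.subspace W" "vec.dim W = 3" "center P1 \<in> points W" "center P2 \<in> points W"
    and FQ: "\<And>x. x \<in> W \<Longrightarrow> fundamental_form Q1 Q2 (cmatrix P1 *v x) (cmatrix P2 *v x) = 0"
  obtains \<alpha>1 \<beta>1 \<omega>1 \<alpha>2 \<beta>2 \<omega>2 b k k' where
    "form 1 \<alpha>1" "form 1 \<beta>1" "form 1 \<omega>1" "form 1 \<alpha>2" "form 1 \<beta>2" "form 1 \<omega>2" "b \<noteq> 0" "k \<noteq> 0" "k' \<noteq> 0"
    "\<And>x. \<alpha>1 (cmatrix P1 *v x) = \<alpha>2 (cmatrix P2 *v x)"
    "\<And>x. \<omega>1 (cmatrix P1 *v x) = \<omega>2 (cmatrix P2 *v x)"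
    "\<And>x. \<beta>1 (cmatrix Q1 *v x) = b * \<beta>2 (cmatrix Q2 *v x)"
    "\<And>x. \<omega>1 (cmatrix Q1 *v x) = b * \<omega>2 (cmatrix Q2 *v x)"
    "\<exists>X. \<alpha>1 X = 1 \<and> \<omega>1 X = 0" "\<exists>X. \<alpha>1 X = 0 \<and> \<omega>1 X = 1"
    "\<exists>X. \<alpha>2 X = 1 \<and> \<omega>2 X = 0" "\<exists>X. \<alpha>2 X = 0 \<and> \<omega>2 X = 1"
    "\<exists>X. \<beta>1 X = 1 \<and> \<omega>1 X = 0" "\<exists>X. \<beta>1 X = 0 \<and> \<omega>1 X = 1"
    "\<exists>X. \<beta>2 X = 1 \<and> \<omega>2 X = 0" "\<exists>X. \<beta>2 X = 0 \<and> \<omega>2 X = 1"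
    "\<And>X Y. fundamental_form P1 P2 X Y = k * (\<alpha>1 X * \<omega>2 Y - \<omega>1 X * \<alpha>2 Y)"
    "\<And>X Y. fundamental_form Q1 Q2 X Y = k' * (\<beta>1 X * \<omega>2 Y - \<omega>1 X * \<beta>2 Y)"
    "W = {x. \<omega>1 (cmatrix P1 *v x) = 0}"
proof -
  obtain \<alpha>1 \<omega>1 \<alpha>2 \<omega>2 k where \<alpha>:
    "form 1 \<alpha>1" "form 1 \<omega>1" "form 1 \<alpha>2" "form 1 \<omega>2"
    "\<And>x. \<alpha>1 (cmatrix P1 *v x) = \<alpha>2 (cmatrix P2 *v x)"
    "\<And>x. \<omega>1 (cmatrix P1 *v x) = \<omega>2 (cmatrix P2 *v x)"
    "\<exists>X. \<alpha>1 X = 1 \<and> \<omega>1 X = 0" "\<exists>X. \<alpha>1 X = 0 \<and> \<omega>1 X = 1"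
    "\<exists>X. \<alpha>2 X = 1 \<and> \<omega>2 X = 0" "\<exists>X. \<alpha>2 X = 0 \<and> \<omega>2 X = 1"
    "k \<noteq> 0" "\<And>X Y. fundamental_form P1 P2 X Y = k * (\<alpha>1 X * \<omega>2 Y - \<omega>1 X * \<alpha>2 Y)"
    "W = {x. \<omega>1 (cmatrix P1 *v x) = 0}"
    by (rule camera_pair_functionals[OF camP neP W]) (rule that)
  let ?F = "fundamental_form Q1 Q2"
  have van: "?F X Y = 0" if "\<omega>1 X = 0" "\<omega>2 Y = 0" for X Y
  proof (rule fundamental_form_vanishes[OF camP neP \<alpha>(1-5,7,9,12) _ that])
    fix x assume "\<omega>1 (cmatrix P1 *v x) = 0"
    then show "?F (cmatrix P1 *v x) (cmatrix P2 *v x) = 0" using FQ \<alpha>(13) by blast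
  qed
  obtain T1 where T1: "\<omega>1 T1 = 1" using \<alpha>(8) by blast
  obtain T2 where T2: "\<omega>2 T2 = 1" using \<alpha>(10) by blast
  obtain q1 where q1: "q1 \<noteq> 0" "center Q1 = pt q1" by (rule pt_exhaust)
  obtain q2 where q2: "q2 \<noteq> 0" "center Q2 = pt q2" by (rule pt_exhaust)
  have Bq: "cmatrix Q1 *v q1 = 0" "cmatrix Q2 *v q2 = 0"
    using pt_eq_center_iff[OF camQ(1) q1(1)] pt_eq_center_iff[OF camQ(2) q2(1)] q1(2) q2(2) by simp_all
  let ?E = "cmatrix Q1 *v q2"
  have E: "?F ?E Y = 0" for Y
    unfolding fundamental_form_eq_0_iff using q2(1) Bq(2)
    by (intro exI[of _ q2] exI[of _ 1] exI[of _ 0]) simp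
  have \<omega>E: "\<omega>1 ?E = 0"
  proof (rule ccontr)
    assume nz: "\<omega>1 ?E \<noteq> 0"
    obtain X Y where XY: "\<omega>2 Y = 0" "?F X Y \<noteq> 0"
      by (rule fundamental_form_right_kernel[OF camQ neQ \<alpha>(4)]) (rule that)
    have "\<omega>1 (X + (- \<omega>1 X / \<omega>1 ?E) *s ?E) = 0" using nz by (simp only: form_1_linear[OF \<alpha>(2)]) simp
    from van[OF this XY(1)] have "?F X Y = 0" by (simp only: fundamental_form_bilinear E) simp
    then show False using XY(2) by simp
  qed
  \<comment> \<open>The functional \<omega>1 vanishes on the views of both centers of
    \<open>Q\<close>, so its zero set is a plane through them. The determinant shape relative to
    this plane gives \<delta>1 the same zeros as \<omega>1.\<close>
  define V where "V = {x. \<omega>1 (cmatrix Q1 *v x) = 0}"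
  have "form 1 (\<lambda>x. \<omega>1 (cmatrix Q1 *v x))" using form_subst[OF \<alpha>(2) form_matrix] by simp
  moreover obtain e where "cmatrix Q1 *v e = T1" using cmatrix_onto[OF camQ(1)] by blast
  then have "\<omega>1 (cmatrix Q1 *v e) \<noteq> 0" using T1 by simp
  ultimately have "is_plane V" unfolding V_def by (rule functional_kernel_plane)
  then have V: "vec.subspace V" "vec.dim V = 3" unfolding is_plane_def by blast+
  have "q1 \<in> V" "q2 \<in> V" unfolding V_def using \<omega>E Bq(1) form_zero_at_0[OF \<alpha>(2)] by simp_all
  then have qV: "center Q1 \<in> points V" "center Q2 \<in> points V" using q1(2) q2(2) pt_in_points[OF V(1) q1(1)] pt_in_points[OF V(1) q2(1)] by simp_all
  obtain \<gamma>1 \<delta>1 \<gamma>2 \<delta>2 k' where \<gamma>: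
    "form 1 \<gamma>1" "form 1 \<delta>1" "form 1 \<gamma>2" "form 1 \<delta>2"
    "\<And>x. \<gamma>1 (cmatrix Q1 *v x) = \<gamma>2 (cmatrix Q2 *v x)"
    "\<And>x. \<delta>1 (cmatrix Q1 *v x) = \<delta>2 (cmatrix Q2 *v x)"
    "\<exists>X. \<gamma>1 X = 1 \<and> \<delta>1 X = 0" "\<exists>X. \<gamma>1 X = 0 \<and> \<delta>1 X = 1"
    "\<exists>X. \<gamma>2 X = 1 \<and> \<delta>2 X = 0" "\<exists>X. \<gamma>2 X = 0 \<and> \<delta>2 X = 1"
    "k' \<noteq> 0" "\<And>X Y. fundamental_form Q1 Q2 X Y = k' * (\<gamma>1 X * \<delta>2 Y - \<delta>1 X * \<gamma>2 Y)"
    "V = {x. \<delta>1 (cmatrix Q1 *v x) = 0}"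
    by (rule camera_pair_functionals[OF camQ neQ V qV]) (rule that)
  note lin = form_1_linear[OF \<gamma>(1)] form_1_linear[OF \<gamma>(3)] form_1_linear[OF \<alpha>(2)] form_1_linear[OF \<alpha>(4)]
  obtain S1 where S1: "\<gamma>1 S1 = 1" "\<delta>1 S1 = 0" using \<gamma>(7) by blast
  obtain S1' where S1': "\<gamma>1 S1' = 0" "\<delta>1 S1' = 1" using \<gamma>(8) by blast
  obtain S2 where S2: "\<gamma>2 S2 = 1" "\<delta>2 S2 = 0" using \<gamma>(9) by blast
  obtain S2' where S2': "\<gamma>2 S2' = 0" "\<delta>2 S2' = 1" using \<gamma>(10) by blast
  have k1: "\<delta>1 X = 0 \<longleftrightarrow> \<omega>1 X = 0" for X
    using cmatrix_onto[OF camQ(1), of X] \<gamma>(13) unfolding V_def by blast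
  obtain c1 where c1: "c1 \<noteq> 0" "\<And>X. \<delta>1 X = c1 * \<omega>1 X"
    by (rule proportional_functional[OF \<alpha>(2) \<gamma>(2) T1, of S1']) (use k1 S1' that in auto)
  have k2: "\<delta>2 Y = 0" if "\<omega>2 Y = 0" for Y
    using van[of S1 Y] that k1[of S1] \<gamma>(11) by (simp add: S1 \<gamma>(12))
  obtain c2 where c2: "c2 \<noteq> 0" "\<And>Y. \<delta>2 Y = c2 * \<omega>2 Y"
    by (rule proportional_functional[OF \<alpha>(4) \<gamma>(4) T2, of S2']) (use k2 S2' that in auto)
  \<comment> \<open>The two proportionality factors may differ. Their quotient is absorbed into the
    second camera of \<open>Q\<close>, and dividing \<gamma>2 by it keeps both relations and the
    shape of the form.\<close>
  define b where "b = c2 / c1"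
  have b: "b \<noteq> 0" using c1 c2 by (simp add: b_def)
  show thesis
  proof (rule that[of \<alpha>1 \<gamma>1 \<omega>1 \<alpha>2 "\<lambda>Y. 1 / b * \<gamma>2 Y" \<omega>2 b k "k' * c2"])
    show "form 1 (\<lambda>Y. 1 / b * \<gamma>2 Y)" by (rule form_scale[OF \<gamma>(3)])
    show "k' * c2 \<noteq> 0" using \<gamma>(11) c2 by simp
    show "\<gamma>1 (cmatrix Q1 *v x) = b * (1 / b * \<gamma>2 (cmatrix Q2 *v x))" for x using \<gamma>(5) b by simp
    show "\<omega>1 (cmatrix Q1 *v x) = b * \<omega>2 (cmatrix Q2 *v x)" for x
      using \<gamma>(6)[of x] c1 unfolding c1(2) c2(2) b_def by (simp add: field_simps)
    show "\<exists>X. \<gamma>1 X = 1 \<and> \<omega>1 X = 0" using S1 c1 by auto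
    show "\<exists>X. \<gamma>1 X = 0 \<and> \<omega>1 X = 1" using S1' c1 by (intro exI[of _ "c1 *s S1'"]) (simp add: lin)
    show "\<exists>X. 1 / b * \<gamma>2 X = 1 \<and> \<omega>2 X = 0" using S2 c2 b by (intro exI[of _ "b *s S2"]) (simp add: lin)
    show "\<exists>X. 1 / b * \<gamma>2 X = 0 \<and> \<omega>2 X = 1" using S2' c2 by (intro exI[of _ "c2 *s S2'"]) (simp add: lin)
    show "?F X Y = k' * c2 * (\<gamma>1 X * \<omega>2 Y - \<omega>1 X * (1 / b * \<gamma>2 Y))" for X Y
      using c1 c2 unfolding \<gamma>(12) c1(2) c2(2) b_def by (simp add: field_simps)
  qed (rule \<alpha> \<gamma> b)+
qed

text \<open>A common zero of the three functionals on the first image is proportional to the view of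
  the second center there, which puts this center on \<open>W'\<close>; likewise with the roles
  exchanged. As not both centers lie on \<open>W'\<close>, one image is regular, and its camera is
  taken first.\<close>

lemma two_views_exists:
  assumes camP: "is_camera P1" "is_camera P2" and neP: "center P1 \<noteq> center P2"
    and camQ: "is_camera Q1" "is_camera Q2" and neQ: "center Q1 \<noteq> center Q2"
    and W: "is_plane W" "is_plane W'" "W \<noteq> W'"
    and quad: "quadric P1 P2 Q1 Q2 = points W \<union> points W'"
    and cW: "center P1 \<in> points W" "center P2 \<in> points W"
    and cW': "\<not> {center P1, center P2} \<subseteq> points W \<inter> points W'"
  shows "(\<exists>a b \<alpha>1 \<beta>1 \<omega>1 \<alpha>2 \<beta>2 \<omega>2. two_views P1 P2 Q1 Q2 a b \<alpha>1 \<beta>1 \<omega>1 \<alpha>2 \<beta>2 \<omega>2) \<or>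
    (\<exists>a b \<alpha>1 \<beta>1 \<omega>1 \<alpha>2 \<beta>2 \<omega>2. two_views P2 P1 Q2 Q1 a b \<alpha>1 \<beta>1 \<omega>1 \<alpha>2 \<beta>2 \<omega>2)"
proof -
  let ?F = "\<lambda>x. fundamental_form Q1 Q2 (cmatrix P1 *v x) (cmatrix P2 *v x)"
  have subs: "vec.subspace W" "vec.dim W = 3" "vec.subspace W'" "vec.dim W' = 3" using W unfolding is_plane_def by blast+
  have F0: "?F x = 0 \<longleftrightarrow> x \<in> W \<or> x \<in> W'" for x
  proof (cases "x = 0")
    case True
    then show ?thesis using vec.subspace_0[OF subs(1)] fundamental_form_bilinear(2)[of Q1 Q2 0 0 0] by simp
  next
    case False
    then have "?F x = 0 \<longleftrightarrow> pt x \<in> points W \<union> points W'" using pt_in_quadric_iff[OF False] quad by metis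
    then show ?thesis using pt_in_points[OF subs(1) False] pt_in_points[OF subs(3) False] by simp
  qed
  have FQW: "x \<in> W \<Longrightarrow> ?F x = 0" for x using F0 by blast
  obtain \<alpha>1 \<beta>1 \<omega>1 \<alpha>2 \<beta>2 \<omega>2 b k k' where
    FP: "\<And>X Y. fundamental_form P1 P2 X Y = k * (\<alpha>1 X * \<omega>2 Y - \<omega>1 X * \<alpha>2 Y)"
    and FQ: "\<And>X Y. fundamental_form Q1 Q2 X Y = k' * (\<beta>1 X * \<omega>2 Y - \<omega>1 X * \<beta>2 Y)"
    and A: "\<And>x. \<alpha>1 (cmatrix P1 *v x) = \<alpha>2 (cmatrix P2 *v x)"
    "\<And>x. \<omega>1 (cmatrix P1 *v x) = \<omega>2 (cmatrix P2 *v x)"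
    and B: "\<And>x. \<beta>1 (cmatrix Q1 *v x) = b * \<beta>2 (cmatrix Q2 *v x)"
    "\<And>x. \<omega>1 (cmatrix Q1 *v x) = b * \<omega>2 (cmatrix Q2 *v x)"
    and f: "form 1 \<alpha>1" "form 1 \<beta>1" "form 1 \<omega>1" "form 1 \<alpha>2" "form 1 \<beta>2" "form 1 \<omega>2" and nz: "b \<noteq> 0" "k \<noteq> 0" "k' \<noteq> 0"
    and ind: "\<exists>X. \<alpha>1 X = 1 \<and> \<omega>1 X = 0" "\<exists>X. \<alpha>1 X = 0 \<and> \<omega>1 X = 1"
    "\<exists>X. \<alpha>2 X = 1 \<and> \<omega>2 X = 0" "\<exists>X. \<alpha>2 X = 0 \<and> \<omega>2 X = 1"
    "\<exists>X. \<beta>1 X = 1 \<and> \<omega>1 X = 0" "\<exists>X. \<beta>1 X = 0 \<and> \<omega>1 X = 1"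
    "\<exists>X. \<beta>2 X = 1 \<and> \<omega>2 X = 0" "\<exists>X. \<beta>2 X = 0 \<and> \<omega>2 X = 1"
    and Weq: "W = {x. \<omega>1 (cmatrix P1 *v x) = 0}"
    by (rule common_functionals[OF camP neP camQ neQ subs(1,2) cW FQW]) (assumption, rule that)
  note lin = form_1_linear[OF f(1)] form_1_linear[OF f(2)] form_1_linear[OF f(3)]
    form_1_linear[OF f(4)] form_1_linear[OF f(5)] form_1_linear[OF f(6)]
  have qP: "?F x = 0 \<longleftrightarrow> \<omega>1 (cmatrix P1 *v x) = 0 \<or> \<beta>1 (cmatrix P1 *v x) = \<beta>2 (cmatrix P2 *v x)" for x
  proof -
    have "?F x = k' * (\<omega>1 (cmatrix P1 *v x) * (\<beta>1 (cmatrix P1 *v x) - \<beta>2 (cmatrix P2 *v x)))"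
      by (simp add: FQ A algebra_simps)
    then show ?thesis using nz by simp
  qed
  have qQ: "fundamental_form P1 P2 (cmatrix Q1 *v x) (cmatrix Q2 *v x) = 0 \<longleftrightarrow>
    \<omega>1 (cmatrix Q1 *v x) = 0 \<or> \<alpha>1 (cmatrix Q1 *v x) = b * \<alpha>2 (cmatrix Q2 *v x)" for x
  proof -
    have "fundamental_form P1 P2 (cmatrix Q1 *v x) (cmatrix Q2 *v x) =
        k * (\<omega>2 (cmatrix Q2 *v x) * (\<alpha>1 (cmatrix Q1 *v x) - b * \<alpha>2 (cmatrix Q2 *v x)))"
      by (simp add: FP B algebra_simps)
    then show ?thesis using nz B(2)[of x] by simp
  qed
  show ?thesis
  proof (cases "\<forall>X. \<alpha>1 X = 0 \<longrightarrow> \<beta>1 X = 0 \<longrightarrow> \<omega>1 X = 0 \<longrightarrow> X = 0")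
    case True
    have "two_views P1 P2 Q1 Q2 1 b \<alpha>1 \<beta>1 \<omega>1 \<alpha>2 \<beta>2 \<omega>2"
    proof
      show "\<alpha>1 X = 0 \<Longrightarrow> \<beta>1 X = 0 \<Longrightarrow> \<omega>1 X = 0 \<Longrightarrow> X = 0" for X using True by blast
    qed (use camP camQ neP neQ nz f ind in \<open>simp_all add: lin qP qQ\<close>, simp_all add: A B)
    then show ?thesis by blast
  next
    case irregular1: False
    show ?thesis
    proof (cases "\<forall>X. \<alpha>2 X = 0 \<longrightarrow> \<beta>2 X = 0 \<longrightarrow> \<omega>2 X = 0 \<longrightarrow> X = 0")
      case True
      have "\<alpha>2 (cmatrix Q2 *v x) = \<alpha>1 (cmatrix Q1 *v x) / b \<longleftrightarrow> \<alpha>1 (cmatrix Q1 *v x) = b * \<alpha>2 (cmatrix Q2 *v x)" for x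
        using nz by (auto simp: field_simps)
      note eq = this
      \<comment> \<open>The scalar relates the second camera to the first, so exchanging the cameras
        inverts it.\<close>
      have "two_views P2 P1 Q2 Q1 1 (1 / b) \<alpha>2 \<beta>2 \<omega>2 \<alpha>1 \<beta>1 \<omega>1"
      proof
        show "\<alpha>2 X = 0 \<Longrightarrow> \<beta>2 X = 0 \<Longrightarrow> \<omega>2 X = 0 \<Longrightarrow> X = 0" for X using True by blast
        show "fundamental_form Q2 Q1 (cmatrix P2 *v x) (cmatrix P1 *v x) = 0 \<longleftrightarrow>
            \<omega>2 (cmatrix P2 *v x) = 0 \<or> \<beta>2 (cmatrix P2 *v x) = \<beta>1 (1 *s (cmatrix P1 *v x))" for x
          unfolding fundamental_form_swap_eq_0 qP A(2) by auto
        show "fundamental_form P2 P1 (cmatrix Q2 *v x) (cmatrix Q1 *v x) = 0 \<longleftrightarrow>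
            \<omega>2 (cmatrix Q2 *v x) = 0 \<or> \<alpha>2 (cmatrix Q2 *v x) = \<alpha>1 ((1 / b) *s (cmatrix Q1 *v x))" for x
          unfolding fundamental_form_swap_eq_0 qQ B(2) using nz eq[of x] by (simp add: lin)
      qed (use camP camQ neP neQ nz f ind in \<open>simp_all add: lin\<close>, simp_all add: A B)
      then show ?thesis by blast
    next
      case irregular2: False
      obtain X0 where X0: "X0 \<noteq> 0" "\<alpha>1 X0 = 0" "\<beta>1 X0 = 0" "\<omega>1 X0 = 0" using irregular1 by blast
      obtain Y0 where Y0: "Y0 \<noteq> 0" "\<alpha>2 Y0 = 0" "\<beta>2 Y0 = 0" "\<omega>2 Y0 = 0" using irregular2 by blast
      \<comment> \<open>The cofactor of \<omega>1 in the equation of the quadric, up to a constant;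
        its zeros must therefore be \<open>W'\<close>.\<close>
      define L where "L x = \<beta>1 (cmatrix P1 *v x) - \<beta>2 (cmatrix P2 *v x)" for x
      have L: "form 1 L"
        unfolding L_def using form_subst[OF f(2) form_matrix, of "cmatrix P1"] form_subst[OF f(5) form_matrix, of "cmatrix P2"]
        by (intro form_diff) simp_all
      have WL: "x \<in> W \<or> x \<in> W' \<longleftrightarrow> x \<in> W \<or> L x = 0" for x
        using F0[of x] qP[of x] by (simp add: Weq L_def)
      have "\<exists>e. L e \<noteq> 0"
      proof (rule ccontr)
        assume "\<nexists>e. L e \<noteq> 0"
        then have "UNIV \<subseteq> W \<union> W'" using WL by blast
        then have "UNIV \<subseteq> W \<or> UNIV \<subseteq> W'" by (rule subspace_subset_union[OF vec.subspace_UNIV subs(1,3)])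
        moreover have "vec.dim (UNIV :: (complex ^ 4) set) = CARD(4)" by (rule vec_dim_card)
        ultimately show False using vec.dim_subset[of UNIV W] vec.dim_subset[of UNIV W'] subs by auto
      qed
      then obtain e where e: "L e \<noteq> 0" by blast
      have kerL: "is_plane {x. L x = 0}" by (rule functional_kernel_plane[OF L e])
      have sub: "vec.subspace {x. L x = 0}" using kerL unfolding is_plane_def by blast
      have "W' \<subseteq> W \<union> {x. L x = 0}" using WL by blast
      then have "W' \<subseteq> W \<or> W' \<subseteq> {x. L x = 0}" by (rule subspace_subset_union[OF subs(3,1) sub])
      then have W': "W' = {x. L x = 0}" using plane_subset_eq[OF W(2,1)] plane_subset_eq[OF W(2) kerL] W(3) by blast
      have zero: "\<alpha>1 0 = 0" "\<beta>1 0 = 0" "\<omega>1 0 = 0" "\<alpha>2 0 = 0" "\<beta>2 0 = 0" "\<omega>2 0 = 0"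
        using lin(2,4,6,8,10,12)[of 0 0] by simp_all
      obtain p1 where p1: "p1 \<noteq> 0" "center P1 = pt p1" by (rule pt_exhaust)
      obtain p2 where p2: "p2 \<noteq> 0" "center P2 = pt p2" by (rule pt_exhaust)
      have p: "cmatrix P1 *v p1 = 0" "cmatrix P2 *v p2 = 0"
        using pt_eq_center_iff[OF camP(1) p1(1)] pt_eq_center_iff[OF camP(2) p2(1)] p1(2) p2(2) by simp_all
      have v: "\<alpha>2 (cmatrix P2 *v p1) = 0" "\<omega>2 (cmatrix P2 *v p1) = 0" "\<alpha>1 (cmatrix P1 *v p2) = 0" "\<omega>1 (cmatrix P1 *v p2) = 0"
        using A[of p1] A[of p2] p zero by simp_all
      obtain c where "cmatrix P2 *v p1 = c *s Y0" by (rule functional_pair_kernel[OF f(4,6) ind(3,4) Y0(1,2,4) v(1,2)])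
      then have "L p1 = 0" by (simp add: L_def p zero lin Y0)
      moreover obtain c' where "cmatrix P1 *v p2 = c' *s X0" by (rule functional_pair_kernel[OF f(1,3) ind(1,2) X0(1,2,4) v(3,4)])
      then have "L p2 = 0" by (simp add: L_def p zero lin X0)
      ultimately have "center P1 \<in> points W'" "center P2 \<in> points W'"
        unfolding p1(2) p2(2) using pt_in_points[OF subs(3) p1(1)] pt_in_points[OF subs(3) p2(1)] W' by simp_all
      then show ?thesis using cW cW' by blast
    qed
  qed
qed

section \<open>Exchanging the two cameras of each pair\<close>

lemma conjugate_swap: "conjugate P2 P1 Q2 Q1 x y \<longleftrightarrow> conjugate P1 P2 Q1 Q2 x y"
  unfolding conjugate_def quadric_swap[of P2 P1] quadric_swap[of Q2 Q1] by blast

lemma conjugate_curve_swap: "conjugate_curve P2 P1 Q2 Q1 C = conjugate_curve P1 P2 Q1 Q2 C"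
  unfolding conjugate_curve_def psi_graph_def conjugate_swap[of P2 P1] ..

lemma line_through_swap: "line_through x y = line_through y x"
  unfolding line_through_def by (simp add: Un_commute)

lemma has_multiplicity_blowup_swap:
  "center P1 \<noteq> center P2 \<Longrightarrow>
    has_multiplicity_blowup P2 P1 W F (x, w, u) m \<longleftrightarrow> has_multiplicity_blowup P1 P2 W F (x, u, w) m"
  by auto

lemma curve_type_swap:
  assumes "center P1 \<noteq> center P2" and type: "curve_type P1 P2 Q1 Q2 C (t, t', c0, c1, c2)"
  shows "curve_type P2 P1 Q2 Q1 C (t, t', c0, c2, c1)"
proof -
  obtain W W' F F' A A' d d' m0 m1 m2 z u w where
     *: "is_plane W" "is_plane W'" "W \<noteq> W'"
       "quadric P1 P2 Q1 Q2 = points W \<union> points W'"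
       "\<not> {center P1, center P2} \<subseteq> points W \<inter> points W'"
       "epipolar_line1 P1 P2 Q1 Q2 \<subseteq> points W" "epipolar_line2 P1 P2 Q1 Q2 \<subseteq> points W"
       "C = A \<union> A'"
       "plane_curve W F d A" "finite (C \<inter> points W - A)"
       "plane_curve W' F' d' A'" "finite (C \<inter> points W' - A')"
       "(z, u, w) \<in> blowup P1 P2"
       "u = picture Q1 (center Q2)" "w = picture Q2 (center Q1)"
       "has_multiplicity_blowup P1 P2 W F (z, u, w) m0"
       "has_multiplicity W F (center P1) m1"
       "has_multiplicity W F (center P2) m2"
       "t = int d" "t' = int d'" "c0 = int m0" "c1 = int m1" "c2 = int m2"
    using type unfolding curve_type_def prod.case by metis
  have "(z, w, u) \<in> blowup P2 P1" using *(13) blowup_swap by blast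
  moreover have "has_multiplicity_blowup P2 P1 W F (z, w, u) m0"
    using *(16) has_multiplicity_blowup_swap[OF assms(1)] by blast
  moreover have "\<not> {center P2, center P1} \<subseteq> points W \<inter> points W'" using *(5) by blast
  ultimately show ?thesis
    unfolding curve_type_def prod.case quadric_swap[of P2 P1] epipolar_line_swap(1)[of P2 P1] epipolar_line_swap(2)[of P2 P1]
    using * by blast
qed

theorem proposition5p9:
  fixes P\<^sub>1 P\<^sub>2 Q\<^sub>1 Q\<^sub>2 :: camera
    and W W' :: "(complex ^ 4) set"
    and C\<^sub>P :: "4 projective set"
    and a b c\<^sub>0 c\<^sub>1 c\<^sub>2 :: int
  assumes "is_camera P\<^sub>1" "is_camera P\<^sub>2" "is_camera Q\<^sub>1" "is_camera Q\<^sub>2"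
    and "center P\<^sub>1 \<noteq> center P\<^sub>2" and "center Q\<^sub>1 \<noteq> center Q\<^sub>2"
    and "\<not> same_form (fundamental_form P\<^sub>1 P\<^sub>2) (fundamental_form Q\<^sub>1 Q\<^sub>2)"
    and "is_plane W" "is_plane W'" "W \<noteq> W'"
    and "quadric P\<^sub>1 P\<^sub>2 Q\<^sub>1 Q\<^sub>2 = points W \<union> points W'"
    and "\<not> (center P\<^sub>1 \<in> points W \<inter> points W' \<and> center P\<^sub>2 \<in> points W \<inter> points W')"
    and "curve_type P\<^sub>1 P\<^sub>2 Q\<^sub>1 Q\<^sub>2 C\<^sub>P (a, b, c\<^sub>0, c\<^sub>1, c\<^sub>2)"
    and "\<not> epipolar_line1 P\<^sub>1 P\<^sub>2 Q\<^sub>1 Q\<^sub>2 \<subseteq> C\<^sub>P"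
    and "\<not> epipolar_line2 P\<^sub>1 P\<^sub>2 Q\<^sub>1 Q\<^sub>2 \<subseteq> C\<^sub>P"
    and "\<not> line_through (center P\<^sub>1) (center P\<^sub>2) \<subseteq> C\<^sub>P"
  shows "curve_type Q\<^sub>1 Q\<^sub>2 P\<^sub>1 P\<^sub>2 (conjugate_curve P\<^sub>1 P\<^sub>2 Q\<^sub>1 Q\<^sub>2 C\<^sub>P)
           (2 * a - c\<^sub>0 - c\<^sub>1 - c\<^sub>2, b, a - c\<^sub>1 - c\<^sub>2, a - c\<^sub>0 - c\<^sub>2, a - c\<^sub>0 - c\<^sub>1)"
proof -
  note cam = assms(1-4) and ne = assms(5,6) and type = assms(13) and no_lines = assms(14-16)
  \<comment> \<open>The type singles out the plane with the epipolar lines, and each center lies on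
    one of these lines.\<close>
  obtain V V' where V: "is_plane V" "is_plane V'" "V \<noteq> V'"
    "quadric P\<^sub>1 P\<^sub>2 Q\<^sub>1 Q\<^sub>2 = points V \<union> points V'"
    "epipolar_line1 P\<^sub>1 P\<^sub>2 Q\<^sub>1 Q\<^sub>2 \<subseteq> points V" "epipolar_line2 P\<^sub>1 P\<^sub>2 Q\<^sub>1 Q\<^sub>2 \<subseteq> points V"
    "\<not> {center P\<^sub>1, center P\<^sub>2} \<subseteq> points V \<inter> points V'"
    using type unfolding curve_type_def prod.case by metis
  have "center P\<^sub>1 \<in> points V" "center P\<^sub>2 \<in> points V"
    using V(5,6) center_on_epipolar_line1[OF cam(1,2) ne(1)] center_on_epipolar_line2[OF cam(1,2) ne(1)] by blast+
  from two_views_exists[OF cam(1,2) ne(1) cam(3,4) ne(2) V(1-4) this V(7)]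
  show ?thesis
  proof (elim disjE exE)
    fix k l \<alpha>1 \<beta>1 \<omega>1 \<alpha>2 \<beta>2 \<omega>2
    assume "two_views P\<^sub>1 P\<^sub>2 Q\<^sub>1 Q\<^sub>2 k l \<alpha>1 \<beta>1 \<omega>1 \<alpha>2 \<beta>2 \<omega>2"
    then show ?thesis using type no_lines by (rule two_views.conjugate_curve_type)
  next
    fix k l \<alpha>1 \<beta>1 \<omega>1 \<alpha>2 \<beta>2 \<omega>2
    assume views: "two_views P\<^sub>2 P\<^sub>1 Q\<^sub>2 Q\<^sub>1 k l \<alpha>1 \<beta>1 \<omega>1 \<alpha>2 \<beta>2 \<omega>2"
    have no_lines': "\<not> epipolar_line1 P\<^sub>2 P\<^sub>1 Q\<^sub>2 Q\<^sub>1 \<subseteq> C\<^sub>P" "\<not> epipolar_line2 P\<^sub>2 P\<^sub>1 Q\<^sub>2 Q\<^sub>1 \<subseteq> C\<^sub>P"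
      "\<not> line_through (center P\<^sub>2) (center P\<^sub>1) \<subseteq> C\<^sub>P"
      using no_lines by (simp_all add: epipolar_line_swap[of P\<^sub>2] line_through_swap[of "center P\<^sub>2"])
    \<comment> \<open>Exchanging the cameras exchanges the last two entries of a type, here once for
      \<open>P\<close> and once back for \<open>Q\<close>, and the formula is invariant under
      this.\<close>
    from two_views.conjugate_curve_type[OF views curve_type_swap[OF ne(1) type] no_lines']
    have "curve_type Q\<^sub>1 Q\<^sub>2 P\<^sub>1 P\<^sub>2 (conjugate_curve P\<^sub>2 P\<^sub>1 Q\<^sub>2 Q\<^sub>1 C\<^sub>P)
        (2 * a - c\<^sub>0 - c\<^sub>2 - c\<^sub>1, b, a - c\<^sub>2 - c\<^sub>1, a - c\<^sub>0 - c\<^sub>2, a - c\<^sub>0 - c\<^sub>1)"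
      by (rule curve_type_swap[OF ne(2)[symmetric]])
    then show ?thesis unfolding conjugate_curve_swap[of P\<^sub>2] by (simp add: algebra_simps)
  qed
qed

end
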